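(* Consider the production-inventory model described in the context, with optimal cost functions $V_1,V_2$. Let $\overline u_1,\overline u_2:[l,b]\to[0,\infty)$ be non-negative functions such that, for $\{i,j\}=\{1,2\}$, $\overline u_i$ is a viscosity supersolution, at every point of $[l,b)$, of the corresponding Hamilton-Jacobi-Bellman equation, in the sense defined in the context (where the obstacle for $\overline u_i$ is $V_j+K_{ij}$). Define $\overline u(x)=\min\{K_{01}+\overline u_1(x),K_{02}+\overline u_2(x)\}$ and $$\overline u_0(b)=\frac{\lambda}{q+\lambda}\Big(\int_0^{b-l}\overline u(b-\alpha)dF(\alpha)+\int_{b-l}^\infty\big(p(\alpha-b+l)+\overline u(l)\big)dF(\alpha)\Big)+\frac{h_0(b)}{q+\lambda}.$$ Assume that $\overline u_1(b)\le\overline u_0(b)+K_{10}$ and $\overline u_2(b)\le\overline u_0(b)+K_{20}$. Then $\overline u_j(x)\le V_j^\pi(x)$ for every $j\in\{1,2\}$, every $x\in[l,b)$ and every admissible strategy $\pi\in\Pi_{x,j}$; and $\overline u_0(b)\le V_0^\pi(b)$ for every admissible strategy $\pi\in\Pi_{b,0}$.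
   Context: **Model.** Fix $l\le 0<b$ (minimum inventory level and storage capacity), production rates $0<\sigma_2<\sigma_1$, $\sigma_0=0$, a discount rate $q>0$, and a compound Poisson demand process $\sum_{n=1}^{N_t}Y_n$, where $N$ is a Poisson process of rate $\lambda>0$ with arrival times $\tau_1<\tau_2<\cdots$, and $Y_n$ are i.i.d. positive random variables, independent of $N$, with distribution function $F$ and finite mean. $(\mathcal F_t)$ is the filtration generated by the demand process. **Costs.** For $i=1,2$, $h_i:[l,b)\to[0,\infty)$ is bounded with finitely many discontinuities and is Lipschitz (constant $m_h$) between discontinuities; $h_0(b)\ge 0$ is a constant. $p:[0,\infty)\to[0,\infty)$ is non-decreasing with $\int_0^\infty p(y)\,dF(y)<\infty$. Switching costs $K_{ij}\ge 0$ ($i\ne j$ in $\{0,1,2\}$) satisfy $K_{0i}\le K_{0j}+K_{ji}$ for $\{i,j\}=\{1,2\}$ and $K_{12}+K_{21}>0$. **Strategies.** A production strategy starting from inventory level $x$ and phase $i$ is $\pi=(T_k,J_k)_{k\ge0}$ with $T_0=0$, $J_0=i$, where $T_1<T_2<\cdots$ are the switching times, $T_k$ being the time of the switch from phase $J_{k-1}$ to phase $J_k$, with $J_k\in\{0,1,2\}$ and $J_k\neq J_{k-1}$. The phase process is $\mathcal J_t=J_k$ for $t\in[T_k,T_{k+1})$. The inventory $X^\pi_t$ starts at $X^\pi_0=x$, grows at rate $\sigma_{\mathcal J_t}$ between demands, and at each $\tau_n$ jumps down by $\min\{Y_n,X^\pi_{\tau_n^-}-l\}$ (the part of the demand that would bring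 the inventory below $l$ is lost). $\pi$ is admissible ($\pi\in\Pi_{x,i}$) if it is $\mathcal F_t$-adapted and càdlàg and: whenever $X_t^\pi<b$, the phase is $1$ or $2$; whenever $X^\pi$ reaches $b$ in phase $1$ or $2$, at that time there is a mandatory switch to phase $0$, after which $X^\pi=b$ until the next demand arrival, which is the next switching time, at which the new phase is $1$ or $2$. Initial data are either $x\in[l,b)$, $i\in\{1,2\}$, or $x=b$, $i=0$. **Cost functions.** For $\pi\in\Pi_{x,i}$, $$V_i^\pi(x)=\mathbb E\Big[\int_0^\infty e^{-qt}h_{\mathcal J_t}(X_t^\pi)dt\Big]+\mathbb E\Big[\sum_{k\ge0}e^{-qT_{k+1}}K_{J_k,J_{k+1}}\Big]+\mathbb E\Big[\sum_{n\ge1}e^{-q\tau_n}1_{\{X^\pi_{\tau_n^-}-l<Y_n\}}\,p(Y_n-X^\pi_{\tau_n^-}+l)\Big]$$ (where $h_0$ is used at level $b$). The optimal cost functions are $V_i(x)=\inf_{\pi\in\Pi_{x,i}}V_i^\pi(x)$ for $i=1,2$ and $x\in[l,b)$. **Operators.** For $i=1,2$, $$\mathcal L_i(u)(x)=\sigma_iu'(x)-(\lambda+q)u(x)+\lambda\int_0^{x-l}u(x-\alpha)dF(\alpha)+\lambda\int_{x-l}^\infty p(\alpha-x+l)dF(\alpha)+\lambda u(l)(1-F(x-l))+h_i(x).$$ Here, and in the formula for $\overline u_0(b)$, integrals $\int_0^{x-l}$ include the endpoint $\alpha=x-l$ and $\int_{x-l}^\infty$ exclude it. **Hamilton-Jacobi-Bellman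 equations and viscosity supersolutions.** For $\{i,j\}=\{1,2\}$ the equation for $V_i$ is $\min\{\mathcal L_i(V_i)(x),\,V_j(x)+K_{ij}-V_i(x)\}=0$, $x\in[l,b)$. A function $\overline u_i:[l,b]\to\mathbb R$ is a viscosity supersolution of this equation at $x\in[l,b)$ if it is Lipschitz and every continuously differentiable $\varphi_i:[l,b]\to\mathbb R$ with $\varphi_i(x)=\overline u_i(x)$ such that $\overline u_i-\varphi_i$ attains its maximum at $x$ satisfies $\min\{\mathcal L_i(\varphi_i)(x),\,V_j(x)+K_{ij}-\overline u_i(x)\}\ge0$, where $V_j$ is the optimal cost function of the other phase. *)

theory Defs
  imports "HOL-Probability.Probability"
begin

section \<open>Model data\<close>

text \<open>
  Arrivals and demands are numbered from 1: \<open>arrival S n\<close> is the time of the \<open>n\<close>-th arrival and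
  \<open>demand S n\<close> its size. The entry \<open>arrival S 0\<close> is the time origin 0; the entry
  \<open>demand S 0\<close> is not used. The phase \<open>i\<close> has the production rate \<open>prate S i\<close> and the holding
  cost \<open>hold S i\<close>; the constant holding cost in phase 0 is \<open>hold S 0 (cap S)\<close>.
\<close>

record 'a inventory_data =
  pspace :: "'a measure"
  arrival :: "nat \<Rightarrow> 'a \<Rightarrow> real"
  demand :: "nat \<Rightarrow> 'a \<Rightarrow> real"
  demand_cdf :: "real \<Rightarrow> real"
  arr_rate :: real
  disc :: real
  lmin :: real
  cap :: real
  prate :: "nat \<Rightarrow> real"
  hold :: "nat \<Rightarrow> real \<Rightarrow> real"
  penalty :: "real \<Rightarrow> real"
  swcost :: "nat \<Rightarrow> nat \<Rightarrow> real"

text \<open>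
  A Poisson process of rate \<open>r\<close>, given by its arrival times: the counting process whose
  inter-arrival times are independent and exponential with parameter \<open>r\<close>. Its value at every time
  is finite, so the arrival times tend to infinity on every path.
\<close>

definition poisson_arrivals :: "'a measure \<Rightarrow> real \<Rightarrow> (nat \<Rightarrow> 'a \<Rightarrow> real) \<Rightarrow> bool" where
  "poisson_arrivals M r \<tau> \<longleftrightarrow>
     (\<forall>\<omega>\<in>space M. \<tau> 0 \<omega> = 0 \<and> strict_mono (\<lambda>n. \<tau> n \<omega>) \<and> filterlim (\<lambda>n. \<tau> n \<omega>) at_top sequentially) \<and>
     prob_space.indep_vars M (\<lambda>_. borel) (\<lambda>n \<omega>. \<tau> (Suc n) \<omega> - \<tau> n \<omega>) UNIV \<and>
     (\<forall>n. distributed M lborel (\<lambda>\<omega>. \<tau> (Suc n) \<omega> - \<tau> n \<omega>) (exponential_density r))"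

definition compound_poisson_demand :: "'a inventory_data \<Rightarrow> bool" where
  "compound_poisson_demand S \<longleftrightarrow>
     prob_space (pspace S) \<and> 0 < arr_rate S \<and>
     poisson_arrivals (pspace S) (arr_rate S) (arrival S) \<and>
     prob_space.indep_vars (pspace S) (\<lambda>_. borel) (demand S) {1..} \<and>
     (\<forall>n\<ge>1. (\<forall>\<omega>\<in>space (pspace S). 0 < demand S n \<omega>) \<and>
            cdf (distr (pspace S) borel (demand S n)) = demand_cdf S \<and>
            integrable (pspace S) (demand S n)) \<and>
     prob_space.indep_var (pspace S)
       (Pi\<^sub>M UNIV (\<lambda>_. borel)) (\<lambda>\<omega>. \<lambda>n\<in>UNIV. arrival S n \<omega>)
       (Pi\<^sub>M {1..} (\<lambda>_. borel)) (\<lambda>\<omega>. \<lambda>n\<in>{1..}. demand S n \<omega>)"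

abbreviation dF :: "'a inventory_data \<Rightarrow> real measure" where
  "dF S \<equiv> interval_measure (demand_cdf S)"

definition discontinuities :: "real set \<Rightarrow> (real \<Rightarrow> real) \<Rightarrow> real set" where
  "discontinuities A f = {x\<in>A. \<not> continuous (at x within A) f}"

definition inventory_model :: "'a inventory_data \<Rightarrow> bool" where
  "inventory_model S \<longleftrightarrow>
     compound_poisson_demand S \<and>
     lmin S \<le> 0 \<and> 0 < cap S \<and>
     prate S 0 = 0 \<and> 0 < prate S 2 \<and> prate S 2 < prate S 1 \<and>
     0 < disc S \<and>
     (\<forall>i\<in>{1,2}. (\<forall>x\<in>{lmin S..<cap S}. 0 \<le> hold S i x) \<and>
        bounded (hold S i ` {lmin S..<cap S}) \<and>
        finite (discontinuities {lmin S..<cap S} (hold S i))) \<and>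
     (\<exists>m. \<forall>i\<in>{1,2}. \<forall>x y.
        {x..y} \<subseteq> {lmin S..<cap S} - discontinuities {lmin S..<cap S} (hold S i) \<longrightarrow>
        m-lipschitz_on {x..y} (hold S i)) \<and>
     0 \<le> hold S 0 (cap S) \<and>
     (\<forall>y\<ge>0. 0 \<le> penalty S y) \<and> mono_on {0..} (penalty S) \<and>
     set_integrable (dF S) {0..} (penalty S) \<and>
     (\<forall>i\<in>{0,1,2}. \<forall>j\<in>{0,1,2}. i \<noteq> j \<longrightarrow> 0 \<le> swcost S i j) \<and>
     swcost S 0 1 \<le> swcost S 0 2 + swcost S 2 1 \<and>
     swcost S 0 2 \<le> swcost S 0 1 + swcost S 1 2 \<and>
     0 < swcost S 1 2 + swcost S 2 1"

definition demand_count :: "'a inventory_data \<Rightarrow> real \<Rightarrow> 'a \<Rightarrow> nat" where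
  "demand_count S t \<omega> = card {n. 1 \<le> n \<and> arrival S n \<omega> \<le> t}"

definition cum_demand :: "'a inventory_data \<Rightarrow> real \<Rightarrow> 'a \<Rightarrow> real" where
  "cum_demand S t \<omega> = (\<Sum>n = 1..demand_count S t \<omega>. demand S n \<omega>)"

definition demand_filtration :: "'a inventory_data \<Rightarrow> real \<Rightarrow> 'a measure" where
  "demand_filtration S t = sigma (space (pspace S))
     {cum_demand S s -` A \<inter> space (pspace S) | s A. 0 \<le> s \<and> s \<le> t \<and> A \<in> sets borel}"


section \<open>Strategies\<close>

text \<open>
  Switching times are extended reals: \<open>T k \<omega> = \<infinity>\<close> means that the \<open>k\<close>-th switch does not take place on
  the path \<open>\<omega>\<close>. Since \<open>T 0 = T 1 = 0\<close> is allowed, a strategy may switch at time 0.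
\<close>

definition phase :: "(nat \<Rightarrow> 'a \<Rightarrow> ereal) \<Rightarrow> (nat \<Rightarrow> 'a \<Rightarrow> nat) \<Rightarrow> real \<Rightarrow> 'a \<Rightarrow> nat" where
  "phase T J t \<omega> = J (THE k. T k \<omega> \<le> ereal t \<and> ereal t < T (Suc k) \<omega>) \<omega>"

text \<open>
  The phase process is a right-continuous step function by construction; that it is
  has left limits on the whole half-line is the last condition, absence of accumulation of switching
  times.
\<close>

definition switching_strategy ::
  "'a inventory_data \<Rightarrow> nat \<Rightarrow> (nat \<Rightarrow> 'a \<Rightarrow> ereal) \<Rightarrow> (nat \<Rightarrow> 'a \<Rightarrow> nat) \<Rightarrow> bool" where
  "switching_strategy S i T J \<longleftrightarrow>
     (\<forall>\<omega>\<in>space (pspace S).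
        T 0 \<omega> = 0 \<and> J 0 \<omega> = i \<and> 0 \<le> T 1 \<omega> \<and>
        (\<forall>k\<ge>1. if T k \<omega> < \<infinity> then T k \<omega> < T (Suc k) \<omega> else T (Suc k) \<omega> = \<infinity>) \<and>
        (\<forall>k. J k \<omega> \<in> {0,1,2}) \<and>
        (\<forall>k. T (Suc k) \<omega> < \<infinity> \<longrightarrow> J (Suc k) \<omega> \<noteq> J k \<omega>) \<and>
        (\<forall>t::real. \<exists>k. ereal t < T k \<omega>))"

definition produced ::
  "'a inventory_data \<Rightarrow> (nat \<Rightarrow> 'a \<Rightarrow> ereal) \<Rightarrow> (nat \<Rightarrow> 'a \<Rightarrow> nat) \<Rightarrow> real \<Rightarrow> real \<Rightarrow> 'a \<Rightarrow> real" where
  "produced S T J s t \<omega> = (LBINT r:{s..t}. prate S (phase T J r \<omega>))"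

text \<open>
  The inventory level just after the \<open>n\<close>-th arrival (for \<open>n = 0\<close>: the initial level), and the left
  limit of the inventory at the \<open>n\<close>-th arrival, \<open>n \<ge> 1\<close>.
\<close>

primrec level_after ::
  "'a inventory_data \<Rightarrow> (nat \<Rightarrow> 'a \<Rightarrow> ereal) \<Rightarrow> (nat \<Rightarrow> 'a \<Rightarrow> nat) \<Rightarrow> real \<Rightarrow> nat \<Rightarrow> 'a \<Rightarrow> real" where
  "level_after S T J x 0 \<omega> = x"
| "level_after S T J x (Suc n) \<omega> =
     (let y = level_after S T J x n \<omega> + produced S T J (arrival S n \<omega>) (arrival S (Suc n) \<omega>) \<omega>
      in y - min (demand S (Suc n) \<omega>) (y - lmin S))"

definition level_before ::
  "'a inventory_data \<Rightarrow> (nat \<Rightarrow> 'a \<Rightarrow> ereal) \<Rightarrow> (nat \<Rightarrow> 'a \<Rightarrow> nat) \<Rightarrow> real \<Rightarrow> nat \<Rightarrow> 'a \<Rightarrow> real" where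
  "level_before S T J x n \<omega> =
     level_after S T J x (n - 1) \<omega> + produced S T J (arrival S (n - 1) \<omega>) (arrival S n \<omega>) \<omega>"

definition inventory ::
  "'a inventory_data \<Rightarrow> (nat \<Rightarrow> 'a \<Rightarrow> ereal) \<Rightarrow> (nat \<Rightarrow> 'a \<Rightarrow> nat) \<Rightarrow> real \<Rightarrow> real \<Rightarrow> 'a \<Rightarrow> real" where
  "inventory S T J x t \<omega> =
     (let n = demand_count S t \<omega>
      in level_after S T J x n \<omega> + produced S T J (arrival S n \<omega>) t \<omega>)"

text \<open>
  Adaptedness is imposed on the phase process, which determines the \<open>T k\<close> and, on \<open>T k < \<infinity>\<close>, the \<open>J k\<close>.
  The operating rules are pathwise requirements and hold almost surely: below the capacity the phase
  is 1 or 2; on reaching the capacity the phase becomes 0 at once; phase 0 lasts, with the inventory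
  at the capacity, until the next arrival, when the phase becomes 1 or 2.
\<close>

definition admissible ::
  "'a inventory_data \<Rightarrow> real \<Rightarrow> nat \<Rightarrow> (nat \<Rightarrow> 'a \<Rightarrow> ereal) \<Rightarrow> (nat \<Rightarrow> 'a \<Rightarrow> nat) \<Rightarrow> bool" where
  "admissible S x i T J \<longleftrightarrow>
     switching_strategy S i T J \<and>
     (\<forall>t\<ge>0. phase T J t \<in> measurable (demand_filtration S t) (count_space UNIV)) \<and>
     (AE \<omega> in pspace S.
        (\<forall>t\<ge>0. inventory S T J x t \<omega> < cap S \<longrightarrow> phase T J t \<omega> \<in> {1,2}) \<and>
        (\<forall>t\<ge>0. inventory S T J x t \<omega> = cap S \<longrightarrow> phase T J t \<omega> = 0) \<and>
        (\<forall>k. T k \<omega> < \<infinity> \<and> J k \<omega> = 0 \<longrightarrow>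
           T (Suc k) \<omega> = ereal (arrival S (Suc (demand_count S (real_of_ereal (T k \<omega>)) \<omega>)) \<omega>) \<and>
           J (Suc k) \<omega> \<in> {1,2} \<and>
           (\<forall>t. T k \<omega> \<le> ereal t \<and> ereal t < T (Suc k) \<omega> \<longrightarrow> inventory S T J x t \<omega> = cap S)))"


section \<open>Cost functions\<close>

text \<open>All costs are non-negative and the expected cost of a strategy may be infinite.\<close>

definition cost ::
  "'a inventory_data \<Rightarrow> real \<Rightarrow> (nat \<Rightarrow> 'a \<Rightarrow> ereal) \<Rightarrow> (nat \<Rightarrow> 'a \<Rightarrow> nat) \<Rightarrow> ennreal" where
  "cost S x T J =
     (\<integral>\<^sup>+\<omega>. (\<integral>\<^sup>+t\<in>{0..}. ennreal (exp (- disc S * t) *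
          hold S (phase T J t \<omega>) (inventory S T J x t \<omega>)) \<partial>lborel) \<partial>pspace S)
   + (\<integral>\<^sup>+\<omega>. (\<Sum>k. if T (Suc k) \<omega> < \<infinity>
          then ennreal (exp (- disc S * real_of_ereal (T (Suc k) \<omega>)) * swcost S (J k \<omega>) (J (Suc k) \<omega>))
          else 0) \<partial>pspace S)
   + (\<integral>\<^sup>+\<omega>. (\<Sum>n. let y = level_before S T J x (Suc n) \<omega> - lmin S in
          if y < demand S (Suc n) \<omega>
          then ennreal (exp (- disc S * arrival S (Suc n) \<omega>) * penalty S (demand S (Suc n) \<omega> - y))
          else 0) \<partial>pspace S)"

text \<open>
  The optimal cost is finite, because the strategy that switches only when it has to has finite
  cost, so \<open>enn2real\<close> loses nothing.
\<close>

definition opt_cost :: "'a inventory_data \<Rightarrow> nat \<Rightarrow> real \<Rightarrow> real" where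
  "opt_cost S i x = enn2real (Inf {cost S x T J | T J. admissible S x i T J})"


section \<open>Hamilton-Jacobi-Bellman equations\<close>

text \<open>Derivatives of functions on \<open>[l,b]\<close> are one-sided at the endpoints.\<close>

definition HJB_op :: "'a inventory_data \<Rightarrow> nat \<Rightarrow> (real \<Rightarrow> real) \<Rightarrow> real \<Rightarrow> real" where
  "HJB_op S i u x =
     prate S i * vector_derivative u (at x within {lmin S..cap S})
     - (arr_rate S + disc S) * u x
     + arr_rate S * (LINT \<alpha>:{0..x - lmin S}|dF S. u (x - \<alpha>))
     + arr_rate S * (LINT \<alpha>:{x - lmin S<..}|dF S. penalty S (\<alpha> - x + lmin S))
     + arr_rate S * u (lmin S) * (1 - demand_cdf S (x - lmin S))
     + hold S i x"

definition C1_on_interval :: "real \<Rightarrow> real \<Rightarrow> (real \<Rightarrow> real) \<Rightarrow> bool" where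
  "C1_on_interval a c \<phi> \<longleftrightarrow>
     (\<exists>\<phi>'. (\<forall>y\<in>{a..c}. (\<phi> has_vector_derivative \<phi>' y) (at y within {a..c})) \<and>
           continuous_on {a..c} \<phi>')"

definition viscosity_supersolution ::
  "'a inventory_data \<Rightarrow> nat \<Rightarrow> nat \<Rightarrow> (real \<Rightarrow> real) \<Rightarrow> real \<Rightarrow> bool" where
  "viscosity_supersolution S i j u x \<longleftrightarrow>
     (\<exists>C. C-lipschitz_on {lmin S..cap S} u) \<and>
     (\<forall>\<phi>. C1_on_interval (lmin S) (cap S) \<phi> \<and> \<phi> x = u x \<and>
          (\<forall>y\<in>{lmin S..cap S}. u y - \<phi> y \<le> u x - \<phi> x) \<longrightarrow>
          min (HJB_op S i \<phi> x) (opt_cost S j x + swcost S i j - u x) \<ge> 0)"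

definition u_bar :: "'a inventory_data \<Rightarrow> (nat \<Rightarrow> real \<Rightarrow> real) \<Rightarrow> real \<Rightarrow> real" where
  "u_bar S u x = min (swcost S 0 1 + u 1 x) (swcost S 0 2 + u 2 x)"

definition u_bar0 :: "'a inventory_data \<Rightarrow> (nat \<Rightarrow> real \<Rightarrow> real) \<Rightarrow> real" where
  "u_bar0 S u =
     arr_rate S / (disc S + arr_rate S) *
       ((LINT \<alpha>:{0..cap S - lmin S}|dF S. u_bar S u (cap S - \<alpha>)) +
        (LINT \<alpha>:{cap S - lmin S<..}|dF S. penalty S (\<alpha> - cap S + lmin S) + u_bar S u (lmin S)))
     + hold S 0 (cap S) / (disc S + arr_rate S)"

end

theory Submission
  imports Defs
begin

text \<open>
  A strategy is first carried over to the space of demand paths (inter-arrival times and demands),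
  where it can be restarted at a fixed time or at the first arrival and remains admissible. Before the
  first arrival the phase is deterministic. So there is a fixed time \<open>\<theta>\<close> such that the first switch
  takes place at \<open>\<theta>\<close> if no demand has arrived by then, and not before the first arrival otherwise.
  Along the straight trajectory on \<open>[0, \<theta>]\<close> the differential inequality integrates to a dynamic
  programming inequality for \<open>u i\<close> with the random horizon given by \<open>\<theta>\<close> or the first arrival, whichever
  comes first. At that horizon \<open>u\<close> is compared with the cost of the restarted strategy: by the
  obstacle inequality if there is a switch, and by the assertion itself if there is none. If the
  assertion holds up to an error \<open>\<epsilon>\<close>, this shows that it holds up to the error \<open>\<rho> * \<epsilon>\<close>, where
  \<open>\<rho> = \<lambda> / (\<lambda> + q)\<close> is the mean discount at the first arrival. Since \<open>u\<close> is bounded, the error is 0.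
\<close>

section \<open>Switching paths\<close>

text \<open>The original probability space need not carry a shift, so restarts are made on path
  space, by \<open>delay\<close> and \<open>prepend\<close>. Yet \<open>opt_cost\<close> is an
  infimum over strategies on the original space. Strategies therefore travel both ways: the given
  one to path space (\<open>canonical_version\<close>), its restarted versions back
  (\<open>pull_back_admissible\<close>). The obstacle of the equation is the true optimal cost V_j,
  not \<open>u j\<close>. At a switch between the phases 1 and 2 the value \<open>u i\<close> is
  thus bounded by the cost of the restarted strategy with no error at all, and the number of
  switches between two arrivals does not matter. Errors are passed on only at arrivals, which is
  where the discount gives the factor \<open>\<rho>\<close>. Two irregularities shape the analysis.
  The obstacle inequality is available only on a dense set of levels, and V_j is not known to be
  continuous; the strategy itself is followed for a short time until its level meets such a point.
  The running gain (holding cost and mean effect of a demand) is discontinuous in the level;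
  Lipschitz majorants replace it in the viscosity argument.\<close>

definition switching_path :: "nat \<Rightarrow> (nat \<Rightarrow> 'a \<Rightarrow> ereal) \<Rightarrow> (nat \<Rightarrow> 'a \<Rightarrow> nat) \<Rightarrow> 'a \<Rightarrow> bool" where
  "switching_path i T J \<omega> \<longleftrightarrow>
     T 0 \<omega> = 0 \<and> J 0 \<omega> = i \<and> 0 \<le> T 1 \<omega> \<and>
     (\<forall>k\<ge>1. if T k \<omega> < \<infinity> then T k \<omega> < T (Suc k) \<omega> else T (Suc k) \<omega> = \<infinity>) \<and>
     (\<forall>k. J k \<omega> \<in> {0,1,2}) \<and>
     (\<forall>k. T (Suc k) \<omega> < \<infinity> \<longrightarrow> J (Suc k) \<omega> \<noteq> J k \<omega>) \<and>
     (\<forall>t::real. \<exists>k. ereal t < T k \<omega>)"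

lemma switching_strategy_iff:
  "switching_strategy S i T J \<longleftrightarrow> (\<forall>\<omega>\<in>space (pspace S). switching_path i T J \<omega>)"
  unfolding switching_strategy_def switching_path_def ..

context
  fixes i T J and \<omega> :: 'a
  assumes sw: "switching_path i T J \<omega>"
begin

lemma switching_path_0: "T 0 \<omega> = 0" "J 0 \<omega> = i"
  using sw by (auto simp: switching_path_def)

lemma switching_path_le_Suc: "T k \<omega> \<le> T (Suc k) \<omega>"
proof (cases "k = 0")
  case True then show ?thesis using sw by (auto simp: switching_path_def)
next
  case False
  then have "k \<ge> 1" by simp
  with sw have "if T k \<omega> < \<infinity> then T k \<omega> < T (Suc k) \<omega> else T (Suc k) \<omega> = \<infinity>"
    unfolding switching_path_def by blast
  then show ?thesis by (auto split: if_splits)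
qed

lemma switching_path_mono: "k \<le> m \<Longrightarrow> T k \<omega> \<le> T m \<omega>"
  using switching_path_le_Suc by (rule lift_Suc_mono_le)

lemma switching_path_nonneg: "0 \<le> T k \<omega>"
  using switching_path_mono[of 0 k] switching_path_0 by simp

lemma switching_path_strict: "1 \<le> k \<Longrightarrow> T k \<omega> < \<infinity> \<Longrightarrow> T k \<omega> < T (Suc k) \<omega>"
  using sw unfolding switching_path_def by (metis)

lemma switching_path_phases: "J k \<omega> \<in> {0,1,2}"
  using sw unfolding switching_path_def by blast

lemma switching_path_neq: "T (Suc k) \<omega> < \<infinity> \<Longrightarrow> J (Suc k) \<omega> \<noteq> J k \<omega>"
  using sw unfolding switching_path_def by blast

lemma switching_path_unbounded: "\<exists>k. ereal t < T k \<omega>"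
  using sw unfolding switching_path_def by blast

lemma switching_path_interval:
  assumes "0 \<le> t" obtains k where "T k \<omega> \<le> ereal t" "ereal t < T (Suc k) \<omega>"
proof -
  define k where "k = (LEAST k. ereal t < T k \<omega>)"
  have k: "ereal t < T k \<omega>" unfolding k_def using switching_path_unbounded by (rule LeastI_ex)
  then have "k \<noteq> 0" using switching_path_0 assms by (cases k) (auto simp: zero_ereal_def)
  then obtain m where m: "k = Suc m" by (cases k) auto
  then have "\<not> ereal t < T m \<omega>" using not_less_Least[of m "\<lambda>k. ereal t < T k \<omega>"] k_def by auto
  then have "T m \<omega> \<le> ereal t" by simp
  with k m show ?thesis by (intro that[of m]) auto
qed

lemma switching_path_interval_unique:
  assumes "T k \<omega> \<le> t" "t < T (Suc k) \<omega>" "T m \<omega> \<le> t" "t < T (Suc m) \<omega>"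
  shows "k = m"
proof (rule ccontr)
  assume "k \<noteq> m"
  then consider "Suc k \<le> m" | "Suc m \<le> k" by linarith
  then show False
    by cases (use assms switching_path_mono[of "Suc k" m] switching_path_mono[of "Suc m" k] in auto)
qed

lemma phase_eq:
  assumes "T k \<omega> \<le> ereal t" "ereal t < T (Suc k) \<omega>"
  shows "phase T J t \<omega> = J k \<omega>"
proof -
  have "(THE k. T k \<omega> \<le> ereal t \<and> ereal t < T (Suc k) \<omega>) = k"
    by (rule the_equality) (use assms switching_path_interval_unique in blast)+
  then show ?thesis by (simp add: phase_def)
qed

lemma phase_range: "0 \<le> t \<Longrightarrow> phase T J t \<omega> \<in> {0,1,2}"
  using switching_path_phases phase_eq by (metis switching_path_interval)

end

text \<open>A finite switch changes the phase, and the new phase holds on a nondegenerate interval,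
  so the phase process shows every switch. This is how adaptedness, which concerns the phase process
  alone, controls \<open>T\<close> and \<open>J\<close>. Where \<open>T k\<close> is infinite,
  \<open>J k\<close> stays undetermined.\<close>

lemma switching_path_determined:
  assumes sw: "switching_path i T J \<omega>" and sw': "switching_path i T' J' \<omega>'"
    and ph: "\<And>t. 0 \<le> t \<Longrightarrow> phase T J t \<omega> = phase T' J' t \<omega>'"
  shows "T k \<omega> = T' k \<omega>'" "T k \<omega> < \<infinity> \<Longrightarrow> J k \<omega> = J' k \<omega>'"
proof -
  \<comment> \<open>Generalised over both paths, so that it applies in either direction: at the
    earlier switch one process has left the common phase and the other has not.\<close>
  have *: "\<not> T (Suc k) \<omega> < T' (Suc k) \<omega>'"
    if sw: "switching_path i T J \<omega>" and sw': "switching_path i T' J' \<omega>'"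
    and ph: "\<And>t. 0 \<le> t \<Longrightarrow> phase T J t \<omega> = phase T' J' t \<omega>'"
    and eq: "T k \<omega> = T' k \<omega>'" "T k \<omega> < \<infinity> \<longrightarrow> J k \<omega> = J' k \<omega>'"
    for k T J T' J' and \<omega> :: 'c and \<omega>' :: 'd
  proof
    assume less: "T (Suc k) \<omega> < T' (Suc k) \<omega>'"
    then have fin: "T (Suc k) \<omega> < \<infinity>" by auto
    obtain r where r: "T (Suc k) \<omega> = ereal r" "0 \<le> r"
      using fin switching_path_nonneg[OF sw, of "Suc k"] by (cases "T (Suc k) \<omega>") (auto simp: zero_ereal_def)
    have "phase T J r \<omega> = J (Suc k) \<omega>"
      using r switching_path_strict[OF sw _ fin] by (intro phase_eq[OF sw]) auto
    moreover have "phase T' J' r \<omega>' = J' k \<omega>'"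
      using r less switching_path_le_Suc[OF sw, of k] eq by (intro phase_eq[OF sw']) auto
    moreover have "J' k \<omega>' = J k \<omega>" using eq switching_path_le_Suc[OF sw, of k] fin by auto
    ultimately show False using switching_path_neq[OF sw fin] ph[OF r(2)] by simp
  qed
  have "T k \<omega> = T' k \<omega>' \<and> (T k \<omega> < \<infinity> \<longrightarrow> J k \<omega> = J' k \<omega>')"
  proof (induction k)
    case 0
    then show ?case using switching_path_0[OF sw] switching_path_0[OF sw'] by simp
  next
    case (Suc k)
    have le: "T (Suc k) \<omega> = T' (Suc k) \<omega>'"
      using *[OF sw sw' ph] *[OF sw' sw ph[symmetric]] Suc by (metis linorder_less_linear)
    show ?case
    proof (intro conjI impI le)
      assume fin: "T (Suc k) \<omega> < \<infinity>"
      obtain r where r: "T (Suc k) \<omega> = ereal r" "0 \<le> r"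
        using fin switching_path_nonneg[OF sw, of "Suc k"] by (cases "T (Suc k) \<omega>") (auto simp: zero_ereal_def)
      have "phase T J r \<omega> = J (Suc k) \<omega>"
        using r switching_path_strict[OF sw _ fin] by (intro phase_eq[OF sw]) auto
      moreover have "phase T' J' r \<omega>' = J' (Suc k) \<omega>'"
        using r le switching_path_strict[OF sw', of "Suc k"] by (intro phase_eq[OF sw']) auto
      ultimately show "J (Suc k) \<omega> = J' (Suc k) \<omega>'" using ph[OF r(2)] by simp
    qed
  qed
  then show "T k \<omega> = T' k \<omega>'" "T k \<omega> < \<infinity> \<Longrightarrow> J k \<omega> = J' k \<omega>'" by auto
qed

text \<open>For values in a discrete set, right continuity and the existence of left limits are
  these two conditions of local constancy.\<close>

definition cadlag_step :: "(real \<Rightarrow> nat) \<Rightarrow> bool" where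
  "cadlag_step f \<longleftrightarrow> (\<forall>t\<ge>0. \<exists>e>0. \<forall>r\<in>{t..<t+e}. f r = f t) \<and>
     (\<forall>t>0. \<exists>e>0. \<forall>r\<in>{t-e<..<t}. \<forall>s\<in>{t-e<..<t}. f r = f s)"

text \<open>The start value \<open>i\<close> may differ from \<open>f 0\<close>; the first jump is
  then at time 0. Once the process no longer leaves its value, the time stays infinite.\<close>

primrec jumps :: "nat \<Rightarrow> (real \<Rightarrow> nat) \<Rightarrow> nat \<Rightarrow> ereal \<times> nat" where
  "jumps i f 0 = (0, i)"
| "jumps i f (Suc k) = (let (s, v) = jumps i f k; D = {r. 0 \<le> r \<and> s \<le> ereal r \<and> f r \<noteq> v} in
     if D = {} then (\<infinity>, v) else (ereal (Inf D), f (Inf D)))"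

text \<open>Right continuity makes the infimum of the exit times a time at which the phase has
  really changed; left limits keep the jump times from accumulating.\<close>

lemma switching_path_jumps:
  assumes f: "cadlag_step f" and range: "\<And>t. 0 \<le> t \<Longrightarrow> f t \<in> {0,1,2}" and i: "i \<in> {0,1,2}"
  defines "T \<equiv> \<lambda>k (_::'a). fst (jumps i f k)" and "J \<equiv> \<lambda>k (_::'a). snd (jumps i f k)"
  shows "switching_path i T J \<omega>" "0 \<le> t \<Longrightarrow> phase T J t \<omega> = f t"
proof -
  define D where "D k = {r. 0 \<le> r \<and> T k \<omega> \<le> ereal r \<and> f r \<noteq> J k \<omega>}" for k
  have rc: "\<exists>e>0. \<forall>r\<in>{t..<t+e}. f r = f t" if "0 \<le> t" for t
    using f that unfolding cadlag_step_def by blast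
  have emp: "T (Suc k) \<omega> = \<infinity>" "J (Suc k) \<omega> = J k \<omega>" if "D k = {}" for k
    using that by (auto simp: T_def J_def D_def Let_def split: prod.split)
  have nemp: "T (Suc k) \<omega> = ereal (Inf (D k))" "J (Suc k) \<omega> = f (Inf (D k))" if "D k \<noteq> {}" for k
    using that by (auto simp: T_def J_def D_def Let_def split: prod.split)
  have bdd: "bdd_below (D k)" for k unfolding D_def by (rule bdd_belowI[of _ 0]) auto
  have Inf_in: "Inf (D k) \<in> D k" if ne: "D k \<noteq> {}" for k
  proof -
    let ?m = "Inf (D k)"
    have m0: "0 \<le> ?m" using ne by (intro cInf_greatest) (auto simp: D_def)
    have mT: "T k \<omega> \<le> ereal ?m"
    proof (cases "T k \<omega>")
      case (real s)
      then have "s \<le> ?m" using ne by (intro cInf_greatest) (auto simp: D_def)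
      with real show ?thesis by simp
    qed (use ne in \<open>auto simp: D_def\<close>)
    have "f ?m \<noteq> J k \<omega>"
    proof
      assume eq: "f ?m = J k \<omega>"
      obtain e where e: "e > 0" "\<forall>r\<in>{?m..<?m+e}. f r = f ?m" using rc[OF m0] by blast
      have "?m + e \<le> ?m"
      proof (rule cInf_greatest[OF ne])
        fix r assume r: "r \<in> D k"
        then have "?m \<le> r" using bdd by (intro cInf_lower)
        moreover have "f r \<noteq> J k \<omega>" using r by (simp add: D_def)
        ultimately have "r \<notin> {?m..<?m+e}" using e(2) eq by auto
        then show "?m + e \<le> r" using \<open>?m \<le> r\<close> by auto
      qed
      with e show False by simp
    qed
    with m0 mT show ?thesis by (simp add: D_def)
  qed
  have T0: "T 0 \<omega> = 0" and J0: "J 0 \<omega> = i" by (auto simp: T_def J_def)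
  have le: "T k \<omega> \<le> T (Suc k) \<omega>" for k
    using emp[of k] nemp[of k] Inf_in[of k] by (cases "D k = {}") (auto simp: D_def)
  have mono: "k \<le> m \<Longrightarrow> T k \<omega> \<le> T m \<omega>" for k m
    using le by (rule lift_Suc_mono_le)
  have nonneg: "0 \<le> T k \<omega>" for k using mono[of 0 k] T0 by simp
  have JT: "J k \<omega> = f (real_of_ereal (T k \<omega>))" if "1 \<le> k" "T k \<omega> < \<infinity>" for k
    using that emp[of "k-1"] nemp[of "k-1"] by (cases "D (k-1) = {}") auto
  have neq: "J (Suc k) \<omega> \<noteq> J k \<omega>" if "T (Suc k) \<omega> < \<infinity>" for k
    using that emp[of k] nemp[of k] Inf_in[of k] by (cases "D k = {}") (auto simp: D_def)
  have strict: "if T k \<omega> < \<infinity> then T k \<omega> < T (Suc k) \<omega> else T (Suc k) \<omega> = \<infinity>" if k: "1 \<le> k" for k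
  proof (cases "T k \<omega> < \<infinity>")
    case True
    have "T k \<omega> \<noteq> T (Suc k) \<omega>"
    proof
      assume eq: "T k \<omega> = T (Suc k) \<omega>"
      then have "J (Suc k) \<omega> = J k \<omega>" using True JT[OF k True] JT[of "Suc k"] by simp
      then show False using neq[of k] eq True by simp
    qed
    with le[of k] True show ?thesis by auto
  next
    case False
    then show ?thesis using le[of k] by auto
  qed
  have Jr: "J k \<omega> \<in> {0,1,2}" for k
  proof (induction k)
    case 0 then show ?case using i J0 by simp
  next
    case (Suc k)
    show ?case
    proof (cases "D k = {}")
      case True then show ?thesis using emp Suc by simp
    next
      case False
      then show ?thesis using nemp[OF False] Inf_in[OF False] range[of "Inf (D k)"] by (simp add: D_def)
    qed
  qed
  \<comment> \<open>Bounded jump times would increase to a limit; the process is constant shortly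
    before that limit, yet two consecutive jumps fall there.\<close>
  have unb: "\<exists>k. ereal t < T k \<omega>" for t :: real
  proof (rule ccontr)
    assume "\<not> ?thesis"
    then have bd: "T k \<omega> \<le> ereal t" for k by (auto simp: not_less)
    define x where "x k = real_of_ereal (T k \<omega>)" for k
    have x: "T k \<omega> = ereal (x k)" for k
      using bd[of k] nonneg[of k] unfolding x_def by (cases "T k \<omega>") auto
    have xm: "incseq x" using mono unfolding incseq_def by (simp add: x)
    have "bdd_above (range x)" using bd by (intro bdd_aboveI[of _ t]) (auto simp: x)
    then have lim: "x \<longlonglongrightarrow> (SUP k. x k)" using xm by (rule LIMSEQ_incseq_SUP)
    let ?L = "SUP k. x k"
    have upper: "x k \<le> ?L" for k using \<open>bdd_above (range x)\<close> by (intro cSUP_upper) auto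
    have st: "x k < x (Suc k)" if "1 \<le> k" for k using strict[OF that] by (simp add: x)
    have lt: "x k < ?L" for k
    proof -
      have "x k \<le> x (Suc k)" using xm by (simp add: incseq_SucD)
      also have "x (Suc k) < x (Suc (Suc k))" by (rule st) simp
      also have "\<dots> \<le> ?L" by (rule upper)
      finally show ?thesis .
    qed
    have "0 \<le> x 0" using nonneg[of 0] by (simp add: x)
    then have "0 < ?L" using lt[of 0] by simp
    then obtain e where e: "e > 0" "\<forall>r\<in>{?L-e<..<?L}. \<forall>s\<in>{?L-e<..<?L}. f r = f s"
      using f unfolding cadlag_step_def by blast
    have "eventually (\<lambda>k. ?L - e < x k) sequentially" using lim e(1) by (intro order_tendstoD) auto
    then obtain K where K: "\<And>k. k \<ge> K \<Longrightarrow> ?L - e < x k" by (auto simp: eventually_sequentially)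
    let ?k = "Suc K"
    have "f (x ?k) = f (x (Suc ?k))" using e(2) K[of ?k] K[of "Suc ?k"] lt by auto
    moreover have "J ?k \<omega> = f (x ?k)" "J (Suc ?k) \<omega> = f (x (Suc ?k))"
      using JT[of ?k] JT[of "Suc ?k"] by (auto simp: x)
    ultimately show False using neq[of ?k] by (simp add: x)
  qed
  show sw: "switching_path i T J \<omega>"
    unfolding switching_path_def using T0 J0 le[of 0] strict Jr neq unb by auto
  show "phase T J t \<omega> = f t" if t: "0 \<le> t"
  proof -
    obtain k where k: "T k \<omega> \<le> ereal t" "ereal t < T (Suc k) \<omega>"
      using switching_path_interval[OF sw t] by blast
    have "f t = J k \<omega>"
    proof (rule ccontr)
      assume "f t \<noteq> J k \<omega>"
      then have "t \<in> D k" using t k by (simp add: D_def)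
      then have "Inf (D k) \<le> t" using bdd by (intro cInf_lower)
      moreover have "T (Suc k) \<omega> = ereal (Inf (D k))" using \<open>t \<in> D k\<close> by (intro nemp) auto
      ultimately show False using k(2) by simp
    qed
    then show ?thesis using phase_eq[OF sw k] by simp
  qed
qed

section \<open>Inventory trajectories\<close>

definition arrival_path :: "'a inventory_data \<Rightarrow> 'a \<Rightarrow> bool" where
  "arrival_path S \<omega> \<longleftrightarrow> arrival S 0 \<omega> = 0 \<and> strict_mono (\<lambda>n. arrival S n \<omega>) \<and>
     filterlim (\<lambda>n. arrival S n \<omega>) at_top sequentially \<and> (\<forall>n\<ge>1. 0 < demand S n \<omega>)"

context
  fixes S :: "'a inventory_data" and \<omega> :: 'a
  assumes ap: "arrival_path S \<omega>"
begin

lemma arrival_0: "arrival S 0 \<omega> = 0"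
  using ap by (simp add: arrival_path_def)

lemma arrival_less_iff: "arrival S m \<omega> < arrival S n \<omega> \<longleftrightarrow> m < n"
  using ap strict_mono_less[of "\<lambda>n. arrival S n \<omega>" m n] by (simp add: arrival_path_def)

lemma arrival_le_iff: "arrival S m \<omega> \<le> arrival S n \<omega> \<longleftrightarrow> m \<le> n"
  using ap strict_mono_less_eq[of "\<lambda>n. arrival S n \<omega>" m n] by (simp add: arrival_path_def)

lemma arrival_nonneg: "0 \<le> arrival S n \<omega>"
  using arrival_le_iff[of 0 n] arrival_0 by simp

lemma arrival_interval:
  assumes "0 \<le> t" obtains n where "arrival S n \<omega> \<le> t" "t < arrival S (Suc n) \<omega>"
proof -
  have "eventually (\<lambda>n. t < arrival S n \<omega>) sequentially"
    using ap by (auto simp: arrival_path_def filterlim_at_top_dense)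
  then have ex: "\<exists>n. t < arrival S n \<omega>" by (auto simp: eventually_sequentially)
  define n where "n = (LEAST n. t < arrival S n \<omega>)"
  have n: "t < arrival S n \<omega>" unfolding n_def using ex by (rule LeastI_ex)
  then have "n \<noteq> 0" using arrival_0 assms by (cases n) auto
  then obtain m where m: "n = Suc m" by (cases n) auto
  then have "\<not> t < arrival S m \<omega>" using not_less_Least[of m "\<lambda>n. t < arrival S n \<omega>"] n_def by auto
  with n m show ?thesis by (intro that[of m]) auto
qed

lemma demand_count_eq:
  assumes "arrival S n \<omega> \<le> t" "t < arrival S (Suc n) \<omega>"
  shows "demand_count S t \<omega> = n"
proof -
  have *: "arrival S k \<omega> \<le> t \<longleftrightarrow> k \<le> n" for k
    using assms arrival_le_iff[of k n] arrival_le_iff[of "Suc n" k] by (cases "k \<le> n") auto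
  have "{k. 1 \<le> k \<and> arrival S k \<omega> \<le> t} = {k. 1 \<le> k \<and> k \<le> n}" by (simp only: *)
  also have "\<dots> = {1..n}" by auto
  finally show ?thesis by (simp add: demand_count_def)
qed

lemma demand_count_bounds:
  assumes "0 \<le> t"
  shows "arrival S (demand_count S t \<omega>) \<omega> \<le> t" "t < arrival S (Suc (demand_count S t \<omega>)) \<omega>"
  using arrival_interval[OF assms] demand_count_eq by metis+

lemma demand_count_mono:
  assumes "0 \<le> s" "s \<le> t" shows "demand_count S s \<omega> \<le> demand_count S t \<omega>"
proof -
  have "arrival S (demand_count S s \<omega>) \<omega> < arrival S (Suc (demand_count S t \<omega>)) \<omega>"
    using demand_count_bounds[of s] demand_count_bounds[of t] assms by linarith
  then show ?thesis using arrival_less_iff by simp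
qed

end

definition good_rates :: "(nat \<Rightarrow> real) \<Rightarrow> bool" where
  "good_rates \<sigma> \<longleftrightarrow> \<sigma> 0 = 0 \<and> 0 < \<sigma> 2 \<and> \<sigma> 2 < \<sigma> 1"

lemma phase_borel_measurable:
  assumes sw: "switching_path i T J \<omega>"
  shows "(\<lambda>t. phase T J t \<omega>) \<in> borel \<rightarrow>\<^sub>M count_space UNIV"
proof (subst measurable_count_space_eq_countable)
  \<comment> \<open>No switching interval contains a negative time, so \<open>phase\<close> takes
    one unspecified value at all of them.\<close>
  define c where "c = J (THE k. False) \<omega>"
  have neg: "phase T J t \<omega> = c" if "t < 0" for t
  proof -
    have "\<not> T k \<omega> \<le> ereal t" for k
      using switching_path_nonneg[OF sw, of k] that
      by (metis dual_order.trans ereal_less_eq(3) linorder_not_le zero_ereal_def)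
    then show ?thesis by (simp add: phase_def c_def)
  qed
  have pos: "phase T J t \<omega> = v \<longleftrightarrow> (\<exists>k\<in>{k. J k \<omega> = v}. T k \<omega> \<le> ereal t \<and> ereal t < T (Suc k) \<omega>)"
    if t: "0 \<le> t" for t v
  proof -
    obtain k where k: "T k \<omega> \<le> ereal t" "ereal t < T (Suc k) \<omega>"
      using switching_path_interval[OF sw t] by blast
    then have "phase T J t \<omega> = J k \<omega>" by (rule phase_eq[OF sw])
    show ?thesis
    proof
      assume "phase T J t \<omega> = v"
      then show "\<exists>k\<in>{k. J k \<omega> = v}. T k \<omega> \<le> ereal t \<and> ereal t < T (Suc k) \<omega>"
        using k \<open>phase T J t \<omega> = J k \<omega>\<close> by (intro bexI[of _ k]) simp_all
    next
      assume "\<exists>k\<in>{k. J k \<omega> = v}. T k \<omega> \<le> ereal t \<and> ereal t < T (Suc k) \<omega>"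
      then obtain m where "J m \<omega> = v" "T m \<omega> \<le> ereal t" "ereal t < T (Suc m) \<omega>" by (elim bexE conjE) simp
      then show "phase T J t \<omega> = v" using phase_eq[OF sw, of m t] by simp
    qed
  qed
  have eq: "(\<lambda>t. phase T J t \<omega>) -` {v} \<inter> space borel = {t. t < 0 \<and> c = v} \<union>
     (\<Union>k\<in>{k. J k \<omega> = v}. {t. 0 \<le> t \<and> T k \<omega> \<le> ereal t \<and> ereal t < T (Suc k) \<omega>})" for v
  proof (intro set_eqI)
    fix t show "t \<in> (\<lambda>t. phase T J t \<omega>) -` {v} \<inter> space borel \<longleftrightarrow> t \<in> {t. t < 0 \<and> c = v} \<union>
     (\<Union>k\<in>{k. J k \<omega> = v}. {t. 0 \<le> t \<and> T k \<omega> \<le> ereal t \<and> ereal t < T (Suc k) \<omega>})"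
      using neg[of t] pos[of t v] by (cases "t < 0") (simp_all add: not_less)
  qed
  show "(\<lambda>t. phase T J t \<omega>) \<in> space borel \<rightarrow> UNIV \<and>
     (\<forall>v\<in>UNIV. (\<lambda>t. phase T J t \<omega>) -` {v} \<inter> space borel \<in> sets borel)"
    unfolding eq by (auto intro!: sets.Un sets.countable_UN)
qed auto

context
  fixes S :: "'a inventory_data" and i T J and \<omega> :: 'a
  assumes rates: "good_rates (prate S)" and sw: "switching_path i T J \<omega>"
begin

lemma prate_bounds: "0 \<le> t \<Longrightarrow> 0 \<le> prate S (phase T J t \<omega>) \<and> prate S (phase T J t \<omega>) \<le> prate S 1"
  using phase_range[OF sw, of t] rates by (auto simp: good_rates_def)

lemma prate_set_integrable: "0 \<le> s \<Longrightarrow> set_integrable lborel {s..t} (\<lambda>r. prate S (phase T J r \<omega>))"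
  unfolding set_integrable_def
proof (rule integrableI_bounded_set_indicator[where B="prate S 1"])
  show "(\<lambda>r. prate S (phase T J r \<omega>)) \<in> borel_measurable lborel"
    using measurable_compose[OF phase_borel_measurable[OF sw], of "prate S" borel] by simp
  show "0 \<le> s \<Longrightarrow> AE r in lborel. r \<in> {s..t} \<longrightarrow> norm (prate S (phase T J r \<omega>)) \<le> prate S 1"
    using prate_bounds by (intro AE_I2) auto
qed (auto simp: emeasure_lborel_Icc_eq)

lemma produced_add:
  assumes "0 \<le> s" "s \<le> t" "t \<le> r"
  shows "produced S T J s t \<omega> + produced S T J t r \<omega> = produced S T J s r \<omega>"
proof -
  have "{s..r} = {s..t} \<union> {t..r}" using assms by auto
  moreover have "AE x in lborel. \<not> (x \<in> {s..t} \<and> x \<in> {t..r})"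
    using AE_lborel_singleton[of t] by eventually_elim auto
  ultimately show ?thesis unfolding produced_def
    using prate_set_integrable assms by (simp add: set_integral_Un_AE)
qed

lemma produced_nonneg: "0 \<le> s \<Longrightarrow> 0 \<le> produced S T J s t \<omega>"
  unfolding produced_def set_lebesgue_integral_def
  using prate_bounds by (intro Bochner_Integration.integral_nonneg) (auto simp: indicator_def)

lemma produced_le:
  assumes "0 \<le> s" "s \<le> t" shows "produced S T J s t \<omega> \<le> prate S 1 * (t - s)"
proof -
  have "produced S T J s t \<omega> \<le> (LBINT r:{s..t}. prate S 1)"
    unfolding produced_def using assms prate_bounds
    by (intro set_integral_mono prate_set_integrable) (auto simp: set_integrable_def)
  also have "\<dots> = prate S 1 * (t - s)"
    using assms by (simp add: set_lebesgue_integral_def)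
  finally show ?thesis .
qed

lemma produced_continuous: "0 \<le> s \<Longrightarrow> continuous_on {s..} (\<lambda>t. produced S T J s t \<omega>)"
proof -
  assume s: "0 \<le> s"
  have "(prate S 1)-lipschitz_on {s..} (\<lambda>t. produced S T J s t \<omega>)"
  proof (rule lipschitz_onI)
    show "0 \<le> prate S 1" using rates by (auto simp: good_rates_def)
    have *: "dist (produced S T J s t \<omega>) (produced S T J s r \<omega>) \<le> prate S 1 * dist t r"
      if "s \<le> t" "t \<le> r" for t r
      using produced_add[of s t r] produced_nonneg[of t r] produced_le[of t r] that s
      by (simp add: dist_real_def)
    then show "dist (produced S T J s t \<omega>) (produced S T J s r \<omega>) \<le> prate S 1 * dist t r"
      if "t \<in> {s..}" "r \<in> {s..}" for t r
      using that *[of t r] *[of r t] by (cases "t \<le> r") (auto simp: dist_commute)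
  qed
  then show ?thesis by (rule lipschitz_on_continuous_on)
qed

end

lemma produced_const:
  assumes "\<And>r. s \<le> r \<Longrightarrow> r < t \<Longrightarrow> phase T J r \<omega> = j" "s \<le> t"
  shows "produced S T J s t \<omega> = prate S j * (t - s)"
proof -
  have "produced S T J s t \<omega> = (LBINT r:{s..t}. prate S j)"
    unfolding produced_def set_lebesgue_integral_def
  proof (rule Bochner_Integration.integral_cong_AE)
    have ae: "AE r in lborel. indicator {s..t} r *\<^sub>R prate S (phase T J r \<omega>) = indicator {s..t} r *\<^sub>R prate S j"
      using AE_lborel_singleton[of t] by eventually_elim (use assms in \<open>auto simp: indicator_def\<close>)
    then show "AE r in lborel. indicator {s..t} r *\<^sub>R prate S (phase T J r \<omega>) = indicator {s..t} r *\<^sub>R prate S j" .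
    \<comment> \<open>The two integrands differ at the endpoint \<open>t\<close> only, which also
      settles measurability.\<close>
    have "(\<lambda>r. indicator {s..t} r *\<^sub>R prate S (phase T J r \<omega>)) =
        (\<lambda>r. if r = t then indicator {s..t} t *\<^sub>R prate S (phase T J t \<omega>) else indicator {s..t} r *\<^sub>R prate S j)"
      using assms by (auto simp: indicator_def)
    then show "(\<lambda>r. indicator {s..t} r *\<^sub>R prate S (phase T J r \<omega>)) \<in> borel_measurable lborel" by simp
  qed auto
  also have "\<dots> = prate S j * (t - s)" using assms by (simp add: set_lebesgue_integral_def)
  finally show ?thesis .
qed

section \<open>The operating rules and the range of the inventory\<close>

definition operating_rules ::
  "'a inventory_data \<Rightarrow> real \<Rightarrow> (nat \<Rightarrow> 'a \<Rightarrow> ereal) \<Rightarrow> (nat \<Rightarrow> 'a \<Rightarrow> nat) \<Rightarrow> 'a \<Rightarrow> bool" where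
  "operating_rules S x T J \<omega> \<longleftrightarrow>
        (\<forall>t\<ge>0. inventory S T J x t \<omega> < cap S \<longrightarrow> phase T J t \<omega> \<in> {1,2}) \<and>
        (\<forall>t\<ge>0. inventory S T J x t \<omega> = cap S \<longrightarrow> phase T J t \<omega> = 0) \<and>
        (\<forall>k. T k \<omega> < \<infinity> \<and> J k \<omega> = 0 \<longrightarrow>
           T (Suc k) \<omega> = ereal (arrival S (Suc (demand_count S (real_of_ereal (T k \<omega>)) \<omega>)) \<omega>) \<and>
           J (Suc k) \<omega> \<in> {1,2} \<and>
           (\<forall>t. T k \<omega> \<le> ereal t \<and> ereal t < T (Suc k) \<omega> \<longrightarrow> inventory S T J x t \<omega> = cap S))"

lemma admissible_iff:
  "admissible S x i T J \<longleftrightarrow> switching_strategy S i T J \<and>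
     (\<forall>t\<ge>0. phase T J t \<in> measurable (demand_filtration S t) (count_space UNIV)) \<and>
     (AE \<omega> in pspace S. operating_rules S x T J \<omega>)"
  unfolding admissible_def operating_rules_def ..

context
  fixes S :: "'a inventory_data" and i T J and \<omega> :: 'a and x
  assumes rates: "good_rates (prate S)" and sw: "switching_path i T J \<omega>" and ap: "arrival_path S \<omega>"
    and x: "lmin S \<le> x" "x \<le> cap S" and lc: "lmin S < cap S" and ru: "operating_rules S x T J \<omega>"
begin

lemma inventory_eq: "arrival S n \<omega> \<le> t \<Longrightarrow> t < arrival S (Suc n) \<omega> \<Longrightarrow>
    inventory S T J x t \<omega> = level_after S T J x n \<omega> + produced S T J (arrival S n \<omega>) t \<omega>"
  using demand_count_eq[OF ap] by (simp add: inventory_def)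

text \<open>The rules do not mention levels above the capacity. These are excluded because the level
  is continuous between arrivals: to exceed the capacity it must first attain it, and then phase 0
  keeps it there until the next arrival. The positive demand at that arrival brings it strictly
  below.\<close>

lemma level_range_step:
  assumes lev: "lmin S \<le> level_after S T J x n \<omega>" "level_after S T J x n \<omega> \<le> cap S"
  shows "arrival S n \<omega> \<le> t \<Longrightarrow> t \<le> arrival S (Suc n) \<omega> \<Longrightarrow>
      level_after S T J x n \<omega> + produced S T J (arrival S n \<omega>) t \<omega> \<in> {lmin S..cap S}"
    and "level_after S T J x (Suc n) \<omega> \<in> {lmin S..<cap S}"
proof -
  let ?a = "arrival S n \<omega>" and ?b = "arrival S (Suc n) \<omega>"
  define f where "f t = level_after S T J x n \<omega> + produced S T J ?a t \<omega>" for t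
  note a0 = arrival_nonneg[OF ap, of n]
  have ab: "?a < ?b" using arrival_less_iff[OF ap] by simp
  have cont: "continuous_on {?a..} f" unfolding f_def
    by (intro continuous_intros produced_continuous[OF rates sw] a0)
  have fa: "f ?a \<le> cap S" using produced_const[of ?a ?a T J \<omega> 0 S] lev by (simp add: f_def)
  have lt: "f t \<le> cap S" if t: "?a \<le> t" "t < ?b" for t
  proof (rule ccontr)
    assume "\<not> ?thesis"
    then have gt: "cap S < f t" by simp
    have "\<exists>r\<ge>?a. r \<le> t \<and> f r = cap S"
      using cont t fa gt by (intro IVT') (auto intro: continuous_on_subset)
    then obtain r where r: "?a \<le> r" "r \<le> t" "f r = cap S" by blast
    have inv: "inventory S T J x r \<omega> = cap S" using inventory_eq[of n r] r t by (simp add: f_def)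
    have r0: "0 \<le> r" using r a0 by simp
    have ph: "phase T J r \<omega> = 0" using ru inv r0 unfolding operating_rules_def by blast
    obtain k where k: "T k \<omega> \<le> ereal r" "ereal r < T (Suc k) \<omega>"
      using switching_path_interval[OF sw r0] by blast
    have Jk: "J k \<omega> = 0" using phase_eq[OF sw k] ph by simp
    have "T k \<omega> < \<infinity>" using k by auto
    then obtain m where m: "T (Suc k) \<omega> = ereal (arrival S m \<omega>)"
      and all: "\<And>t. T k \<omega> \<le> ereal t \<and> ereal t < T (Suc k) \<omega> \<Longrightarrow> inventory S T J x t \<omega> = cap S"
      using ru Jk unfolding operating_rules_def by blast
    have "arrival S n \<omega> < arrival S m \<omega>" using k(2) m r by simp
    then have "Suc n \<le> m" using arrival_less_iff[OF ap] by simp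
    then have "?b \<le> arrival S m \<omega>" using arrival_le_iff[OF ap] by simp
    then have "inventory S T J x t \<omega> = cap S"
      using all[of t] m t r k by (metis ereal_less(2) ereal_less_eq(3) less_ereal.simps(1) order_less_le_trans order_trans)
    then show False using inventory_eq[of n t] t gt by (simp add: f_def)
  qed
  \<comment> \<open>At the arrival \<open>inventory\<close> already includes the demand, so the
    bound for the left limit comes from an earlier time with a level halfway between
    \<open>cap S\<close> and \<open>f ?b\<close>.\<close>
  have fb: "f ?b \<le> cap S"
  proof (rule ccontr)
    assume "\<not> ?thesis"
    then have gt: "cap S < f ?b" by simp
    have "\<exists>r\<ge>?a. r \<le> ?b \<and> f r = (max (f ?a) (cap S) + f ?b) / 2"
      using cont ab fa gt by (intro IVT') (auto intro: continuous_on_subset)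
    then obtain r where r: "?a \<le> r" "r \<le> ?b" "f r = (cap S + f ?b) / 2" using fa by (auto simp: max_def split: if_splits)
    then have "r \<noteq> ?b" using gt by auto
    then show False using lt[of r] r gt by auto
  qed
  have le: "f t \<le> cap S" if "?a \<le> t" "t \<le> ?b" for t
    using lt[of t] fb that by (cases "t = ?b") auto
  have ge: "lmin S \<le> f t" for t
    using lev produced_nonneg[OF rates sw a0, of t] by (simp add: f_def)
  show "arrival S n \<omega> \<le> t \<Longrightarrow> t \<le> arrival S (Suc n) \<omega> \<Longrightarrow>
      level_after S T J x n \<omega> + produced S T J (arrival S n \<omega>) t \<omega> \<in> {lmin S..cap S}"
    using le ge by (simp add: f_def)
  have "0 < demand S (Suc n) \<omega>" using ap by (simp add: arrival_path_def)
  then show "level_after S T J x (Suc n) \<omega> \<in> {lmin S..<cap S}"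
    using fb ge[of ?b] lc unfolding f_def by (auto simp: Let_def min_def)
qed

lemma level_after_range: "level_after S T J x n \<omega> \<in> {lmin S..cap S}"
  "level_after S T J x (Suc n) \<omega> \<in> {lmin S..<cap S}"
proof -
  have *: "level_after S T J x n \<omega> \<in> {lmin S..cap S}" for n
  proof (induction n)
    case (Suc n)
    then show ?case using level_range_step(2)[of n] by fastforce
  qed (use x in simp)
  then show "level_after S T J x n \<omega> \<in> {lmin S..cap S}" .
  show "level_after S T J x (Suc n) \<omega> \<in> {lmin S..<cap S}" using level_range_step(2)[of n] *[of n] by simp
qed

lemma level_before_range: "level_before S T J x (Suc n) \<omega> \<in> {lmin S..cap S}"
  using level_range_step(1)[of n "arrival S (Suc n) \<omega>"] level_after_range[of n] arrival_le_iff[OF ap, of n "Suc n"]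
  by (simp add: level_before_def)

lemma inventory_range:
  assumes "0 \<le> t"
  shows "inventory S T J x t \<omega> \<in> {lmin S..cap S}"
    and "phase T J t \<omega> = 0 \<longleftrightarrow> inventory S T J x t \<omega> = cap S"
    and "phase T J t \<omega> \<noteq> 0 \<Longrightarrow> phase T J t \<omega> \<in> {1,2} \<and> inventory S T J x t \<omega> \<in> {lmin S..<cap S}"
proof -
  obtain n where n: "arrival S n \<omega> \<le> t" "t < arrival S (Suc n) \<omega>" using arrival_interval[OF ap assms] .
  show 1: "inventory S T J x t \<omega> \<in> {lmin S..cap S}"
    using level_range_step(1)[of n t] level_after_range[of n] n inventory_eq[OF n] by simp
  show 2: "phase T J t \<omega> = 0 \<longleftrightarrow> inventory S T J x t \<omega> = cap S"
    using ru assms 1 unfolding operating_rules_def by force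
  show "phase T J t \<omega> \<noteq> 0 \<Longrightarrow> phase T J t \<omega> \<in> {1,2} \<and> inventory S T J x t \<omega> \<in> {lmin S..<cap S}"
    using 1 2 phase_range[OF sw assms] by auto
qed

end

section \<open>Continuation of a trajectory\<close>

text \<open>Two records are involved because the comparison serves twice: for a restart at time
  \<open>s\<close> within one record and, with \<open>s = 0\<close> and \<open>m = 0\<close>, for a
  path and its image on path space. Only the phase processes have to match, not the switching
  times.\<close>

locale trajectory_shift =
  fixes S :: "'a inventory_data" and S' :: "'b inventory_data" and \<omega> :: 'a and \<omega>' :: 'b
    and T J T' J' and s :: real and m :: nat and x x' :: real and i :: nat
  assumes ap: "arrival_path S \<omega>" and ap': "arrival_path S' \<omega>'"
    and rates: "good_rates (prate S)" and sw: "switching_path i T J \<omega>"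
    and par: "lmin S' = lmin S" "cap S' = cap S" "prate S' = prate S"
    and s: "0 \<le> s" "arrival S m \<omega> \<le> s" "s < arrival S (Suc m) \<omega>"
    and arr: "\<And>n. 1 \<le> n \<Longrightarrow> arrival S' n \<omega>' = arrival S (n + m) \<omega> - s"
    and dem: "\<And>n. 1 \<le> n \<Longrightarrow> demand S' n \<omega>' = demand S (n + m) \<omega>"
    and ph: "\<And>t. 0 \<le> t \<Longrightarrow> phase T' J' t \<omega>' = phase T J (s + t) \<omega>"
    and x': "x' = inventory S T J x s \<omega>"
begin

lemma produced_shift:
  assumes "0 \<le> a" shows "produced S' T' J' a b \<omega>' = produced S T J (s + a) (s + b) \<omega>"
proof -
  let ?f = "\<lambda>r. indicator {s + a..s + b} r *\<^sub>R prate S (phase T J r \<omega>)"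
  have "produced S T J (s + a) (s + b) \<omega> = (\<integral>r. ?f (s + 1 * r) \<partial>lborel)"
    unfolding produced_def set_lebesgue_integral_def
    using lborel_integral_real_affine[of 1 ?f s] by simp
  also have "\<dots> = (\<integral>r. indicator {a..b} r *\<^sub>R prate S' (phase T' J' r \<omega>') \<partial>lborel)"
    using ph assms par by (intro Bochner_Integration.integral_cong) (auto simp: indicator_def)
  finally show ?thesis by (simp add: produced_def set_lebesgue_integral_def)
qed

lemma demand_count_shift:
  assumes "0 \<le> t" shows "demand_count S (s + t) \<omega> = demand_count S' t \<omega>' + m"
proof (rule demand_count_eq[OF ap])
  let ?n = "demand_count S' t \<omega>'"
  note b = demand_count_bounds[OF ap' assms]
  show "arrival S (?n + m) \<omega> \<le> s + t"
    using b(1) arr[of ?n] s assms by (cases "?n = 0") auto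
  show "s + t < arrival S (Suc (?n + m)) \<omega>" using b(2) arr[of "Suc ?n"] by simp
qed

lemma x'_eq: "x' = level_after S T J x m \<omega> + produced S T J (arrival S m \<omega>) s \<omega>"
  using demand_count_eq[OF ap s(2,3)] x' by (simp add: inventory_def)

text \<open>The induction starts at the first arrival after the restart, because \<open>x'\<close>
  is in general a level reached between two arrivals and not a level after one.\<close>

lemma level_before_shift: "level_before S' T' J' x' (Suc n) \<omega>' = level_before S T J x (Suc n + m) \<omega>"
  and level_after_shift: "level_after S' T' J' x' (Suc n) \<omega>' = level_after S T J x (Suc n + m) \<omega>"
proof -
  have step: "level_before S' T' J' x' (Suc n) \<omega>' = level_before S T J x (Suc n + m) \<omega> \<Longrightarrow>
    level_after S' T' J' x' (Suc n) \<omega>' = level_after S T J x (Suc n + m) \<omega>" for n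
    using dem[of "Suc n"] par by (simp add: level_before_def Let_def)
  have "level_before S' T' J' x' (Suc n) \<omega>' = level_before S T J x (Suc n + m) \<omega>"
  proof (induction n)
    case 0
    have "produced S' T' J' 0 (arrival S' 1 \<omega>') \<omega>' = produced S T J s (arrival S (Suc m) \<omega>) \<omega>"
      using produced_shift[of 0 "arrival S' 1 \<omega>'"] arr[of 1] by simp
    then show ?case
      using produced_add[OF rates sw, of "arrival S m \<omega>" s "arrival S (Suc m) \<omega>"] s
        arrival_nonneg[OF ap, of m] arrival_0[OF ap'] x'_eq by (simp add: level_before_def)
  next
    case (Suc n)
    have "0 \<le> arrival S' (Suc n) \<omega>'" using arrival_nonneg[OF ap'] .
    then have "produced S' T' J' (arrival S' (Suc n) \<omega>') (arrival S' (Suc (Suc n)) \<omega>') \<omega>'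
        = produced S T J (arrival S (Suc n + m) \<omega>) (arrival S (Suc (Suc n) + m) \<omega>) \<omega>"
      using produced_shift arr[of "Suc n"] arr[of "Suc (Suc n)"] by simp
    then show ?case using step[OF Suc] by (simp add: level_before_def)
  qed
  then show "level_before S' T' J' x' (Suc n) \<omega>' = level_before S T J x (Suc n + m) \<omega>" .
  then show "level_after S' T' J' x' (Suc n) \<omega>' = level_after S T J x (Suc n + m) \<omega>" by (rule step)
qed

lemma inventory_shift:
  assumes "0 \<le> t" shows "inventory S' T' J' x' t \<omega>' = inventory S T J x (s + t) \<omega>"
proof -
  let ?n = "demand_count S' t \<omega>'"
  note cnt = demand_count_shift[OF assms]
  show ?thesis
  proof (cases ?n)
    case 0
    then show ?thesis
      using produced_shift[of 0 t] produced_add[OF rates sw, of "arrival S m \<omega>" s "s + t"] s assms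
        arrival_nonneg[OF ap, of m] arrival_0[OF ap'] x'_eq cnt
      by (simp add: inventory_def Let_def)
  next
    case (Suc k)
    have "produced S' T' J' (arrival S' (Suc k) \<omega>') t \<omega>' = produced S T J (arrival S (Suc k + m) \<omega>) (s + t) \<omega>"
      using produced_shift[OF arrival_nonneg[OF ap'], of "Suc k" t] arr[of "Suc k"] by simp
    then show ?thesis using level_after_shift[of k] cnt Suc by (simp add: inventory_def Let_def)
  qed
qed

end

section \<open>Pathwise costs and their splitting at a restart time\<close>

definition hold_cost ::
  "'a inventory_data \<Rightarrow> real \<Rightarrow> (nat \<Rightarrow> 'a \<Rightarrow> ereal) \<Rightarrow> (nat \<Rightarrow> 'a \<Rightarrow> nat) \<Rightarrow> 'a \<Rightarrow> ennreal" where
  "hold_cost S x T J \<omega> = (\<integral>\<^sup>+t\<in>{0..}. ennreal (exp (- disc S * t) *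
          hold S (phase T J t \<omega>) (inventory S T J x t \<omega>)) \<partial>lborel)"

definition switch_term ::
  "'a inventory_data \<Rightarrow> (nat \<Rightarrow> 'a \<Rightarrow> ereal) \<Rightarrow> (nat \<Rightarrow> 'a \<Rightarrow> nat) \<Rightarrow> 'a \<Rightarrow> nat \<Rightarrow> ennreal" where
  "switch_term S T J \<omega> k = (if T (Suc k) \<omega> < \<infinity>
          then ennreal (exp (- disc S * real_of_ereal (T (Suc k) \<omega>)) * swcost S (J k \<omega>) (J (Suc k) \<omega>))
          else 0)"

definition penalty_term ::
  "'a inventory_data \<Rightarrow> real \<Rightarrow> (nat \<Rightarrow> 'a \<Rightarrow> ereal) \<Rightarrow> (nat \<Rightarrow> 'a \<Rightarrow> nat) \<Rightarrow> 'a \<Rightarrow> nat \<Rightarrow> ennreal" where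
  "penalty_term S x T J \<omega> n = (let y = level_before S T J x (Suc n) \<omega> - lmin S in
          if y < demand S (Suc n) \<omega>
          then ennreal (exp (- disc S * arrival S (Suc n) \<omega>) * penalty S (demand S (Suc n) \<omega> - y))
          else 0)"

definition path_cost ::
  "'a inventory_data \<Rightarrow> real \<Rightarrow> (nat \<Rightarrow> 'a \<Rightarrow> ereal) \<Rightarrow> (nat \<Rightarrow> 'a \<Rightarrow> nat) \<Rightarrow> 'a \<Rightarrow> ennreal" where
  "path_cost S x T J \<omega> = hold_cost S x T J \<omega> + (\<Sum>k. switch_term S T J \<omega> k) + (\<Sum>n. penalty_term S x T J \<omega> n)"

lemma cost_eq: "cost S x T J = (\<integral>\<^sup>+\<omega>. hold_cost S x T J \<omega> \<partial>pspace S)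
   + (\<integral>\<^sup>+\<omega>. (\<Sum>k. switch_term S T J \<omega> k) \<partial>pspace S)
   + (\<integral>\<^sup>+\<omega>. (\<Sum>n. penalty_term S x T J \<omega> n) \<partial>pspace S)"
  unfolding cost_def hold_cost_def switch_term_def penalty_term_def ..

text \<open>Here \<open>m\<close> arrivals and \<open>\<kappa>\<close> switches have occurred up to
  time \<open>s\<close>. The restarted strategy begins in the phase that holds at \<open>s\<close>,
  whose switch \<open>T \<kappa>\<close> may lie before \<open>s\<close>; hence the separate value
  of \<open>T'\<close> for \<open>k = 0\<close>.\<close>

locale strategy_shift =
  fixes S :: "'a inventory_data" and \<omega> \<omega>' :: 'a
    and T J T' J' and s :: real and m \<kappa> :: nat and x x' :: real and i :: nat
  assumes ap: "arrival_path S \<omega>" and ap': "arrival_path S \<omega>'"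
    and rates: "good_rates (prate S)" and sw: "switching_path i T J \<omega>"
    and s: "0 \<le> s" "arrival S m \<omega> \<le> s" "s < arrival S (Suc m) \<omega>"
    and arr: "\<And>n. 1 \<le> n \<Longrightarrow> arrival S n \<omega>' = arrival S (n + m) \<omega> - s"
    and dem: "\<And>n. 1 \<le> n \<Longrightarrow> demand S n \<omega>' = demand S (n + m) \<omega>"
    and \<kappa>: "T \<kappa> \<omega> \<le> ereal s" "ereal s < T (Suc \<kappa>) \<omega>"
    and T': "\<And>k. T' k \<omega>' = (if k = 0 then 0 else T (k + \<kappa>) \<omega> - ereal s)"
    and J': "\<And>k. J' k \<omega>' = J (k + \<kappa>) \<omega>"
    and x': "x' = inventory S T J x s \<omega>"
begin

lemma T'_le_iff:
  assumes "0 \<le> t"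
  shows "T' k \<omega>' \<le> ereal t \<longleftrightarrow> T (k + \<kappa>) \<omega> \<le> ereal (s + t)"
    and "ereal t < T' k \<omega>' \<longleftrightarrow> ereal (s + t) < T (k + \<kappa>) \<omega>"
proof -
  have "T \<kappa> \<omega> \<le> ereal (s + t)" using \<kappa>(1) assms by (cases "T \<kappa> \<omega>") auto
  then show *: "T' k \<omega>' \<le> ereal t \<longleftrightarrow> T (k + \<kappa>) \<omega> \<le> ereal (s + t)"
    using assms T'[of k] \<kappa>(1) by (cases "T (k + \<kappa>) \<omega>"; cases "k = 0") (auto simp: zero_ereal_def)
  show "ereal t < T' k \<omega>' \<longleftrightarrow> ereal (s + t) < T (k + \<kappa>) \<omega>" using * by (simp add: not_le[symmetric])
qed

lemma T'_finite_iff: "T' k \<omega>' < \<infinity> \<longleftrightarrow> T (k + \<kappa>) \<omega> < \<infinity>"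
  using T'[of k] \<kappa>(1) by (cases "T (k + \<kappa>) \<omega>"; cases "k = 0") auto

lemma T'_pos: "0 < T' 1 \<omega>'"
  using T'_le_iff(2)[of 0 1] \<kappa>(2) by (simp add: zero_ereal_def)

lemma switching_path_shift: "switching_path (J \<kappa> \<omega>) T' J' \<omega>'"
  unfolding switching_path_def
proof (intro conjI allI impI)
  show "T' 0 \<omega>' = 0" "J' 0 \<omega>' = J \<kappa> \<omega>" using T' J' by simp_all
  show "0 \<le> T' 1 \<omega>'" using T'_pos by simp
  show "J' k \<omega>' \<in> {0, 1, 2}" for k using switching_path_phases[OF sw] by (simp add: J')
  show "J' (Suc k) \<omega>' \<noteq> J' k \<omega>'" if "T' (Suc k) \<omega>' < \<infinity>" for k
    using switching_path_neq[OF sw, of "k + \<kappa>"] that T'_finite_iff[of "Suc k"] by (simp add: J')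
  show "if T' k \<omega>' < \<infinity> then T' k \<omega>' < T' (Suc k) \<omega>' else T' (Suc k) \<omega>' = \<infinity>" if k: "1 \<le> k" for k
  proof (cases "T' k \<omega>' < \<infinity>")
    case True
    then have "T (k + \<kappa>) \<omega> < T (Suc k + \<kappa>) \<omega>"
      using switching_path_strict[OF sw, of "k + \<kappa>"] T'_finite_iff[of k] k by simp
    then show ?thesis using True T'[of k] T'[of "Suc k"] k switching_path_nonneg[OF sw, of "k + \<kappa>"]
      by (cases "T (k + \<kappa>) \<omega>"; cases "T (Suc k + \<kappa>) \<omega>") auto
  next
    case False
    then have "T (k + \<kappa>) \<omega> = \<infinity>" using T'_finite_iff[of k] by simp
    then have "T (Suc k + \<kappa>) \<omega> = \<infinity>" using switching_path_le_Suc[OF sw, of "k + \<kappa>"] by simp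
    then show ?thesis using False T'[of "Suc k"] by simp
  qed
  fix t :: real
  obtain k where k: "ereal (s + max 0 t) < T k \<omega>" using switching_path_unbounded[OF sw] by blast
  have "\<kappa> \<le> k"
  proof (rule ccontr)
    assume "\<not> \<kappa> \<le> k"
    then have "T k \<omega> \<le> T \<kappa> \<omega>" using switching_path_mono[OF sw] by simp
    then have "T k \<omega> \<le> ereal (s + max 0 t)" using \<kappa>(1) by (cases "T \<kappa> \<omega>"; cases "T k \<omega>") auto
    with k show False by simp
  qed
  then have "ereal (max 0 t) < T' (k - \<kappa>) \<omega>'" using T'_le_iff(2)[of "max 0 t" "k - \<kappa>"] k by simp
  then show "\<exists>k. ereal t < T' k \<omega>'"
    by (intro exI[of _ "k - \<kappa>"]) (metis ereal_less_eq(3) max.cobounded2 order_le_less_trans)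
qed

lemma phase_shift:
  assumes "0 \<le> t" shows "phase T' J' t \<omega>' = phase T J (s + t) \<omega>"
proof -
  obtain k where k: "T' k \<omega>' \<le> ereal t" "ereal t < T' (Suc k) \<omega>'"
    using switching_path_interval[OF switching_path_shift assms] .
  have "phase T' J' t \<omega>' = J' k \<omega>'" using k by (rule phase_eq[OF switching_path_shift])
  moreover have "phase T J (s + t) \<omega> = J (k + \<kappa>) \<omega>"
    using k T'_le_iff[OF assms] by (intro phase_eq[OF sw]) auto
  ultimately show ?thesis by (simp add: J')
qed

sublocale trajectory_shift S S \<omega> \<omega>' T J T' J' s m x x' i
  by unfold_locales (use ap ap' rates sw s arr dem phase_shift x' in auto)

lemma operating_rules_shift:
  assumes ru: "operating_rules S x T J \<omega>"
  shows "operating_rules S x' T' J' \<omega>'"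
  unfolding operating_rules_def
proof (intro conjI allI impI)
  fix t :: real assume t: "0 \<le> t"
  show "phase T' J' t \<omega>' \<in> {1, 2}" if "inventory S T' J' x' t \<omega>' < cap S"
    using that ru t s inventory_shift[OF t] phase_shift[OF t] unfolding operating_rules_def by simp
  show "phase T' J' t \<omega>' = 0" if "inventory S T' J' x' t \<omega>' = cap S"
    using that ru t s inventory_shift[OF t] phase_shift[OF t] unfolding operating_rules_def by simp
next
  fix k assume k: "T' k \<omega>' < \<infinity> \<and> J' k \<omega>' = 0"
  then have fin: "T (k + \<kappa>) \<omega> < \<infinity>" and J0: "J (k + \<kappa>) \<omega> = 0" using T'_finite_iff J' by auto
  let ?d = "demand_count S (real_of_ereal (T (k + \<kappa>) \<omega>)) \<omega>"
  have nx: "T (Suc k + \<kappa>) \<omega> = ereal (arrival S (Suc ?d) \<omega>)"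
    and J1: "J (Suc k + \<kappa>) \<omega> \<in> {1, 2}"
    and full: "\<And>t. T (k + \<kappa>) \<omega> \<le> ereal t \<Longrightarrow> ereal t < T (Suc k + \<kappa>) \<omega> \<Longrightarrow> inventory S T J x t \<omega> = cap S"
    using ru fin J0 unfolding operating_rules_def by auto
  show "J' (Suc k) \<omega>' \<in> {1, 2}" using J1 J' by simp
  obtain r where r: "T (k + \<kappa>) \<omega> = ereal r" "0 \<le> r"
    using fin switching_path_nonneg[OF sw, of "k + \<kappa>"]
    by (cases "T (k + \<kappa>) \<omega>") (auto simp: zero_ereal_def)
  let ?t = "real_of_ereal (T' k \<omega>')"
  have t0: "0 \<le> ?t"
  proof (cases "k = 0")
    case False
    then have "T (Suc \<kappa>) \<omega> \<le> T (k + \<kappa>) \<omega>" using switching_path_mono[OF sw, of "Suc \<kappa>" "k + \<kappa>"] by simp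
    then have "ereal s < T (k + \<kappa>) \<omega>" using \<kappa>(2) by order
    then show ?thesis using T'[of k] r False by simp
  qed (simp add: T')
  have cnt: "?d = demand_count S ?t \<omega>' + m"
  proof (cases "k = 0")
    case False
    then have "r = s + ?t" using T'[of k] r by simp
    then show ?thesis using demand_count_shift[OF t0] r by simp
  next
    case True
    \<comment> \<open>The current stay in phase 0 may have begun before \<open>s\<close>. It lasts
      beyond \<open>s\<close>, so no arrival falls between its start and \<open>s\<close>, and the
      next arrival is the same counted from either time.\<close>
    have "r \<le> s" using r \<kappa>(1) True by simp
    then have "demand_count S r \<omega> \<le> demand_count S s \<omega>" using demand_count_mono[OF ap r(2)] by simp
    moreover have "demand_count S s \<omega> = m" using demand_count_eq[OF ap s(2,3)] .
    moreover have "s < arrival S (Suc (demand_count S r \<omega>)) \<omega>" using nx \<kappa>(2) True r by simp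
    then have "arrival S m \<omega> < arrival S (Suc (demand_count S r \<omega>)) \<omega>" using s by simp
    then have "m < Suc (demand_count S r \<omega>)" using arrival_less_iff[OF ap] by simp
    ultimately have "demand_count S r \<omega> = m" by simp
    moreover have "demand_count S 0 \<omega>' = 0"
      using demand_count_eq[OF ap', of 0 0] arrival_0[OF ap'] arrival_less_iff[OF ap', of 0 1] by simp
    ultimately show ?thesis using True r T'[of 0] by simp
  qed
  show "T' (Suc k) \<omega>' = ereal (arrival S (Suc (demand_count S ?t \<omega>')) \<omega>')"
    using T'[of "Suc k"] nx cnt arr[of "Suc (demand_count S ?t \<omega>')"] by simp
  fix t assume t: "T' k \<omega>' \<le> ereal t \<and> ereal t < T' (Suc k) \<omega>'"
  have "0 \<le> t" using t switching_path_nonneg[OF switching_path_shift, of k]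
    by (metis dual_order.trans ereal_less_eq(3) zero_ereal_def)
  then show "inventory S T' J' x' t \<omega>' = cap S"
    using inventory_shift t full[of "s + t"] T'_le_iff[of t k] T'_le_iff[of t "Suc k"] by simp
qed

text \<open>\<open>switch_term\<close> number \<open>k\<close> belongs to the switch at
  \<open>T (Suc k)\<close> and \<open>penalty_term\<close> number \<open>n\<close> to arrival
  \<open>Suc n\<close>. The sums below \<open>\<kappa>\<close> and \<open>m\<close> therefore
  contain what happens up to and including time \<open>s\<close>, and the remaining terms form the
  discounted cost of the restart.\<close>

lemma path_cost_shift:
  assumes meas: "(\<lambda>t. indicator {0..} t * ennreal (exp (- disc S * t) *
      hold S (phase T J t \<omega>) (inventory S T J x t \<omega>))) \<in> borel_measurable borel"
  shows "path_cost S x T J \<omega> =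
    (\<integral>\<^sup>+t\<in>{0..<s}. ennreal (exp (- disc S * t) * hold S (phase T J t \<omega>) (inventory S T J x t \<omega>)) \<partial>lborel)
    + (\<Sum>k<\<kappa>. switch_term S T J \<omega> k) + (\<Sum>n<m. penalty_term S x T J \<omega> n)
    + ennreal (exp (- disc S * s)) * path_cost S x' T' J' \<omega>'"
proof -
  define f where "f t = ennreal (exp (- disc S * t) * hold S (phase T J t \<omega>) (inventory S T J x t \<omega>))" for t
  let ?e = "ennreal (exp (- disc S * s))"
  have exps: "exp (- disc S * (s + t)) = exp (- disc S * s) * exp (- disc S * t)" for t
    by (simp add: exp_add[symmetric] algebra_simps)
  have meas': "(\<lambda>t. indicator {0..} t * f t) \<in> borel_measurable borel" using meas by (simp add: f_def)
  have m1: "(\<lambda>t. indicator A t * (indicator {0..} t * f t)) \<in> borel_measurable borel" if "A \<in> sets borel" for A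
    using meas' that by measurable
  have "hold_cost S x T J \<omega> = (\<integral>\<^sup>+t. indicator {0..<s} t * (indicator {0..} t * f t)
      + indicator {s..} t * (indicator {0..} t * f t) \<partial>lborel)"
    unfolding hold_cost_def f_def[symmetric] using s
    by (intro nn_integral_cong) (auto simp: indicator_def)
  also have "\<dots> = (\<integral>\<^sup>+t. indicator {0..<s} t * (indicator {0..} t * f t) \<partial>lborel)
      + (\<integral>\<^sup>+t. indicator {s..} t * (indicator {0..} t * f t) \<partial>lborel)"
    using m1 by (intro nn_integral_add) auto
  also have "(\<integral>\<^sup>+t. indicator {0..<s} t * (indicator {0..} t * f t) \<partial>lborel) = (\<integral>\<^sup>+t\<in>{0..<s}. f t \<partial>lborel)"
    by (intro nn_integral_cong) (auto simp: indicator_def)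
  also have "(\<integral>\<^sup>+t. indicator {s..} t * (indicator {0..} t * f t) \<partial>lborel)
      = (\<integral>\<^sup>+t. indicator {s..} (s + 1 * t) * (indicator {0..} (s + 1 * t) * f (s + 1 * t)) \<partial>lborel)"
    using m1[of "{s..}"] by (subst nn_integral_real_affine[where c=1 and t=s]) auto
  also have "\<dots> = (\<integral>\<^sup>+t. ?e * (indicator {0..} t * ennreal (exp (- disc S * t) *
      hold S (phase T' J' t \<omega>') (inventory S T' J' x' t \<omega>'))) \<partial>lborel)"
  proof (intro nn_integral_cong)
    fix t :: real
    show "indicator {s..} (s + 1 * t) * (indicator {0..} (s + 1 * t) * f (s + 1 * t)) =
      ?e * (indicator {0..} t * ennreal (exp (- disc S * t) *
      hold S (phase T' J' t \<omega>') (inventory S T' J' x' t \<omega>')))"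
      using s phase_shift[of t] inventory_shift[of t] unfolding f_def exps
      by (cases "0 \<le> t") (auto simp: ennreal_mult'[symmetric] mult.assoc exps)
  qed
  also have "\<dots> = ?e * hold_cost S x' T' J' \<omega>'"
  proof -
    have "(\<lambda>t. indicator {s..} (s + 1 * t) * (indicator {0..} (s + 1 * t) * f (s + 1 * t))) \<in> borel_measurable borel"
      by (rule measurable_compose[OF _ m1]) auto
    \<comment> \<open>Taking the discount factor out of the integral requires a measurable integrand
      for the restarted strategy; it is obtained from the translated old one by multiplication with
      \<open>exp (disc S * s)\<close>.\<close>
    then have "(\<lambda>t. ennreal (exp (disc S * s)) * (indicator {s..} (s + 1 * t) * (indicator {0..} (s + 1 * t) * f (s + 1 * t)))) \<in> borel_measurable borel"
      by measurable
    also have "(\<lambda>t. ennreal (exp (disc S * s)) * (indicator {s..} (s + 1 * t) * (indicator {0..} (s + 1 * t) * f (s + 1 * t))))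
       = (\<lambda>t. indicator {0..} t * ennreal (exp (- disc S * t) *
      hold S (phase T' J' t \<omega>') (inventory S T' J' x' t \<omega>')))"
    proof
      fix t
      have "exp (disc S * s) * exp (- disc S * (s + t)) = exp (- disc S * t)"
        by (simp add: exp_add[symmetric] algebra_simps)
      then show "ennreal (exp (disc S * s)) * (indicator {s..} (s + 1 * t) * (indicator {0..} (s + 1 * t) * f (s + 1 * t))) =
        indicator {0..} t * ennreal (exp (- disc S * t) *
        hold S (phase T' J' t \<omega>') (inventory S T' J' x' t \<omega>'))"
        using s phase_shift[of t] inventory_shift[of t] unfolding f_def
        by (cases "0 \<le> t") (auto simp: ennreal_mult'[symmetric] mult.assoc[symmetric])
    qed
    finally show ?thesis
      unfolding hold_cost_def by (subst nn_integral_cmult) (auto simp: mult.commute)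
  qed
  finally have h: "hold_cost S x T J \<omega> = (\<integral>\<^sup>+t\<in>{0..<s}. f t \<partial>lborel) + ?e * hold_cost S x' T' J' \<omega>'" .
  have sw: "(\<Sum>k. switch_term S T J \<omega> k) = (\<Sum>k<\<kappa>. switch_term S T J \<omega> k) + ?e * (\<Sum>k. switch_term S T' J' \<omega>' k)"
  proof -
    have "switch_term S T J \<omega> (k + \<kappa>) = ?e * switch_term S T' J' \<omega>' k" for k
    proof (cases "T' (Suc k) \<omega>' < \<infinity>")
      case True
      then obtain r where r: "T (Suc k + \<kappa>) \<omega> = ereal r"
        using T'_finite_iff[of "Suc k"] switching_path_nonneg[OF sw, of "Suc k + \<kappa>"]
        by (cases "T (Suc k + \<kappa>) \<omega>") auto
      then have "exp (- disc S * r) = exp (- disc S * s) * exp (- disc S * real_of_ereal (T' (Suc k) \<omega>'))"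
        using exps[of "r - s"] T'[of "Suc k"] by simp
      then show ?thesis using True r T'_finite_iff[of "Suc k"] J'
        by (simp add: switch_term_def ennreal_mult'[symmetric] mult.assoc)
    next
      case False
      then show ?thesis using T'_finite_iff[of "Suc k"] by (simp add: switch_term_def)
    qed
    then show ?thesis
      by (subst suminf_offset[where i=\<kappa>]) (auto simp: add.commute)
  qed
  have pen: "(\<Sum>n. penalty_term S x T J \<omega> n) = (\<Sum>n<m. penalty_term S x T J \<omega> n) + ?e * (\<Sum>n. penalty_term S x' T' J' \<omega>' n)"
  proof -
    have "penalty_term S x T J \<omega> (n + m) = ?e * penalty_term S x' T' J' \<omega>' n" for n
    proof -
      have "exp (- disc S * arrival S (Suc (n + m)) \<omega>) = exp (- disc S * s) * exp (- disc S * arrival S (Suc n) \<omega>')"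
        using exps[of "arrival S (Suc (n + m)) \<omega> - s"] arr[of "Suc n"] by simp
      then show ?thesis using level_before_shift[of n] dem[of "Suc n"]
        by (simp add: penalty_term_def Let_def ennreal_mult'[symmetric] mult.assoc)
    qed
    then show ?thesis
      by (subst suminf_offset[where i=m]) (auto simp: add.commute)
  qed
  show ?thesis unfolding path_cost_def h sw pen f_def[symmetric] by (simp add: algebra_simps)
qed

end

section \<open>Measurability of jump times\<close>

text \<open>Observing a step process at countably many times reveals its jump times and values. This
  serves for the phase process of a strategy and for the cumulative demand, whose jump times are the
  arrivals; \<open>V\<close> is real to cover both. A jump at time 0 is allowed, so the start value
  \<open>v\<^sub>0\<close> need not be visible in \<open>Z 0\<close>.\<close>

locale jump_process =
  fixes \<Omega> :: "'a set" and F :: "real \<Rightarrow> 'a measure" and T :: "nat \<Rightarrow> 'a \<Rightarrow> ereal"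
    and V :: "nat \<Rightarrow> 'a \<Rightarrow> real" and Z :: "real \<Rightarrow> 'a \<Rightarrow> real" and v\<^sub>0 :: real
  assumes space_F: "\<And>t. space (F t) = \<Omega>"
    and sets_F_mono: "\<And>s t. 0 \<le> s \<Longrightarrow> s \<le> t \<Longrightarrow> sets (F s) \<subseteq> sets (F t)"
    and Z_measurable: "\<And>t. 0 \<le> t \<Longrightarrow> Z t \<in> borel_measurable (F t)"
    and T_0: "\<And>\<omega>. \<omega> \<in> \<Omega> \<Longrightarrow> T 0 \<omega> = 0" and V_0: "\<And>\<omega>. \<omega> \<in> \<Omega> \<Longrightarrow> V 0 \<omega> = v\<^sub>0"
    and T_mono: "\<And>\<omega> k. \<omega> \<in> \<Omega> \<Longrightarrow> T k \<omega> \<le> T (Suc k) \<omega>"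
    and T_strict: "\<And>\<omega> k. \<omega> \<in> \<Omega> \<Longrightarrow> 1 \<le> k \<Longrightarrow> T k \<omega> < \<infinity> \<Longrightarrow> T k \<omega> < T (Suc k) \<omega>"
    and V_neq: "\<And>\<omega> k. \<omega> \<in> \<Omega> \<Longrightarrow> T (Suc k) \<omega> < \<infinity> \<Longrightarrow> V (Suc k) \<omega> \<noteq> V k \<omega>"
    and Z_eq: "\<And>\<omega> k t. \<omega> \<in> \<Omega> \<Longrightarrow> T k \<omega> \<le> ereal t \<Longrightarrow> ereal t < T (Suc k) \<omega> \<Longrightarrow> Z t \<omega> = V k \<omega>"
begin

text \<open>Rational times alone would miss a jump exactly at \<open>t\<close>.\<close>

definition times :: "real \<Rightarrow> real set" where "times t = (\<rat> \<inter> {0..t}) \<union> {t}"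

lemma times_countable: "countable (times t)"
  unfolding times_def using countable_rat by (auto intro: countable_subset[of _ \<rat>])

lemma times_pick:
  assumes "0 \<le> r" "r \<le> t" "ereal r < e"
  obtains p where "p \<in> times t" "r \<le> p" "ereal p < e"
proof (cases "r = t")
  case True
  then show ?thesis using assms that[of t] by (auto simp: times_def)
next
  case False
  obtain c where c: "r < c" "ereal c \<le> e"
    using assms(3) by (cases e) (auto intro: that[of "r + 1"])
  have "r < min t c" using False assms c by auto
  then obtain p where p: "p \<in> \<rat>" "r < p" "p < min t c" using Rats_dense_in_real by blast
  have "ereal p < e" using p(3) c(2) by (metis ereal_less_eq(3) less_ereal.simps(1) min_less_iff_conj order_less_le_trans)
  then show ?thesis using p assms by (intro that[of p]) (auto simp: times_def)
qed

lemma timesD: "0 \<le> t \<Longrightarrow> p \<in> times t \<Longrightarrow> 0 \<le> p \<and> p \<le> t"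
  by (auto simp: times_def)

lemma T_nonneg: "\<omega> \<in> \<Omega> \<Longrightarrow> 0 \<le> T k \<omega>"
  by (induction k) (use T_0 T_mono order_trans in \<open>auto, blast\<close>)

lemma T_real:
  assumes "\<omega> \<in> \<Omega>" "T k \<omega> \<le> ereal t"
  obtains r where "T k \<omega> = ereal r" "0 \<le> r" "r \<le> t"
  using assms T_nonneg[of \<omega> k] by (cases "T k \<omega>") (auto simp: zero_ereal_def)

lemma Z_sets: "0 \<le> p \<Longrightarrow> p \<le> t \<Longrightarrow> A \<in> sets borel \<Longrightarrow> {\<omega>\<in>\<Omega>. Z p \<omega> \<in> A} \<in> sets (F t)"
  using measurable_sets[OF Z_measurable, of p A] sets_F_mono[of p t] space_F[of p]
  by (auto simp: vimage_def Int_def conj_commute)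

text \<open>A jump after the first has occurred by \<open>t\<close> exactly if \<open>Z\<close>
  differs at two observation times, the earlier of which does not precede the previous jump. For the
  first jump the comparison is with \<open>v\<^sub>0\<close>, because that jump may take place at
  time 0.\<close>

lemma jump_time_sets_Suc: "0 \<le> t \<Longrightarrow> {\<omega>\<in>\<Omega>. T (Suc k) \<omega> \<le> ereal t} \<in> sets (F t)"
proof (induction k arbitrary: t)
  case (0 t)
  have "{\<omega>\<in>\<Omega>. T (Suc 0) \<omega> \<le> ereal t} = (\<Union>p\<in>times t. {\<omega>\<in>\<Omega>. Z p \<omega> \<in> - {v\<^sub>0}})"
  proof (intro set_eqI iffI)
    fix \<omega> assume "\<omega> \<in> {\<omega>\<in>\<Omega>. T (Suc 0) \<omega> \<le> ereal t}"
    then have \<omega>: "\<omega> \<in> \<Omega>" "T (Suc 0) \<omega> \<le> ereal t" by auto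
    obtain r where r: "T (Suc 0) \<omega> = ereal r" "0 \<le> r" "r \<le> t" using T_real[OF \<omega>] .
    have "ereal r < T (Suc (Suc 0)) \<omega>" using T_strict[of \<omega> "Suc 0"] \<omega> r by simp
    then obtain p where p: "p \<in> times t" "r \<le> p" "ereal p < T (Suc (Suc 0)) \<omega>"
      using times_pick[OF r(2,3)] by blast
    have "Z p \<omega> = V (Suc 0) \<omega>" using p r \<omega> by (intro Z_eq) auto
    then have "Z p \<omega> \<noteq> v\<^sub>0" using V_neq[of \<omega> 0] V_0[of \<omega>] \<omega> r by simp
    then show "\<omega> \<in> (\<Union>p\<in>times t. {\<omega>\<in>\<Omega>. Z p \<omega> \<in> - {v\<^sub>0}})" using p \<omega> by blast
  next
    fix \<omega> assume "\<omega> \<in> (\<Union>p\<in>times t. {\<omega>\<in>\<Omega>. Z p \<omega> \<in> - {v\<^sub>0}})"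
    then obtain p where p: "p \<in> times t" "\<omega> \<in> \<Omega>" "Z p \<omega> \<noteq> v\<^sub>0" by blast
    have "\<not> ereal p < T (Suc 0) \<omega>"
      using Z_eq[of \<omega> 0 p] p timesD[OF 0 p(1)] T_0[of \<omega>] V_0[of \<omega>] by (auto simp: zero_ereal_def)
    then show "\<omega> \<in> {\<omega>\<in>\<Omega>. T (Suc 0) \<omega> \<le> ereal t}"
      using p timesD[OF 0 p(1)] by (auto simp: not_less intro: order_trans)
  qed
  also have "\<dots> \<in> sets (F t)"
    using timesD[OF 0] times_countable by (intro sets.countable_UN'' Z_sets) auto
  finally show ?case .
next
  case (Suc k t)
  have "{\<omega>\<in>\<Omega>. T (Suc (Suc k)) \<omega> \<le> ereal t} = (\<Union>p\<in>times t. \<Union>q\<in>times t \<inter> {p..}.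
      {\<omega>\<in>\<Omega>. T (Suc k) \<omega> \<le> ereal p} \<inter> {\<omega>\<in>\<Omega>. Z q \<omega> - Z p \<omega> \<in> - {0}})"
  proof (intro set_eqI iffI)
    fix \<omega> assume "\<omega> \<in> {\<omega>\<in>\<Omega>. T (Suc (Suc k)) \<omega> \<le> ereal t}"
    then have \<omega>: "\<omega> \<in> \<Omega>" "T (Suc (Suc k)) \<omega> \<le> ereal t" by auto
    obtain r where r: "T (Suc (Suc k)) \<omega> = ereal r" "0 \<le> r" "r \<le> t" using T_real[OF \<omega>] .
    have "T (Suc k) \<omega> \<le> ereal t" using \<omega> T_mono[of \<omega> "Suc k"] by (auto intro: order_trans)
    then obtain u where u: "T (Suc k) \<omega> = ereal u" "0 \<le> u" "u \<le> t" using T_real \<omega>(1) by blast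
    have "u < r" using T_strict[of \<omega> "Suc k"] \<omega> u r by simp
    then obtain p where p: "p \<in> \<rat>" "u < p" "p < r" using Rats_dense_in_real by blast
    have "ereal r < T (Suc (Suc (Suc k))) \<omega>" using T_strict[of \<omega> "Suc (Suc k)"] \<omega> r by simp
    then obtain q where q: "q \<in> times t" "r \<le> q" "ereal q < T (Suc (Suc (Suc k))) \<omega>"
      using times_pick[OF r(2,3)] by blast
    have "Z q \<omega> = V (Suc (Suc k)) \<omega>" using q r \<omega> by (intro Z_eq) auto
    moreover have "Z p \<omega> = V (Suc k) \<omega>" using p r u \<omega> by (intro Z_eq) auto
    ultimately have "Z q \<omega> - Z p \<omega> \<noteq> 0" using V_neq[of \<omega> "Suc k"] \<omega> r by simp
    moreover have "p \<in> times t" using p u r by (auto simp: times_def)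
    ultimately show "\<omega> \<in> (\<Union>p\<in>times t. \<Union>q\<in>times t \<inter> {p..}.
      {\<omega>\<in>\<Omega>. T (Suc k) \<omega> \<le> ereal p} \<inter> {\<omega>\<in>\<Omega>. Z q \<omega> - Z p \<omega> \<in> - {0}})"
      using q \<omega> p u by (intro UN_I[of p] UN_I[of q]) auto
  next
    fix \<omega> assume "\<omega> \<in> (\<Union>p\<in>times t. \<Union>q\<in>times t \<inter> {p..}.
      {\<omega>\<in>\<Omega>. T (Suc k) \<omega> \<le> ereal p} \<inter> {\<omega>\<in>\<Omega>. Z q \<omega> - Z p \<omega> \<in> - {0}})"
    then obtain p q where pq: "p \<in> times t" "q \<in> times t" "p \<le> q" "\<omega> \<in> \<Omega>"
      "T (Suc k) \<omega> \<le> ereal p" "Z q \<omega> \<noteq> Z p \<omega>" by auto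
    have "\<not> ereal q < T (Suc (Suc k)) \<omega>"
    proof
      assume lt: "ereal q < T (Suc (Suc k)) \<omega>"
      have "Z q \<omega> = V (Suc k) \<omega>"
        using lt pq by (intro Z_eq) (auto intro: order_trans)
      moreover have "ereal p < T (Suc (Suc k)) \<omega>"
        using lt pq(3) by (metis ereal_less_eq(3) order_le_less_trans)
      then have "Z p \<omega> = V (Suc k) \<omega>" using pq by (intro Z_eq) auto
      ultimately show False using pq by simp
    qed
    then show "\<omega> \<in> {\<omega>\<in>\<Omega>. T (Suc (Suc k)) \<omega> \<le> ereal t}"
      using pq timesD[OF Suc.prems pq(2)] by (auto simp: not_less intro: order_trans)
  qed
  also have "\<dots> \<in> sets (F t)"
  proof (intro sets.countable_UN'' sets.Int)
    show "countable (times t)" "countable (times t \<inter> {p..})" for p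
      using times_countable by (auto intro: countable_subset)
    fix p assume p: "p \<in> times t"
    then show "{\<omega>\<in>\<Omega>. T (Suc k) \<omega> \<le> ereal p} \<in> sets (F t)"
      using Suc.IH[of p] timesD[OF Suc.prems p] sets_F_mono[of p t] by auto
    fix q assume q: "q \<in> times t \<inter> {p..}"
    have "Z r \<in> borel_measurable (F t)" if "r \<in> times t" for r
      using that timesD[OF Suc.prems that] Z_measurable[of r] sets_F_mono[of r t] space_F
      by (intro measurable_mono[of borel borel "F r" "F t", THEN subsetD]) auto
    then have "(\<lambda>\<omega>. Z q \<omega> - Z p \<omega>) \<in> borel_measurable (F t)" using p q by auto
    from measurable_sets[OF this, of "- {0}"] show "{\<omega>\<in>\<Omega>. Z q \<omega> - Z p \<omega> \<in> - {0}} \<in> sets (F t)"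
      by (simp add: space_F vimage_def Int_def conj_commute)
  qed
  finally show ?case .
qed

lemma jump_time_sets: "0 \<le> t \<Longrightarrow> {\<omega>\<in>\<Omega>. T k \<omega> \<le> ereal t} \<in> sets (F t)"
proof (cases k)
  case 0
  assume "0 \<le> t"
  then have "{\<omega>\<in>\<Omega>. T k \<omega> \<le> ereal t} = space (F t)" using 0 T_0 space_F by (auto simp: zero_ereal_def)
  then show ?thesis by simp
qed (use jump_time_sets_Suc in simp)

text \<open>A jump that has occurred by \<open>t\<close> is followed, before the next one, by an
  observation time at which \<open>Z\<close> shows its value.\<close>

lemma jump_value_sets:
  assumes t: "0 \<le> t" and A: "A \<in> sets borel"
  shows "{\<omega>\<in>\<Omega>. T k \<omega> \<le> ereal t \<and> V k \<omega> \<in> A} \<in> sets (F t)"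
proof (cases k)
  case 0
  then have "{\<omega>\<in>\<Omega>. T k \<omega> \<le> ereal t \<and> V k \<omega> \<in> A} = (if v\<^sub>0 \<in> A then space (F t) else {})"
    using t T_0 V_0 space_F by (auto simp: zero_ereal_def)
  then show ?thesis by simp
next
  case (Suc j)
  have "{\<omega>\<in>\<Omega>. T k \<omega> \<le> ereal t \<and> V k \<omega> \<in> A} = (\<Union>p\<in>times t.
      ({\<omega>\<in>\<Omega>. T k \<omega> \<le> ereal p} - {\<omega>\<in>\<Omega>. T (Suc k) \<omega> \<le> ereal p}) \<inter> {\<omega>\<in>\<Omega>. Z p \<omega> \<in> A})"
  proof (intro set_eqI iffI)
    fix \<omega> assume "\<omega> \<in> {\<omega>\<in>\<Omega>. T k \<omega> \<le> ereal t \<and> V k \<omega> \<in> A}"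
    then have \<omega>: "\<omega> \<in> \<Omega>" "T k \<omega> \<le> ereal t" "V k \<omega> \<in> A" by auto
    obtain r where r: "T k \<omega> = ereal r" "0 \<le> r" "r \<le> t" using T_real[OF \<omega>(1,2)] .
    have "ereal r < T (Suc k) \<omega>" using T_strict[of \<omega> k] \<omega> r Suc by simp
    then obtain p where p: "p \<in> times t" "r \<le> p" "ereal p < T (Suc k) \<omega>"
      using times_pick[OF r(2,3)] by blast
    have "Z p \<omega> = V k \<omega>" using p r \<omega> by (intro Z_eq) auto
    then show "\<omega> \<in> (\<Union>p\<in>times t.
      ({\<omega>\<in>\<Omega>. T k \<omega> \<le> ereal p} - {\<omega>\<in>\<Omega>. T (Suc k) \<omega> \<le> ereal p}) \<inter> {\<omega>\<in>\<Omega>. Z p \<omega> \<in> A})"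
      using p r \<omega> by (intro UN_I[of p]) auto
  next
    fix \<omega> assume "\<omega> \<in> (\<Union>p\<in>times t.
      ({\<omega>\<in>\<Omega>. T k \<omega> \<le> ereal p} - {\<omega>\<in>\<Omega>. T (Suc k) \<omega> \<le> ereal p}) \<inter> {\<omega>\<in>\<Omega>. Z p \<omega> \<in> A})"
    then obtain p where p: "p \<in> times t" "\<omega> \<in> \<Omega>" "T k \<omega> \<le> ereal p" "ereal p < T (Suc k) \<omega>" "Z p \<omega> \<in> A"
      by (auto simp: not_le)
    then have "V k \<omega> \<in> A" using Z_eq[of \<omega> k p] by simp
    then show "\<omega> \<in> {\<omega>\<in>\<Omega>. T k \<omega> \<le> ereal t \<and> V k \<omega> \<in> A}"
      using p timesD[OF t p(1)] by (auto intro: order_trans)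
  qed
  also have "\<dots> \<in> sets (F t)"
  proof (intro sets.countable_UN'' sets.Int sets.Diff times_countable)
    fix p assume p: "p \<in> times t"
    have "{\<omega>\<in>\<Omega>. T k \<omega> \<le> ereal p} \<in> sets (F t)" for k
      using jump_time_sets[of p k] timesD[OF t p] sets_F_mono[of p t] by auto
    then show "{\<omega>\<in>\<Omega>. T k \<omega> \<le> ereal p} \<in> sets (F t)" "{\<omega>\<in>\<Omega>. T (Suc k) \<omega> \<le> ereal p} \<in> sets (F t)" by auto
    show "{\<omega>\<in>\<Omega>. Z p \<omega> \<in> A} \<in> sets (F t)" using timesD[OF t p] A by (intro Z_sets) auto
  qed
  finally show ?thesis .
qed

end

text \<open>A constant filtration turns the adaptedness statements into plain measurability.\<close>

locale jump_variables = jump_process \<Omega> "\<lambda>_. M" T V Z v\<^sub>0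
  for \<Omega> and M :: "'a measure" and T V Z v\<^sub>0
begin

lemma T_measurable: "T k \<in> borel_measurable M"
proof (subst borel_measurable_iff_Iic_ereal, intro allI)
  fix a
  show "T k -` {..a} \<inter> space M \<in> sets M"
  proof (cases a)
    case (real r)
    have "T k -` {..a} \<inter> space M = (if r < 0 then {} else {\<omega>\<in>\<Omega>. T k \<omega> \<le> ereal r})"
      using T_nonneg[of _ k] space_F real
      by (auto simp: not_less) (metis ereal_less_eq(3) order_trans not_le zero_ereal_def)
    then show ?thesis using jump_time_sets[of r k] by simp
  next
    case MInf
    have "T k -` {..a} \<inter> space M = {}" using MInf T_nonneg[of _ k] space_F by fastforce
    then show ?thesis by (metis sets.empty_sets)
  next
    case PInf
    then have "T k -` {..a} \<inter> space M = space M" by auto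
    then show ?thesis by simp
  qed
qed

text \<open>Where \<open>T k\<close> is infinite, \<open>V k\<close> is never observed; a constant
  is put there.\<close>

lemma V_measurable: "(\<lambda>\<omega>. if T k \<omega> < \<infinity> then V k \<omega> else c) \<in> borel_measurable M"
proof (rule measurableI)
  fix A :: "real set" assume A: "A \<in> sets borel"
  have fin: "T k \<omega> < \<infinity> \<longleftrightarrow> (\<exists>n. T k \<omega> \<le> ereal (real n))" if "\<omega> \<in> \<Omega>" for \<omega>
    using T_nonneg[OF that, of k] by (cases "T k \<omega>") (auto intro: real_arch_simple)
  have "(\<lambda>\<omega>. if T k \<omega> < \<infinity> then V k \<omega> else c) -` A \<inter> space M =
      (\<Union>n. {\<omega>\<in>\<Omega>. T k \<omega> \<le> ereal (real n) \<and> V k \<omega> \<in> A}) \<union>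
      (if c \<in> A then space M - (\<Union>n. {\<omega>\<in>\<Omega>. T k \<omega> \<le> ereal (real n)}) else {})"
    using fin space_F by (auto split: if_splits)
  also have "\<dots> \<in> sets M"
    using jump_value_sets[of _ A k] jump_time_sets[of _ k] A by (auto intro!: sets.Un sets.countable_UN sets.Diff)
  finally show "(\<lambda>\<omega>. if T k \<omega> < \<infinity> then V k \<omega> else c) -` A \<inter> space M \<in> sets M" .
qed simp

end

section \<open>The space of demand paths\<close>

abbreviation path_borel :: "((nat \<Rightarrow> real) \<times> (nat \<Rightarrow> real)) measure" where
  "path_borel \<equiv> (\<Pi>\<^sub>M n\<in>UNIV. borel) \<Otimes>\<^sub>M (\<Pi>\<^sub>M n\<in>UNIV. borel)"

definition demand_path :: "'a inventory_data \<Rightarrow> 'a \<Rightarrow> (nat \<Rightarrow> real) \<times> (nat \<Rightarrow> real)" where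
  "demand_path S \<omega> = (\<lambda>n. arrival S (Suc n) \<omega> - arrival S n \<omega>, \<lambda>n. demand S (Suc n) \<omega>)"

definition good_paths :: "((nat \<Rightarrow> real) \<times> (nat \<Rightarrow> real)) set" where
  "good_paths = {z. (\<forall>n. 0 < fst z n) \<and> (\<forall>n. 0 < snd z n) \<and>
     filterlim (\<lambda>n. \<Sum>m<n. fst z m) at_top sequentially}"

definition path_measure :: "'a inventory_data \<Rightarrow> ((nat \<Rightarrow> real) \<times> (nat \<Rightarrow> real)) measure" where
  "path_measure S = (\<Pi>\<^sub>M n\<in>UNIV. density lborel (exponential_density (arr_rate S))) \<Otimes>\<^sub>M (\<Pi>\<^sub>M n\<in>UNIV. dF S)"

text \<open>
  The holding and penalty costs are changed where no admissible strategy evaluates them, which makes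
  them Borel functions.
\<close>

definition canonical :: "'a inventory_data \<Rightarrow> ((nat \<Rightarrow> real) \<times> (nat \<Rightarrow> real)) inventory_data" where
  "canonical S = \<lparr>
     pspace = restrict_space (path_measure S) good_paths,
     arrival = (\<lambda>n z. \<Sum>m<n. fst z m),
     demand = (\<lambda>n z. snd z (n - 1)),
     demand_cdf = demand_cdf S,
     arr_rate = arr_rate S,
     disc = disc S,
     lmin = lmin S,
     cap = cap S,
     prate = prate S,
     hold = (\<lambda>i x. if i = 0 then hold S 0 (cap S)
        else if i \<in> {1,2} \<and> lmin S \<le> x \<and> x < cap S then hold S i x else 0),
     penalty = (\<lambda>y. penalty S (max 0 y)),
     swcost = swcost S \<rparr>"

lemma canonical_simps [simp]:
  "pspace (canonical S) = restrict_space (path_measure S) good_paths"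
  "arrival (canonical S) = (\<lambda>n z. \<Sum>m<n. fst z m)"
  "demand (canonical S) = (\<lambda>n z. snd z (n - 1))"
  "demand_cdf (canonical S) = demand_cdf S" "arr_rate (canonical S) = arr_rate S"
  "disc (canonical S) = disc S" "lmin (canonical S) = lmin S" "cap (canonical S) = cap S"
  "prate (canonical S) = prate S" "swcost (canonical S) = swcost S"
  "penalty (canonical S) y = penalty S (max 0 y)"
  by (simp_all add: canonical_def)

lemma hold_canonical: "hold (canonical S) i x = (if i = 0 then hold S 0 (cap S)
        else if i \<in> {1,2} \<and> lmin S \<le> x \<and> x < cap S then hold S i x else 0)"
  by (simp add: canonical_def)

lemma path_component_measurable [measurable]:
  "(\<lambda>z. fst z n) \<in> borel_measurable path_borel" "(\<lambda>z. snd z n) \<in> borel_measurable path_borel"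
  by (rule measurable_compose[OF measurable_fst measurable_component_singleton], simp)
     (rule measurable_compose[OF measurable_snd measurable_component_singleton], simp)

lemma filterlim_at_top_nat:
  "filterlim (f :: nat \<Rightarrow> real) at_top sequentially \<longleftrightarrow> (\<forall>N::nat. \<exists>k. \<forall>n\<ge>k. real N \<le> f n)"
proof
  assume "\<forall>N::nat. \<exists>k. \<forall>n\<ge>k. real N \<le> f n"
  then have "\<exists>k. \<forall>n\<ge>k. c \<le> f n" for c
    using real_arch_simple[of c] by (meson order_trans)
  then show "filterlim f at_top sequentially"
    by (auto simp: filterlim_at_top eventually_sequentially)
qed (auto simp: filterlim_at_top eventually_sequentially)

lemma space_path_borel [simp]: "space path_borel = UNIV"
  by (auto simp: space_pair_measure space_PiM)

lemma good_paths_sets: "good_paths \<in> sets path_borel"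
proof -
  have "good_paths = {z \<in> space path_borel. (\<forall>n. 0 < fst z n) \<and> (\<forall>n. 0 < snd z n) \<and>
     (\<forall>N::nat. \<exists>k. \<forall>n\<ge>k. real N \<le> (\<Sum>m<n. fst z m))}"
    by (simp add: good_paths_def filterlim_at_top_nat)
  also have "\<dots> \<in> sets path_borel" by measurable
  finally show ?thesis .
qed

lemma sets_path_measure [measurable_cong]: "sets (path_measure S) = sets path_borel"
  unfolding path_measure_def by (intro sets_pair_measure_cong sets_PiM_cong) auto

lemma space_path_measure [simp]: "space (path_measure S) = UNIV"
  using sets_eq_imp_space_eq[OF sets_path_measure] by simp

lemma space_canonical: "space (restrict_space (path_measure S) good_paths) = good_paths"
  by (simp add: space_restrict_space)

lemma good_paths_arrival_path: "z \<in> good_paths \<Longrightarrow> arrival_path (canonical S) z"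
  by (auto simp: arrival_path_def good_paths_def intro!: strict_mono_Suc_iff[THEN iffD2])

locale inventory_system =
  fixes S :: "'a inventory_data"
  assumes model: "inventory_model S"
begin

abbreviation "C \<equiv> canonical S"

lemma compound: "compound_poisson_demand S" using model by (simp add: inventory_model_def)

lemma params: "lmin S \<le> 0" "0 < cap S" "0 < disc S" "lmin S < cap S" "good_rates (prate S)"
  using model by (auto simp: inventory_model_def good_rates_def)

lemma arr_rate_pos: "0 < arr_rate S" using compound by (simp add: compound_poisson_demand_def)

sublocale P: prob_space "pspace S" using compound by (simp add: compound_poisson_demand_def)

lemma poisson: "poisson_arrivals (pspace S) (arr_rate S) (arrival S)"
  using compound by (simp add: compound_poisson_demand_def)

lemma demand_facts:
  assumes "1 \<le> n"
  shows "\<omega> \<in> space (pspace S) \<Longrightarrow> 0 < demand S n \<omega>"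
    and "cdf (distr (pspace S) borel (demand S n)) = demand_cdf S"
    and "demand S n \<in> borel_measurable (pspace S)"
  using compound assms by (auto simp: compound_poisson_demand_def dest: borel_measurable_integrable)

lemma arrival_path_model: "\<omega> \<in> space (pspace S) \<Longrightarrow> arrival_path S \<omega>"
  using poisson demand_facts(1) by (auto simp: poisson_arrivals_def arrival_path_def)

lemma indep_arrival_demand: "P.indep_var
       (Pi\<^sub>M UNIV (\<lambda>_. borel)) (\<lambda>\<omega>. \<lambda>n\<in>UNIV. arrival S n \<omega>)
       (Pi\<^sub>M {1..} (\<lambda>_. borel)) (\<lambda>\<omega>. \<lambda>n\<in>{1..}. demand S n \<omega>)"
  using compound by (simp add: compound_poisson_demand_def)

lemma arrival_measurable [measurable]: "arrival S n \<in> borel_measurable (pspace S)"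
  using measurable_compose[OF P.indep_var_rv1[OF indep_arrival_demand] measurable_component_singleton[of n]] by simp

lemma demand_distr: "1 \<le> n \<Longrightarrow> distr (pspace S) borel (demand S n) = dF S"
proof -
  assume n: "1 \<le> n"
  interpret D: real_distribution "distr (pspace S) borel (demand S n)"
    using demand_facts(3)[OF n] by (rule P.real_distribution_distr)
  note F = demand_facts(2)[OF n]
  have ivl: "\<And>x y. x \<le> y \<Longrightarrow> demand_cdf S x \<le> demand_cdf S y" "\<And>a. continuous (at_right a) (demand_cdf S)"
    "(demand_cdf S \<longlongrightarrow> 0) at_bot" "(demand_cdf S \<longlongrightarrow> 1) at_top"
    using D.cdf_nondecreasing D.cdf_is_right_cont D.cdf_lim_at_bot D.cdf_lim_at_top_prob by (auto simp: F)
  show ?thesis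
  proof (rule cdf_unique)
    show "real_distribution (dF S)" by (rule real_distribution_interval_measure[OF ivl])
    show "cdf (distr (pspace S) borel (demand S n)) = cdf (dF S)"
      using cdf_interval_measure[OF ivl(1-3)] F by simp
  qed unfold_locales
qed

sublocale F: prob_space "dF S"
  using P.prob_space_distr[OF demand_facts(3)[of 1]] demand_distr[of 1] by simp

sublocale W: prob_space "density lborel (exponential_density (arr_rate S))"
  using arr_rate_pos by (rule prob_space_exponential_density)

sublocale PW: prob_space "\<Pi>\<^sub>M n\<in>(UNIV::nat set). density lborel (exponential_density (arr_rate S))"
  by (rule prob_space_PiM) (rule W.prob_space_axioms)

sublocale PF: prob_space "\<Pi>\<^sub>M n\<in>(UNIV::nat set). dF S"
  by (rule prob_space_PiM) (rule F.prob_space_axioms)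

sublocale Q: prob_space "path_measure S"
  unfolding path_measure_def by (rule prob_space_pair) unfold_locales

lemma dF_pos: "AE y in dF S. 0 < y"
proof -
  have "AE y in distr (pspace S) borel (demand S 1). 0 < y"
    using demand_facts[of 1] by (subst AE_distr_iff) auto
  then show ?thesis unfolding demand_distr[OF order_refl] .
qed

lemma demand_path_measurable: "demand_path S \<in> pspace S \<rightarrow>\<^sub>M path_borel"
  unfolding demand_path_def
  using demand_facts(3) by (intro measurable_Pair measurable_PiM_single') auto

text \<open>The inter-arrival times form one i.i.d. sequence and the demands another, and both are
  functions of the independent sequences of arrivals and demands; so the joint law is the product.
  The demands are numbered from 1 and have to be reindexed.\<close>

lemma demand_path_distr: "distr (pspace S) path_borel (demand_path S) = path_measure S"
proof -
  let ?P = "pspace S" and ?B = "\<Pi>\<^sub>M n\<in>(UNIV::nat set). (borel :: real measure)"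
  let ?X = "\<lambda>n \<omega>. arrival S (Suc n) \<omega> - arrival S n \<omega>"
  have e: "distr ?P borel (?X n) = density lborel (exponential_density (arr_rate S))" for n
  proof -
    have "distr ?P borel (?X n) = distr ?P lborel (?X n)" by (rule distr_cong) auto
    also have "\<dots> = density lborel (exponential_density (arr_rate S))"
      using poisson by (intro distributed_distr_eq_density) (simp add: poisson_arrivals_def)
    finally show ?thesis .
  qed
  have "distr ?P ?B (\<lambda>\<omega> n. ?X n \<omega>) = (\<Pi>\<^sub>M n\<in>UNIV. distr ?P borel (?X n))"
    using P.indep_vars_iff_distr_eq_PiM'[where I=UNIV and M'="\<lambda>_. borel" and X="?X"] poisson
    by (simp add: poisson_arrivals_def restrict_def)
  also have "\<dots> = (\<Pi>\<^sub>M n\<in>UNIV. density lborel (exponential_density (arr_rate S)))" by (simp only: e)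
  finally have 1: "distr ?P ?B (\<lambda>\<omega> n. ?X n \<omega>) = (\<Pi>\<^sub>M n\<in>UNIV. density lborel (exponential_density (arr_rate S)))" .
  have d1: "distr ?P (\<Pi>\<^sub>M n\<in>{1..}. borel) (\<lambda>\<omega>. \<lambda>n\<in>{1..}. demand S n \<omega>) = (\<Pi>\<^sub>M n\<in>{1..}. dF S)"
  proof -
    have "distr ?P (\<Pi>\<^sub>M n\<in>{1..}. borel) (\<lambda>\<omega>. \<lambda>n\<in>{1..}. demand S n \<omega>) = (\<Pi>\<^sub>M n\<in>{1..}. distr ?P borel (demand S n))"
      using P.indep_vars_iff_distr_eq_PiM'[where I="{1..}" and M'="\<lambda>_. borel" and X="demand S"] compound demand_facts(3)
      by (simp add: compound_poisson_demand_def)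
    also have "\<dots> = (\<Pi>\<^sub>M n\<in>{1..}. dF S)" using demand_distr by (intro PiM_cong) auto
    finally show ?thesis .
  qed
  have m: "(\<lambda>d n. d (Suc n)) \<in> (\<Pi>\<^sub>M n\<in>{1..}. (borel :: real measure)) \<rightarrow>\<^sub>M ?B"
    by (intro measurable_PiM_single' measurable_component_singleton) auto
  have rd: "(\<lambda>\<omega>. \<lambda>n\<in>{1..}. demand S n \<omega>) \<in> ?P \<rightarrow>\<^sub>M (\<Pi>\<^sub>M n\<in>{1..}. borel)"
    using P.indep_var_rv2[OF indep_arrival_demand] .
  have "distr ?P ?B (\<lambda>\<omega> n. demand S (Suc n) \<omega>) =
      distr (distr ?P (\<Pi>\<^sub>M n\<in>{1..}. borel) (\<lambda>\<omega>. \<lambda>n\<in>{1..}. demand S n \<omega>)) ?B (\<lambda>d n. d (Suc n))"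
    by (subst distr_distr[OF m rd]) (simp add: comp_def)
  also have "\<dots> = distr (\<Pi>\<^sub>M n\<in>{1..}. dF S) (\<Pi>\<^sub>M n\<in>UNIV. dF S) (\<lambda>d. \<lambda>n\<in>UNIV. d (Suc n))"
    unfolding d1 by (intro distr_cong refl sets_PiM_cong) auto
  also have "\<dots> = (\<Pi>\<^sub>M n\<in>UNIV. dF S)"
    by (rule distr_PiM_reindex) (auto intro: F.prob_space_axioms)
  finally have 2: "distr ?P ?B (\<lambda>\<omega> n. demand S (Suc n) \<omega>) = (\<Pi>\<^sub>M n\<in>UNIV. dF S)" .
  have m1: "(\<lambda>a n. a (Suc n) - a n) \<in> ?B \<rightarrow>\<^sub>M ?B"
    by (intro measurable_PiM_single' borel_measurable_diff measurable_component_singleton) auto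
  have "P.indep_var ?B ((\<lambda>a n. a (Suc n) - a n) \<circ> (\<lambda>\<omega>. \<lambda>n\<in>UNIV. arrival S n \<omega>))
      ?B ((\<lambda>d n. d (Suc n)) \<circ> (\<lambda>\<omega>. \<lambda>n\<in>{1..}. demand S n \<omega>))"
    by (rule P.indep_var_compose[OF indep_arrival_demand m1 m])
  also have "(\<lambda>a n. a (Suc n) - a n) \<circ> (\<lambda>\<omega>. \<lambda>n\<in>UNIV. arrival S n \<omega>) = (\<lambda>\<omega> n. ?X n \<omega>)"
    by (auto simp: fun_eq_iff)
  also have "(\<lambda>d n. d (Suc n)) \<circ> (\<lambda>\<omega>. \<lambda>n\<in>{1..}. demand S n \<omega>) = (\<lambda>\<omega> n. demand S (Suc n) \<omega>)"
    by (auto simp: fun_eq_iff)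
  finally have "distr ?P ?B (\<lambda>\<omega> n. ?X n \<omega>) \<Otimes>\<^sub>M distr ?P ?B (\<lambda>\<omega> n. demand S (Suc n) \<omega>) =
      distr ?P path_borel (\<lambda>\<omega>. (\<lambda>n. ?X n \<omega>, \<lambda>n. demand S (Suc n) \<omega>))"
    by (simp add: P.indep_var_distribution_eq)
  then show ?thesis unfolding 1 2 path_measure_def demand_path_def[abs_def] by simp
qed

lemma demand_path_good: "\<omega> \<in> space (pspace S) \<Longrightarrow> demand_path S \<omega> \<in> good_paths"
proof -
  assume \<omega>: "\<omega> \<in> space (pspace S)"
  note ap = arrival_path_model[OF \<omega>]
  have "(\<Sum>m<n. fst (demand_path S \<omega>) m) = arrival S n \<omega>" for n
    using arrival_0[OF ap] sum_lessThan_telescope[of "\<lambda>n. arrival S n \<omega>" n] by (simp add: demand_path_def)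
  then show ?thesis using ap arrival_less_iff[OF ap]
    by (auto simp: good_paths_def arrival_path_def demand_path_def)
qed

lemma canonical_arrival_demand:
  assumes "\<omega> \<in> space (pspace S)"
  shows "arrival C n (demand_path S \<omega>) = arrival S n \<omega>"
    and "1 \<le> n \<Longrightarrow> demand C n (demand_path S \<omega>) = demand S n \<omega>"
  using arrival_0[OF arrival_path_model[OF assms]] sum_lessThan_telescope[of "\<lambda>n. arrival S n \<omega>" n]
  by (simp_all add: demand_path_def)

lemma demand_path_measurable_C: "demand_path S \<in> pspace S \<rightarrow>\<^sub>M pspace C"
  using demand_path_measurable demand_path_good
  by (auto intro!: measurable_restrict_space2 simp: measurable_cong_sets[OF refl sets_path_measure])

lemma demand_path_distr_C: "distr (pspace S) (pspace C) (demand_path S) = pspace C"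
proof (rule measure_eqI)
  fix A assume "A \<in> sets (distr (pspace S) (pspace C) (demand_path S))"
  then have A: "A \<in> sets (pspace C)" by simp
  then have A': "A \<in> sets path_borel" "A \<subseteq> good_paths"
    using good_paths_sets sets_path_measure[of S] by (auto simp: sets_restrict_space)
  have "emeasure (distr (pspace S) (pspace C) (demand_path S)) A = emeasure (pspace S) (demand_path S -` A \<inter> space (pspace S))"
    using A demand_path_measurable_C by (rule emeasure_distr[rotated])
  also have "\<dots> = emeasure (distr (pspace S) path_borel (demand_path S)) A"
    using A' demand_path_measurable by (simp add: emeasure_distr)
  also have "\<dots> = emeasure (pspace C) A"
    using A' good_paths_sets sets_path_measure[of S] unfolding demand_path_distr
    by (simp add: emeasure_restrict_space)
  finally show "emeasure (distr (pspace S) (pspace C) (demand_path S)) A = emeasure (pspace C) A" .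
qed simp

lemma good_paths_AE: "AE z in path_measure S. z \<in> good_paths"
proof -
  have "AE z in distr (pspace S) path_borel (demand_path S). z \<in> good_paths"
    using demand_path_good good_paths_sets demand_path_measurable by (subst AE_distr_iff) auto
  then show ?thesis unfolding demand_path_distr .
qed

lemma nn_integral_demand_path:
  "f \<in> borel_measurable (pspace C) \<Longrightarrow> (\<integral>\<^sup>+\<omega>. f (demand_path S \<omega>) \<partial>pspace S) = (\<integral>\<^sup>+z. f z \<partial>pspace C)"
  using nn_integral_distr[OF demand_path_measurable_C, of f] unfolding demand_path_distr_C by simp

lemma AE_demand_path: "AE z in pspace C. R z \<Longrightarrow> AE \<omega> in pspace S. R (demand_path S \<omega>)"
  using AE_distrD[OF demand_path_measurable_C, of R] unfolding demand_path_distr_C by simp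

lemma AE_canonical:
  "{z\<in>space (pspace C). R z} \<in> sets (pspace C) \<Longrightarrow> AE \<omega> in pspace S. R (demand_path S \<omega>) \<Longrightarrow> AE z in pspace C. R z"
  using AE_distr_iff[OF demand_path_measurable_C, of R] unfolding demand_path_distr_C by simp

lemma nn_integral_canonical: "(\<integral>\<^sup>+z. f z \<partial>pspace C) = (\<integral>\<^sup>+z. f z * indicator good_paths z \<partial>path_measure S)"
  using good_paths_sets sets_path_measure[of S] by (simp add: nn_integral_restrict_space)

end

section \<open>Delaying and prepending: laws of the demand path\<close>

definition delay :: "real \<Rightarrow> (nat \<Rightarrow> real) \<times> (nat \<Rightarrow> real) \<Rightarrow> (nat \<Rightarrow> real) \<times> (nat \<Rightarrow> real)" where
  "delay s z = ((fst z)(0 := s + fst z 0), snd z)"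

definition prepend :: "real \<Rightarrow> real \<Rightarrow> (nat \<Rightarrow> real) \<times> (nat \<Rightarrow> real) \<Rightarrow> (nat \<Rightarrow> real) \<times> (nat \<Rightarrow> real)" where
  "prepend w y z = (case_nat w (fst z), case_nat y (snd z))"

lemma case_nat_measurable: "(\<lambda>(w, a). case_nat w a) \<in> borel \<Otimes>\<^sub>M (\<Pi>\<^sub>M n\<in>UNIV. borel) \<rightarrow>\<^sub>M (\<Pi>\<^sub>M n\<in>UNIV. (borel :: real measure))"
proof -
  have "(\<lambda>p n. case_nat (fst p) (snd p) n) \<in> borel \<Otimes>\<^sub>M (\<Pi>\<^sub>M n\<in>UNIV. borel) \<rightarrow>\<^sub>M (\<Pi>\<^sub>M n\<in>UNIV. (borel :: real measure))"
  proof (intro measurable_PiM_single')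
    fix n :: nat
    show "(\<lambda>p. case_nat (fst p) (snd p) n) \<in> borel \<Otimes>\<^sub>M (\<Pi>\<^sub>M n\<in>UNIV. borel) \<rightarrow>\<^sub>M (borel :: real measure)"
      by (cases n) (auto intro: measurable_compose[OF measurable_snd measurable_component_singleton])
  qed auto
  then show ?thesis by (simp add: case_prod_beta')
qed

lemma fun_upd_measurable:
  fixes n :: nat
  shows "(\<lambda>(v, a). a(n := v)) \<in> borel \<Otimes>\<^sub>M (\<Pi>\<^sub>M n\<in>UNIV. borel) \<rightarrow>\<^sub>M (\<Pi>\<^sub>M n\<in>UNIV. (borel :: real measure))"
proof -
  have "(\<lambda>p m. ((snd p)(n := fst p)) m) \<in> borel \<Otimes>\<^sub>M (\<Pi>\<^sub>M n\<in>UNIV. borel) \<rightarrow>\<^sub>M (\<Pi>\<^sub>M n\<in>UNIV. (borel :: real measure))"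
  proof (intro measurable_PiM_single')
    fix m :: nat
    show "(\<lambda>p. ((snd p)(n := fst p)) m) \<in> borel \<Otimes>\<^sub>M (\<Pi>\<^sub>M n\<in>UNIV. borel) \<rightarrow>\<^sub>M (borel :: real measure)"
      by (cases "m = n") (auto intro: measurable_compose[OF measurable_snd measurable_component_singleton])
  qed auto
  then show ?thesis by (simp add: case_prod_beta' fun_upd_def)
qed

lemma path_map_measurable:
  assumes "h \<in> borel \<Otimes>\<^sub>M (\<Pi>\<^sub>M n\<in>UNIV. borel) \<rightarrow>\<^sub>M (\<Pi>\<^sub>M n\<in>UNIV. (borel :: real measure))"
  shows "(\<lambda>p. (h (fst p, fst (snd p)), snd (snd p))) \<in> borel \<Otimes>\<^sub>M path_borel \<rightarrow>\<^sub>M path_borel"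
    and "(\<lambda>p. (fst (snd p), h (fst p, snd (snd p)))) \<in> borel \<Otimes>\<^sub>M path_borel \<rightarrow>\<^sub>M path_borel"
  using assms by (auto intro!: measurable_Pair measurable_compose[OF _ assms])

lemma delay_measurable: "delay s \<in> path_borel \<rightarrow>\<^sub>M path_borel"
proof -
  have "(\<lambda>z. (\<lambda>n. if n = 0 then s + fst z 0 else fst z n)) \<in> path_borel \<rightarrow>\<^sub>M (\<Pi>\<^sub>M n\<in>UNIV. (borel :: real measure))"
    by (intro measurable_PiM_single') auto
  moreover have "(\<lambda>z. (\<lambda>n. if n = 0 then s + fst z 0 else fst z n)) = (\<lambda>z :: (nat \<Rightarrow> real) \<times> (nat \<Rightarrow> real). (fst z)(0 := s + fst z 0))"
    by (auto simp: fun_eq_iff)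
  ultimately show ?thesis unfolding delay_def[abs_def] by (intro measurable_Pair) simp_all
qed

lemma prepend_measurable: "(\<lambda>p. prepend (fst p) (fst (snd p)) (snd (snd p))) \<in> borel \<Otimes>\<^sub>M (borel \<Otimes>\<^sub>M path_borel) \<rightarrow>\<^sub>M path_borel"
  unfolding prepend_def
proof (intro measurable_Pair)
  show "(\<lambda>p. case_nat (fst p) (fst (snd (snd p)))) \<in> borel \<Otimes>\<^sub>M (borel \<Otimes>\<^sub>M path_borel) \<rightarrow>\<^sub>M (\<Pi>\<^sub>M n\<in>UNIV. (borel :: real measure))"
    using measurable_compose[OF _ case_nat_measurable, of "\<lambda>p. (fst p, fst (snd (snd p)))" "borel \<Otimes>\<^sub>M (borel \<Otimes>\<^sub>M path_borel)"]
    by simp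
  show "(\<lambda>p. case_nat (fst (snd p)) (snd (snd (snd p)))) \<in> borel \<Otimes>\<^sub>M (borel \<Otimes>\<^sub>M path_borel) \<rightarrow>\<^sub>M (\<Pi>\<^sub>M n\<in>UNIV. (borel :: real measure))"
    using measurable_compose[OF _ case_nat_measurable, of "\<lambda>p. (fst (snd p), snd (snd (snd p)))" "borel \<Otimes>\<^sub>M (borel \<Otimes>\<^sub>M path_borel)"]
    by simp
qed

lemma sum_tail_at_top:
  fixes f g :: "nat \<Rightarrow> real"
  assumes "filterlim f at_top sequentially" and "\<And>n. g (Suc n) = c + f (n + d)"
  shows "filterlim g at_top sequentially"
proof -
  have "filterlim (\<lambda>n. f (n + d)) at_top sequentially"
    using assms(1) by (rule filterlim_compose) (rule filterlim_add_const_nat_at_top)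
  then have "filterlim (\<lambda>n. c + f (n + d)) at_top sequentially"
    by (rule filterlim_tendsto_add_at_top[OF tendsto_const])
  then have "filterlim (\<lambda>n. g (Suc n)) at_top sequentially" by (simp add: assms(2))
  then show ?thesis by (simp add: filterlim_sequentially_Suc)
qed

lemma delay_arrival: "(\<Sum>m<Suc n. fst (delay s z) m) = s + (\<Sum>m<Suc n. fst z m)"
  by (simp add: delay_def sum.lessThan_Suc_shift del: sum.lessThan_Suc)

lemma prepend_arrival: "(\<Sum>m<Suc n. fst (prepend w y z) m) = w + (\<Sum>m<n. fst z m)"
  by (simp add: prepend_def sum.lessThan_Suc_shift del: sum.lessThan_Suc)

lemma delay_good: "0 \<le> s \<Longrightarrow> z \<in> good_paths \<Longrightarrow> delay s z \<in> good_paths"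
  using sum_tail_at_top[of "\<lambda>n. \<Sum>m<n. fst z m" "\<lambda>n. \<Sum>m<n. fst (delay s z) m" s 1] delay_arrival[where s=s and z=z]
  by (auto simp: good_paths_def delay_def intro: add_nonneg_pos)

lemma prepend_good: "0 < w \<Longrightarrow> 0 < y \<Longrightarrow> z \<in> good_paths \<Longrightarrow> prepend w y z \<in> good_paths"
  using sum_tail_at_top[of "\<lambda>n. \<Sum>m<n. fst z m" "\<lambda>n. \<Sum>m<n. fst (prepend w y z) m" w 0] prepend_arrival[where w=w and y=y and z=z]
  by (auto simp: good_paths_def prepend_def split: nat.split)

context inventory_system begin

abbreviation "PW \<equiv> \<Pi>\<^sub>M n\<in>(UNIV::nat set). density lborel (exponential_density (arr_rate S))"
abbreviation "WW \<equiv> density lborel (exponential_density (arr_rate S))"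
abbreviation "PF \<equiv> \<Pi>\<^sub>M n\<in>(UNIV::nat set). dF S"

lemma sets_PW: "sets PW = sets (\<Pi>\<^sub>M n\<in>UNIV. borel)" and sets_PF: "sets PF = sets (\<Pi>\<^sub>M n\<in>UNIV. borel)"
  by (intro sets_PiM_cong; simp)+

text \<open>\<open>h\<close> acts on the inter-arrival times and one further independent variable.
  It stands for putting a new one in front and for resampling a single one; both preserve the
  product law.\<close>

lemma first_coordinate_law:
  assumes h: "h \<in> borel \<Otimes>\<^sub>M (\<Pi>\<^sub>M n\<in>UNIV. borel) \<rightarrow>\<^sub>M (\<Pi>\<^sub>M n\<in>UNIV. borel)"
    and law: "distr (WW \<Otimes>\<^sub>M PW) PW h = PW" and f: "f \<in> borel_measurable path_borel"
  shows "(\<integral>\<^sup>+z. f z \<partial>path_measure S) = (\<integral>\<^sup>+v. \<integral>\<^sup>+z. f (h (v, fst z), snd z) \<partial>path_measure S \<partial>WW)"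
proof -
  have sPW: "sets (WW \<Otimes>\<^sub>M PW) = sets (borel \<Otimes>\<^sub>M (\<Pi>\<^sub>M n\<in>UNIV. borel))"
    by (intro sets_pair_measure_cong sets_PW) simp
  have sQ: "sets (PW \<Otimes>\<^sub>M PF) = sets path_borel"
    by (intro sets_pair_measure_cong sets_PW sets_PF)
  have h': "h \<in> WW \<Otimes>\<^sub>M PW \<rightarrow>\<^sub>M PW" using h by (simp add: measurable_cong_sets[OF sPW sets_PW])
  have f': "f \<in> borel_measurable (PW \<Otimes>\<^sub>M PF)" using f by (simp add: measurable_cong_sets[OF sQ refl])
  define g where "g a = (\<integral>\<^sup>+b. f (a, b) \<partial>PF)" for a
  have g: "g \<in> borel_measurable PW" unfolding g_def using f' by measurable
  have s2: "sets (WW \<Otimes>\<^sub>M (PW \<Otimes>\<^sub>M PF)) = sets (borel \<Otimes>\<^sub>M path_borel)"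
    by (intro sets_pair_measure_cong sQ) simp
  have "(\<integral>\<^sup>+z. f z \<partial>path_measure S) = (\<integral>\<^sup>+a. g a \<partial>PW)"
    unfolding path_measure_def g_def by (rule PF.nn_integral_fst[symmetric, OF f'])
  also have "\<dots> = (\<integral>\<^sup>+p. g (h p) \<partial>(WW \<Otimes>\<^sub>M PW))"
    using nn_integral_distr[OF h', of g] g law by simp
  also have "\<dots> = (\<integral>\<^sup>+v. \<integral>\<^sup>+a. g (h (v, a)) \<partial>PW \<partial>WW)"
    using measurable_compose[OF h' g] by (intro PW.nn_integral_fst[symmetric]) simp
  also have "\<dots> = (\<integral>\<^sup>+v. \<integral>\<^sup>+z. f (h (v, fst z), snd z) \<partial>path_measure S \<partial>WW)"
  proof (intro nn_integral_cong)
    fix v :: real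
    have "(\<lambda>p. f (h (fst p, fst (snd p)), snd (snd p))) \<in> borel_measurable (WW \<Otimes>\<^sub>M (PW \<Otimes>\<^sub>M PF))"
      using measurable_compose[OF path_map_measurable(1)[OF h] f] by (simp add: measurable_cong_sets[OF s2 refl])
    from measurable_Pair2[OF this, of v] have "(\<lambda>z. f (h (v, fst z), snd z)) \<in> borel_measurable (PW \<Otimes>\<^sub>M PF)"
      by simp
    from PF.nn_integral_fst[OF this]
    show "(\<integral>\<^sup>+a. g (h (v, a)) \<partial>PW) = (\<integral>\<^sup>+z. f (h (v, fst z), snd z) \<partial>path_measure S)"
      by (simp add: g_def path_measure_def)
  qed
  finally show ?thesis .
qed

text \<open>The demands are the second factor of the product measure, so the order of integration is
  exchanged to put a new first demand in front.\<close>

lemma demand_law: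
  assumes f: "f \<in> borel_measurable path_borel"
  shows "(\<integral>\<^sup>+z. f z \<partial>path_measure S) = (\<integral>\<^sup>+y. \<integral>\<^sup>+z. f (fst z, case_nat y (snd z)) \<partial>path_measure S \<partial>dF S)"
proof -
  let ?h = "\<lambda>(w, a). case_nat w a"
  interpret seq: sequence_space "dF S" ..
  interpret pp: pair_sigma_finite PW PF ..
  have law: "distr (dF S \<Otimes>\<^sub>M PF) PF ?h = PF" using seq.PiM_iter by simp
  note h = case_nat_measurable
  have sPF: "sets (dF S \<Otimes>\<^sub>M PF) = sets (borel \<Otimes>\<^sub>M (\<Pi>\<^sub>M n\<in>UNIV. borel))"
    by (intro sets_pair_measure_cong sets_PF) simp
  have sQ: "sets (PW \<Otimes>\<^sub>M PF) = sets path_borel"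
    by (intro sets_pair_measure_cong sets_PW sets_PF)
  have h': "?h \<in> dF S \<Otimes>\<^sub>M PF \<rightarrow>\<^sub>M PF" using h by (simp add: measurable_cong_sets[OF sPF sets_PF])
  have f': "f \<in> borel_measurable (PW \<Otimes>\<^sub>M PF)" using f by (simp add: measurable_cong_sets[OF sQ refl])
  define g where "g b = (\<integral>\<^sup>+a. f (a, b) \<partial>PW)" for b
  have g: "g \<in> borel_measurable PF" unfolding g_def using f' by measurable
  have s2: "sets (dF S \<Otimes>\<^sub>M (PW \<Otimes>\<^sub>M PF)) = sets (borel \<Otimes>\<^sub>M path_borel)"
    by (intro sets_pair_measure_cong sQ) simp
  have "(\<integral>\<^sup>+z. f z \<partial>path_measure S) = (\<integral>\<^sup>+b. g b \<partial>PF)"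
    unfolding path_measure_def g_def by (rule pp.nn_integral_snd[symmetric, simplified, OF f'[simplified]])
  also have "\<dots> = (\<integral>\<^sup>+p. g (?h p) \<partial>(dF S \<Otimes>\<^sub>M PF))"
    using nn_integral_distr[OF h', of g] g law by simp
  also have "\<dots> = (\<integral>\<^sup>+y. \<integral>\<^sup>+b. g (?h (y, b)) \<partial>PF \<partial>dF S)"
    using measurable_compose[OF h' g] by (intro PF.nn_integral_fst[symmetric]) simp
  also have "\<dots> = (\<integral>\<^sup>+y. \<integral>\<^sup>+z. f (fst z, case_nat y (snd z)) \<partial>path_measure S \<partial>dF S)"
  proof (intro nn_integral_cong)
    fix y :: real
    have "(\<lambda>p. f (fst (snd p), ?h (fst p, snd (snd p)))) \<in> borel_measurable (dF S \<Otimes>\<^sub>M (PW \<Otimes>\<^sub>M PF))"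
      using measurable_compose[OF path_map_measurable(2)[OF h] f] by (simp add: measurable_cong_sets[OF s2 refl])
    from measurable_Pair2[OF this, of y] have "(\<lambda>(a, b). f (a, case_nat y b)) \<in> borel_measurable (PW \<Otimes>\<^sub>M PF)"
      by (simp add: case_prod_beta')
    from pp.nn_integral_snd[OF this]
    show "(\<integral>\<^sup>+b. g (?h (y, b)) \<partial>PF) = (\<integral>\<^sup>+z. f (fst z, case_nat y (snd z)) \<partial>path_measure S)"
      by (simp add: g_def path_measure_def case_prod_beta')
  qed
  finally show ?thesis .
qed

lemma interarrival_law:
  "f \<in> borel_measurable path_borel \<Longrightarrow>
    (\<integral>\<^sup>+z. f z \<partial>path_measure S) = (\<integral>\<^sup>+w. \<integral>\<^sup>+z. f (case_nat w (fst z), snd z) \<partial>path_measure S \<partial>WW)"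
proof -
  interpret seq: sequence_space WW ..
  show "f \<in> borel_measurable path_borel \<Longrightarrow> ?thesis"
    using first_coordinate_law[OF case_nat_measurable, of f] seq.PiM_iter by simp
qed

text \<open>Resampling coordinate \<open>n\<close> separates it from events that do not look at it,
  which gives independence in the form of a product of integrals.\<close>

lemma resample_law:
  "f \<in> borel_measurable path_borel \<Longrightarrow>
    (\<integral>\<^sup>+z. f z \<partial>path_measure S) = (\<integral>\<^sup>+v. \<integral>\<^sup>+z. f ((fst z)(n := v), snd z) \<partial>path_measure S \<partial>WW)"
  using first_coordinate_law[OF fun_upd_measurable[of n], of f]
    distr_pair_PiM_eq_PiM[of UNIV "\<lambda>_. WW" n] W.prob_space_axioms by simp

text \<open>Regeneration at the first arrival: what follows is a fresh path, independent of the
  first inter-arrival time and the first demand.\<close>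

lemma first_arrival_law:
  assumes f: "f \<in> borel_measurable path_borel"
  shows "(\<integral>\<^sup>+z. f z \<partial>path_measure S) = (\<integral>\<^sup>+w. \<integral>\<^sup>+y. \<integral>\<^sup>+z. f (prepend w y z) \<partial>path_measure S \<partial>dF S \<partial>WW)"
proof -
  have "(\<integral>\<^sup>+z. f (case_nat w (fst z), snd z) \<partial>path_measure S) = (\<integral>\<^sup>+y. \<integral>\<^sup>+z. f (prepend w y z) \<partial>path_measure S \<partial>dF S)" for w
  proof -
    have "(\<lambda>p. f ((\<lambda>(w, a). case_nat w a) (fst p, fst (snd p)), snd (snd p))) \<in> borel_measurable (borel \<Otimes>\<^sub>M path_borel)"
      by (rule measurable_compose[OF path_map_measurable(1)[OF case_nat_measurable] f])
    from measurable_Pair2[OF this, of w] have "(\<lambda>z. f (case_nat w (fst z), snd z)) \<in> borel_measurable path_borel"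
      by simp
    from demand_law[OF this] show ?thesis by (simp add: prepend_def)
  qed
  then show ?thesis using interarrival_law[OF f] by simp
qed

lemma nn_integral_WW: "g \<in> borel_measurable borel \<Longrightarrow> (\<integral>\<^sup>+w. g w \<partial>WW) =
    (\<integral>\<^sup>+w\<in>{0<..}. ennreal (arr_rate S * exp (- arr_rate S * w)) * g w \<partial>lborel)"
proof -
  assume g: "g \<in> borel_measurable borel"
  have "(\<integral>\<^sup>+w. g w \<partial>WW) = (\<integral>\<^sup>+w. ennreal (exponential_density (arr_rate S) w) * g w \<partial>lborel)"
    using g by (subst nn_integral_density) auto
  also have "\<dots> = (\<integral>\<^sup>+w\<in>{0<..}. ennreal (arr_rate S * exp (- arr_rate S * w)) * g w \<partial>lborel)"
  proof (rule nn_integral_cong_AE)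
    show "AE w in lborel. ennreal (exponential_density (arr_rate S) w) * g w =
      ennreal (arr_rate S * exp (- arr_rate S * w)) * g w * indicator {0<..} w"
      using AE_lborel_singleton[of 0]
      by eventually_elim (auto simp: exponential_density_def indicator_def mult_ac)
  qed
  finally show ?thesis .
qed

text \<open>Given that no demand arrives up to \<open>s\<close>, the path is distributed like a
  fresh one whose first arrival is postponed by \<open>s\<close>: translating the exponential
  density by \<open>s\<close> only produces the factor
  \<open>exp (- arr_rate S * s)\<close>.\<close>

lemma memoryless:
  assumes f: "f \<in> borel_measurable path_borel" and s: "0 \<le> s"
  shows "(\<integral>\<^sup>+z. f z * indicator {z. s < fst z 0} z \<partial>path_measure S) =
    ennreal (exp (- arr_rate S * s)) * (\<integral>\<^sup>+z. f (delay s z) \<partial>path_measure S)"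
proof -
  let ?l = "arr_rate S"
  define G where "G w = (\<integral>\<^sup>+z. f (case_nat w (fst z), snd z) \<partial>path_measure S)" for w
  have sQ: "sets (borel \<Otimes>\<^sub>M path_measure S) = sets (borel \<Otimes>\<^sub>M path_borel)"
    by (intro sets_pair_measure_cong sets_path_measure refl)
  have "(\<lambda>p. f ((\<lambda>(w, a). case_nat w a) (fst p, fst (snd p)), snd (snd p))) \<in> borel_measurable (borel \<Otimes>\<^sub>M path_borel)"
    by (rule measurable_compose[OF path_map_measurable(1)[OF case_nat_measurable] f])
  then have "(\<lambda>(w, z). f (case_nat w (fst z), snd z)) \<in> borel_measurable (borel \<Otimes>\<^sub>M path_measure S)"
    by (simp add: measurable_cong_sets[OF sQ refl] case_prod_beta')
  then have G: "G \<in> borel_measurable borel"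
    unfolding G_def by (rule Q.borel_measurable_nn_integral)
  have m1: "(\<lambda>z. f z * indicator {z. s < fst z 0} z) \<in> borel_measurable path_borel"
  proof -
    have "{z. s < fst z 0} = {z\<in>space path_borel. s < fst z 0}" by simp
    also have "\<dots> \<in> sets path_borel" by measurable
    finally show ?thesis using f by (intro borel_measurable_times_ennreal borel_measurable_indicator) auto
  qed
  have "(\<integral>\<^sup>+z. f z * indicator {z. s < fst z 0} z \<partial>path_measure S) = (\<integral>\<^sup>+w. G w * indicator {s<..} w \<partial>WW)"
    unfolding interarrival_law[OF m1] G_def
    by (intro nn_integral_cong) (auto simp: indicator_def)
  also have "\<dots> = (\<integral>\<^sup>+w\<in>{0<..}. ennreal (?l * exp (- ?l * w)) * (G w * indicator {s<..} w) \<partial>lborel)"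
    using G by (intro nn_integral_WW) auto
  also have "\<dots> = (\<integral>\<^sup>+w. ennreal (?l * exp (- ?l * (s + 1 * w))) * (G (s + 1 * w) * indicator {s<..} (s + 1 * w))
      * indicator {0<..} (s + 1 * w) \<partial>lborel)"
    using G by (subst nn_integral_real_affine[where c=1 and t=s]) auto
  also have "\<dots> = (\<integral>\<^sup>+w. ennreal (exp (- ?l * s)) * (ennreal (?l * exp (- ?l * w)) * G (s + w) * indicator {0<..} w) \<partial>lborel)"
  proof (intro nn_integral_cong)
    fix w :: real
    have "?l * exp (- ?l * (s + w)) = exp (- ?l * s) * (?l * exp (- ?l * w))"
      by (simp add: exp_add[symmetric] algebra_simps)
    then show "ennreal (?l * exp (- ?l * (s + 1 * w))) * (G (s + 1 * w) * indicator {s<..} (s + 1 * w))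
      * indicator {0<..} (s + 1 * w) = ennreal (exp (- ?l * s)) * (ennreal (?l * exp (- ?l * w)) * G (s + w) * indicator {0<..} w)"
      using s arr_rate_pos by (cases "0 < w") (simp_all add: ennreal_mult' mult_ac)
  qed
  also have "\<dots> = ennreal (exp (- ?l * s)) * (\<integral>\<^sup>+w. ennreal (?l * exp (- ?l * w)) * G (s + w) * indicator {0<..} w \<partial>lborel)"
    using G by (intro nn_integral_cmult) simp
  also have "(\<integral>\<^sup>+w. ennreal (?l * exp (- ?l * w)) * G (s + w) * indicator {0<..} w \<partial>lborel) = (\<integral>\<^sup>+w. G (s + w) \<partial>WW)"
    using G by (subst nn_integral_WW) auto
  also have "\<dots> = (\<integral>\<^sup>+w. \<integral>\<^sup>+z. f (delay s (case_nat w (fst z), snd z)) \<partial>path_measure S \<partial>WW)"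
  proof (intro nn_integral_cong)
    fix w
    have "(case_nat w a)(0 := s + w) = case_nat (s + w) a" for a :: "nat \<Rightarrow> real"
      by (auto simp: fun_eq_iff split: nat.split)
    then show "G (s + w) = (\<integral>\<^sup>+z. f (delay s (case_nat w (fst z), snd z)) \<partial>path_measure S)"
      by (simp add: G_def delay_def)
  qed
  also have "\<dots> = (\<integral>\<^sup>+z. f (delay s z) \<partial>path_measure S)"
    by (rule interarrival_law[symmetric]) (rule measurable_compose[OF delay_measurable f])
  finally show ?thesis .
qed

text \<open>The case of the constant function 1 in \<open>memoryless\<close>.\<close>

lemma exponential_tail:
  assumes "0 \<le> t" shows "(\<integral>\<^sup>+w. indicator {t<..} w \<partial>WW) = ennreal (exp (- arr_rate S * t))"
proof -
  have "(\<lambda>z. 1 * indicator {z. t < fst z 0} z :: ennreal) \<in> borel_measurable path_borel"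
  proof -
    have "{z. t < fst z 0} = {z\<in>space path_borel. t < fst z 0}" by simp
    also have "\<dots> \<in> sets path_borel" by measurable
    finally show ?thesis by simp
  qed
  from interarrival_law[OF this]
  have "(\<integral>\<^sup>+w. indicator {t<..} w \<partial>WW) = (\<integral>\<^sup>+z. 1 * indicator {z. t < fst z 0} z \<partial>path_measure S)"
    by (simp add: indicator_def Q.emeasure_space_1[simplified])
  also have "\<dots> = ennreal (exp (- arr_rate S * t))"
    using memoryless[of "\<lambda>_. 1" t] Q.emeasure_space_1 assms by simp
  finally show ?thesis .
qed

end

section \<open>Measurability of the cost\<close>

context inventory_system begin

text \<open>Off its finitely many discontinuities the holding cost is continuous on the half-open
  interval, and changing a function on a countable set preserves Borel measurability.\<close>

lemma hold_canonical_measurable: "hold C i \<in> borel_measurable borel"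
proof (cases "i \<in> {1,2}")
  case True
  let ?A = "{lmin S..<cap S}"
  define D where "D = discontinuities ?A (hold S i)"
  have D: "finite D" using model True by (auto simp: inventory_model_def D_def)
  have cont: "continuous_on (?A - D) (hold S i)"
    unfolding continuous_on_eq_continuous_within
  proof
    fix x assume "x \<in> ?A - D"
    then have "continuous (at x within ?A) (hold S i)" by (auto simp: D_def discontinuities_def)
    then show "continuous (at x within ?A - D) (hold S i)" by (rule continuous_within_subset) auto
  qed
  have "(\<lambda>x. indicator (?A - D) x *\<^sub>R hold S i x) \<in> borel_measurable borel"
    using borel_closed[OF finite_imp_closed[OF D]]
    by (intro borel_measurable_continuous_on_indicator cont sets.Diff) simp_all
  then show ?thesis
    by (rule measurable_discrete_difference[where X=D])
       (use D True in \<open>auto simp: hold_canonical indicator_def intro: countable_finite\<close>)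
next
  case False
  then have "hold C i = (\<lambda>_. if i = 0 then hold S 0 (cap S) else 0)"
    by (auto simp: hold_canonical fun_eq_iff)
  then show ?thesis by simp
qed

lemma penalty_canonical_measurable: "penalty C \<in> borel_measurable borel"
proof -
  have "mono_on {0..} (penalty S)" using model by (simp add: inventory_model_def)
  then have "mono (\<lambda>y. penalty S (max 0 y))" by (auto simp: mono_def mono_on_def)
  then have "(\<lambda>y. penalty S (max 0 y)) \<in> borel_measurable borel" by (rule borel_measurable_mono)
  moreover have "penalty C = (\<lambda>y. penalty S (max 0 y))" by (simp add: fun_eq_iff)
  ultimately show ?thesis by (simp only:)
qed

lemma arrival_C_measurable: "arrival C n \<in> borel_measurable (pspace C)"
  and demand_C_measurable: "demand C n \<in> borel_measurable (pspace C)"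
proof -
  have "(\<lambda>z. \<Sum>m<n. fst z m) \<in> borel_measurable path_borel" "(\<lambda>z. snd z (n - 1)) \<in> borel_measurable path_borel"
    by measurable
  then have "(\<lambda>z. \<Sum>m<n. fst z m) \<in> borel_measurable (path_measure S)" "(\<lambda>z. snd z (n - 1)) \<in> borel_measurable (path_measure S)"
    by (simp_all add: measurable_cong_sets[OF sets_path_measure refl])
  then show "arrival C n \<in> borel_measurable (pspace C)" "demand C n \<in> borel_measurable (pspace C)"
    by (auto intro: measurable_restrict_space1)
qed

lemma space_C: "space (pspace C) = good_paths" by (simp add: space_canonical)

lemma arrival_path_C: "z \<in> good_paths \<Longrightarrow> arrival_path C z" by (rule good_paths_arrival_path)

end

locale canonical_strategy = inventory_system S for S :: "'a inventory_data" +
  fixes i T J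
  assumes switching: "switching_strategy (canonical S) i T J"
    and phase_meas: "\<And>t. 0 \<le> t \<Longrightarrow> phase T J t \<in> pspace (canonical S) \<rightarrow>\<^sub>M count_space UNIV"
begin

abbreviation "M \<equiv> pspace (canonical S)"

lemma sw: "z \<in> good_paths \<Longrightarrow> switching_path i T J z"
  using switching by (simp add: switching_strategy_iff space_canonical)

sublocale jv: jump_variables good_paths M T "\<lambda>k z. real (J k z)" "\<lambda>t z. real (phase T J t z)" "real i"
proof (unfold_locales, goal_cases)
  case 1 show ?case by (simp add: space_canonical)
next
  case (3 t)
  show ?case using measurable_compose[OF phase_meas[OF 3], of real borel] by simp
next
  case (6 z k) then show ?case using switching_path_le_Suc[OF sw] by blast
next
  case (7 z k) then show ?case using switching_path_strict[OF sw] by blast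
next
  case (8 z k) then show ?case using switching_path_neq[OF sw] by simp
next
  case (9 z k t) then show ?case using phase_eq[OF sw] by simp
qed (auto simp: switching_path_0[OF sw])

text \<open>The phase process determines \<open>J k\<close> only where \<open>T k\<close> is finite;
  3, which is no phase, stands for it elsewhere.\<close>

definition Jfin :: "nat \<Rightarrow> (nat \<Rightarrow> real) \<times> (nat \<Rightarrow> real) \<Rightarrow> nat" where
  "Jfin k z = (if T k z < \<infinity> then J k z else 3)"

lemma Jfin_measurable: "Jfin k \<in> M \<rightarrow>\<^sub>M count_space UNIV"
proof -
  have "(\<lambda>x::real. nat \<lfloor>x\<rfloor>) \<in> borel \<rightarrow>\<^sub>M count_space UNIV" by measurable
  from measurable_compose[OF jv.V_measurable[of k 3] this] show ?thesis
    by (rule measurable_cong[THEN iffD1, rotated]) (auto simp: Jfin_def)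
qed

text \<open>Inserting \<open>max 0\<close> removes the negative times, at which \<open>phase\<close>
  is unspecified.\<close>

lemma phase_joint: "(\<lambda>p. phase T J (max 0 (snd p)) (fst p)) \<in> M \<Otimes>\<^sub>M borel \<rightarrow>\<^sub>M count_space UNIV"
proof (subst measurable_count_space_eq_countable, simp, intro conjI ballI Pi_I UNIV_I)
  fix v :: nat
  have sp: "space (M \<Otimes>\<^sub>M (borel :: real measure)) = good_paths \<times> UNIV"
    by (simp add: space_pair_measure space_canonical)
  have "(\<lambda>p. phase T J (max 0 (snd p)) (fst p)) -` {v} \<inter> space (M \<Otimes>\<^sub>M borel) =
     (\<Union>k. {p\<in>space (M \<Otimes>\<^sub>M borel). T k (fst p) \<le> ereal (max 0 (snd p)) \<and>
        ereal (max 0 (snd p)) < T (Suc k) (fst p) \<and> Jfin k (fst p) = v})" (is "?L = ?R")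
  proof (intro set_eqI iffI)
    fix p assume p: "p \<in> ?L"
    then have z: "fst p \<in> good_paths" using sp by auto
    have "0 \<le> max 0 (snd p)" by simp
    then obtain k where k: "T k (fst p) \<le> ereal (max 0 (snd p))" "ereal (max 0 (snd p)) < T (Suc k) (fst p)"
      using switching_path_interval[OF sw[OF z]] by blast
    then have "phase T J (max 0 (snd p)) (fst p) = J k (fst p)" by (rule phase_eq[OF sw[OF z]])
    moreover have "T k (fst p) < \<infinity>" by (rule order_le_less_trans[OF k(1)]) (simp del: ereal_max)
    ultimately show "p \<in> ?R" using p k by (auto simp: Jfin_def)
  next
    fix p assume "p \<in> ?R"
    then obtain k where k: "p \<in> space (M \<Otimes>\<^sub>M borel)" "T k (fst p) \<le> ereal (max 0 (snd p))"
       "ereal (max 0 (snd p)) < T (Suc k) (fst p)" "Jfin k (fst p) = v" by blast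
    then have z: "fst p \<in> good_paths" using sp by auto
    have "T k (fst p) < \<infinity>" by (rule order_le_less_trans[OF k(2)]) (simp del: ereal_max)
    then have "phase T J (max 0 (snd p)) (fst p) = v" using phase_eq[OF sw[OF z] k(2,3)] k(4) by (simp add: Jfin_def)
    then show "p \<in> ?L" using k(1) by simp
  qed
  also have "\<dots> \<in> sets (M \<Otimes>\<^sub>M borel)"
  proof (rule sets.countable_UN'')
    fix k
    note [measurable] = measurable_compose[OF measurable_fst jv.T_measurable]
      measurable_compose[OF measurable_fst Jfin_measurable]
    show "{p\<in>space (M \<Otimes>\<^sub>M borel). T k (fst p) \<le> ereal (max 0 (snd p)) \<and>
        ereal (max 0 (snd p)) < T (Suc k) (fst p) \<and> Jfin k (fst p) = v} \<in> sets (M \<Otimes>\<^sub>M borel)"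
      by measurable
  qed simp
  finally show "(\<lambda>p. phase T J (max 0 (snd p)) (fst p)) -` {v} \<inter> space (M \<Otimes>\<^sub>M borel) \<in> sets (M \<Otimes>\<^sub>M borel)" .
qed

text \<open>Path and endpoints are chosen measurably on an arbitrary space \<open>N\<close>, so that
  the lemma applies to \<open>M\<close> itself and to its product with the time axis.\<close>

lemma produced_measurable:
  assumes \<zeta>: "\<zeta> \<in> N \<rightarrow>\<^sub>M M" and a: "a \<in> borel_measurable N" and b: "b \<in> borel_measurable N"
    and nn: "\<And>w. w \<in> space N \<Longrightarrow> 0 \<le> a w"
  shows "(\<lambda>w. produced C T J (a w) (b w) (\<zeta> w)) \<in> borel_measurable N"
proof -
  have "(\<lambda>p. (\<zeta> (fst p), snd p)) \<in> N \<Otimes>\<^sub>M lborel \<rightarrow>\<^sub>M M \<Otimes>\<^sub>M borel" using \<zeta> by measurable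
  from measurable_compose[OF this phase_joint] have "(\<lambda>p. phase T J (max 0 (snd p)) (\<zeta> (fst p))) \<in> N \<Otimes>\<^sub>M lborel \<rightarrow>\<^sub>M count_space UNIV"
    by simp
  from measurable_compose[OF this, of "prate S" borel]
  have [measurable]: "(\<lambda>p. prate S (phase T J (max 0 (snd p)) (\<zeta> (fst p)))) \<in> borel_measurable (N \<Otimes>\<^sub>M lborel)" by simp
  have [measurable]: "(\<lambda>p. a (fst p)) \<in> borel_measurable (N \<Otimes>\<^sub>M lborel)" "(\<lambda>p. b (fst p)) \<in> borel_measurable (N \<Otimes>\<^sub>M lborel)"
    using a b by auto
  have "(\<lambda>p. (if a (fst p) \<le> snd p \<and> snd p \<le> b (fst p) then 1 else 0) *\<^sub>R
      prate S (phase T J (max 0 (snd p)) (\<zeta> (fst p)))) \<in> borel_measurable (N \<Otimes>\<^sub>M lborel)"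
    by measurable
  then have "(\<lambda>w. \<integral>r. (if a w \<le> r \<and> r \<le> b w then 1 else 0) *\<^sub>R prate S (phase T J (max 0 r) (\<zeta> w)) \<partial>lborel) \<in> borel_measurable N"
    by (intro lborel.borel_measurable_lebesgue_integral) (simp add: case_prod_beta')
  then show ?thesis
  proof (rule measurable_cong[THEN iffD1, rotated])
    fix w assume "w \<in> space N"
    from nn[OF this] show "(\<integral>r. (if a w \<le> r \<and> r \<le> b w then 1 else 0) *\<^sub>R prate S (phase T J (max 0 r) (\<zeta> w)) \<partial>lborel)
        = produced C T J (a w) (b w) (\<zeta> w)"
      unfolding produced_def set_lebesgue_integral_def
      by (intro Bochner_Integration.integral_cong) (auto simp: indicator_def max_def)
  qed
qed

lemma level_step_measurable: "(\<lambda>z. produced C T J (arrival C n z) (arrival C m z) z) \<in> borel_measurable M"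
  using arrival_nonneg[OF arrival_path_C] arrival_C_measurable space_C
  by (intro produced_measurable) auto

lemma level_after_measurable: "level_after C T J x n \<in> borel_measurable M"
proof (induction n)
  case 0
  have "level_after C T J x 0 = (\<lambda>_. x)" by (simp add: fun_eq_iff)
  then show ?case by simp
next
  case (Suc n)
  let ?y = "\<lambda>z. level_after C T J x n z + produced C T J (arrival C n z) (arrival C (Suc n) z) z"
  have y: "?y \<in> borel_measurable M" using Suc level_step_measurable by (rule borel_measurable_add)
  have "(\<lambda>z. ?y z - min (demand C (Suc n) z) (?y z - lmin S)) \<in> borel_measurable M"
    by (intro borel_measurable_diff borel_measurable_min y demand_C_measurable borel_measurable_const)
  moreover have "level_after C T J x (Suc n) = (\<lambda>z. ?y z - min (demand C (Suc n) z) (?y z - lmin S))"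
    by (simp add: fun_eq_iff Let_def)
  ultimately show ?case by (simp only:)
qed

lemma level_before_measurable: "level_before C T J x (Suc n) \<in> borel_measurable M"
proof -
  have "level_before C T J x (Suc n) = (\<lambda>z. level_after C T J x n z + produced C T J (arrival C n z) (arrival C (Suc n) z) z)"
    by (simp add: fun_eq_iff level_before_def)
  then show ?thesis using borel_measurable_add[OF level_after_measurable level_step_measurable] by (simp only:)
qed

lemma demand_count_joint: "(\<lambda>p. demand_count C (max 0 (snd p)) (fst p)) \<in> M \<Otimes>\<^sub>M borel \<rightarrow>\<^sub>M count_space UNIV"
proof (subst measurable_count_space_eq_countable, simp, intro conjI ballI Pi_I UNIV_I)
  fix n :: nat
  have "(\<lambda>p. demand_count C (max 0 (snd p)) (fst p)) -` {n} \<inter> space (M \<Otimes>\<^sub>M borel) =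
    {p\<in>space (M \<Otimes>\<^sub>M borel). arrival C n (fst p) \<le> max 0 (snd p) \<and> max 0 (snd p) < arrival C (Suc n) (fst p)}"
  proof (intro set_eqI)
    fix p
    show "p \<in> (\<lambda>p. demand_count C (max 0 (snd p)) (fst p)) -` {n} \<inter> space (M \<Otimes>\<^sub>M borel) \<longleftrightarrow>
      p \<in> {p\<in>space (M \<Otimes>\<^sub>M borel). arrival C n (fst p) \<le> max 0 (snd p) \<and> max 0 (snd p) < arrival C (Suc n) (fst p)}"
    proof (cases "p \<in> space (M \<Otimes>\<^sub>M borel)")
      case True
      then have ap: "arrival_path C (fst p)" using arrival_path_C space_C by (simp add: space_pair_measure mem_Times_iff del: canonical_simps)
      show ?thesis using demand_count_bounds[OF ap, of "max 0 (snd p)"] demand_count_eq[OF ap, of n "max 0 (snd p)"] True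
        by (auto simp del: canonical_simps)
    qed simp
  qed
  also have "\<dots> \<in> sets (M \<Otimes>\<^sub>M borel)"
  proof -
    note [measurable] = measurable_compose[OF measurable_fst arrival_C_measurable]
    show ?thesis by measurable
  qed
  finally show "(\<lambda>p. demand_count C (max 0 (snd p)) (fst p)) -` {n} \<inter> space (M \<Otimes>\<^sub>M borel) \<in> sets (M \<Otimes>\<^sub>M borel)" .
qed

text \<open>The number of arrivals is a measurable integer, and for each of its values the level is
  the level after the last arrival plus the production since then.\<close>

lemma inventory_joint: "(\<lambda>p. inventory C T J x (max 0 (snd p)) (fst p)) \<in> borel_measurable (M \<Otimes>\<^sub>M borel)"
proof -
  have "(\<lambda>p. level_after C T J x n (fst p) + produced C T J (arrival C n (fst p)) (max 0 (snd p)) (fst p))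
      \<in> borel_measurable (M \<Otimes>\<^sub>M borel)" for n
    using arrival_nonneg[OF arrival_path_C] space_C
    by (intro borel_measurable_add produced_measurable measurable_compose[OF measurable_fst level_after_measurable]
      measurable_compose[OF measurable_fst arrival_C_measurable])
      (auto simp: space_pair_measure simp del: canonical_simps)
  from measurable_compose_countable[OF this demand_count_joint] show ?thesis
    by (simp add: inventory_def Let_def del: canonical_simps)
qed

lemma hold_integrand_joint: "(\<lambda>p. indicator {0..} (snd p) * ennreal (exp (- disc C * snd p) *
      hold C (phase T J (snd p) (fst p)) (inventory C T J x (snd p) (fst p)))) \<in> borel_measurable (M \<Otimes>\<^sub>M borel)"
proof -
  have "(\<lambda>p. hold C i (inventory C T J x (max 0 (snd p)) (fst p))) \<in> borel_measurable (M \<Otimes>\<^sub>M borel)" for i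
    using measurable_compose[OF inventory_joint hold_canonical_measurable] by simp
  from measurable_compose_countable[OF this phase_joint]
  have [measurable]: "(\<lambda>p. hold C (phase T J (max 0 (snd p)) (fst p)) (inventory C T J x (max 0 (snd p)) (fst p))) \<in> borel_measurable (M \<Otimes>\<^sub>M borel)" .
  have "(\<lambda>p. indicator {0..} (snd p) * ennreal (exp (- disc C * snd p) *
      hold C (phase T J (max 0 (snd p)) (fst p)) (inventory C T J x (max 0 (snd p)) (fst p)))) \<in> borel_measurable (M \<Otimes>\<^sub>M borel)"
    by measurable
  then show ?thesis by (rule measurable_cong[THEN iffD1, rotated]) (auto simp: indicator_def max_def)
qed

lemma hold_integrand_measurable:
  assumes z: "z \<in> good_paths"
  shows "(\<lambda>t. indicator {0..} t * ennreal (exp (- disc C * t) *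
      hold C (phase T J t z) (inventory C T J x t z))) \<in> borel_measurable borel"
  using measurable_Pair2[OF hold_integrand_joint, of z] z by (simp add: space_canonical)

lemma hold_cost_measurable: "hold_cost C x T J \<in> borel_measurable M"
proof -
  have "(\<lambda>(z, t). indicator {0..} t * ennreal (exp (- disc C * t) *
      hold C (phase T J t z) (inventory C T J x t z))) \<in> borel_measurable (M \<Otimes>\<^sub>M lborel)"
    using hold_integrand_joint[of x]
    by (simp add: case_prod_beta' measurable_cong_sets[OF sets_pair_measure_cong[OF refl sets_lborel] refl])
  then have "(\<lambda>z. \<integral>\<^sup>+t. indicator {0..} t * ennreal (exp (- disc C * t) *
      hold C (phase T J t z) (inventory C T J x t z)) \<partial>lborel) \<in> borel_measurable M"
    by (rule lborel.borel_measurable_nn_integral)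
  then show ?thesis by (simp add: hold_cost_def[abs_def] mult.commute)
qed

lemma switch_term_measurable: "(\<lambda>z. switch_term C T J z k) \<in> borel_measurable M"
proof -
  have "(\<lambda>z. swcost S (Jfin k z) (Jfin (Suc k) z)) \<in> borel_measurable M"
    by (rule measurable_compose_countable[OF _ Jfin_measurable]) (rule measurable_compose[OF Jfin_measurable], simp)
  note [measurable] = this jv.T_measurable
  have "(\<lambda>z. if T (Suc k) z < \<infinity>
          then ennreal (exp (- disc S * real_of_ereal (T (Suc k) z)) * swcost S (Jfin k z) (Jfin (Suc k) z))
          else 0) \<in> borel_measurable M" by measurable
  then show ?thesis
  proof (rule measurable_cong[THEN iffD1, rotated])
    fix z assume "z \<in> space M"
    then have "T k z \<le> T (Suc k) z" using switching_path_le_Suc[OF sw] by (simp add: space_canonical)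
    then have "T (Suc k) z < \<infinity> \<Longrightarrow> T k z < \<infinity>" by auto
    then show "(if T (Suc k) z < \<infinity> then ennreal (exp (- disc S * real_of_ereal (T (Suc k) z)) * swcost S (Jfin k z) (Jfin (Suc k) z))
          else 0) = switch_term C T J z k"
      by (simp add: switch_term_def Jfin_def)
  qed
qed

lemma penalty_term_measurable: "(\<lambda>z. penalty_term C x T J z n) \<in> borel_measurable M"
proof -
  note [measurable] = level_before_measurable[of x n] demand_C_measurable[of "Suc n"] arrival_C_measurable[of "Suc n"]
  have [measurable]: "(\<lambda>z. penalty C (demand C (Suc n) z - (level_before C T J x (Suc n) z - lmin C))) \<in> borel_measurable M"
    by (rule measurable_compose[OF _ penalty_canonical_measurable]) measurable
  show ?thesis unfolding penalty_term_def Let_def by measurable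
qed

lemma path_cost_measurable: "path_cost C x T J \<in> borel_measurable M"
  unfolding path_cost_def[abs_def]
  using hold_cost_measurable switch_term_measurable penalty_term_measurable
  by (intro borel_measurable_add borel_measurable_suminf_order) auto

text \<open>\<open>cost\<close> is a sum of three integrals. Measurability merges them into the
  integral of one functional of the path, to which the splitting at a restart applies.\<close>

lemma cost_canonical: "cost C x T J = (\<integral>\<^sup>+z. path_cost C x T J z \<partial>M)"
proof -
  have s: "(\<lambda>z. \<Sum>k. switch_term C T J z k) \<in> borel_measurable M"
    using switch_term_measurable by (rule borel_measurable_suminf_order)
  have p: "(\<lambda>z. \<Sum>n. penalty_term C x T J z n) \<in> borel_measurable M"
    using penalty_term_measurable by (rule borel_measurable_suminf_order)
  show ?thesis unfolding path_cost_def cost_eq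
    by (simp only: nn_integral_add[OF hold_cost_measurable s] nn_integral_add[OF borel_measurable_add[OF hold_cost_measurable s] p])
qed

end

section \<open>Nonanticipative strategies\<close>

lemma inventory_at:
  assumes "arrival_path S \<omega>" "arrival S n \<omega> \<le> t" "t < arrival S (Suc n) \<omega>"
  shows "inventory S T J x t \<omega> = level_after S T J x n \<omega> + produced S T J (arrival S n \<omega>) t \<omega>"
  using demand_count_eq[OF assms] by (simp add: inventory_def)

lemma inventory_0: "arrival_path S \<omega> \<Longrightarrow> inventory S T J x 0 \<omega> = x"
  using inventory_at[of S \<omega> 0 0 T J x] arrival_0[of S \<omega>] arrival_less_iff[of S \<omega> 0 1]
    produced_const[of 0 0 T J \<omega> 0 S] by simp

lemma inventory_increment:
  assumes "good_rates (prate S)" "switching_path i T J \<omega>" and ap: "arrival_path S \<omega>"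
    and n: "arrival S n \<omega> \<le> t" "t \<le> r" "r < arrival S (Suc n) \<omega>"
  shows "inventory S T J x r \<omega> = inventory S T J x t \<omega> + produced S T J t r \<omega>"
  using inventory_at[OF ap, of n t] inventory_at[OF ap, of n r] n
    produced_add[OF assms(1,2), of "arrival S n \<omega>" t r] arrival_nonneg[OF ap, of n] by simp

text \<open>
  Restricting the time to the rationals makes the set of paths that obey the operating rules
  measurable.
\<close>

lemma operating_rules_rational:
  assumes rates: "good_rates (prate S)" and sw: "switching_path i T J \<omega>" and ap: "arrival_path S \<omega>"
    and x: "lmin S \<le> x" "x \<le> cap S" and lc: "lmin S < cap S" and i0: "i = 0 \<longrightarrow> x = cap S"
  shows "operating_rules S x T J \<omega> \<longleftrightarrow>
     (\<forall>t\<in>\<rat>. 0 \<le> t \<longrightarrow> inventory S T J x t \<omega> \<le> cap S \<and> (inventory S T J x t \<omega> < cap S \<longrightarrow> phase T J t \<omega> \<noteq> 0))"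
proof
  assume "operating_rules S x T J \<omega>"
  then show "\<forall>t\<in>\<rat>. 0 \<le> t \<longrightarrow> inventory S T J x t \<omega> \<le> cap S \<and> (inventory S T J x t \<omega> < cap S \<longrightarrow> phase T J t \<omega> \<noteq> 0)"
    using inventory_range(1,2)[OF rates sw ap x lc] by auto
next
  let ?I = "\<lambda>t. inventory S T J x t \<omega>" and ?p = "\<lambda>t. phase T J t \<omega>"
  assume "\<forall>t\<in>\<rat>. 0 \<le> t \<longrightarrow> ?I t \<le> cap S \<and> (?I t < cap S \<longrightarrow> ?p t \<noteq> 0)"
  then have rat: "?I t \<le> cap S" "?I t < cap S \<Longrightarrow> ?p t \<noteq> 0" if "t \<in> \<rat>" "0 \<le> t" for t
    using that by auto
  note inc = inventory_increment[OF rates sw ap]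
  have I_le: "?I t \<le> cap S" if t: "0 \<le> t" for t
  proof -
    obtain n where n: "arrival S n \<omega> \<le> t" "t < arrival S (Suc n) \<omega>" using arrival_interval[OF ap t] by blast
    then obtain r where r: "r \<in> \<rat>" "t < r" "r < arrival S (Suc n) \<omega>" using Rats_dense_in_real by blast
    then show ?thesis using inc[of n t r x] n produced_nonneg[OF rates sw t, of r] rat(1)[of r] t by simp
  qed
  \<comment> \<open>On a short interval to the right of \<open>t\<close> the phase is constant and
    the level linear, so a violation of the rules at \<open>t\<close> is still seen at a rational
    time.\<close>
  have pick: "\<exists>r\<in>\<rat>. t < r \<and> r < t + d \<and> ?p r = ?p t \<and> ?I r = ?I t + prate S (?p t) * (r - t)"
    if t: "0 \<le> t" and d: "0 < d" for t d
  proof -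
    obtain n where n: "arrival S n \<omega> \<le> t" "t < arrival S (Suc n) \<omega>" using arrival_interval[OF ap t] by blast
    obtain k where k: "T k \<omega> \<le> ereal t" "ereal t < T (Suc k) \<omega>" using switching_path_interval[OF sw t] by blast
    obtain c where c: "t < c" "ereal c \<le> T (Suc k) \<omega>"
      using k(2) by (cases "T (Suc k) \<omega>") (auto intro: that[of "t + 1"])
    have "t < min (min c (t + d)) (arrival S (Suc n) \<omega>)" using c n d by simp
    then obtain r where r: "r \<in> \<rat>" "t < r" "r < min (min c (t + d)) (arrival S (Suc n) \<omega>)"
      using Rats_dense_in_real by blast
    have ph: "?p u = J k \<omega>" if u: "t \<le> u" "u \<le> r" for u
    proof (rule phase_eq[OF sw])
      show "T k \<omega> \<le> ereal u" using k(1) u by (metis ereal_less_eq(3) order_trans)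
      have "ereal u < ereal c" using u r by simp
      then show "ereal u < T (Suc k) \<omega>" using c(2) by (rule order_less_le_trans)
    qed
    have "?I r = ?I t + prate S (J k \<omega>) * (r - t)"
      using inc[of n t r x] produced_const[of t r T J \<omega> "J k \<omega>" S] ph n r by simp
    then show ?thesis using r ph[of r] ph[of t] by auto
  qed
  have lt_cap: "?p t \<noteq> 0" if t: "0 \<le> t" and lt: "?I t < cap S" for t
  proof
    assume p0: "?p t = 0"
    obtain r where r: "r \<in> \<rat>" "t < r" "?p r = ?p t" "?I r = ?I t + prate S (?p t) * (r - t)"
      using pick[OF t zero_less_one] by blast
    then have "?I r < cap S" using lt p0 rates by (simp add: good_rates_def)
    then show False using rat(2)[of r] r t p0 by simp
  qed
  have eq_cap: "?p t = 0" if t: "0 \<le> t" and eq: "?I t = cap S" for t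
  proof (rule ccontr)
    assume "?p t \<noteq> 0"
    then have "0 < prate S (?p t)" using phase_range[OF sw t] rates by (auto simp: good_rates_def)
    moreover obtain r where r: "r \<in> \<rat>" "t < r" "?I r = ?I t + prate S (?p t) * (r - t)"
      using pick[OF t zero_less_one] by blast
    ultimately have "cap S < ?I r" using eq by simp
    then show False using rat(1)[of r] r t by simp
  qed
  show "operating_rules S x T J \<omega>"
    unfolding operating_rules_def
  proof (intro conjI allI impI)
    fix t :: real assume t: "0 \<le> t"
    show "?p t \<in> {1, 2}" if "?I t < cap S" using lt_cap[OF t that] phase_range[OF sw t] by auto
    show "?p t = 0" if "?I t = cap S" using eq_cap[OF t that] .
  next
    fix k assume k: "T k \<omega> < \<infinity> \<and> J k \<omega> = 0"
    obtain t where t: "T k \<omega> = ereal t" "0 \<le> t"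
      using k switching_path_nonneg[OF sw, of k] by (cases "T k \<omega>") (auto simp: zero_ereal_def)
    \<comment> \<open>Equality is conceivable for \<open>T 0\<close> and \<open>T 1\<close> only. It
      would mean leaving phase 0 at time 0, when the inventory is at the capacity by
      \<open>i0\<close>.\<close>
    have lt: "T k \<omega> < T (Suc k) \<omega>"
    proof (cases "k = 0")
      case False then show ?thesis using switching_path_strict[OF sw, of k] k by simp
    next
      case True
      have "?p 0 = 0" using eq_cap[of 0] inventory_0[OF ap] i0 k True switching_path_0(2)[OF sw] by simp
      show ?thesis
      proof (rule ccontr)
        assume "\<not> ?thesis"
        then have "T 1 \<omega> = 0" using True switching_path_0(1)[OF sw] switching_path_nonneg[OF sw, of 1] by simp
        then have "phase T J 0 \<omega> = J 1 \<omega>"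
          using switching_path_strict[OF sw, of 1] by (intro phase_eq[OF sw]) (auto simp: zero_ereal_def)
        then show False using \<open>?p 0 = 0\<close> switching_path_neq[OF sw, of 0] k True \<open>T 1 \<omega> = 0\<close> by simp
      qed
    qed
    obtain n where n: "arrival S n \<omega> \<le> t" "t < arrival S (Suc n) \<omega>" using arrival_interval[OF ap t(2)] by blast
    let ?a = "arrival S (Suc n) \<omega>"
    have "?p t = 0" using phase_eq[OF sw, of k t] t lt k by simp
    then have It: "?I t = cap S" using lt_cap[OF t(2)] I_le[OF t(2)] by fastforce
    have full: "?I r = cap S \<and> ?p r = 0" if r: "t \<le> r" "r < ?a" for r
    proof -
      have "?I r = cap S" using inc[of n t r x] n r It produced_nonneg[OF rates sw t(2), of r] I_le[of r] t by simp
      then show ?thesis using eq_cap[of r] r t by simp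
    qed
    \<comment> \<open>Until the next arrival \<open>?a\<close> the level stays at the capacity and
      the phase is 0, so no switch precedes \<open>?a\<close>. At \<open>?a\<close> the demand
      lowers the level, and phase 0 ends exactly there.\<close>
    have ge: "ereal ?a \<le> T (Suc k) \<omega>"
    proof (rule ccontr)
      assume "\<not> ?thesis"
      then have fin: "T (Suc k) \<omega> < ereal ?a" by simp
      then obtain r where r: "T (Suc k) \<omega> = ereal r" using lt t by (cases "T (Suc k) \<omega>") auto
      have "?p r = J (Suc k) \<omega>"
        using switching_path_strict[OF sw, of "Suc k"] r by (intro phase_eq[OF sw]) auto
      then show False using full[of r] r fin lt t switching_path_neq[OF sw, of k] k by simp
    qed
    have lev: "level_after S T J x n \<omega> + produced S T J (arrival S n \<omega>) ?a \<omega> = cap S"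
      using inventory_at[OF ap n, of T J x] It produced_add[OF rates sw, of "arrival S n \<omega>" t ?a] n
        arrival_nonneg[OF ap, of n] produced_const[of t ?a T J \<omega> 0 S] full rates
      by (simp add: good_rates_def)
    have "0 < demand S (Suc n) \<omega>" using ap by (simp add: arrival_path_def)
    then have "level_after S T J x (Suc n) \<omega> < cap S" using lev lc by (simp add: Let_def)
    then have "?I ?a < cap S"
      using inventory_at[OF ap, of "Suc n" ?a T J x] arrival_less_iff[OF ap, of "Suc n" "Suc (Suc n)"]
        produced_const[of ?a ?a T J \<omega> 0 S] by simp
    then have "?p ?a \<noteq> 0" using lt_cap[of ?a] arrival_nonneg[OF ap] by simp
    then have "\<not> ereal ?a < T (Suc k) \<omega>" using phase_eq[OF sw, of k ?a] t n k by auto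
    then have T1: "T (Suc k) \<omega> = ereal ?a" using ge by simp
    show "T (Suc k) \<omega> = ereal (arrival S (Suc (demand_count S (real_of_ereal (T k \<omega>)) \<omega>)) \<omega>)"
      using T1 demand_count_eq[OF ap n] t by simp
    show "J (Suc k) \<omega> \<in> {1, 2}"
      using switching_path_neq[OF sw, of k] switching_path_phases[OF sw, of "Suc k"] T1 k by auto
    fix r assume "T k \<omega> \<le> ereal r \<and> ereal r < T (Suc k) \<omega>"
    then show "?I r = cap S" using full[of r] T1 t by simp
  qed
qed

section \<open>Information up to a fixed time\<close>

definition same_upto :: "real \<Rightarrow> (nat \<Rightarrow> real) \<times> (nat \<Rightarrow> real) \<Rightarrow> (nat \<Rightarrow> real) \<times> (nat \<Rightarrow> real) \<Rightarrow> bool" where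
  "same_upto t z z' \<longleftrightarrow> (\<exists>n. (\<forall>m<n. fst z m = fst z' m \<and> snd z m = snd z' m) \<and>
     (\<Sum>m<n. fst z m) \<le> t \<and> t < (\<Sum>m<Suc n. fst z m) \<and> t < (\<Sum>m<Suc n. fst z' m))"

lemma space_demand_filtration: "space (demand_filtration S t) = space (pspace S)"
  unfolding demand_filtration_def by (rule space_measure_of) auto

lemma sets_demand_filtration: "sets (demand_filtration S t) = sigma_sets (space (pspace S))
     {cum_demand S s -` A \<inter> space (pspace S) | s A. 0 \<le> s \<and> s \<le> t \<and> A \<in> sets borel}"
  unfolding demand_filtration_def by (rule sets_measure_of) auto

lemma sets_demand_filtration_mono: "s \<le> t \<Longrightarrow> sets (demand_filtration S s) \<subseteq> sets (demand_filtration S t)"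
  unfolding sets_demand_filtration by (rule sigma_sets_mono') (auto intro: order_trans)

lemma cum_demand_measurable: "0 \<le> s \<Longrightarrow> cum_demand S s \<in> borel_measurable (demand_filtration S s)"
  by (rule measurableI) (auto simp: space_demand_filtration sets_demand_filtration intro!: sigma_sets.Basic)

text \<open>The sets that do not separate two given points form a \<sigma>-algebra, and it contains
  all generators of the filtration up to \<open>t\<close>.\<close>

lemma nonanticipative:
  assumes f: "f \<in> demand_filtration S t \<rightarrow>\<^sub>M count_space UNIV" and z: "z \<in> space (pspace S)" "z' \<in> space (pspace S)"
    and eq: "\<And>s. 0 \<le> s \<Longrightarrow> s \<le> t \<Longrightarrow> cum_demand S s z = cum_demand S s z'"
  shows "f z = f z'"
proof -
  have "z \<in> A \<longleftrightarrow> z' \<in> A" if "A \<in> sigma_sets (space (pspace S))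
     {cum_demand S s -` A \<inter> space (pspace S) | s A. 0 \<le> s \<and> s \<le> t \<and> A \<in> sets borel}" for A
    using that by induction (use z eq in auto)
  then have *: "z \<in> A \<longleftrightarrow> z' \<in> A" if "A \<in> sets (demand_filtration S t)" for A
    using that by (simp add: sets_demand_filtration)
  have "f -` {f z} \<inter> space (pspace S) \<in> sets (demand_filtration S t)"
    using measurable_sets[OF f, of "{f z}"] by (simp add: space_demand_filtration)
  from *[OF this] show ?thesis using z by auto
qed

lemma demand_count_same_upto:
  assumes z: "z \<in> good_paths" "z' \<in> good_paths" and n: "\<And>m. m < n \<Longrightarrow> fst z m = fst z' m"
    and t: "arrival (canonical S) n z \<le> t" "t < arrival (canonical S) (Suc n) z'" "t < arrival (canonical S) (Suc n) z"
    and s: "0 \<le> s" "s \<le> t"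
  shows "demand_count (canonical S) s z' = demand_count (canonical S) s z" "demand_count (canonical S) s z \<le> n"
proof -
  let ?C = "canonical S"
  note ap = good_paths_arrival_path[OF z(1), of S] good_paths_arrival_path[OF z(2), of S]
  have eq: "arrival ?C m z = arrival ?C m z'" if "m \<le> n" for m using n that by (auto intro!: sum.cong)
  let ?m = "demand_count ?C s z"
  note b = demand_count_bounds[OF ap(1) s(1)]
  show mn: "?m \<le> n"
    using b(1) t(3) s arrival_less_iff[OF ap(1), of ?m "Suc n"] by linarith
  show "demand_count ?C s z' = ?m"
  proof (rule demand_count_eq[OF ap(2)])
    show "arrival ?C ?m z' \<le> s" using b(1) eq[OF mn] by simp
    show "s < arrival ?C (Suc ?m) z'" using b(2) eq[of "Suc ?m"] t(2) s mn by (cases "?m = n") auto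
  qed
qed

lemma cum_demand_same_upto:
  assumes z: "z \<in> good_paths" "z' \<in> good_paths" and same: "same_upto t z z'" and s: "0 \<le> s" "s \<le> t"
  shows "cum_demand (canonical S) s z = cum_demand (canonical S) s z'"
proof -
  obtain n where n0: "\<forall>m<n. fst z m = fst z' m \<and> snd z m = snd z' m" "(\<Sum>m<n. fst z m) \<le> t"
    "t < (\<Sum>m<Suc n. fst z m)" "t < (\<Sum>m<Suc n. fst z' m)"
    using same unfolding same_upto_def by blast
  have n: "\<And>m. m < n \<Longrightarrow> fst z m = fst z' m \<and> snd z m = snd z' m"
    "arrival (canonical S) n z \<le> t" "t < arrival (canonical S) (Suc n) z" "t < arrival (canonical S) (Suc n) z'"
    unfolding canonical_simps using n0 by blast+
  have *: "demand_count (canonical S) s z' = demand_count (canonical S) s z" "demand_count (canonical S) s z \<le> n"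
    using demand_count_same_upto[OF z, of n S t s] n s by blast+
  have "snd z (k - Suc 0) = snd z' (k - Suc 0)" if "k \<in> {Suc 0..demand_count (canonical S) s z}" for k
    using n(1)[of "k - 1"] that *(2) by auto
  then show ?thesis unfolding cum_demand_def *(1) by (auto intro!: sum.cong)
qed

text \<open>A representative of the paths that agree with \<open>z\<close> up to \<open>t\<close>:
  the next arrival is moved to \<open>t + 1\<close>, later arrivals follow at unit distance, and all
  later demands are 1. These constants keep the path good and carry no information on the future of
  \<open>z\<close>.\<close>

definition stopped :: "real \<Rightarrow> (nat \<Rightarrow> real) \<times> (nat \<Rightarrow> real) \<Rightarrow> (nat \<Rightarrow> real) \<times> (nat \<Rightarrow> real)" where
  "stopped t z =
     ((\<lambda>m. if (\<Sum>k<Suc m. fst z k) \<le> t then fst z m else if (\<Sum>k<m. fst z k) \<le> t then t - (\<Sum>k<m. fst z k) + 1 else 1),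
      (\<lambda>m. if (\<Sum>k<Suc m. fst z k) \<le> t then snd z m else 1))"

lemma stopped_same_upto:
  assumes z: "z \<in> good_paths" and t: "0 \<le> t"
  shows "stopped t z \<in> good_paths" "same_upto t z (stopped t z)"
proof -
  define s where "s n = (\<Sum>k<n. fst z k)" for n
  have ap: "arrival_path (canonical undefined) z" using good_paths_arrival_path[OF z] .
  obtain n where n: "s n \<le> t" "t < s (Suc n)"
    using arrival_interval[OF ap t] unfolding s_def canonical_simps by blast
  have le: "s m \<le> t \<longleftrightarrow> m \<le> n" for m
    using n arrival_le_iff[OF ap, of m n] arrival_le_iff[OF ap, of "Suc n" m]
    by (cases "m \<le> n") (auto simp: s_def)
  have st: "stopped t z = (\<lambda>m. if m < n then fst z m else if m = n then t - s n + 1 else 1, \<lambda>m. if m < n then snd z m else 1)"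
    unfolding stopped_def s_def[symmetric] le by (auto simp: fun_eq_iff Suc_le_eq)
  have "real N \<le> (\<Sum>k<m. fst (stopped t z) k)" if m: "N + Suc n \<le> m" for N m
  proof -
    have pos: "0 \<le> fst (stopped t z) k" for k using z n(1) by (auto simp: st good_paths_def less_imp_le)
    have "real N \<le> (\<Sum>k\<in>{Suc n..<m}. 1)" using m by simp
    also have "\<dots> = (\<Sum>k\<in>{Suc n..<m}. fst (stopped t z) k)" by (intro sum.cong) (auto simp: st)
    also have "\<dots> \<le> (\<Sum>k<m. fst (stopped t z) k)" using pos by (intro sum_mono2) auto
    finally show ?thesis .
  qed
  then have "filterlim (\<lambda>m. \<Sum>k<m. fst (stopped t z) k) at_top sequentially"
    unfolding filterlim_at_top_nat by blast
  then show "stopped t z \<in> good_paths"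
    using z n(1) by (auto simp: good_paths_def st)
  have "(\<Sum>k<n. fst (stopped t z) k) = s n" unfolding s_def by (auto simp: st intro!: sum.cong)
  then have "t < (\<Sum>k<Suc n. fst (stopped t z) k)" by (simp add: st)
  then show "same_upto t z (stopped t z)"
    unfolding same_upto_def s_def[symmetric] using n by (intro exI[of _ n]) (auto simp: st)
qed

context inventory_system begin

lemma cum_demand_C_measurable: "0 \<le> s \<Longrightarrow> cum_demand C s \<in> borel_measurable (pspace C)"
proof -
  assume s: "0 \<le> s"
  have dc: "demand_count C s \<in> pspace C \<rightarrow>\<^sub>M count_space UNIV"
  proof (subst measurable_count_space_eq_countable, simp, intro conjI ballI Pi_I UNIV_I)
    fix n
    have "demand_count C s -` {n} \<inter> space (pspace C) = {z\<in>space (pspace C). arrival C n z \<le> s \<and> s < arrival C (Suc n) z}"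
      using demand_count_bounds[OF arrival_path_C s] demand_count_eq[OF arrival_path_C, of _ n s] space_C
      by (auto simp del: canonical_simps)
    also have "\<dots> \<in> sets (pspace C)" using arrival_C_measurable by measurable
    finally show "demand_count C s -` {n} \<inter> space (pspace C) \<in> sets (pspace C)" .
  qed
  have "(\<lambda>z. \<Sum>k=1..n. demand C k z) \<in> borel_measurable (pspace C)" for n
    using demand_C_measurable by (rule borel_measurable_sum)
  from measurable_compose_countable[OF this dc] show ?thesis by (simp only: cum_demand_def[abs_def])
qed

lemma demand_filtration_C_sub: "sets (demand_filtration C t) \<subseteq> sets (pspace C)"
  unfolding sets_demand_filtration
  by (intro sets.sigma_sets_subset) (auto intro: measurable_sets[OF cum_demand_C_measurable] simp del: canonical_simps)

lemma demand_filtration_C_measurable: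
  "f \<in> demand_filtration C t \<rightarrow>\<^sub>M N \<Longrightarrow> f \<in> pspace C \<rightarrow>\<^sub>M N"
  using measurable_mono[of N N "demand_filtration C t" "pspace C"] demand_filtration_C_sub[of t]
  by (auto simp: space_demand_filtration simp del: canonical_simps)

lemma C_nonanticipative:
  assumes "f \<in> demand_filtration C t \<rightarrow>\<^sub>M count_space UNIV" "z \<in> good_paths" "z' \<in> good_paths" "same_upto t z z'"
  shows "f z = f z'"
proof (rule nonanticipative[OF assms(1)])
  show "z \<in> space (pspace C)" "z' \<in> space (pspace C)" unfolding space_C by fact+
qed (rule cum_demand_same_upto[OF assms(2-4)])

text \<open>Demands are positive, so the cumulative demand jumps at every arrival and its filtration
  knows the arrival times.\<close>

sublocale arrivals: jump_process good_paths "demand_filtration C" "\<lambda>n z. ereal (arrival C n z)"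
  "\<lambda>n z. \<Sum>k=1..n. demand C k z" "cum_demand C" 0
proof (unfold_locales, goal_cases)
  case 1 show ?case using space_C by (simp add: space_demand_filtration del: canonical_simps)
next
  case (2 s t) show ?case using 2(2) by (rule sets_demand_filtration_mono)
next
  case 3 then show ?case by (rule cum_demand_measurable)
next
  case (6 z k) then show ?case using arrival_le_iff[OF arrival_path_C] by (simp del: canonical_simps)
next
  case (7 z k) then show ?case using arrival_less_iff[OF arrival_path_C] by (simp del: canonical_simps)
next
  case (8 z k)
  then have "0 < demand C (Suc k) z" using arrival_path_C by (simp add: arrival_path_def del: canonical_simps)
  then show ?case by (simp del: canonical_simps)
next
  case (9 z k t)
  then have "demand_count C t z = k" using demand_count_eq[OF arrival_path_C] by (simp del: canonical_simps)
  then show ?case by (simp add: cum_demand_def del: canonical_simps)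
qed auto

text \<open>Galmarino's test. By \<open>same\<close>, \<open>f\<close> takes the same value at
  \<open>z\<close> and at the stopped path, and stopping at \<open>t\<close> is a measurable map
  from the information up to \<open>t\<close> into path space.\<close>

lemma galmarino:
  assumes f: "f \<in> pspace C \<rightarrow>\<^sub>M count_space UNIV" and t: "0 \<le> t"
    and same: "\<And>z z'. z \<in> good_paths \<Longrightarrow> z' \<in> good_paths \<Longrightarrow> same_upto t z z' \<Longrightarrow> f z = f z'"
  shows "f \<in> demand_filtration C t \<rightarrow>\<^sub>M count_space UNIV"
proof -
  let ?F = "demand_filtration C t"
  have spF: "space ?F = good_paths" using space_C by (simp add: space_demand_filtration del: canonical_simps)
  have le: "{z\<in>good_paths. arrival C n z \<le> t} \<in> sets ?F" for n
    using arrivals.jump_time_sets[OF t, of n] by (simp del: canonical_simps)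
  \<comment> \<open>An arrival time is unknown before it occurs, but its minimum with
    \<open>t\<close> is known at time \<open>t\<close>.\<close>
  have mn: "(\<lambda>z. min (arrival C n z) t) \<in> borel_measurable ?F" for n
  proof (subst borel_measurable_iff_le, intro allI)
    fix r
    consider "t \<le> r" | "r < 0" | "0 \<le> r" "r < t" by linarith
    then show "{z \<in> space ?F. min (arrival C n z) t \<le> r} \<in> sets ?F"
    proof cases
      case 1
      then have "{z \<in> space ?F. min (arrival C n z) t \<le> r} = space ?F" by (auto simp: min_le_iff_disj)
      then show ?thesis by simp
    next
      case 2
      have "0 \<le> arrival C n z" if "z \<in> space ?F" for z using arrival_nonneg[OF arrival_path_C] that spF by simp
      then have "{z \<in> space ?F. min (arrival C n z) t \<le> r} = {}" using 2 t by (force simp del: canonical_simps)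
      then show ?thesis by (simp only: sets.empty_sets)
    next
      case 3
      then have "{z \<in> space ?F. min (arrival C n z) t \<le> r} = {z\<in>good_paths. arrival C n z \<le> r}"
        using spF by (auto simp: min_le_iff_disj simp del: canonical_simps)
      then show ?thesis using arrivals.jump_time_sets[OF 3(1), of n] sets_demand_filtration_mono[of r t C] 3
        by (auto simp del: canonical_simps)
    qed
  qed
  have V: "(\<lambda>z. if arrival C n z \<le> t then \<Sum>k=1..n. demand C k z else 0) \<in> borel_measurable ?F" for n
  proof (rule measurableI)
    fix A :: "real set" assume A: "A \<in> sets borel"
    have "(\<lambda>z. if arrival C n z \<le> t then \<Sum>k=1..n. demand C k z else 0) -` A \<inter> space ?F =
      {z\<in>good_paths. arrival C n z \<le> t \<and> (\<Sum>k=1..n. demand C k z) \<in> A} \<union>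
      (if 0 \<in> A then space ?F - {z\<in>good_paths. arrival C n z \<le> t} else {})"
      using spF by (auto simp del: canonical_simps split: if_splits)
    also have "\<dots> \<in> sets ?F"
      using arrivals.jump_value_sets[OF t A, of n] le[of n] by (auto simp del: canonical_simps intro!: sets.Un)
    finally show "(\<lambda>z. if arrival C n z \<le> t then \<Sum>k=1..n. demand C k z else 0) -` A \<inter> space ?F \<in> sets ?F" .
  qed simp
  have le': "Measurable.pred ?F (\<lambda>z. arrival C n z \<le> t)" for n
    using le[of n] spF by (simp add: pred_def del: canonical_simps)
  have fst_meas: "(\<lambda>z. fst (stopped t z) m) \<in> borel_measurable ?F" for m
  proof -
    have "(\<lambda>z. if arrival C (Suc m) z \<le> t then min (arrival C (Suc m) z) t - min (arrival C m z) t
       else if arrival C m z \<le> t then t - min (arrival C m z) t + 1 else 1) \<in> borel_measurable ?F"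
      using mn le' by (intro measurable_If borel_measurable_diff borel_measurable_add) (auto simp del: canonical_simps simp: pred_def)
    then show ?thesis
    proof (rule measurable_cong[THEN iffD1, rotated])
      fix z assume "z \<in> space ?F"
      then have "arrival C m z \<le> arrival C (Suc m) z" using arrival_le_iff[OF arrival_path_C] spF by (simp del: canonical_simps)
      then show "(if arrival C (Suc m) z \<le> t then min (arrival C (Suc m) z) t - min (arrival C m z) t
       else if arrival C m z \<le> t then t - min (arrival C m z) t + 1 else 1) = fst (stopped t z) m"
        by (auto simp: stopped_def)
    qed
  qed
  have snd_meas: "(\<lambda>z. snd (stopped t z) m) \<in> borel_measurable ?F" for m
  proof -
    have "(\<lambda>z. if arrival C (Suc m) z \<le> t then (if arrival C (Suc m) z \<le> t then \<Sum>k=1..Suc m. demand C k z else 0)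
       - (if arrival C m z \<le> t then \<Sum>k=1..m. demand C k z else 0) else 1) \<in> borel_measurable ?F"
      by (intro measurable_If[OF _ _ le'[of "Suc m", unfolded pred_def]] borel_measurable_diff V borel_measurable_const)
    then show ?thesis
    proof (rule measurable_cong[THEN iffD1, rotated])
      fix z assume "z \<in> space ?F"
      then have "arrival C m z \<le> arrival C (Suc m) z" using arrival_le_iff[OF arrival_path_C] spF by (simp del: canonical_simps)
      then show "(if arrival C (Suc m) z \<le> t then (if arrival C (Suc m) z \<le> t then \<Sum>k=1..Suc m. demand C k z else 0)
       - (if arrival C m z \<le> t then \<Sum>k=1..m. demand C k z else 0) else 1) = snd (stopped t z) m"
        by (auto simp: stopped_def)
    qed
  qed
  have "stopped t \<in> ?F \<rightarrow>\<^sub>M path_borel"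
  proof -
    have "(\<lambda>z. (\<lambda>m. fst (stopped t z) m, \<lambda>m. snd (stopped t z) m)) \<in> ?F \<rightarrow>\<^sub>M path_borel"
      using fst_meas snd_meas by (intro measurable_Pair measurable_PiM_single') auto
    then show ?thesis by simp
  qed
  then have "stopped t \<in> ?F \<rightarrow>\<^sub>M pspace C"
    using stopped_same_upto(1)[OF _ t] spF
    by (auto intro!: measurable_restrict_space2 simp: measurable_cong_sets[OF refl sets_path_measure])
  from measurable_compose[OF this f] show ?thesis
    by (rule measurable_cong[THEN iffD1, rotated]) (use same stopped_same_upto[OF _ t] spF in metis)
qed

end

section \<open>Transfer to the space of demand paths\<close>

context canonical_strategy begin

lemma inventory_C_measurable: "0 \<le> t \<Longrightarrow> inventory C T J x t \<in> borel_measurable M"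
proof -
  assume t: "0 \<le> t"
  have "(\<lambda>z. (z, t)) \<in> M \<rightarrow>\<^sub>M M \<Otimes>\<^sub>M borel" by simp
  from measurable_compose[OF this inventory_joint[of x]] show ?thesis
    using t by (simp add: max_def)
qed

lemma operating_rules_sets:
  assumes x: "lmin S \<le> x" "x \<le> cap S" and i0: "i = 0 \<longrightarrow> x = cap S"
  shows "{z\<in>space M. operating_rules C x T J z} \<in> sets M"
proof -
  have "{z\<in>space M. operating_rules C x T J z} = {z\<in>space M. \<forall>t\<in>\<rat>\<inter>{0..}.
      inventory C T J x t z \<le> cap S \<and> (inventory C T J x t z < cap S \<longrightarrow> phase T J t z \<noteq> 0)}"
  proof (intro Collect_cong conj_cong refl)
    fix z assume "z \<in> space M"
    then have z: "z \<in> good_paths" by (simp only: space_C)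
    have "operating_rules C x T J z \<longleftrightarrow> (\<forall>t\<in>\<rat>. 0 \<le> t \<longrightarrow>
      inventory C T J x t z \<le> cap C \<and> (inventory C T J x t z < cap C \<longrightarrow> phase T J t z \<noteq> 0))"
      using params x i0 by (intro operating_rules_rational[OF _ sw[OF z] arrival_path_C[OF z]]) simp_all
    then show "operating_rules C x T J z \<longleftrightarrow> (\<forall>t\<in>\<rat>\<inter>{0..}.
      inventory C T J x t z \<le> cap S \<and> (inventory C T J x t z < cap S \<longrightarrow> phase T J t z \<noteq> 0))"
      unfolding canonical_simps by (simp only: Ball_def Int_iff atLeast_iff) blast
  qed
  also have "\<dots> = space M - (\<Union>t\<in>\<rat>\<inter>{0..}. space M - {z\<in>space M.
      inventory C T J x t z \<le> cap S \<and> (inventory C T J x t z < cap S \<longrightarrow> phase T J t z \<noteq> 0)})" by blast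
  also have "\<dots> \<in> sets M"
  proof (intro sets.Diff sets.top sets.countable_UN'')
    fix t :: real assume "t \<in> \<rat> \<inter> {0..}"
    then have [measurable]: "inventory C T J x t \<in> borel_measurable M" "phase T J t \<in> M \<rightarrow>\<^sub>M count_space UNIV"
      using inventory_C_measurable phase_meas by auto
    show "{z\<in>space M. inventory C T J x t z \<le> cap S \<and> (inventory C T J x t z < cap S \<longrightarrow> phase T J t z \<noteq> 0)} \<in> sets M"
      by measurable
  next
    show "countable (\<rat> \<inter> {0::real..})" using countable_rat by (rule countable_subset[rotated]) auto
  qed
  finally show ?thesis .
qed

end

context inventory_system begin

text \<open>
  Equality of the phase processes leaves \<open>J k\<close> on \<open>T k = \<infinity>\<close> undetermined, but neither the costs
  nor the rules depend on it.
\<close>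

context
  fixes \<omega> i T J T' J' x
  assumes \<omega>: "\<omega> \<in> space (pspace S)" and sw: "switching_path i T J \<omega>"
    and sw': "switching_path i T' J' (demand_path S \<omega>)"
    and ph: "\<And>t. 0 \<le> t \<Longrightarrow> phase T' J' t (demand_path S \<omega>) = phase T J t \<omega>"
    and x: "lmin S \<le> x" "x \<le> cap S" and i0: "i = 0 \<longrightarrow> x = cap S"
begin

interpretation tr: trajectory_shift S C \<omega> "demand_path S \<omega>" T J T' J' 0 0 x x i
proof (unfold_locales, goal_cases)
  case 1 show ?case using \<omega> by (rule arrival_path_model)
next
  case 2 show ?case using demand_path_good[OF \<omega>] by (rule arrival_path_C)
next
  case 3 show ?case by (rule params)
next
  case 4 show ?case by (rule sw)
next
  case 9 show ?case using arrival_0[OF arrival_path_model[OF \<omega>]] by simp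
next
  case 10 show ?case using arrival_less_iff[OF arrival_path_model[OF \<omega>], of 0 1] arrival_0[OF arrival_path_model[OF \<omega>]] by simp
next
  case (11 n) show ?case using canonical_arrival_demand(1)[OF \<omega>] by simp
next
  case (12 n) then show ?case using canonical_arrival_demand(2)[OF \<omega>] by simp
next
  case (13 t) then show ?case using ph by simp
next
  case 14 show ?case using inventory_0[OF arrival_path_model[OF \<omega>]] by simp
qed simp_all

lemma transfer_inventory: "0 \<le> t \<Longrightarrow> inventory C T' J' x t (demand_path S \<omega>) = inventory S T J x t \<omega>"
  using tr.inventory_shift by simp

text \<open>Both sides reduce to conditions on phase and level at rational times, where the two
  paths agree.\<close>

lemma transfer_rules: "operating_rules C x T' J' (demand_path S \<omega>) \<longleftrightarrow> operating_rules S x T J \<omega>"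
proof -
  have "operating_rules C x T' J' (demand_path S \<omega>) \<longleftrightarrow> (\<forall>t\<in>\<rat>. 0 \<le> t \<longrightarrow>
      inventory C T' J' x t (demand_path S \<omega>) \<le> cap C \<and> (inventory C T' J' x t (demand_path S \<omega>) < cap C \<longrightarrow> phase T' J' t (demand_path S \<omega>) \<noteq> 0))"
    using params x i0
    by (intro operating_rules_rational[OF _ sw' arrival_path_C[OF demand_path_good[OF \<omega>]]]) simp_all
  moreover have "operating_rules S x T J \<omega> \<longleftrightarrow> (\<forall>t\<in>\<rat>. 0 \<le> t \<longrightarrow>
      inventory S T J x t \<omega> \<le> cap S \<and> (inventory S T J x t \<omega> < cap S \<longrightarrow> phase T J t \<omega> \<noteq> 0))"
    using params x i0
    by (intro operating_rules_rational[OF _ sw arrival_path_model[OF \<omega>]]) simp_all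
  ultimately show ?thesis using ph transfer_inventory by simp
qed

lemma transfer_costs:
  assumes ru: "operating_rules S x T J \<omega>"
  shows "hold_cost S x T J \<omega> = hold_cost C x T' J' (demand_path S \<omega>)"
    and "switch_term S T J \<omega> k = switch_term C T' J' (demand_path S \<omega>) k"
    and "penalty_term S x T J \<omega> n = penalty_term C x T' J' (demand_path S \<omega>) n"
proof -
  have "hold S (phase T J t \<omega>) (inventory S T J x t \<omega>) =
      hold C (phase T' J' t (demand_path S \<omega>)) (inventory C T' J' x t (demand_path S \<omega>))" if t: "0 \<le> t" for t
  proof -
    note r = inventory_range[OF params(5) sw arrival_path_model[OF \<omega>] x params(4) ru t]
    show ?thesis unfolding ph[OF t] transfer_inventory[OF t] hold_canonical using r by auto
  qed
  then show "hold_cost S x T J \<omega> = hold_cost C x T' J' (demand_path S \<omega>)"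
    unfolding hold_cost_def by (intro nn_integral_cong) (auto simp: indicator_def)
  have det: "T k \<omega> = T' k (demand_path S \<omega>)" "T k \<omega> < \<infinity> \<Longrightarrow> J k \<omega> = J' k (demand_path S \<omega>)" for k
    using switching_path_determined[OF sw sw', of k] ph by (simp_all add: ph)
  have "T k \<omega> \<le> T (Suc k) \<omega>" by (rule switching_path_le_Suc[OF sw])
  then have fin: "T (Suc k) \<omega> < \<infinity> \<Longrightarrow> T k \<omega> < \<infinity>" by (rule order_le_less_trans)
  show "switch_term S T J \<omega> k = switch_term C T' J' (demand_path S \<omega>) k"
    using det(1)[of "Suc k"] det(2)[OF fin] det(2)[of "Suc k"] unfolding switch_term_def canonical_simps
    by (cases "T (Suc k) \<omega> < \<infinity>") simp_all
  show "penalty_term S x T J \<omega> n = penalty_term C x T' J' (demand_path S \<omega>) n"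
    using tr.level_before_shift[of n] canonical_arrival_demand[OF \<omega>, of "Suc n"]
    unfolding penalty_term_def Let_def by (simp del: canonical_simps(2,3))
qed

end

lemma transfer_cost:
  assumes cs: "canonical_strategy S i T' J'" and swS: "switching_strategy S i T J"
    and ph: "AE \<omega> in pspace S. \<forall>t\<ge>0. phase T' J' t (demand_path S \<omega>) = phase T J t \<omega>"
    and x: "lmin S \<le> x" "x \<le> cap S" and i0: "i = 0 \<longrightarrow> x = cap S"
    and ru: "AE \<omega> in pspace S. operating_rules S x T J \<omega>"
  shows "cost S x T J = cost C x T' J'"
proof -
  interpret canonical_strategy S i T' J' by (rule cs)
  have swp: "switching_path i T J \<omega>" "switching_path i T' J' (demand_path S \<omega>)" if "\<omega> \<in> space (pspace S)" for \<omega>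
    using that swS sw[OF demand_path_good[OF that]] by (simp_all add: switching_strategy_iff)
  have AE: "AE \<omega> in pspace S. hold_cost S x T J \<omega> = hold_cost C x T' J' (demand_path S \<omega>)
     \<and> (\<forall>k. switch_term S T J \<omega> k = switch_term C T' J' (demand_path S \<omega>) k)
     \<and> (\<forall>n. penalty_term S x T J \<omega> n = penalty_term C x T' J' (demand_path S \<omega>) n)"
    using ph ru AE_space
  proof eventually_elim
    case (elim \<omega>)
    have "\<And>t. 0 \<le> t \<Longrightarrow> phase T' J' t (demand_path S \<omega>) = phase T J t \<omega>" using elim(1) by blast
    from transfer_costs[OF elim(3) swp[OF elim(3)] this x i0 elim(2)] show ?case by blast
  qed
  have "(\<integral>\<^sup>+\<omega>. hold_cost S x T J \<omega> \<partial>pspace S) = (\<integral>\<^sup>+\<omega>. hold_cost C x T' J' (demand_path S \<omega>) \<partial>pspace S)"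
    using AE by (intro nn_integral_cong_AE) (auto elim: eventually_mono)
  also have "\<dots> = (\<integral>\<^sup>+z. hold_cost C x T' J' z \<partial>M)" by (rule nn_integral_demand_path[OF hold_cost_measurable])
  finally have 1: "(\<integral>\<^sup>+\<omega>. hold_cost S x T J \<omega> \<partial>pspace S) = (\<integral>\<^sup>+z. hold_cost C x T' J' z \<partial>M)" .
  have "(\<integral>\<^sup>+\<omega>. (\<Sum>k. switch_term S T J \<omega> k) \<partial>pspace S) = (\<integral>\<^sup>+\<omega>. (\<Sum>k. switch_term C T' J' (demand_path S \<omega>) k) \<partial>pspace S)"
    using AE by (intro nn_integral_cong_AE) (auto elim: eventually_mono)
  also have "\<dots> = (\<integral>\<^sup>+z. (\<Sum>k. switch_term C T' J' z k) \<partial>M)"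
    by (rule nn_integral_demand_path[OF borel_measurable_suminf_order[OF switch_term_measurable]])
  finally have 2: "(\<integral>\<^sup>+\<omega>. (\<Sum>k. switch_term S T J \<omega> k) \<partial>pspace S) = (\<integral>\<^sup>+z. (\<Sum>k. switch_term C T' J' z k) \<partial>M)" .
  have "(\<integral>\<^sup>+\<omega>. (\<Sum>n. penalty_term S x T J \<omega> n) \<partial>pspace S) = (\<integral>\<^sup>+\<omega>. (\<Sum>n. penalty_term C x T' J' (demand_path S \<omega>) n) \<partial>pspace S)"
    using AE by (intro nn_integral_cong_AE) (auto elim: eventually_mono)
  also have "\<dots> = (\<integral>\<^sup>+z. (\<Sum>n. penalty_term C x T' J' z n) \<partial>M)"
    by (rule nn_integral_demand_path[OF borel_measurable_suminf_order[OF penalty_term_measurable]])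
  finally have 3: "(\<integral>\<^sup>+\<omega>. (\<Sum>n. penalty_term S x T J \<omega> n) \<partial>pspace S) = (\<integral>\<^sup>+z. (\<Sum>n. penalty_term C x T' J' z n) \<partial>M)" .
  show ?thesis unfolding cost_eq 1 2 3 ..
qed

lemma admissible_canonical_strategy: "admissible C x i T J \<Longrightarrow> canonical_strategy S i T J"
  using demand_filtration_C_measurable inventory_system_axioms
  by (auto simp: canonical_strategy_def canonical_strategy_axioms_def admissible_iff simp del: canonical_simps)

lemma demand_path_filtration: "demand_path S \<in> demand_filtration S t \<rightarrow>\<^sub>M demand_filtration C t"
proof (rule measurable_sigma_sets[OF sets_demand_filtration])
  show "{cum_demand C s -` A \<inter> space (pspace C) |s A. 0 \<le> s \<and> s \<le> t \<and> A \<in> sets borel} \<subseteq> Pow (space (pspace C))"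
    by auto
  show "demand_path S \<in> space (demand_filtration S t) \<rightarrow> space (pspace C)"
    using demand_path_good space_C by (simp add: space_demand_filtration del: canonical_simps)
  fix B assume "B \<in> {cum_demand C s -` A \<inter> space (pspace C) |s A. 0 \<le> s \<and> s \<le> t \<and> A \<in> sets borel}"
  then obtain s A where B: "B = cum_demand C s -` A \<inter> space (pspace C)" "0 \<le> s" "s \<le> t" "A \<in> sets borel" by blast
  have eq: "cum_demand C s (demand_path S \<omega>) = cum_demand S s \<omega>" if "\<omega> \<in> space (pspace S)" for \<omega>
    unfolding cum_demand_def demand_count_def canonical_arrival_demand(1)[OF that]
    using canonical_arrival_demand(2)[OF that] by (intro sum.cong) auto
  have "demand_path S -` B \<inter> space (demand_filtration S t) = cum_demand S s -` A \<inter> space (pspace S)"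
  proof (intro set_eqI)
    fix \<omega>
    show "\<omega> \<in> demand_path S -` B \<inter> space (demand_filtration S t) \<longleftrightarrow> \<omega> \<in> cum_demand S s -` A \<inter> space (pspace S)"
      unfolding B space_demand_filtration space_C Int_iff vimage_eq using eq[of \<omega>] demand_path_good[of \<omega>]
      by (cases "\<omega> \<in> space (pspace S)") (simp_all del: canonical_simps)
  qed
  then show "demand_path S -` B \<inter> space (demand_filtration S t) \<in> sets (demand_filtration S t)"
    unfolding sets_demand_filtration using B by (auto intro!: sigma_sets.Basic)
qed

text \<open>\<open>opt_cost\<close> is an infimum over strategies on the original space, so a
  strategy constructed on path space has to be carried back for a comparison. Composition with
  \<open>demand_path S\<close> does this and preserves adaptedness, rules and cost.\<close>

lemma pull_back_admissible:
  assumes adm: "admissible C x i T J" and x: "lmin S \<le> x" "x \<le> cap S" and i0: "i = 0 \<longrightarrow> x = cap S"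
  shows "\<exists>T' J'. admissible S x i T' J' \<and> cost S x T' J' = cost C x T J"
proof -
  interpret canonical_strategy S i T J using adm by (rule admissible_canonical_strategy)
  define T' where "T' = (\<lambda>k \<omega>. T k (demand_path S \<omega>))"
  define J' where "J' = (\<lambda>k \<omega>. J k (demand_path S \<omega>))"
  have ph: "phase T' J' t \<omega> = phase T J t (demand_path S \<omega>)" for t \<omega>
    by (simp add: phase_def T'_def J'_def)
  have swp: "switching_path i T' J' \<omega>" if "\<omega> \<in> space (pspace S)" for \<omega>
    using sw[OF demand_path_good[OF that]] unfolding switching_path_def T'_def J'_def .
  then have sw': "switching_strategy S i T' J'" by (simp add: switching_strategy_iff)
  have ad: "phase T' J' t \<in> demand_filtration S t \<rightarrow>\<^sub>M count_space UNIV" if "0 \<le> t" for t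
  proof -
    have "phase T J t \<in> demand_filtration C t \<rightarrow>\<^sub>M count_space UNIV" using adm that by (simp add: admissible_iff)
    from measurable_compose[OF demand_path_filtration this] show ?thesis by (simp add: ph[abs_def])
  qed
  have "AE z in pspace C. operating_rules C x T J z" using adm by (simp add: admissible_iff)
  from AE_demand_path[OF this]
  have ru: "AE \<omega> in pspace S. operating_rules S x T' J' \<omega>"
    using AE_space
  proof eventually_elim
    case (elim \<omega>)
    then show ?case using transfer_rules[OF elim(2) swp[OF elim(2)] sw[OF demand_path_good[OF elim(2)]] _ x i0] ph by simp
  qed
  have "cost S x T' J' = cost C x T J"
    by (rule transfer_cost[OF canonical_strategy_axioms sw' _ x i0 ru]) (simp add: ph)
  then show ?thesis using sw' ad ru by (auto simp: admissible_iff)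
qed

end

section \<open>Recovering the phase process from the demand path\<close>

definition past :: "nat \<Rightarrow> (nat \<Rightarrow> real) \<times> (nat \<Rightarrow> real) \<Rightarrow> (nat \<Rightarrow> real) \<times> (nat \<Rightarrow> real)" where
  "past n z = (\<lambda>m. if m < n then fst z m else 1, \<lambda>m. if m < n then snd z m else 1)"

lemma past_cong: "(\<And>m. m < n \<Longrightarrow> fst z m = fst z' m \<and> snd z m = snd z' m) \<Longrightarrow> past n z = past n z'"
  by (auto simp: past_def fun_eq_iff)

lemma past_measurable: "past n \<in> path_borel \<rightarrow>\<^sub>M path_borel"
  unfolding past_def[abs_def] by (intro measurable_Pair measurable_PiM_single') auto

text \<open>The least index is nondecreasing in \<open>t\<close> and bounded by its value at
  \<open>t\<close> before \<open>t\<close>; hence it takes finitely many values there and is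
  constant shortly before \<open>t\<close>.\<close>

lemma cadlag_step_Least:
  fixes e :: "nat \<Rightarrow> ereal" and v :: "nat \<Rightarrow> nat"
  assumes unb: "\<And>t::real. \<exists>k. ereal t < e k"
  shows "cadlag_step (\<lambda>t. v (LEAST k. ereal t < e k))"
proof -
  define L where "L t = (LEAST k. ereal t < e k)" for t :: real
  have L: "ereal t < e (L t)" for t unfolding L_def using unb by (rule LeastI_ex)
  have L_le: "ereal t < e k \<Longrightarrow> L t \<le> k" for t k unfolding L_def by (rule Least_le)
  have mono: "L s \<le> L t" if "s \<le> t" for s t
    by (rule L_le) (metis L ereal_less_eq(3) order_le_less_trans that)
  show ?thesis
    unfolding cadlag_step_def L_def[symmetric]
  proof (intro conjI allI impI)
    fix t :: real
    obtain c where c: "t < c" "ereal c \<le> e (L t)"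
      using L[of t] by (cases "e (L t)") (auto intro: that[of "t + 1"])
    show "\<exists>d>0. \<forall>r\<in>{t..<t + d}. v (L r) = v (L t)"
    proof (intro exI[of _ "c - t"] conjI ballI)
      fix r assume r: "r \<in> {t..<t + (c - t)}"
      then have "ereal r < ereal c" by simp
      then have "ereal r < e (L t)" using c(2) by (rule order_less_le_trans)
      then have "L r \<le> L t" by (rule L_le)
      moreover have "L t \<le> L r" using r by (intro mono) simp
      ultimately show "v (L r) = v (L t)" by simp
    qed (use c in simp)
  next
    fix t :: real
    have "L ` {..<t} \<subseteq> {..L t}" by (intro image_subsetI) (simp add: mono)
    then have fin: "finite (L ` {..<t})" by (rule finite_subset) simp
    have "Max (L ` {..<t}) \<in> L ` {..<t}" using fin by (intro Max_in) auto
    then obtain u where u: "u < t" "L u = Max (L ` {..<t})" by auto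
    have const: "L r = L u" if "r \<in> {t - (t - u)<..<t}" for r
    proof (rule antisym)
      show "L r \<le> L u" using fin that unfolding u(2) by (intro Max_ge) auto
      show "L u \<le> L r" using that by (intro mono) simp
    qed
    show "\<exists>d>0. \<forall>r\<in>{t - d<..<t}. \<forall>s\<in>{t - d<..<t}. v (L r) = v (L s)"
    proof (intro exI[of _ "t - u"] conjI ballI)
      fix r s assume "r \<in> {t - (t - u)<..<t}" "s \<in> {t - (t - u)<..<t}"
      then show "v (L r) = v (L s)" using const[of r] const[of s] by simp
    qed (use u in simp)
  qed
qed

lemma cadlag_step_piecewise:
  assumes ap: "arrival_path S \<omega>" and c: "\<And>n. cadlag_step (c n)"
  shows "cadlag_step (\<lambda>t. c (demand_count S t \<omega>) t)"
  unfolding cadlag_step_def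
proof (intro conjI allI impI)
  fix t :: real assume t: "0 \<le> t"
  obtain n where n: "arrival S n \<omega> \<le> t" "t < arrival S (Suc n) \<omega>" using arrival_interval[OF ap t] by blast
  obtain d where d: "d > 0" "\<forall>r\<in>{t..<t + d}. c n r = c n t" using c t unfolding cadlag_step_def by blast
  show "\<exists>d>0. \<forall>r\<in>{t..<t + d}. c (demand_count S r \<omega>) r = c (demand_count S t \<omega>) t"
  proof (intro exI[of _ "min d (arrival S (Suc n) \<omega> - t)"] conjI ballI)
    fix r assume "r \<in> {t..<t + min d (arrival S (Suc n) \<omega> - t)}"
    then have r: "t \<le> r" "r < t + d" "r < arrival S (Suc n) \<omega>" by auto
    then have "demand_count S r \<omega> = n" using n by (intro demand_count_eq[OF ap]) auto
    moreover have "c n r = c n t" using r by (intro bspec[OF d(2)]) simp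
    ultimately show "c (demand_count S r \<omega>) r = c (demand_count S t \<omega>) t"
      using demand_count_eq[OF ap n] by (simp only:)
  qed (use d n in simp)
next
  fix t :: real assume t: "0 < t"
  \<comment> \<open>If \<open>t\<close> is itself an arrival, the times just before it belong to the
    preceding piece.\<close>
  have "\<exists>n. arrival S n \<omega> < t \<and> t \<le> arrival S (Suc n) \<omega>"
  proof -
    obtain n where n: "arrival S n \<omega> \<le> t" "t < arrival S (Suc n) \<omega>"
      using arrival_interval[OF ap, of t] t by auto
    show ?thesis
    proof (cases "arrival S n \<omega> = t")
      case True
      then obtain m where m: "n = Suc m" using t arrival_0[OF ap] by (cases n) auto
      then show ?thesis using True arrival_less_iff[OF ap, of m n] by auto
    next
      case False
      with n show ?thesis by (intro exI[of _ n]) simp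
    qed
  qed
  then obtain n where n: "arrival S n \<omega> < t" "t \<le> arrival S (Suc n) \<omega>" by blast
  obtain d where d: "d > 0" "\<forall>r\<in>{t - d<..<t}. \<forall>s\<in>{t - d<..<t}. c n r = c n s" using c t unfolding cadlag_step_def by blast
  show "\<exists>d>0. \<forall>r\<in>{t - d<..<t}. \<forall>s\<in>{t - d<..<t}. c (demand_count S r \<omega>) r = c (demand_count S s \<omega>) s"
  proof (intro exI[of _ "min d (t - arrival S n \<omega>)"] conjI ballI)
    have dc: "demand_count S r \<omega> = n" if "r \<in> {t - min d (t - arrival S n \<omega>)<..<t}" for r
      using that n by (intro demand_count_eq[OF ap]) auto
    fix r s assume rs: "r \<in> {t - min d (t - arrival S n \<omega>)<..<t}" "s \<in> {t - min d (t - arrival S n \<omega>)<..<t}"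
    then have "r \<in> {t - d<..<t}" "s \<in> {t - d<..<t}" by auto
    then have "c n r = c n s" by (rule d(2)[THEN bspec, THEN bspec])
    then show "c (demand_count S r \<omega>) r = c (demand_count S s \<omega>) s" using dc[OF rs(1)] dc[OF rs(2)] by (simp only:)
  qed (use d n in simp)
qed

context inventory_system begin

text \<open>Between arrival \<open>n\<close> and the next one, the cumulative demand at any time up
  to \<open>t\<close> is a function of the first \<open>n\<close> inter-arrival times and demands.
  Complements and countable unions keep this property.\<close>

lemma filtration_trace:
  assumes "G \<in> sets (demand_filtration S t)"
  shows "\<exists>D\<in>sets path_borel. \<forall>\<omega>\<in>space (pspace S). arrival S n \<omega> \<le> t \<and> t < arrival S (Suc n) \<omega> \<longrightarrow>
    (\<omega> \<in> G \<longleftrightarrow> past n (demand_path S \<omega>) \<in> D)"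
  using assms unfolding sets_demand_filtration
proof induction
  case (Basic a)
  then obtain s A where a: "a = cum_demand S s -` A \<inter> space (pspace S)" "0 \<le> s" "s \<le> t" "A \<in> sets borel" by blast
  define f where "f = (\<lambda>z :: (nat \<Rightarrow> real) \<times> (nat \<Rightarrow> real). \<Sum>m<n. if (\<Sum>k<Suc m. fst z k) \<le> s then snd z m else 0)"
  have "f \<in> borel_measurable path_borel" unfolding f_def by measurable
  then have "f -` A \<in> sets path_borel" using measurable_sets[OF _ a(4), of f path_borel] by simp
  moreover have "\<omega> \<in> a \<longleftrightarrow> past n (demand_path S \<omega>) \<in> f -` A"
    if \<omega>: "\<omega> \<in> space (pspace S)" and n: "arrival S n \<omega> \<le> t" "t < arrival S (Suc n) \<omega>" for \<omega>
  proof -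
    note ap = arrival_path_model[OF \<omega>]
    let ?d = "demand_count S s \<omega>"
    have "?d \<le> demand_count S t \<omega>" using demand_count_mono[OF ap a(2,3)] .
    then have d: "?d \<le> n" using demand_count_eq[OF ap n] by simp
    have arr: "(\<Sum>k<Suc m. fst (past n (demand_path S \<omega>)) k) = arrival S (Suc m) \<omega>" if "m < n" for m
    proof -
      have "(\<Sum>k<Suc m. fst (past n (demand_path S \<omega>)) k) = (\<Sum>k<Suc m. fst (demand_path S \<omega>) k)"
        using that by (intro sum.cong) (auto simp: past_def)
      then show ?thesis using canonical_arrival_demand(1)[OF \<omega>, of "Suc m"] by (simp only: canonical_simps)
    qed
    have le: "arrival S (Suc m) \<omega> \<le> s \<longleftrightarrow> m < ?d" for m
      using demand_count_bounds[OF ap a(2)] arrival_le_iff[OF ap, of "Suc m" ?d] arrival_le_iff[OF ap, of "Suc ?d" "Suc m"]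
      by (cases "m < ?d") auto
    have "f (past n (demand_path S \<omega>)) = (\<Sum>m<n. if m < ?d then demand S (Suc m) \<omega> else 0)"
      unfolding f_def by (intro sum.cong refl) (simp only: arr le lessThan_iff, simp add: past_def demand_path_def)
    also have "\<dots> = (\<Sum>m<?d. demand S (Suc m) \<omega>)"
      using d by (intro sum.mono_neutral_cong_right) auto
    also have "\<dots> = cum_demand S s \<omega>"
      by (simp add: cum_demand_def sum.atLeast1_atMost_eq)
    finally show ?thesis using a(1) \<omega> by simp
  qed
  ultimately show ?case by blast
next
  case Empty
  show ?case by (rule bexI[of _ "{}"]) auto
next
  case (Compl a)
  then obtain D where D: "D \<in> sets path_borel" "\<forall>\<omega>\<in>space (pspace S). arrival S n \<omega> \<le> t \<and> t < arrival S (Suc n) \<omega> \<longrightarrow>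
    (\<omega> \<in> a \<longleftrightarrow> past n (demand_path S \<omega>) \<in> D)" by blast
  have "space path_borel - D \<in> sets path_borel" using D(1) by (rule sets.compl_sets)
  then show ?case using D(2) by (intro bexI[of _ "space path_borel - D"]) auto
next
  case (Union a)
  then have "\<forall>m. \<exists>D. D \<in> sets path_borel \<and> (\<forall>\<omega>\<in>space (pspace S). arrival S n \<omega> \<le> t \<and> t < arrival S (Suc n) \<omega> \<longrightarrow>
    (\<omega> \<in> a m \<longleftrightarrow> past n (demand_path S \<omega>) \<in> D))" by blast
  then obtain D where D: "\<And>m. D m \<in> sets path_borel" "\<And>m. \<forall>\<omega>\<in>space (pspace S). arrival S n \<omega> \<le> t \<and> t < arrival S (Suc n) \<omega> \<longrightarrow>
    (\<omega> \<in> a m \<longleftrightarrow> past n (demand_path S \<omega>) \<in> D m)" by metis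
  then show ?case by (intro bexI[of _ "\<Union>m. D m"]) auto
qed

end

locale strategy_on_space = inventory_system S for S :: "'a inventory_data" +
  fixes i and T :: "nat \<Rightarrow> 'a \<Rightarrow> ereal" and J :: "nat \<Rightarrow> 'a \<Rightarrow> nat"
  assumes switching: "switching_strategy S i T J"
    and adapted: "\<And>t. 0 \<le> t \<Longrightarrow> phase T J t \<in> demand_filtration S t \<rightarrow>\<^sub>M count_space UNIV"
    and i: "i \<in> {0,1,2}"
begin

lemma swS: "\<omega> \<in> space (pspace S) \<Longrightarrow> switching_path i T J \<omega>"
  using switching by (simp add: switching_strategy_iff)

sublocale jp: jump_process "space (pspace S)" "demand_filtration S" T "\<lambda>k \<omega>. real (J k \<omega>)"
  "\<lambda>t \<omega>. real (phase T J t \<omega>)" "real i"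
proof (unfold_locales, goal_cases)
  case 1 show ?case by (rule space_demand_filtration)
next
  case (2 s t) show ?case using 2(2) by (rule sets_demand_filtration_mono)
next
  case (3 t)
  show ?case using measurable_compose[OF adapted[OF 3], of real borel] by simp
next
  case (6 \<omega> k) then show ?case using switching_path_le_Suc[OF swS] by blast
next
  case (7 \<omega> k) then show ?case using switching_path_strict[OF swS] by blast
next
  case (8 \<omega> k) then show ?case using switching_path_neq[OF swS] by simp
next
  case (9 \<omega> k t) then show ?case using phase_eq[OF swS] by simp
qed (auto simp: switching_path_0[OF swS])

text \<open>
  On the paths with exactly \<open>n\<close> arrivals up to time \<open>q\<close>, the event that the \<open>k\<close>-th switch has
  occurred by time \<open>q\<close> and leads to phase \<open>v\<close> depends on the first \<open>n\<close> arrivals and demands only.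
\<close>

definition event :: "nat \<Rightarrow> nat \<Rightarrow> nat \<Rightarrow> real \<Rightarrow> ((nat \<Rightarrow> real) \<times> (nat \<Rightarrow> real)) set" where
  "event n k v q = (SOME D. D \<in> sets path_borel \<and> (\<forall>\<omega>\<in>space (pspace S).
     arrival S n \<omega> \<le> q \<and> q < arrival S (Suc n) \<omega> \<longrightarrow>
     (T k \<omega> \<le> ereal q \<and> J k \<omega> = v \<longleftrightarrow> past n (demand_path S \<omega>) \<in> D)))"

lemma event:
  assumes "0 \<le> q"
  shows "event n k v q \<in> sets path_borel"
    and "\<omega> \<in> space (pspace S) \<Longrightarrow> arrival S n \<omega> \<le> q \<Longrightarrow> q < arrival S (Suc n) \<omega> \<Longrightarrow>
     past n (demand_path S \<omega>) \<in> event n k v q \<longleftrightarrow> T k \<omega> \<le> ereal q \<and> J k \<omega> = v"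
proof -
  have "{\<omega>\<in>space (pspace S). T k \<omega> \<le> ereal q \<and> real (J k \<omega>) \<in> {real v}} \<in> sets (demand_filtration S q)"
    using assms by (intro jp.jump_value_sets) auto
  from filtration_trace[OF this, of n]
  have "\<exists>D. D \<in> sets path_borel \<and> (\<forall>\<omega>\<in>space (pspace S).
     arrival S n \<omega> \<le> q \<and> q < arrival S (Suc n) \<omega> \<longrightarrow>
     (T k \<omega> \<le> ereal q \<and> J k \<omega> = v \<longleftrightarrow> past n (demand_path S \<omega>) \<in> D))" by auto
  from someI_ex[OF this]
  have *: "event n k v q \<in> sets path_borel \<and> (\<forall>\<omega>\<in>space (pspace S).
     arrival S n \<omega> \<le> q \<and> q < arrival S (Suc n) \<omega> \<longrightarrow>
     (T k \<omega> \<le> ereal q \<and> J k \<omega> = v \<longleftrightarrow> past n (demand_path S \<omega>) \<in> event n k v q))"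
    unfolding event_def .
  show "event n k v q \<in> sets path_borel" using * by blast
  show "\<omega> \<in> space (pspace S) \<Longrightarrow> arrival S n \<omega> \<le> q \<Longrightarrow> q < arrival S (Suc n) \<omega> \<Longrightarrow>
     past n (demand_path S \<omega>) \<in> event n k v q \<longleftrightarrow> T k \<omega> \<le> ereal q \<and> J k \<omega> = v"
    using * by blast
qed

text \<open>A candidate for \<open>T k\<close>, in case it leads to phase \<open>v\<close>: the
  infimum of the rational times from arrival \<open>n\<close> on at which the first \<open>n\<close>
  inter-arrival times and demands show this switch. Unlike \<open>T k\<close>, it is a function on
  all of path space.\<close>

definition first_time :: "nat \<Rightarrow> nat \<Rightarrow> nat \<Rightarrow> (nat \<Rightarrow> real) \<times> (nat \<Rightarrow> real) \<Rightarrow> ereal" where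
  "first_time n k v z = (INF q\<in>\<rat>. if 0 \<le> q \<and> (\<Sum>m<n. fst z m) \<le> q \<and> past n z \<in> event n k v q then ereal q else \<infinity>)"

lemma first_time_measurable [measurable]: "first_time n k v \<in> borel_measurable path_borel"
  unfolding first_time_def[abs_def]
proof (rule borel_measurable_INF)
  show "countable (\<rat> :: real set)" by (rule countable_rat)
  fix q :: real
  show "(\<lambda>z. if 0 \<le> q \<and> (\<Sum>m<n. fst z m) \<le> q \<and> past n z \<in> event n k v q then ereal q else \<infinity>) \<in> borel_measurable path_borel"
  proof (cases "0 \<le> q")
    case True
    note [measurable] = event(1)[OF True, of n k v] past_measurable[of n]
    show ?thesis by measurable
  qed simp
qed

text \<open>Only comparisons with times between arrival \<open>n\<close> and the next can be
  recovered. A switch by time \<open>t\<close> shows at all rational times shortly after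
  \<open>t\<close>. Conversely, a rational time before the next arrival shows the switch only if it
  has happened, and later rational times exceed \<open>t\<close> by a fixed amount.\<close>

lemma first_time_le_iff:
  assumes \<omega>: "\<omega> \<in> space (pspace S)" and t: "arrival S n \<omega> \<le> t" "t < arrival S (Suc n) \<omega>"
  shows "first_time n k v (demand_path S \<omega>) \<le> ereal t \<longleftrightarrow> T k \<omega> \<le> ereal t \<and> J k \<omega> = v"
proof -
  let ?z = "demand_path S \<omega>"
  let ?g = "\<lambda>q. if 0 \<le> q \<and> (\<Sum>m<n. fst ?z m) \<le> q \<and> past n ?z \<in> event n k v q then ereal q else \<infinity>"
  note ap = arrival_path_model[OF \<omega>]
  have arr: "(\<Sum>m<n. fst ?z m) = arrival S n \<omega>" using canonical_arrival_demand(1)[OF \<omega>, of n] by simp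
  have n0: "0 \<le> arrival S n \<omega>" by (rule arrival_nonneg[OF ap])
  show ?thesis
  proof
    assume Tk: "T k \<omega> \<le> ereal t \<and> J k \<omega> = v"
    show "first_time n k v ?z \<le> ereal t"
    proof (rule ccontr)
      assume "\<not> ?thesis"
      then have less: "ereal t < first_time n k v ?z" by simp
      obtain c where c: "t < c" "ereal c \<le> first_time n k v ?z"
        using less by (cases "first_time n k v ?z") (auto intro: that[of "t + 1"])
      have "t < min c (arrival S (Suc n) \<omega>)" using c t by simp
      then obtain q where q: "q \<in> \<rat>" "t < q" "q < min c (arrival S (Suc n) \<omega>)" using Rats_dense_in_real by blast
      have "T k \<omega> \<le> ereal q" using Tk q(2) by (meson ereal_less_eq(3) less_imp_le order_trans)
      then have "past n ?z \<in> event n k v q"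
        using event(2)[of q \<omega> n k v] \<omega> q t n0 Tk by simp
      then have "?g q = ereal q" using arr q t n0 by simp
      moreover have "first_time n k v ?z \<le> ?g q" unfolding first_time_def using q(1) by (rule INF_lower)
      ultimately have "first_time n k v ?z \<le> ereal q" by simp
      also have "\<dots> < ereal c" using q by simp
      finally show False using c(2) by simp
    qed
  next
    assume le: "first_time n k v ?z \<le> ereal t"
    show "T k \<omega> \<le> ereal t \<and> J k \<omega> = v"
    proof (rule ccontr)
      assume no: "\<not> ?thesis"
      define m where "m = (if J k \<omega> = v then min (T k \<omega>) (ereal (arrival S (Suc n) \<omega>)) else ereal (arrival S (Suc n) \<omega>))"
      have "m \<le> first_time n k v ?z"
        unfolding first_time_def
      proof (rule INF_greatest)
        fix q :: real
        show "m \<le> ?g q"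
        proof (cases "0 \<le> q \<and> (\<Sum>m<n. fst ?z m) \<le> q \<and> past n ?z \<in> event n k v q")
          case True
          then have q: "0 \<le> q" "arrival S n \<omega> \<le> q" "past n ?z \<in> event n k v q" using arr by auto
          have "m \<le> ereal q"
          proof (cases "q < arrival S (Suc n) \<omega>")
            case True
            then show ?thesis using event(2)[of q \<omega> n k v] \<omega> q by (simp add: m_def min_le_iff_disj)
          qed (simp add: m_def min_le_iff_disj)
          then show ?thesis using True by simp
        next
          case False
          then have "?g q = \<infinity>" by (rule if_not_P)
          then show ?thesis by simp
        qed
      qed
      moreover have "ereal t < m" using no t by (auto simp: m_def not_le)
      ultimately show False using le by (meson leD order_less_le_trans)
    qed
  qed
qed

definition switch_time :: "nat \<Rightarrow> nat \<Rightarrow> (nat \<Rightarrow> real) \<times> (nat \<Rightarrow> real) \<Rightarrow> ereal" where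
  "switch_time n k z = min (first_time n k 0 z) (min (first_time n k 1 z) (first_time n k 2 z))"

text \<open>If the switch has occurred by the time considered, only the candidate for the true phase
  is that early, so it alone realises the minimum.\<close>

definition switch_phase :: "nat \<Rightarrow> nat \<Rightarrow> (nat \<Rightarrow> real) \<times> (nat \<Rightarrow> real) \<Rightarrow> nat" where
  "switch_phase n k z = (if k = 0 then i else if first_time n k 0 z = switch_time n k z then 0
     else if first_time n k 1 z = switch_time n k z then 1 else 2)"

lemma switch_time_measurable [measurable]: "switch_time n k \<in> borel_measurable path_borel"
  unfolding switch_time_def[abs_def] by measurable

lemma switch_phase_measurable [measurable]: "switch_phase n k \<in> path_borel \<rightarrow>\<^sub>M count_space UNIV"
  unfolding switch_phase_def[abs_def] by measurable

lemma switch_phase_range: "switch_phase n k z \<in> {0,1,2}"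
  using i by (auto simp: switch_phase_def)

lemma switch_time_le_iff:
  assumes \<omega>: "\<omega> \<in> space (pspace S)" and t: "arrival S n \<omega> \<le> t" "t < arrival S (Suc n) \<omega>"
  shows "switch_time n k (demand_path S \<omega>) \<le> ereal t \<longleftrightarrow> T k \<omega> \<le> ereal t"
  unfolding switch_time_def min_le_iff_disj first_time_le_iff[OF assms]
  using switching_path_phases[OF swS[OF \<omega>], of k] by auto

lemma switch_phase_eq:
  assumes \<omega>: "\<omega> \<in> space (pspace S)" and t: "arrival S n \<omega> \<le> t" "t < arrival S (Suc n) \<omega>"
    and k: "T k \<omega> \<le> ereal t"
  shows "switch_phase n k (demand_path S \<omega>) = J k \<omega>"
proof (cases "k = 0")
  case True
  then show ?thesis using switching_path_0(2)[OF swS[OF \<omega>]] by (simp add: switch_phase_def)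
next
  case False
  let ?f = "\<lambda>v. first_time n k v (demand_path S \<omega>)"
  note iff = first_time_le_iff[OF \<omega> t, of k]
  have st: "switch_time n k (demand_path S \<omega>) \<le> ereal t" using switch_time_le_iff[OF \<omega> t] k by simp
  have ne: "?f v \<noteq> switch_time n k (demand_path S \<omega>)" if "J k \<omega> \<noteq> v" for v
    using iff[of v] that st by auto
  have st_in: "switch_time n k (demand_path S \<omega>) = ?f 0 \<or> switch_time n k (demand_path S \<omega>) = ?f 1
      \<or> switch_time n k (demand_path S \<omega>) = ?f 2" by (simp add: switch_time_def min_def)
  consider "J k \<omega> = 0" | "J k \<omega> = 1" | "J k \<omega> = 2"
    using switching_path_phases[OF swS[OF \<omega>], of k] by auto
  then show ?thesis
  proof cases
    case 1
    then have "?f 0 = switch_time n k (demand_path S \<omega>)" using st_in ne[of 1] ne[of 2] by simp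
    then show ?thesis using 1 False by (simp add: switch_phase_def)
  next
    case 2
    then have "?f 0 \<noteq> switch_time n k (demand_path S \<omega>)" "?f 1 = switch_time n k (demand_path S \<omega>)"
      using st_in ne[of 0] ne[of 2] by simp_all
    then show ?thesis using 2 False by (simp add: switch_phase_def)
  next
    case 3
    then have "?f 0 \<noteq> switch_time n k (demand_path S \<omega>)" "?f 1 \<noteq> switch_time n k (demand_path S \<omega>)"
      using ne[of 0] ne[of 1] by simp_all
    then show ?thesis using 3 False by (simp add: switch_phase_def)
  qed
qed

definition regular :: "nat \<Rightarrow> (nat \<Rightarrow> real) \<times> (nat \<Rightarrow> real) \<Rightarrow> bool" where
  "regular n z \<longleftrightarrow> (\<forall>N::nat. \<exists>k. ereal (real N) < switch_time n (Suc k) z)"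

text \<open>
  Outside the image of \<open>demand_path S\<close> the recovered switching times can accumulate; the constant
  phase 1 is used there. These paths have measure zero, since the recovered times do not depend on
  the next inter-arrival time, which exceeds any bound with positive probability.
\<close>

definition piece :: "nat \<Rightarrow> (nat \<Rightarrow> real) \<times> (nat \<Rightarrow> real) \<Rightarrow> real \<Rightarrow> nat" where
  "piece n z t = (if regular n z then switch_phase n (LEAST k. ereal t < switch_time n (Suc k) z) z else 1)"

definition path_phase :: "(nat \<Rightarrow> real) \<times> (nat \<Rightarrow> real) \<Rightarrow> real \<Rightarrow> nat" where
  "path_phase z t = piece (demand_count C t z) z t"

lemma regular_cong:
  assumes "\<And>m. m < n \<Longrightarrow> fst z m = fst z' m \<and> snd z m = snd z' m"
  shows "switch_time n k z = switch_time n k z'" "switch_phase n k z = switch_phase n k z'" "piece n z = piece n z'"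
proof -
  have s: "(\<Sum>m<n. fst z m) = (\<Sum>m<n. fst z' m)" using assms by (intro sum.cong) auto
  have p: "past n z = past n z'" by (rule past_cong) (rule assms)
  have "first_time n k v z = first_time n k v z'" for k v
    unfolding first_time_def s p ..
  then show st: "switch_time n k z = switch_time n k z'" for k by (simp add: switch_time_def)
  show sp: "switch_phase n k z = switch_phase n k z'" for k
    using st \<open>\<And>k v. first_time n k v z = first_time n k v z'\<close> by (simp add: switch_phase_def)
  show "piece n z = piece n z'" by (rule ext) (simp only: piece_def regular_def st sp)
qed

lemma cadlag_piece: "cadlag_step (piece n z)"
proof (cases "regular n z")
  case True
  have "\<exists>k. ereal t < switch_time n (Suc k) z" for t
  proof -
    obtain N :: nat where "t \<le> real N" using real_arch_simple by blast
    moreover obtain k where "ereal (real N) < switch_time n (Suc k) z" using True unfolding regular_def by blast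
    ultimately show ?thesis by (intro exI[of _ k]) (metis ereal_less_eq(3) order_le_less_trans)
  qed
  from cadlag_step_Least[of "\<lambda>k. switch_time n (Suc k) z" "\<lambda>k. switch_phase n k z", OF this]
  show ?thesis using True by (simp add: piece_def[abs_def])
next
  case False
  then have "piece n z = (\<lambda>_. 1)" by (simp add: fun_eq_iff piece_def)
  then show ?thesis by (auto simp: cadlag_step_def intro: zero_less_one)
qed

lemma cadlag_path_phase: "z \<in> good_paths \<Longrightarrow> cadlag_step (path_phase z)"
  unfolding path_phase_def[abs_def] by (rule cadlag_step_piecewise[OF arrival_path_C cadlag_piece])

lemma path_phase_range: "path_phase z t \<in> {0,1,2}"
  using switch_phase_range by (simp add: path_phase_def piece_def)

text \<open>Galmarino's test applies: paths that agree up to \<open>t\<close> have the same number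
  of arrivals by then and the same \<open>piece\<close>.\<close>

lemma path_phase_adapted:
  assumes t: "0 \<le> t" shows "(\<lambda>z. path_phase z t) \<in> demand_filtration C t \<rightarrow>\<^sub>M count_space UNIV"
proof (rule galmarino[OF _ t])
  have "(\<lambda>z. piece n z t) \<in> path_borel \<rightarrow>\<^sub>M count_space UNIV" for n
  proof -
    have [measurable]: "Measurable.pred path_borel (regular n)" unfolding regular_def by measurable
    have "(\<lambda>z. LEAST k. ereal t < switch_time n (Suc k) z) \<in> path_borel \<rightarrow>\<^sub>M count_space UNIV"
      by measurable
    from measurable_compose_countable[OF switch_phase_measurable this]
    have [measurable]: "(\<lambda>z. switch_phase n (LEAST k. ereal t < switch_time n (Suc k) z) z) \<in> path_borel \<rightarrow>\<^sub>M count_space UNIV" .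
    show ?thesis unfolding piece_def[abs_def] by measurable
  qed
  then have p: "(\<lambda>z. piece n z t) \<in> pspace C \<rightarrow>\<^sub>M count_space UNIV" for n
    by (simp add: measurable_restrict_space1 measurable_cong_sets[OF sets_path_measure refl])
  have dc: "demand_count C t \<in> pspace C \<rightarrow>\<^sub>M count_space UNIV"
  proof (rule demand_filtration_C_measurable)
    show "demand_count C t \<in> demand_filtration C t \<rightarrow>\<^sub>M count_space UNIV"
    proof (subst measurable_count_space_eq_countable, simp, intro conjI ballI Pi_I UNIV_I)
      fix n
      have "demand_count C t -` {n} \<inter> space (demand_filtration C t) =
          {z\<in>good_paths. ereal (arrival C n z) \<le> ereal t} - {z\<in>good_paths. ereal (arrival C (Suc n) z) \<le> ereal t}"
        (is "?L = ?R")
      proof (intro set_eqI)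
        fix z
        show "z \<in> ?L \<longleftrightarrow> z \<in> ?R"
        proof (cases "z \<in> good_paths")
          case True
          show ?thesis
            using demand_count_bounds[OF arrival_path_C[OF True] t] demand_count_eq[OF arrival_path_C[OF True], of n t] True
            unfolding space_demand_filtration space_C
            by (auto simp del: canonical_simps)
        qed (simp add: space_demand_filtration space_C del: canonical_simps)
      qed
      also have "\<dots> \<in> sets (demand_filtration C t)"
        using arrivals.jump_time_sets[OF t] by (intro sets.Diff)
      finally show "demand_count C t -` {n} \<inter> space (demand_filtration C t) \<in> sets (demand_filtration C t)" .
    qed
  qed
  from measurable_compose_countable[OF p this]
  show "(\<lambda>z. path_phase z t) \<in> pspace C \<rightarrow>\<^sub>M count_space UNIV" by (simp only: path_phase_def)
next
  fix z z' assume z: "z \<in> good_paths" "z' \<in> good_paths" and same: "same_upto t z z'"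
  obtain n where n0: "\<forall>m<n. fst z m = fst z' m \<and> snd z m = snd z' m" "(\<Sum>m<n. fst z m) \<le> t"
    "t < (\<Sum>m<Suc n. fst z m)" "t < (\<Sum>m<Suc n. fst z' m)"
    using same unfolding same_upto_def by blast
  have "demand_count C t z = n"
    by (rule demand_count_eq[OF arrival_path_C[OF z(1)]]) (unfold canonical_simps, rule n0(2), rule n0(3))
  moreover have "(\<Sum>m<n. fst z' m) = (\<Sum>m<n. fst z m)" using n0(1) by (intro sum.cong) auto
  then have "demand_count C t z' = n"
    using n0(2,4) by (intro demand_count_eq[OF arrival_path_C[OF z(2)]]) (unfold canonical_simps, simp_all)
  ultimately show "path_phase z t = path_phase z' t"
    unfolding path_phase_def using regular_cong(3)[of n z z'] n0(1) by simp
qed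

lemma path_phase_eq:
  assumes \<omega>: "\<omega> \<in> space (pspace S)" and reg: "\<And>n. regular n (demand_path S \<omega>)" and t: "0 \<le> t"
  shows "path_phase (demand_path S \<omega>) t = phase T J t \<omega>"
proof -
  let ?z = "demand_path S \<omega>"
  obtain n where n: "arrival S n \<omega> \<le> t" "t < arrival S (Suc n) \<omega>"
    using arrival_interval[OF arrival_path_model[OF \<omega>] t] by blast
  obtain K where K: "T K \<omega> \<le> ereal t" "ereal t < T (Suc K) \<omega>"
    using switching_path_interval[OF swS[OF \<omega>] t] by blast
  have dc: "demand_count C t ?z = n"
    using n by (intro demand_count_eq[OF arrival_path_C[OF demand_path_good[OF \<omega>]]]) (simp_all only: canonical_arrival_demand(1)[OF \<omega>])
  have less: "ereal t < switch_time n (Suc k) ?z \<longleftrightarrow> ereal t < T (Suc k) \<omega>" for k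
    using switch_time_le_iff[OF \<omega> n, of "Suc k"] by (simp add: not_le[symmetric])
  have "(LEAST k. ereal t < switch_time n (Suc k) ?z) = K"
    unfolding less
  proof (rule Least_equality)
    fix k assume k: "ereal t < T (Suc k) \<omega>"
    show "K \<le> k"
    proof (rule ccontr)
      assume "\<not> K \<le> k"
      then have "T (Suc k) \<omega> \<le> T K \<omega>" by (intro switching_path_mono[OF swS[OF \<omega>]]) simp
      then show False using k K(1) by order
    qed
  qed (rule K(2))
  then show ?thesis
    unfolding path_phase_def dc piece_def using reg[of n] switch_phase_eq[OF \<omega> n K(1)] phase_eq[OF swS[OF \<omega>] K] by simp
qed

lemma regular_AE: "AE \<omega> in pspace S. \<forall>n. regular n (demand_path S \<omega>)"
proof -
  have "AE \<omega> in pspace S. \<exists>k. ereal (real N) < switch_time n (Suc k) (demand_path S \<omega>)" for n N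
  proof -
    define B where "B = {z\<in>space path_borel. \<forall>k. switch_time n (Suc k) z \<le> ereal (real N)}"
    have B: "B \<in> sets path_borel" unfolding B_def by measurable
    define E where "E = {z\<in>space path_borel. real N < fst z n}"
    have E: "E \<in> sets path_borel" unfolding E_def by measurable
    \<comment> \<open>If the recovered times stay below \<open>N\<close> while the next
      inter-arrival time exceeds \<open>N\<close>, some time at or after \<open>N\<close> lies
      between arrival \<open>n\<close> and the next. Comparisons with that time are faithful, so all
      true switching times would lie before it, although they are unbounded.\<close>
    have no: "demand_path S \<omega> \<notin> B \<inter> E" if \<omega>: "\<omega> \<in> space (pspace S)" for \<omega>
    proof
      assume BE: "demand_path S \<omega> \<in> B \<inter> E"
      define t where "t = max (real N) (arrival S n \<omega>)"
      have "real N < arrival S (Suc n) \<omega> - arrival S n \<omega>" using BE by (simp add: E_def demand_path_def)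
      then have t: "arrival S n \<omega> \<le> t" "t < arrival S (Suc n) \<omega>"
        using arrival_nonneg[OF arrival_path_model[OF \<omega>], of n] arrival_less_iff[OF arrival_path_model[OF \<omega>], of n "Suc n"]
        by (auto simp: t_def)
      obtain k where k: "ereal t < T k \<omega>" using switching_path_unbounded[OF swS[OF \<omega>]] by blast
      have "0 \<le> t" by (simp add: t_def)
      then have "k \<noteq> 0" using k switching_path_0(1)[OF swS[OF \<omega>]] by (cases k) (auto simp: zero_ereal_def)
      then obtain j where j: "k = Suc j" by (cases k) auto
      have "\<not> switch_time n k (demand_path S \<omega>) \<le> ereal t" using switch_time_le_iff[OF \<omega> t, of k] k by simp
      moreover have "switch_time n k (demand_path S \<omega>) \<le> ereal (real N)" using BE j by (simp add: B_def)
      moreover have "ereal (real N) \<le> ereal t" by (simp add: t_def)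
      ultimately show False by (meson order_trans)
    qed
    have "emeasure (path_measure S) (B \<inter> E) = emeasure (distr (pspace S) path_borel (demand_path S)) (B \<inter> E)"
      by (simp only: demand_path_distr)
    also have "\<dots> = emeasure (pspace S) (demand_path S -` (B \<inter> E) \<inter> space (pspace S))"
      using B E demand_path_measurable by (intro emeasure_distr) auto
    also have "demand_path S -` (B \<inter> E) \<inter> space (pspace S) = {}" using no by blast
    finally have 0: "emeasure (path_measure S) (B \<inter> E) = 0" by simp
    \<comment> \<open>\<open>B\<close> ignores coordinate \<open>n\<close>, so resampling it
      factorises the probability of \<open>B \<inter> E\<close>; the factor that belongs to
      \<open>E\<close> is positive.\<close>
    have inv: "((fst z)(n := v), snd z) \<in> B \<longleftrightarrow> z \<in> B" for z v
      unfolding B_def using regular_cong(1)[of n "((fst z)(n := v), snd z)" z] by simp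
    have "0 = (\<integral>\<^sup>+z. indicator (B \<inter> E) z \<partial>path_measure S)"
      using 0 B E by simp
    also have "\<dots> = (\<integral>\<^sup>+v. \<integral>\<^sup>+z. indicator (B \<inter> E) ((fst z)(n := v), snd z) \<partial>path_measure S \<partial>WW)"
      using B E by (intro resample_law) simp
    also have "\<dots> = (\<integral>\<^sup>+v. emeasure (path_measure S) B * indicator {real N<..} v \<partial>WW)"
    proof (intro nn_integral_cong)
      fix v :: real
      have "(\<integral>\<^sup>+z. indicator (B \<inter> E) ((fst z)(n := v), snd z) \<partial>path_measure S) =
          (\<integral>\<^sup>+z. indicator B z * indicator {real N<..} v \<partial>path_measure S)"
        using inv by (intro nn_integral_cong) (auto simp: indicator_def E_def)
      also have "\<dots> = emeasure (path_measure S) B * indicator {real N<..} v"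
        using B by (simp add: nn_integral_multc)
      finally show "(\<integral>\<^sup>+z. indicator (B \<inter> E) ((fst z)(n := v), snd z) \<partial>path_measure S) = emeasure (path_measure S) B * indicator {real N<..} v" .
    qed
    also have "\<dots> = emeasure (path_measure S) B * (\<integral>\<^sup>+v. indicator {real N<..} v \<partial>WW)"
      by (rule nn_integral_cmult) simp
    finally have prod: "emeasure (path_measure S) B * (\<integral>\<^sup>+v. indicator {real N<..} v \<partial>WW) = 0" by simp
    then have "emeasure (path_measure S) B = 0"
      unfolding exponential_tail[OF of_nat_0_le_iff] by simp
    then have "AE z in path_measure S. z \<notin> B" using B by (intro AE_not_in) (simp add: null_sets_def)
    then have "AE z in distr (pspace S) path_borel (demand_path S). z \<notin> B" by (simp only: demand_path_distr)
    from AE_distrD[OF demand_path_measurable this] show ?thesis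
      by eventually_elim (auto simp: B_def not_le)
  qed
  then show ?thesis unfolding regular_def by (simp add: AE_all_countable)
qed

end

context inventory_system begin

text \<open>The phase process is read off along the demand path and decomposed again into switching
  times and phases by \<open>jumps\<close>. Almost surely it is the original one, which is enough
  for rules and cost.\<close>

lemma canonical_version:
  assumes adm: "admissible S x i T J" and x: "lmin S \<le> x" "x \<le> cap S" and i: "i \<in> {0,1,2}"
    and i0: "i = 0 \<longrightarrow> x = cap S"
  shows "\<exists>T' J'. admissible C x i T' J' \<and> cost C x T' J' = cost S x T J"
proof -
  interpret strategy_on_space S i T J
    using adm i by unfold_locales (auto simp: admissible_iff)
  define T' where "T' = (\<lambda>k z. fst (jumps i (path_phase z) k))"
  define J' where "J' = (\<lambda>k z. snd (jumps i (path_phase z) k))"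
  have sw': "switching_path i T' J' z" if z: "z \<in> good_paths" for z
    using switching_path_jumps(1)[OF cadlag_path_phase[OF z] path_phase_range i, of z]
    unfolding switching_path_def T'_def J'_def .
  have ph': "phase T' J' t z = path_phase z t" if z: "z \<in> good_paths" and t: "0 \<le> t" for z t
    using switching_path_jumps(2)[OF cadlag_path_phase[OF z] path_phase_range i t, of z]
    unfolding phase_def T'_def J'_def .
  have switching': "switching_strategy C i T' J'"
    using sw' space_C by (simp add: switching_strategy_iff del: canonical_simps)
  have adapted': "phase T' J' t \<in> demand_filtration C t \<rightarrow>\<^sub>M count_space UNIV" if t: "0 \<le> t" for t
    using path_phase_adapted[OF t]
  proof (rule measurable_cong[THEN iffD1, rotated])
    fix z assume "z \<in> space (demand_filtration C t)"
    then have "z \<in> good_paths" by (simp only: space_demand_filtration space_C)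
    then show "path_phase z t = phase T' J' t z" using ph' t by simp
  qed
  have cs: "canonical_strategy S i T' J'"
    using switching' adapted' demand_filtration_C_measurable by unfold_locales blast+
  interpret C: canonical_strategy S i T' J' by (rule cs)
  have ph: "AE \<omega> in pspace S. \<forall>t\<ge>0. phase T' J' t (demand_path S \<omega>) = phase T J t \<omega>"
    using regular_AE AE_space
    by eventually_elim (use ph'[OF demand_path_good] path_phase_eq in simp)
  have ru: "AE \<omega> in pspace S. operating_rules S x T J \<omega>" using adm by (simp add: admissible_iff)
  have "AE \<omega> in pspace S. operating_rules C x T' J' (demand_path S \<omega>)"
    using ru ph AE_space
  proof eventually_elim
    case (elim \<omega>)
    then show ?case
      using transfer_rules[OF elim(3) swS[OF elim(3)] sw'[OF demand_path_good[OF elim(3)]] _ x i0] by simp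
  qed
  then have "AE z in pspace C. operating_rules C x T' J' z"
    by (rule AE_canonical[OF C.operating_rules_sets[OF x i0]])
  then have "admissible C x i T' J'" using switching' adapted' by (simp add: admissible_iff)
  moreover have "cost S x T J = cost C x T' J'" by (rule transfer_cost[OF cs switching ph x i0 ru])
  ultimately show ?thesis by auto
qed

end

section \<open>Integration of the viscosity inequality\<close>

text \<open>Building block of a continuously differentiable bump function.\<close>

lemma DERIV_square_max: "((\<lambda>s::real. (max 0 s)\<^sup>2) has_real_derivative 2 * max 0 s) (at s)"
proof -
  consider "0 < s" | "s < 0" | "s = 0" by linarith
  then show ?thesis
  proof cases
    case 1
    have "((\<lambda>s::real. s\<^sup>2) has_real_derivative 2 * s) (at s)" by (auto intro!: derivative_eq_intros)
    then have "((\<lambda>s::real. (max 0 s)\<^sup>2) has_real_derivative 2 * s) (at s)"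
      by (rule has_field_derivative_transform_within[where d=s]) (use 1 in \<open>auto simp: dist_real_def\<close>)
    then show ?thesis using 1 by simp
  next
    case 2
    have "((\<lambda>s::real. 0) has_real_derivative 0) (at s)" by simp
    then have "((\<lambda>s::real. (max 0 s)\<^sup>2) has_real_derivative 0) (at s)"
      by (rule has_field_derivative_transform_within[where d="-s"]) (use 2 in \<open>auto simp: dist_real_def\<close>)
    then show ?thesis using 2 by simp
  next
    case 3
    have "(\<lambda>h::real. ((max 0 (0 + h))\<^sup>2 - (max 0 0)\<^sup>2) / h) \<midarrow>0\<rightarrow> 0"
    proof (rule Lim_null_comparison)
      show "\<forall>\<^sub>F h in at 0. norm (((max 0 (0 + h))\<^sup>2 - (max 0 0)\<^sup>2) / h) \<le> \<bar>h::real\<bar>"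
        by (intro always_eventually allI) (auto simp: max_def power2_eq_square)
      show "(\<lambda>h::real. \<bar>h\<bar>) \<midarrow>0\<rightarrow> 0" by (rule tendsto_rabs_zero) (rule tendsto_ident_at)
    qed
    then show ?thesis using 3 by (simp add: DERIV_def)
  qed
qed

text \<open>The operator is nonlocal, so a test function has to be controlled on the whole interval,
  whereas the touching function comes from a local argument. A bump function glues it to a
  polynomial that approximates \<open>u\<close> from above, so that the integral term changes as
  little as desired.\<close>

lemma C1_touching_extension:
  fixes u \<phi> \<phi>' :: "real \<Rightarrow> real"
  assumes u: "continuous_on {l..b} u" and sub: "{c<..<d} \<subseteq> {l..b}" and x: "x \<in> {c<..<d}"
    and der: "\<And>y. y \<in> {c<..<d} \<Longrightarrow> (\<phi> has_real_derivative \<phi>' y) (at y)"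
    and cont: "continuous_on {c<..<d} \<phi>'" and above: "\<And>y. y \<in> {c<..<d} \<Longrightarrow> u y \<le> \<phi> y"
    and touch: "\<phi> x = u x" and e: "0 < e"
  obtains f f' where "\<And>y. (f has_real_derivative f' y) (at y)" "\<And>y. isCont f' y" "f x = u x" "f' x = \<phi>' x"
    "\<And>y. y \<in> {l..b} \<Longrightarrow> u y \<le> f y \<and> f y \<le> u y + e"
proof -
  obtain p where p: "real_polynomial_function p" and pe: "\<And>y. y \<in> {l..b} \<Longrightarrow> \<bar>u y - p y\<bar> < e / 2"
    using Stone_Weierstrass_real_polynomial_function[OF compact_Icc u, of "e/2"] e by auto
  \<comment> \<open>Raised by \<open>e / 2\<close>, the polynomial lies above \<open>u\<close> and
    at most \<open>e\<close> higher.\<close>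
  define g where "g y = p y + e / 2" for y
  have g: "u y \<le> g y \<and> g y \<le> u y + e" if "y \<in> {l..b}" for y using pe[OF that] by (simp add: g_def abs_real_def split: if_splits)
  obtain g' where g': "real_polynomial_function g'" "\<And>y. (p has_real_derivative g' y) (at y)"
    using has_real_derivative_polynomial_function[OF p] by blast
  have gder: "(g has_real_derivative g' y) (at y)" for y unfolding g_def[abs_def] using g'(2) by (auto intro!: derivative_eq_intros)
  have gcont: "isCont g' y" for y using continuous_real_polymonial_function[OF g'(1)] .
  have \<phi>cont: "continuous_on {c<..<d} \<phi>" using der by (intro continuous_at_imp_continuous_on ballI DERIV_isCont) blast
  have ucont: "continuous_on {c<..<d} u" using u sub by (rule continuous_on_subset)
  have "continuous_on {c<..<d} (\<lambda>y. \<phi> y - u y)" using \<phi>cont ucont by (rule continuous_on_diff)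
  then have "isCont (\<lambda>y. \<phi> y - u y) x" using x by (simp add: continuous_on_eq_continuous_at)
  then have "((\<lambda>y. \<phi> y - u y) \<longlongrightarrow> 0) (at x)" using touch by (simp add: isCont_def)
  then have "\<forall>\<^sub>F y in at x. \<phi> y - u y < e" using e by (rule order_tendstoD)
  then obtain \<delta> where \<delta>: "\<delta> > 0" "\<And>y. y \<noteq> x \<Longrightarrow> dist y x < \<delta> \<Longrightarrow> \<phi> y - u y < e"
    unfolding eventually_at by auto
  \<comment> \<open>The bump lives within distance \<open>r\<close> of \<open>x\<close>, while
    \<open>\<phi>\<close> is available and close to \<open>u\<close> up to distance
    \<open>2 * r\<close>; the overlap makes the glued function differentiable everywhere.\<close>
  define r where "r = min \<delta> (min (x - c) (d - x)) / 2"
  have r: "r > 0" using \<delta> x by (auto simp: r_def)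
  have near: "y \<in> {c<..<d}" "\<phi> y \<le> u y + e" if "\<bar>y - x\<bar> < 2 * r" for y
  proof -
    show "y \<in> {c<..<d}" using that by (auto simp: r_def abs_real_def split: if_splits)
    show "\<phi> y \<le> u y + e"
      using that \<delta>(2)[of y] e touch by (cases "y = x") (auto simp: r_def dist_real_def)
  qed
  define \<beta> where "\<beta> y = (max 0 (1 - ((y - x) / r)\<^sup>2))\<^sup>2" for y
  define \<beta>' where "\<beta>' y = 2 * max 0 (1 - ((y - x) / r)\<^sup>2) * (- (2 * ((y - x) / r) * (1 / r)))" for y
  have \<beta>der: "(\<beta> has_real_derivative \<beta>' y) (at y)" for y
  proof -
    have "((\<lambda>y. 1 - ((y - x) / r)\<^sup>2) has_real_derivative - (2 * ((y - x) / r) * (1 / r))) (at y)"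
      using r by (auto intro!: derivative_eq_intros)
    from DERIV_chain2[OF DERIV_square_max this] show ?thesis unfolding \<beta>_def[abs_def] \<beta>'_def .
  qed
  have \<beta>cont': "isCont \<beta>' y" for y unfolding \<beta>'_def[abs_def] using r by (intro continuous_intros) auto
  have \<beta>0: "\<beta> y = 0" "\<beta>' y = 0" if "r < \<bar>y - x\<bar>" for y
  proof -
    have "1 \<le> \<bar>(y - x) / r\<bar>" using that r by (simp add: field_simps)
    then have "1\<^sup>2 \<le> \<bar>(y - x) / r\<bar>\<^sup>2" by (intro power_mono) auto
    then have "1 \<le> ((y - x) / r)\<^sup>2" by (simp only: power2_abs one_power2)
    then show "\<beta> y = 0" "\<beta>' y = 0" by (simp_all add: \<beta>_def \<beta>'_def)
  qed
  have \<beta>01: "0 \<le> \<beta> y" "\<beta> y \<le> 1" for y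
    by (auto simp: \<beta>_def max_def power_le_one_iff)
  define f where "f y = (1 - \<beta> y) * g y + \<beta> y * \<phi> y" for y
  define f' where "f' y = (1 - \<beta> y) * g' y - \<beta>' y * g y + (if \<bar>y - x\<bar> < 2 * r then \<beta>' y * \<phi> y + \<beta> y * \<phi>' y else 0)" for y
  have far: "\<forall>\<^sub>F z in nhds y. r < \<bar>z - x\<bar>" if "\<not> \<bar>y - x\<bar> < 2 * r" for y
  proof -
    have "open {z. r < \<bar>z - x\<bar>}" by (intro open_Collect_less continuous_intros)
    then show ?thesis using that r by (intro eventually_nhds[THEN iffD2] exI[of _ "{z. r < \<bar>z - x\<bar>}"]) auto
  qed
  have close: "\<forall>\<^sub>F z in nhds y. \<bar>z - x\<bar> < 2 * r" if "\<bar>y - x\<bar> < 2 * r" for y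
  proof -
    have "open {z. \<bar>z - x\<bar> < 2 * r}" by (intro open_Collect_less continuous_intros)
    then show ?thesis using that by (intro eventually_nhds[THEN iffD2] exI[of _ "{z. \<bar>z - x\<bar> < 2 * r}"]) auto
  qed
  show ?thesis
  proof (rule that[of f f'])
    fix y
    show "(f has_real_derivative f' y) (at y)"
    proof (cases "\<bar>y - x\<bar> < 2 * r")
      case True
      show ?thesis unfolding f_def[abs_def] f'_def using True
        by (auto intro!: derivative_eq_intros \<beta>der gder der[OF near(1)[OF True]])
    next
      case False
      have "\<forall>\<^sub>F z in nhds y. g z = f z" using far[OF False] by eventually_elim (simp add: f_def \<beta>0)
      moreover have "r < \<bar>y - x\<bar>" using False r by simp
      then have "f' y = g' y" using False by (simp add: f'_def \<beta>0)
      ultimately show ?thesis using DERIV_cong_ev[of y y g f "g' y" "f' y"] gder[of y] by simp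
    qed
    show "isCont f' y"
    proof (cases "\<bar>y - x\<bar> < 2 * r")
      case True
      have y: "y \<in> {c<..<d}" using near(1)[OF True] .
      have "\<forall>\<^sub>F z in nhds y. f' z = (1 - \<beta> z) * g' z - \<beta>' z * g z + (\<beta>' z * \<phi> z + \<beta> z * \<phi>' z)"
        using close[OF True] by eventually_elim (simp add: f'_def)
      moreover have "isCont (\<lambda>z. (1 - \<beta> z) * g' z - \<beta>' z * g z + (\<beta>' z * \<phi> z + \<beta> z * \<phi>' z)) y"
        using \<beta>cont' gcont DERIV_isCont[OF \<beta>der] DERIV_isCont[OF gder] DERIV_isCont[OF der[OF y]]
          continuous_on_eq_continuous_at[of "{c<..<d}" \<phi>'] cont y
        by (intro continuous_intros) auto
      ultimately show ?thesis by (simp add: isCont_cong)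
    next
      case False
      have "\<forall>\<^sub>F z in nhds y. f' z = g' z"
        using far[OF False]
      proof eventually_elim
        case (elim z)
        then show ?case by (simp add: f'_def \<beta>0)
      qed
      then show ?thesis using gcont[of y] by (simp add: isCont_cong)
    qed
  next
    show "f x = u x" by (simp add: f_def \<beta>_def touch)
    show "f' x = \<phi>' x" using r by (simp add: f'_def \<beta>_def \<beta>'_def)
  next
    fix y assume y: "y \<in> {l..b}"
    have gy: "u y \<le> g y" "g y \<le> u y + e" using g[OF y] by auto
    have "u y \<le> f y \<and> f y \<le> u y + e"
    proof (cases "r < \<bar>y - x\<bar>")
      case True then show ?thesis using gy by (simp add: f_def \<beta>0)
    next
      case False
      then have "\<bar>y - x\<bar> < 2 * r" using r by simp
      then have \<phi>y: "u y \<le> \<phi> y" "\<phi> y \<le> u y + e" using near above by auto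
      have "(1 - \<beta> y) * u y + \<beta> y * u y \<le> f y" unfolding f_def
        using gy \<phi>y \<beta>01[of y] by (intro add_mono mult_left_mono) auto
      moreover have "f y \<le> (1 - \<beta> y) * (u y + e) + \<beta> y * (u y + e)" unfolding f_def
        using gy \<phi>y \<beta>01[of y] by (intro add_mono mult_left_mono) auto
      ultimately show ?thesis by (simp add: algebra_simps)
    qed
    then show "u y \<le> f y \<and> f y \<le> u y + e" .
  qed
qed

text \<open>Upper Lipschitz regularisation: continuous majorants of \<open>g\<close> that keep its
  upper bound and converge to it wherever it is continuous. They let the viscosity argument, which
  works with a continuous right-hand side, reach discontinuous holding and penalty costs.\<close>

definition sup_convolution :: "real \<Rightarrow> real \<Rightarrow> (real \<Rightarrow> real) \<Rightarrow> nat \<Rightarrow> real \<Rightarrow> real" where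
  "sup_convolution c d g k y = (SUP z\<in>{c..d}. g z - real k * \<bar>y - z\<bar>)"

context
  fixes c d B :: real and g :: "real \<Rightarrow> real"
  assumes bnd: "\<And>y. y \<in> {c..d} \<Longrightarrow> 0 \<le> g y \<and> g y \<le> B"
begin

lemma sup_convolution_bdd: "bdd_above ((\<lambda>z. g z - real k * \<bar>y - z\<bar>) ` {c..d})"
proof (rule bdd_aboveI2)
  fix z assume "z \<in> {c..d}"
  then show "g z - real k * \<bar>y - z\<bar> \<le> B" using bnd[of z] by (smt (verit) mult_nonneg_nonneg of_nat_0_le_iff abs_ge_zero)
qed

lemma sup_convolution_ge: "y \<in> {c..d} \<Longrightarrow> g y \<le> sup_convolution c d g k y"
  unfolding sup_convolution_def using cSUP_upper[OF _ sup_convolution_bdd[of k y], of y] by simp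

lemma sup_convolution_le: "y \<in> {c..d} \<Longrightarrow> sup_convolution c d g k y \<le> B"
  unfolding sup_convolution_def
proof (rule cSUP_least)
  fix z assume "z \<in> {c..d}"
  then show "g z - real k * \<bar>y - z\<bar> \<le> B" using bnd[of z] by (smt (verit) mult_nonneg_nonneg of_nat_0_le_iff abs_ge_zero)
qed auto

lemma sup_convolution_continuous: "continuous_on {c..d} (sup_convolution c d g k)"
proof -
  have *: "sup_convolution c d g k y \<le> sup_convolution c d g k y' + real k * \<bar>y - y'\<bar>" if "y \<in> {c..d}" for y y'
    unfolding sup_convolution_def[of c d g k y]
  proof (rule cSUP_least)
    show "{c..d} \<noteq> {}" using that by auto
    fix z assume z: "z \<in> {c..d}"
    have "g z - real k * \<bar>y' - z\<bar> \<le> sup_convolution c d g k y'"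
      unfolding sup_convolution_def using z by (intro cSUP_upper sup_convolution_bdd)
    moreover have "real k * \<bar>y' - z\<bar> \<le> real k * (\<bar>y - y'\<bar> + \<bar>y - z\<bar>)" by (intro mult_left_mono) auto
    ultimately show "g z - real k * \<bar>y - z\<bar> \<le> sup_convolution c d g k y' + real k * \<bar>y - y'\<bar>"
      by (simp add: algebra_simps)
  qed
  have "(real k)-lipschitz_on {c..d} (sup_convolution c d g k)"
  proof (rule lipschitz_onI)
    fix y y' assume "y \<in> {c..d}" "y' \<in> {c..d}"
    then show "dist (sup_convolution c d g k y) (sup_convolution c d g k y') \<le> real k * dist y y'"
      using *[of y y'] *[of y' y] by (simp add: dist_real_def abs_minus_commute abs_le_iff)
  qed simp
  then show ?thesis by (rule lipschitz_on_continuous_on)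
qed

lemma sup_convolution_tendsto:
  assumes y: "y \<in> {c..d}" and cont: "continuous (at y within {c..d}) g"
  shows "(\<lambda>k. sup_convolution c d g k y) \<longlonglongrightarrow> g y"
proof (rule LIMSEQ_I)
  fix r :: real assume r: "0 < r"
  obtain \<delta> where \<delta>: "\<delta> > 0" "\<And>z. z \<in> {c..d} \<Longrightarrow> dist z y < \<delta> \<Longrightarrow> dist (g z) (g y) < r / 2"
    using cont r unfolding continuous_within_eps_delta by (metis half_gt_zero)
  \<comment> \<open>From this index on, the linear term at distance \<open>\<delta>\<close> or more
    outweighs the bound \<open>B\<close>, so only points near \<open>y\<close> compete.\<close>
  obtain N :: nat where N: "B / \<delta> \<le> real N" using real_arch_simple by blast
  show "\<exists>no. \<forall>k\<ge>no. norm (sup_convolution c d g k y - g y) < r"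
  proof (intro exI[of _ N] allI impI)
    fix k assume k: "N \<le> k"
    have "sup_convolution c d g k y \<le> g y + r / 2"
      unfolding sup_convolution_def
    proof (rule cSUP_least)
      show "{c..d} \<noteq> {}" using y by auto
      fix z assume z: "z \<in> {c..d}"
      show "g z - real k * \<bar>y - z\<bar> \<le> g y + r / 2"
      proof (cases "dist z y < \<delta>")
        case True
        have "0 \<le> real k * \<bar>y - z\<bar>" by simp
        moreover have "g z < g y + r / 2" using \<delta>(2)[OF z True] by (simp add: dist_real_def abs_real_def split: if_splits)
        ultimately show ?thesis by linarith
      next
        case False
        have "B \<le> real N * \<delta>" using N \<delta>(1) by (simp add: field_simps)
        also have "\<dots> \<le> real k * \<bar>y - z\<bar>"
          using k False \<delta>(1) by (intro mult_mono) (auto simp: dist_real_def)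
        finally show ?thesis using bnd[OF z] bnd[OF y] r by simp
      qed
    qed
    then show "norm (sup_convolution c d g k y - g y) < r"
      using sup_convolution_ge[OF y, of k] r by simp
  qed
qed

end

text \<open>
  If \<open>u\<close> dropped below the claimed bound, subtracting a multiple of \<open>1 / t\<close> would push a maximum
  into the interior, where the touching inequality fails.
\<close>

lemma touching_inequality_integrated:
  fixes u g :: "real \<Rightarrow> real" and a \<sigma> \<theta> x :: real
  assumes u: "continuous_on {l..b} u" and g: "continuous_on {l..b} g" and \<sigma>: "0 < \<sigma>"
    and touch: "\<And>c d y \<phi> \<phi>'. {c<..<d} \<subseteq> {l..b} \<Longrightarrow> y \<in> {c<..<d} \<Longrightarrow>
      (\<And>z. z \<in> {c<..<d} \<Longrightarrow> (\<phi> has_real_derivative \<phi>' z) (at z)) \<Longrightarrow> continuous_on {c<..<d} \<phi>' \<Longrightarrow>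
      (\<And>z. z \<in> {c<..<d} \<Longrightarrow> u z \<le> \<phi> z) \<Longrightarrow> \<phi> y = u y \<Longrightarrow> a * u y - g y \<le> \<sigma> * \<phi>' y"
    and x: "l \<le> x" "0 \<le> \<theta>" "x + \<sigma> * \<theta> \<le> b"
  shows "u x \<le> integral {0..\<theta>} (\<lambda>t. exp (- a * t) * g (x + \<sigma> * t)) + exp (- a * \<theta>) * u (x + \<sigma> * \<theta>)"
proof (rule ccontr)
  assume neg: "\<not> ?thesis"
  define k where "k t = exp (- a * t) * g (x + \<sigma> * t)" for t
  define \<Gamma> where "\<Gamma> t = integral {0..t} k" for t
  \<comment> \<open>The claim compares \<open>w 0\<close> with \<open>w \<theta>\<close>. If
    \<open>u\<close> were differentiable, the touching inequality would say that \<open>w\<close> is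
    nondecreasing.\<close>
  define w where "w t = exp (- a * t) * u (x + \<sigma> * t) + \<Gamma> t" for t
  have rng: "x + \<sigma> * t \<in> {l..b}" if "t \<in> {0..\<theta>}" for t
  proof -
    have "\<sigma> * t \<le> \<sigma> * \<theta>" "0 \<le> \<sigma> * t" using that \<sigma> by (auto intro: mult_left_mono)
    then show ?thesis using x by simp
  qed
  have kc: "continuous_on {0..\<theta>} k" unfolding k_def
    using rng by (intro continuous_intros continuous_on_compose2[OF g]) auto
  have \<Gamma>der: "(\<Gamma> has_real_derivative k t) (at t within {0..\<theta>})" if "t \<in> {0..\<theta>}" for t
    unfolding \<Gamma>_def using kc that by (rule integral_has_real_derivative)
  have \<Gamma>c: "continuous_on {0..\<theta>} \<Gamma>" using \<Gamma>der by (rule DERIV_continuous_on)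
  have wc: "continuous_on {0..\<theta>} w" unfolding w_def
    using rng \<Gamma>c by (intro continuous_intros continuous_on_compose2[OF u]) auto
  have w0: "w 0 = u x" by (simp add: w_def \<Gamma>_def)
  have less: "w \<theta> < w 0" using neg unfolding w0 w_def \<Gamma>_def k_def[abs_def] by simp
  then have \<theta>: "0 < \<theta>" using x(2) by (cases "\<theta> = 0") auto
  \<comment> \<open>Adding the slope \<open>\<delta>\<close> will make the final inequality strict;
    \<open>v\<close> still ends lower than it starts, by the amount \<open>\<gamma>\<close>.\<close>
  define \<delta> where "\<delta> = (w 0 - w \<theta>) / (2 * \<theta>)"
  define \<gamma> where "\<gamma> = (w 0 - w \<theta>) / 2"
  have \<delta>: "0 < \<delta>" and \<gamma>: "0 < \<gamma>" using less \<theta> by (auto simp: \<delta>_def \<gamma>_def)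
  define v where "v t = w t + \<delta> * t" for t
  have v\<theta>: "v \<theta> = v 0 - \<gamma>" using \<theta> by (simp add: v_def \<delta>_def \<gamma>_def field_simps)
  have vc: "continuous_on {0..\<theta>} v" unfolding v_def by (intro continuous_intros wc)
  obtain \<rho> where \<rho>: "\<rho> > 0" "\<And>t. t \<in> {0..\<theta>} \<Longrightarrow> dist t 0 < \<rho> \<Longrightarrow> dist (v t) (v 0) < \<gamma> / 2"
    using vc \<theta> \<gamma> unfolding continuous_on_iff by (metis atLeastAtMost_iff half_gt_zero order_refl less_imp_le)
  define \<eta> where "\<eta> = min \<rho> \<theta> / 2"
  have \<eta>: "0 < \<eta>" "\<eta> < \<theta>" "\<eta> < \<rho>" using \<rho> \<theta> by (auto simp: \<eta>_def)
  have v\<eta>: "v 0 - \<gamma> / 2 < v \<eta>" using \<rho>(2)[of \<eta>] \<eta> by (simp add: dist_real_def abs_real_def split: if_splits)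
  \<comment> \<open>At \<open>\<eta>\<close> the singular term amounts to
    \<open>\<gamma> / 4\<close>. There \<open>v\<close> has lost less than
    \<open>\<gamma> / 2\<close>, so \<open>F \<eta>\<close> still exceeds \<open>v \<theta>\<close>,
    which is \<open>v 0 - \<gamma>\<close>.\<close>
  define \<epsilon> where "\<epsilon> = \<eta> * \<gamma> / 4"
  have \<epsilon>: "0 < \<epsilon>" using \<eta> \<gamma> by (simp add: \<epsilon>_def)
  define F where "F t = v t - \<epsilon> / t" for t
  have F\<eta>: "v \<theta> < F \<eta>" using v\<eta> v\<theta> \<eta> \<gamma> by (simp add: F_def \<epsilon>_def)
  have F\<theta>: "F \<theta> < F \<eta>" using F\<eta> \<epsilon> \<theta> by (smt (verit) F_def divide_pos_pos)
  have "\<exists>m\<in>{0..\<theta>}. \<forall>t\<in>{0..\<theta>}. v t \<le> v m" using vc \<theta> by (intro continuous_attains_sup) auto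
  then obtain m where m: "\<And>t. t \<in> {0..\<theta>} \<Longrightarrow> v t \<le> v m" by blast
  \<comment> \<open>So close to 0 that the singular term outweighs the maximum of \<open>v\<close>.
    This excludes the left endpoint as a maximum point of \<open>F\<close>, just as
    \<open>F \<theta> < F \<eta>\<close> excludes the right one.\<close>
  define \<eta>\<^sub>0 where "\<eta>\<^sub>0 = min (\<eta> / 2) (\<epsilon> / (\<bar>v m - F \<eta>\<bar> + 1))"
  have "\<eta>\<^sub>0 \<le> \<eta> / 2" unfolding \<eta>\<^sub>0_def by (rule min.cobounded1)
  moreover have "0 < \<epsilon> / (\<bar>v m - F \<eta>\<bar> + 1)" using \<epsilon> by (intro divide_pos_pos) auto
  ultimately have \<eta>0: "0 < \<eta>\<^sub>0" "\<eta>\<^sub>0 < \<eta>" using \<eta> by (auto simp: \<eta>\<^sub>0_def)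
  have F\<eta>0: "F \<eta>\<^sub>0 < F \<eta>"
  proof -
    have "\<eta>\<^sub>0 \<le> \<epsilon> / (\<bar>v m - F \<eta>\<bar> + 1)" by (simp add: \<eta>\<^sub>0_def)
    then have "\<bar>v m - F \<eta>\<bar> + 1 \<le> \<epsilon> / \<eta>\<^sub>0" using \<eta>0(1) by (simp add: field_simps)
    moreover have "v \<eta>\<^sub>0 \<le> v m" using m[of \<eta>\<^sub>0] \<eta>0 \<eta> by simp
    ultimately show ?thesis unfolding F_def[of \<eta>\<^sub>0] by linarith
  qed
  have "continuous_on {\<eta>\<^sub>0..\<theta>} F" unfolding F_def
    using \<eta>0 vc by (intro continuous_intros) (auto intro: continuous_on_subset)
  then obtain t\<^sub>0 where t0: "t\<^sub>0 \<in> {\<eta>\<^sub>0..\<theta>}" and max: "\<And>t. t \<in> {\<eta>\<^sub>0..\<theta>} \<Longrightarrow> F t \<le> F t\<^sub>0"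
    using continuous_attains_sup[of "{\<eta>\<^sub>0..\<theta>}" F] \<eta>0 \<eta> by auto
  have "F \<eta> \<le> F t\<^sub>0" using max[of \<eta>] \<eta>0 \<eta> by simp
  then have t0': "\<eta>\<^sub>0 < t\<^sub>0" "t\<^sub>0 < \<theta>" using t0 F\<eta>0 F\<theta> by (auto simp: order_less_le)
  \<comment> \<open>Maximality of \<open>F\<close> at \<open>t\<^sub>0\<close>, solved for
    \<open>u\<close> along the trajectory, says that \<open>\<Phi>\<close> touches from above at
    \<open>t\<^sub>0\<close>. Reparametrised by the level it is the local test function.\<close>
  define \<Phi> where "\<Phi> t = exp (a * t) * (F t\<^sub>0 + \<epsilon> / t - \<delta> * t - \<Gamma> t)" for t
  define \<Phi>' where "\<Phi>' t = a * \<Phi> t + exp (a * t) * (- (\<epsilon> / t\<^sup>2) - \<delta> - k t)" for t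
  have \<Phi>der: "(\<Phi> has_real_derivative \<Phi>' t) (at t)" if t: "\<eta>\<^sub>0 < t" "t < \<theta>" for t
  proof -
    have "at t within {0..\<theta>} = at t" using t \<eta>0 by (intro at_within_interior) (simp add: interior_atLeastAtMost_real)
    then have d1: "(\<Gamma> has_real_derivative k t) (at t)" using \<Gamma>der[of t] t \<eta>0 by simp
    have d2: "((\<lambda>t. \<epsilon> / t) has_real_derivative - (\<epsilon> / t\<^sup>2)) (at t)"
      using t \<eta>0 by (auto intro!: derivative_eq_intros simp: power2_eq_square)
    have d3: "((\<lambda>t. \<delta> * t) has_real_derivative \<delta>) (at t)" by (auto intro!: derivative_eq_intros)
    have "((\<lambda>t. F t\<^sub>0 + \<epsilon> / t - \<delta> * t - \<Gamma> t) has_real_derivative (- (\<epsilon> / t\<^sup>2) - \<delta> - k t)) (at t)"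
      using DERIV_diff[OF DERIV_diff[OF DERIV_add[OF DERIV_const d2] d3] d1] by simp
    moreover have "((\<lambda>t. exp (a * t)) has_real_derivative exp (a * t) * a) (at t)"
      by (auto intro!: derivative_eq_intros)
    ultimately have "(\<Phi> has_real_derivative exp (a * t) * a * (F t\<^sub>0 + \<epsilon> / t - \<delta> * t - \<Gamma> t)
        + (- (\<epsilon> / t\<^sup>2) - \<delta> - k t) * exp (a * t)) (at t)"
      unfolding \<Phi>_def[abs_def] by (intro DERIV_mult)
    then show ?thesis by (simp add: \<Phi>'_def \<Phi>_def mult_ac)
  qed
  have \<Phi>c: "continuous_on {\<eta>\<^sub>0<..<\<theta>} \<Phi>'"
  proof -
    have 1: "continuous_on {\<eta>\<^sub>0<..<\<theta>} \<Phi>" using \<Phi>der by (intro continuous_at_imp_continuous_on ballI DERIV_isCont) auto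
    have 2: "continuous_on {\<eta>\<^sub>0<..<\<theta>} k" by (rule continuous_on_subset[OF kc]) (use \<eta>0 in auto)
    show ?thesis unfolding \<Phi>'_def using \<eta>0 by (intro continuous_intros 1 2) auto
  qed
  have u\<Phi>: "u (x + \<sigma> * t) \<le> \<Phi> t" if t: "t \<in> {\<eta>\<^sub>0..\<theta>}" for t
  proof -
    have "exp (- a * t) * u (x + \<sigma> * t) \<le> F t\<^sub>0 + \<epsilon> / t - \<delta> * t - \<Gamma> t"
      using max[OF t] by (simp add: F_def v_def w_def)
    then have "exp (a * t) * (exp (- a * t) * u (x + \<sigma> * t)) \<le> \<Phi> t" unfolding \<Phi>_def by (intro mult_left_mono) auto
    then show ?thesis by (simp add: mult.assoc[symmetric] exp_add[symmetric])
  qed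
  have eq: "\<Phi> t\<^sub>0 = u (x + \<sigma> * t\<^sub>0)"
  proof -
    have "F t\<^sub>0 + \<epsilon> / t\<^sub>0 - \<delta> * t\<^sub>0 - \<Gamma> t\<^sub>0 = exp (- a * t\<^sub>0) * u (x + \<sigma> * t\<^sub>0)"
      by (simp add: F_def v_def w_def)
    then show ?thesis by (simp add: \<Phi>_def mult.assoc[symmetric] exp_add[symmetric])
  qed
  define c where "c = x + \<sigma> * \<eta>\<^sub>0"
  define d where "d = x + \<sigma> * \<theta>"
  define \<tau> where "\<tau> y = (y - x) / \<sigma>" for y
  have \<tau>: "\<eta>\<^sub>0 < \<tau> y" "\<tau> y < \<theta>" "x + \<sigma> * \<tau> y = y" if "y \<in> {c<..<d}" for y
    using that \<sigma> by (auto simp: \<tau>_def c_def d_def field_simps)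
  let ?y = "x + \<sigma> * t\<^sub>0"
  have \<tau>y: "\<tau> ?y = t\<^sub>0" using \<sigma> by (simp add: \<tau>_def)
  have "a * u ?y - g ?y \<le> \<sigma> * (\<Phi>' (\<tau> ?y) / \<sigma>)"
  proof (rule touch[of c d ?y "\<lambda>y. \<Phi> (\<tau> y)" "\<lambda>y. \<Phi>' (\<tau> y) / \<sigma>"])
    show "{c<..<d} \<subseteq> {l..b}"
    proof
      fix y assume y: "y \<in> {c<..<d}"
      have "\<tau> y \<in> {0..\<theta>}" using \<tau>(1,2)[OF y] \<eta>0 by simp
      from rng[OF this] show "y \<in> {l..b}" using \<tau>(3)[OF y] by simp
    qed
    show "?y \<in> {c<..<d}" using t0' \<sigma> by (simp add: c_def d_def)
    show "((\<lambda>y. \<Phi> (\<tau> y)) has_real_derivative \<Phi>' (\<tau> y) / \<sigma>) (at y)" if y: "y \<in> {c<..<d}" for y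
    proof -
      have "(\<tau> has_real_derivative 1 / \<sigma>) (at y)" unfolding \<tau>_def[abs_def] using \<sigma> by (auto intro!: derivative_eq_intros)
      from DERIV_chain2[OF \<Phi>der[OF \<tau>(1,2)[OF y]] this] show ?thesis by simp
    qed
    show "continuous_on {c<..<d} (\<lambda>y. \<Phi>' (\<tau> y) / \<sigma>)"
    proof -
      have "continuous_on {c<..<d} \<tau>" unfolding \<tau>_def[abs_def] using \<sigma> by (intro continuous_intros) auto
      moreover have "\<tau> ` {c<..<d} \<subseteq> {\<eta>\<^sub>0<..<\<theta>}"
      proof (rule image_subsetI)
        fix y assume "y \<in> {c<..<d}"
        from \<tau>(1,2)[OF this] show "\<tau> y \<in> {\<eta>\<^sub>0<..<\<theta>}" by simp
      qed
      ultimately have "continuous_on {c<..<d} (\<lambda>y. \<Phi>' (\<tau> y))" by (rule continuous_on_compose2[OF \<Phi>c])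
      then show ?thesis using \<sigma> by (intro continuous_on_divide continuous_on_const) auto
    qed
    show "u y \<le> \<Phi> (\<tau> y)" if y: "y \<in> {c<..<d}" for y
      using u\<Phi>[of "\<tau> y"] \<tau>[OF y] by simp
    show "\<Phi> (\<tau> ?y) = u ?y" using eq \<tau>y by simp
  qed
  then have "a * u ?y - g ?y \<le> \<Phi>' t\<^sub>0" using \<sigma> \<tau>y by simp
  \<comment> \<open>Up to the strictly negative contributions of \<open>\<epsilon>\<close> and
    \<open>\<delta>\<close>, \<open>\<Phi>\<close> satisfies the equation with equality, which
    contradicts the touching inequality.\<close>
  also have "\<Phi>' t\<^sub>0 = a * u ?y - exp (a * t\<^sub>0) * (\<epsilon> / t\<^sub>0\<^sup>2 + \<delta>) - g ?y"
  proof -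
    have "exp (a * t\<^sub>0) * k t\<^sub>0 = g ?y" by (simp add: k_def mult.assoc[symmetric] exp_add[symmetric])
    then show ?thesis by (simp add: \<Phi>'_def eq algebra_simps)
  qed
  finally have "exp (a * t\<^sub>0) * (\<epsilon> / t\<^sub>0\<^sup>2 + \<delta>) \<le> 0" by simp
  moreover have "0 < exp (a * t\<^sub>0) * (\<epsilon> / t\<^sub>0\<^sup>2 + \<delta>)"
    using \<epsilon> \<delta> by (intro mult_pos_pos add_nonneg_pos) auto
  ultimately show False by simp
qed

section \<open>The nonlocal term and the regularity of the running gain\<close>

definition excess_penalty :: "'a inventory_data \<Rightarrow> real \<Rightarrow> real" where
  "excess_penalty S v = (if 0 < v then penalty S v else 0)"

text \<open>Clamping merges the cases of a served and of a partly lost demand into one integrand.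
  For levels up to the capacity the upper clamp acts on negative \<open>\<alpha>\<close> only, a
  null set, and keeps the argument in the domain of \<open>u\<close>.\<close>

definition after_demand :: "'a inventory_data \<Rightarrow> (real \<Rightarrow> real) \<Rightarrow> real \<Rightarrow> real \<Rightarrow> real" where
  "after_demand S u y \<alpha> = u (max (lmin S) (min (cap S) (y - \<alpha>)))"

definition jump_mean :: "'a inventory_data \<Rightarrow> (real \<Rightarrow> real) \<Rightarrow> real \<Rightarrow> real" where
  "jump_mean S u y = (\<integral>\<alpha>. after_demand S u y \<alpha> \<partial>dF S) + (\<integral>\<alpha>. excess_penalty S (\<alpha> - (y - lmin S)) \<partial>dF S)"

context inventory_system begin

abbreviation "lo \<equiv> lmin S"
abbreviation "hi \<equiv> cap S"

lemma clamp_range: "max lo (min hi y) \<in> {lo..hi}"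
  using params by auto

lemma clamp_continuous:
  assumes "continuous_on {lo..hi} u" "continuous_on A f"
  shows "continuous_on A (\<lambda>y. u (max lo (min hi (f y))))"
  using assms clamp_range by (intro continuous_on_compose2[OF assms(1)] continuous_intros) auto

lemma after_demand_integrable:
  assumes u: "continuous_on {lo..hi} u"
  shows "integrable (dF S) (after_demand S u y)"
proof -
  have "bounded (u ` {lo..hi})" using u compact_Icc by (intro compact_imp_bounded compact_continuous_image)
  then obtain B where "\<forall>w\<in>u ` {lo..hi}. norm w \<le> B" unfolding bounded_iff by blast
  then have B: "\<And>z. z \<in> {lo..hi} \<Longrightarrow> \<bar>u z\<bar> \<le> B" by simp
  have "continuous_on UNIV (after_demand S u y)"
    unfolding after_demand_def[abs_def] by (rule clamp_continuous[OF u]) (intro continuous_intros)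
  then have "after_demand S u y \<in> borel_measurable (dF S)"
    using borel_measurable_continuous_onI by (simp cong: measurable_cong_sets)
  then show ?thesis
    using B[OF clamp_range] by (intro F.integrable_const_bound[of _ B]) (auto simp: after_demand_def)
qed

lemma penalty_nonneg: "0 \<le> y \<Longrightarrow> 0 \<le> penalty S y"
  using model by (simp add: inventory_model_def)

text \<open>\<open>penalty\<close> may be positive at 0, but a demand that exactly exhausts the
  stock costs nothing; setting the function to 0 up to and including 0 makes it monotone on the
  whole line.\<close>

lemma excess_penalty_mono: "mono (excess_penalty S)"
proof (rule monoI)
  fix v w :: real assume "v \<le> w"
  moreover have "mono_on {0..} (penalty S)" using model by (simp add: inventory_model_def)
  ultimately show "excess_penalty S v \<le> excess_penalty S w"
    using penalty_nonneg[of w] by (auto simp: excess_penalty_def mono_on_def)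
qed

lemma excess_penalty_measurable [measurable]: "excess_penalty S \<in> borel_measurable borel"
  using excess_penalty_mono by (rule borel_measurable_mono)

lemma excess_penalty_nonneg: "0 \<le> excess_penalty S v"
  using penalty_nonneg[of v] by (simp add: excess_penalty_def)

lemma excess_penalty_integrable: "lo \<le> y \<Longrightarrow> integrable (dF S) (\<lambda>\<alpha>. excess_penalty S (\<alpha> - (y - lo)))"
proof (rule Bochner_Integration.integrable_bound)
  show "integrable (dF S) (\<lambda>\<alpha>. indicator {0..} \<alpha> *\<^sub>R penalty S \<alpha>)"
    using model by (simp add: inventory_model_def set_integrable_def)
  show "(\<lambda>\<alpha>. excess_penalty S (\<alpha> - (y - lo))) \<in> borel_measurable (dF S)" by measurable
  assume y: "lo \<le> y"
  show "AE \<alpha> in dF S. norm (excess_penalty S (\<alpha> - (y - lo))) \<le> norm (indicator {0..} \<alpha> *\<^sub>R penalty S \<alpha>)"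
    using dF_pos
  proof eventually_elim
    case (elim \<alpha>)
    have "excess_penalty S (\<alpha> - (y - lo)) \<le> excess_penalty S \<alpha>" using y by (intro monoD[OF excess_penalty_mono]) simp
    then show ?case using elim excess_penalty_nonneg[of "\<alpha> - (y - lo)"] penalty_nonneg[of \<alpha>]
      by (simp add: excess_penalty_def)
  qed
qed

lemma demand_tail: "measure (dF S) {a<..} = 1 - demand_cdf S a"
proof -
  have "cdf (dF S) = demand_cdf S"
    using demand_facts(2)[of 1] unfolding demand_distr[OF order_refl] by simp
  then have "measure (dF S) {..a} = demand_cdf S a" unfolding cdf_def by (rule fun_cong)
  moreover have "measure (dF S) (space (dF S) - {..a}) = 1 - measure (dF S) {..a}"
    by (rule F.prob_compl) simp
  moreover have "space (dF S) - {..a} = {a<..}" by auto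
  ultimately show ?thesis by simp
qed

text \<open>A demand above \<open>y - lo\<close> brings the level down to \<open>lo\<close>, so the
  clamped integrand is constant there; negative demands have mass 0.\<close>

lemma after_demand_split:
  assumes u: "continuous_on {lo..hi} u" and y: "y \<in> {lo..hi}"
  shows "(LINT \<alpha>:{0..y - lo}|dF S. u (y - \<alpha>)) + u lo * (1 - demand_cdf S (y - lo)) = (\<integral>\<alpha>. after_demand S u y \<alpha> \<partial>dF S)"
proof -
  let ?f = "after_demand S u y"
  note int = after_demand_integrable[OF u, of y]
  have i1: "integrable (dF S) (\<lambda>\<alpha>. indicator {0..y - lo} \<alpha> *\<^sub>R ?f \<alpha>)" and i2: "integrable (dF S) (\<lambda>\<alpha>. indicator {y - lo<..} \<alpha> *\<^sub>R ?f \<alpha>)"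
    by (rule integrable_mult_indicator[OF _ int], simp)+
  have "(\<integral>\<alpha>. ?f \<alpha> \<partial>dF S) = (\<integral>\<alpha>. indicator {0..y - lo} \<alpha> *\<^sub>R ?f \<alpha> + indicator {y - lo<..} \<alpha> *\<^sub>R ?f \<alpha> \<partial>dF S)"
    using dF_pos int i1 i2 by (intro integral_cong_AE) (auto elim!: eventually_mono simp: indicator_def)
  also have "\<dots> = (\<integral>\<alpha>. indicator {0..y - lo} \<alpha> *\<^sub>R ?f \<alpha> \<partial>dF S) + (\<integral>\<alpha>. indicator {y - lo<..} \<alpha> *\<^sub>R ?f \<alpha> \<partial>dF S)"
    using i1 i2 by (rule Bochner_Integration.integral_add)
  also have "(\<integral>\<alpha>. indicator {0..y - lo} \<alpha> *\<^sub>R ?f \<alpha> \<partial>dF S) = (LINT \<alpha>:{0..y - lo}|dF S. u (y - \<alpha>))"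
    unfolding set_lebesgue_integral_def using y
    by (intro Bochner_Integration.integral_cong refl)
      (auto simp: indicator_def after_demand_def max_def min_def intro!: arg_cong[where f=u])
  also have "(\<integral>\<alpha>. indicator {y - lo<..} \<alpha> *\<^sub>R ?f \<alpha> \<partial>dF S) = (\<integral>\<alpha>. indicator {y - lo<..} \<alpha> *\<^sub>R u lo \<partial>dF S)"
    using y params by (intro Bochner_Integration.integral_cong refl) (auto simp: indicator_def after_demand_def max_def min_def)
  also have "\<dots> = u lo * (1 - demand_cdf S (y - lo))" by (simp add: demand_tail)
  finally show ?thesis by simp
qed

lemma excess_penalty_eq: "(LINT \<alpha>:{y - lo<..}|dF S. penalty S (\<alpha> - y + lo)) = (\<integral>\<alpha>. excess_penalty S (\<alpha> - (y - lo)) \<partial>dF S)"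
  unfolding set_lebesgue_integral_def
  by (intro Bochner_Integration.integral_cong refl) (auto simp: indicator_def excess_penalty_def algebra_simps)

lemma HJB_op_eq:
  assumes u: "continuous_on {lo..hi} u" and y: "y \<in> {lo..hi}" and der: "(u has_vector_derivative d) (at y within {lo..hi})"
  shows "HJB_op S i u y = prate S i * d - (arr_rate S + disc S) * u y + arr_rate S * jump_mean S u y + hold S i y"
proof -
  have "vector_derivative u (at y within {lo..hi}) = d"
    using vector_derivative_within_closed_interval[OF params(4) y der] .
  then show ?thesis
    unfolding HJB_op_def jump_mean_def after_demand_split[OF u y, symmetric] excess_penalty_eq[symmetric]
    by (simp add: algebra_simps)
qed

lemma u_bar0_eq:
  assumes "continuous_on {lo..hi} (u_bar S u)"
  shows "u_bar0 S u = arr_rate S / (disc S + arr_rate S) * jump_mean S (u_bar S u) hi + hold S 0 hi / (disc S + arr_rate S)"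
proof -
  have "(LINT \<alpha>:{hi - lo<..}|dF S. penalty S (\<alpha> - hi + lo) + u_bar S u lo)
      = (LINT \<alpha>:{hi - lo<..}|dF S. penalty S (\<alpha> - hi + lo)) + (LINT \<alpha>:{hi - lo<..}|dF S. u_bar S u lo)"
  proof (rule set_integral_add)
    have "integrable (dF S) (\<lambda>\<alpha>. excess_penalty S (\<alpha> - (hi - lo)))" using params by (intro excess_penalty_integrable) simp
    also have "(\<lambda>\<alpha>. excess_penalty S (\<alpha> - (hi - lo))) = (\<lambda>\<alpha>. indicator {hi - lo<..} \<alpha> *\<^sub>R penalty S (\<alpha> - hi + lo))"
      by (auto simp: fun_eq_iff indicator_def excess_penalty_def algebra_simps)
    finally show "set_integrable (dF S) {hi - lo<..} (\<lambda>\<alpha>. penalty S (\<alpha> - hi + lo))" by (simp add: set_integrable_def)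
    show "set_integrable (dF S) {hi - lo<..} (\<lambda>\<alpha>. u_bar S u lo)"
      unfolding set_integrable_def by (rule integrable_mult_indicator) simp_all
  qed
  moreover have "(LINT \<alpha>:{hi - lo<..}|dF S. u_bar S u lo) = u_bar S u lo * (1 - demand_cdf S (hi - lo))"
    by (simp add: set_lebesgue_integral_def demand_tail)
  moreover have "(LINT \<alpha>:{0..hi - lo}|dF S. u_bar S u (hi - \<alpha>)) + u_bar S u lo * (1 - demand_cdf S (hi - lo))
      = (\<integral>\<alpha>. after_demand S (u_bar S u) hi \<alpha> \<partial>dF S)"
    using params by (intro after_demand_split[OF assms]) simp
  ultimately have "(LINT \<alpha>:{0..hi - lo}|dF S. u_bar S u (hi - \<alpha>)) + (LINT \<alpha>:{hi - lo<..}|dF S. penalty S (\<alpha> - hi + lo) + u_bar S u lo)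
      = jump_mean S (u_bar S u) hi"
    using excess_penalty_eq[of hi] by (simp only: jump_mean_def)
  then show ?thesis by (simp only: u_bar0_def)
qed

lemma jump_mean_nn_integral:
  assumes u: "continuous_on {lo..hi} u" and nn: "\<And>z. z \<in> {lo..hi} \<Longrightarrow> 0 \<le> u z" and y: "y \<in> {lo..hi}"
  shows "ennreal (jump_mean S u y) = (\<integral>\<^sup>+\<alpha>. ennreal (after_demand S u y \<alpha> + excess_penalty S (\<alpha> - (y - lo))) \<partial>dF S)"
    and "0 \<le> jump_mean S u y"
proof -
  have "lo \<le> y" using y by simp
  note int = after_demand_integrable[OF u, of y] excess_penalty_integrable[OF this]
  have pos: "0 \<le> after_demand S u y \<alpha>" for \<alpha> unfolding after_demand_def by (rule nn[OF clamp_range])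
  have "jump_mean S u y = (\<integral>\<alpha>. after_demand S u y \<alpha> + excess_penalty S (\<alpha> - (y - lo)) \<partial>dF S)"
    unfolding jump_mean_def by (rule Bochner_Integration.integral_add[symmetric, OF int])
  then show "ennreal (jump_mean S u y) = (\<integral>\<^sup>+\<alpha>. ennreal (after_demand S u y \<alpha> + excess_penalty S (\<alpha> - (y - lo))) \<partial>dF S)"
    using int pos excess_penalty_nonneg by (subst nn_integral_eq_integral) (auto intro: add_nonneg_nonneg)
  show "0 \<le> jump_mean S u y" unfolding jump_mean_def
    using pos excess_penalty_nonneg by (intro add_nonneg_nonneg Bochner_Integration.integral_nonneg)
qed

text \<open>Limits the error made when a test function replaces \<open>u\<close> in the nonlocal
  term.\<close>

lemma jump_mean_add_const:
  assumes u: "continuous_on {lo..hi} u" and f: "continuous_on {lo..hi} f"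
    and le: "\<And>z. z \<in> {lo..hi} \<Longrightarrow> f z \<le> u z + e"
  shows "jump_mean S f y \<le> jump_mean S u y + e"
proof -
  have "(\<integral>\<alpha>. after_demand S f y \<alpha> \<partial>dF S) \<le> (\<integral>\<alpha>. after_demand S u y \<alpha> + e \<partial>dF S)"
  proof (rule integral_mono)
    show "integrable (dF S) (after_demand S f y)" by (rule after_demand_integrable[OF f])
    show "integrable (dF S) (\<lambda>\<alpha>. after_demand S u y \<alpha> + e)" using after_demand_integrable[OF u, of y] by simp
    show "after_demand S f y \<alpha> \<le> after_demand S u y \<alpha> + e" for \<alpha>
      unfolding after_demand_def by (rule le[OF clamp_range])
  qed
  also have "\<dots> = (\<integral>\<alpha>. after_demand S u y \<alpha> \<partial>dF S) + e"
    using after_demand_integrable[OF u, of y] F.prob_space by simp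
  finally show ?thesis by (simp add: jump_mean_def)
qed

text \<open>The definition evaluates the whole operator at the test function. Extending the local
  touching function to one close to \<open>u\<close> on the whole interval lets \<open>u\<close>
  itself enter the nonlocal term, up to an arbitrarily small error.\<close>

lemma supersolution_touch:
  assumes vis: "\<And>x. x \<in> {lo..<hi} \<Longrightarrow> viscosity_supersolution S i j u x" and u: "continuous_on {lo..hi} u"
    and sub: "{c<..<d} \<subseteq> {lo..hi}" and y: "y \<in> {c<..<d}"
    and der: "\<And>z. z \<in> {c<..<d} \<Longrightarrow> (\<phi> has_real_derivative \<phi>' z) (at z)" and cont: "continuous_on {c<..<d} \<phi>'"
    and above: "\<And>z. z \<in> {c<..<d} \<Longrightarrow> u z \<le> \<phi> z" and eq: "\<phi> y = u y"
  shows "(arr_rate S + disc S) * u y - (arr_rate S * jump_mean S u y + hold S i y) \<le> prate S i * \<phi>' y"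
proof (rule field_le_epsilon)
  fix e :: real assume e: "0 < e"
  \<comment> \<open>The nonlocal term carries the factor \<open>arr_rate S\<close>.\<close>
  define \<epsilon> where "\<epsilon> = e / arr_rate S"
  have \<epsilon>: "0 < \<epsilon>" using e arr_rate_pos by (simp add: \<epsilon>_def)
  obtain f f' where f: "\<And>z. (f has_real_derivative f' z) (at z)" "\<And>z. isCont f' z" "f y = u y" "f' y = \<phi>' y"
    "\<And>z. z \<in> {lo..hi} \<Longrightarrow> u z \<le> f z \<and> f z \<le> u z + \<epsilon>"
    using C1_touching_extension[OF u sub y der cont above eq \<epsilon>] by blast
  \<comment> \<open>The supersolution property is available below the capacity; an open interval
    inside \<open>{lo..hi}\<close> does not contain \<open>hi\<close>.\<close>
  have "y \<noteq> hi"
  proof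
    assume "y = hi"
    then obtain z where "hi < z" "z < d" using y dense[of hi d] by auto
    then have "z \<in> {c<..<d}" using y \<open>y = hi\<close> by simp
    then have "z \<in> {lo..hi}" using sub by blast
    then show False using \<open>hi < z\<close> by simp
  qed
  then have yr: "y \<in> {lo..<hi}" "y \<in> {lo..hi}" using sub y by auto
  have fc: "continuous_on {lo..hi} f" using f(1) by (intro continuous_at_imp_continuous_on ballI DERIV_isCont) blast
  have fv: "(f has_vector_derivative f' z) (at z within {lo..hi})" for z
    using f(1)[of z] by (auto simp: has_real_derivative_iff_has_vector_derivative intro: has_vector_derivative_at_within)
  have "C1_on_interval lo hi f"
    unfolding C1_on_interval_def using fv f(2) by (intro exI[of _ f'] conjI ballI continuous_at_imp_continuous_on)
  moreover have "\<forall>z\<in>{lo..hi}. u z - f z \<le> u y - f y" using f(3,5) by auto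
  ultimately have "0 \<le> HJB_op S i f y"
    using vis[OF yr(1)] f(3) unfolding viscosity_supersolution_def by fastforce
  then have "(arr_rate S + disc S) * u y \<le> prate S i * \<phi>' y + arr_rate S * jump_mean S f y + hold S i y"
    unfolding HJB_op_eq[OF fc yr(2) fv] f(3,4) by simp
  also have "arr_rate S * jump_mean S f y \<le> arr_rate S * (jump_mean S u y + \<epsilon>)"
    using jump_mean_add_const[OF u fc] f(5) arr_rate_pos by (intro mult_left_mono) auto
  finally show "(arr_rate S + disc S) * u y - (arr_rate S * jump_mean S u y + hold S i y) \<le> prate S i * \<phi>' y + e"
    using arr_rate_pos by (simp add: \<epsilon>_def algebra_simps)
qed

lemma supersolution_continuous:
  assumes "\<And>x. x \<in> {lo..<hi} \<Longrightarrow> viscosity_supersolution S i j u x"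
  shows "\<exists>L. L-lipschitz_on {lo..hi} u" "continuous_on {lo..hi} u"
proof -
  show L: "\<exists>L. L-lipschitz_on {lo..hi} u"
    using assms[of lo] params by (simp add: viscosity_supersolution_def)
  then show "continuous_on {lo..hi} u" using lipschitz_on_continuous_on by blast
qed

lemma after_demand_mean_lipschitz:
  assumes L: "L-lipschitz_on {lo..hi} u"
  shows "L-lipschitz_on UNIV (\<lambda>y. \<integral>\<alpha>. after_demand S u y \<alpha> \<partial>dF S)"
proof (rule lipschitz_onI)
  have u: "continuous_on {lo..hi} u" using L by (rule lipschitz_on_continuous_on)
  show L0: "0 \<le> L" using L by (rule lipschitz_on_nonneg)
  fix y y' :: real
  have pw: "\<bar>after_demand S u y \<alpha> - after_demand S u y' \<alpha>\<bar> \<le> L * dist y y'" for \<alpha>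
  proof -
    have "dist (after_demand S u y \<alpha>) (after_demand S u y' \<alpha>)
        \<le> L * dist (max lo (min hi (y - \<alpha>))) (max lo (min hi (y' - \<alpha>)))"
      unfolding after_demand_def by (rule lipschitz_onD[OF L clamp_range clamp_range])
    also have "\<dots> \<le> L * dist y y'"
      using L0 by (intro mult_left_mono) (auto simp: dist_real_def)
    finally show ?thesis by (simp add: dist_real_def)
  qed
  note int = after_demand_integrable[OF u]
  have "dist (\<integral>\<alpha>. after_demand S u y \<alpha> \<partial>dF S) (\<integral>\<alpha>. after_demand S u y' \<alpha> \<partial>dF S)
     = \<bar>\<integral>\<alpha>. after_demand S u y \<alpha> - after_demand S u y' \<alpha> \<partial>dF S\<bar>"
    by (simp add: dist_real_def Bochner_Integration.integral_diff[OF int int])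
  also have "\<dots> \<le> (\<integral>\<alpha>. \<bar>after_demand S u y \<alpha> - after_demand S u y' \<alpha>\<bar> \<partial>dF S)"
    by (rule integral_abs_bound)
  also have "\<dots> \<le> (\<integral>\<alpha>. L * dist y y' \<partial>dF S)"
    using int pw by (intro integral_mono integrable_abs Bochner_Integration.integrable_diff) auto
  finally show "dist (\<integral>\<alpha>. after_demand S u y \<alpha> \<partial>dF S) (\<integral>\<alpha>. after_demand S u y' \<alpha> \<partial>dF S) \<le> L * dist y y'"
    using F.prob_space by simp
qed

text \<open>Source of the Borel measurability of the mean penalty and of the countability of its
  discontinuities.\<close>

lemma excess_mean_antimono:
  assumes "lo \<le> y" "y \<le> y'"
  shows "(\<integral>\<alpha>. excess_penalty S (\<alpha> - (y' - lo)) \<partial>dF S) \<le> (\<integral>\<alpha>. excess_penalty S (\<alpha> - (y - lo)) \<partial>dF S)"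
  using assms by (intro integral_mono excess_penalty_integrable monoD[OF excess_penalty_mono]) auto

text \<open>Extends functions on \<open>{lo..hi}\<close> to the line, where they can be Borel
  functions.\<close>

definition clamp :: "real \<Rightarrow> real" where "clamp y = max lo (min hi y)"

lemma clamp_id: "y \<in> {lo..hi} \<Longrightarrow> clamp y = y" by (auto simp: clamp_def)

lemma jump_mean_clamp_measurable:
  assumes L: "\<exists>L. L-lipschitz_on {lo..hi} u"
  shows "(\<lambda>y. jump_mean S u (clamp y)) \<in> borel_measurable borel"
proof -
  obtain L where "L-lipschitz_on {lo..hi} u" using L by blast
  then have c: "continuous_on UNIV (\<lambda>y. \<integral>\<alpha>. after_demand S u y \<alpha> \<partial>dF S)"
    by (intro lipschitz_on_continuous_on after_demand_mean_lipschitz)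
  have "continuous_on UNIV clamp" unfolding clamp_def[abs_def] by (intro continuous_intros)
  from continuous_on_compose2[OF c this]
  have "(\<lambda>y. \<integral>\<alpha>. after_demand S u (clamp y) \<alpha> \<partial>dF S) \<in> borel_measurable borel"
    by (intro borel_measurable_continuous_onI) auto
  moreover have "(\<lambda>y. \<integral>\<alpha>. excess_penalty S (\<alpha> - (clamp y - lo)) \<partial>dF S) \<in> borel_measurable borel"
  proof -
    have "mono (\<lambda>y. - (\<integral>\<alpha>. excess_penalty S (\<alpha> - (clamp y - lo)) \<partial>dF S))"
    proof (rule monoI)
      fix y y' :: real assume "y \<le> y'"
      then have "lo \<le> clamp y" "clamp y \<le> clamp y'" by (auto simp: clamp_def)
      from excess_mean_antimono[OF this]
      show "- (\<integral>\<alpha>. excess_penalty S (\<alpha> - (clamp y - lo)) \<partial>dF S) \<le> - (\<integral>\<alpha>. excess_penalty S (\<alpha> - (clamp y' - lo)) \<partial>dF S)" by simp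
    qed
    from borel_measurable_uminus[OF borel_measurable_mono[OF this]] show ?thesis by simp
  qed
  ultimately show ?thesis unfolding jump_mean_def by (rule borel_measurable_add)
qed

lemma hold_canonical_bounds:
  assumes "i \<in> {1,2}"
  shows "0 \<le> hold C i y" "\<exists>B. \<forall>y. hold C i y \<le> B"
proof -
  have *: "\<forall>x\<in>{lo..<hi}. 0 \<le> hold S i x" "bounded (hold S i ` {lo..<hi})"
    using model assms by (auto simp: inventory_model_def)
  then show "0 \<le> hold C i y" using assms by (auto simp: hold_canonical)
  obtain B where "\<forall>w\<in>hold S i ` {lo..<hi}. norm w \<le> B" using *(2) unfolding bounded_iff by blast
  then have "hold S i y \<le> B" if "y \<in> {lo..<hi}" for y using that by (auto simp: abs_le_iff)
  then have "hold C i y \<le> max 0 B" for y using assms by (auto simp: hold_canonical le_max_iff_disj)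
  then show "\<exists>B. \<forall>y. hold C i y \<le> B" by blast
qed

text \<open>Three kinds of terms: the mean of \<open>u\<close> after a demand is Lipschitz, the mean
  penalty is monotone in the level, and the holding cost has finitely many discontinuities.\<close>

lemma running_gain_regular:
  assumes i: "i \<in> {1,2}" and L: "\<exists>L. L-lipschitz_on {lo..hi} u" and nn: "\<And>z. z \<in> {lo..hi} \<Longrightarrow> 0 \<le> u z"
  defines "g \<equiv> \<lambda>y. arr_rate S * jump_mean S u y + hold C i y"
  shows "\<exists>B. \<forall>y\<in>{lo..hi}. 0 \<le> g y \<and> g y \<le> B"
    and "\<exists>N. countable N \<and> (\<forall>y\<in>{lo..hi} - N. continuous (at y within {lo..hi}) g)"
proof -
  obtain L where L: "L-lipschitz_on {lo..hi} u" using L by blast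
  have u: "continuous_on {lo..hi} u" using L by (rule lipschitz_on_continuous_on)
  define A where "A y = (\<integral>\<alpha>. after_demand S u y \<alpha> \<partial>dF S)" for y
  define P where "P y = (\<integral>\<alpha>. excess_penalty S (\<alpha> - (y - lo)) \<partial>dF S)" for y
  have g: "g y = arr_rate S * (A y + P y) + hold C i y" for y by (simp add: g_def jump_mean_def A_def P_def)
  have Ac: "continuous_on {lo..hi} A"
    unfolding A_def by (rule continuous_on_subset[OF lipschitz_on_continuous_on[OF after_demand_mean_lipschitz[OF L]]]) simp
  have "bounded (A ` {lo..hi})" using Ac compact_Icc by (intro compact_imp_bounded compact_continuous_image)
  then obtain BA where "\<forall>w\<in>A ` {lo..hi}. norm w \<le> BA" unfolding bounded_iff by blast
  then have BA: "A y \<le> BA" if "y \<in> {lo..hi}" for y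
    using bspec[of "A ` {lo..hi}" "\<lambda>w. norm w \<le> BA" "A y"] that by (simp add: abs_le_iff)
  obtain BH where BH: "\<And>y. hold C i y \<le> BH" using hold_canonical_bounds[OF i] by blast
  show "\<exists>B. \<forall>y\<in>{lo..hi}. 0 \<le> g y \<and> g y \<le> B"
  proof (intro exI[of _ "arr_rate S * (BA + P lo) + BH"] ballI conjI)
    fix y assume y: "y \<in> {lo..hi}"
    show "0 \<le> g y" unfolding g_def
      using jump_mean_nn_integral(2)[OF u nn y] hold_canonical_bounds(1)[OF i] arr_rate_pos by simp
    have "P y \<le> P lo" unfolding P_def using y by (intro excess_mean_antimono) auto
    then show "g y \<le> arr_rate S * (BA + P lo) + BH" unfolding g
      using BA[OF y] BH arr_rate_pos by (intro add_mono mult_left_mono) auto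
  qed
  define D where "D = discontinuities {lo..<hi} (hold S i)"
  have D: "finite D" using model i by (auto simp: inventory_model_def D_def)
  \<comment> \<open>The capacity is included because \<open>hold C i\<close> takes its default value
    0 there.\<close>
  define N where "N = {a\<in>{lo..hi}. \<not> continuous (at a within {lo..hi}) (\<lambda>y. - P y)} \<union> D \<union> {hi}"
  have "mono_on {lo..hi} (\<lambda>y. - P y)" unfolding P_def by (intro mono_onI) (simp add: excess_mean_antimono)
  then have N: "countable N" unfolding N_def
    using D by (intro countable_Un mono_on_ctble_discont) (auto intro: countable_finite)
  have "continuous (at y within {lo..hi}) g" if y: "y \<in> {lo..hi} - N" for y
  proof -
    have 1: "continuous (at y within {lo..hi}) (\<lambda>y. - P y)" using y by (auto simp: N_def)
    have 2: "continuous (at y within {lo..hi}) A" using Ac y by (simp add: continuous_on_eq_continuous_within)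
    have yr: "y \<in> {lo..<hi}" "y \<notin> D" using y by (auto simp: N_def)
    then have c: "continuous (at y within {lo..<hi}) (hold S i)" by (auto simp: D_def discontinuities_def)
    have "continuous (at y within {lo..<hi}) (hold C i)"
      using c by (rule continuous_transform_within[where \<delta>=1]) (use i yr in \<open>auto simp: hold_canonical\<close>)
    moreover have "at y within {lo..hi} = at y within {lo..<hi}"
      using yr by (intro at_within_nhd[where S="{..<hi}"]) auto
    ultimately have 3: "continuous (at y within {lo..hi}) (hold C i)" by simp
    have "continuous (at y within {lo..hi}) (\<lambda>y. arr_rate S * (A y - - P y) + hold C i y)"
      by (rule continuous_add[OF continuous_mult[OF continuous_const continuous_diff[OF 2 1]] 3])
    then show ?thesis by (simp add: g[abs_def])
  qed
  then show "\<exists>N. countable N \<and> (\<forall>y\<in>{lo..hi} - N. continuous (at y within {lo..hi}) g)" using N by blast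
qed

lemma nn_integral_continuous_Icc:
  fixes f :: "real \<Rightarrow> real"
  assumes f: "continuous_on {a..c} f" and nn: "\<And>t. t \<in> {a..c} \<Longrightarrow> 0 \<le> f t"
  shows "ennreal (integral {a..c} f) = (\<integral>\<^sup>+t\<in>{a..c}. ennreal (f t) \<partial>lborel)"
proof -
  have int: "set_integrable lborel {a..c} f" using f by (rule borel_integrable_atLeastAtMost')
  have "ennreal (integral {a..c} f) = ennreal (LINT t:{a..c}|lborel. f t)"
    using set_borel_integral_eq_integral(2)[OF int] by simp
  also have "\<dots> = (\<integral>\<^sup>+t. ennreal (indicator {a..c} t *\<^sub>R f t) \<partial>lborel)"
    unfolding set_lebesgue_integral_def using int nn
    by (intro nn_integral_eq_integral[symmetric]) (auto simp: set_integrable_def indicator_def)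
  also have "\<dots> = (\<integral>\<^sup>+t\<in>{a..c}. ennreal (f t) \<partial>lborel)"
    by (intro nn_integral_cong) (auto simp: indicator_def)
  finally show ?thesis .
qed

text \<open>The integrated touching inequality holds with each Lipschitz majorant of the running
  gain. The trajectory moves at positive speed and so meets the countably many discontinuities at
  countably many times; dominated convergence then removes the regularisation.\<close>

lemma supersolution_integrated:
  assumes i: "i \<in> {1,2}" and vis: "\<And>x. x \<in> {lo..<hi} \<Longrightarrow> viscosity_supersolution S i j u x"
    and nn: "\<And>z. z \<in> {lo..hi} \<Longrightarrow> 0 \<le> u z"
    and x: "lo \<le> x" "0 \<le> \<theta>" "x + prate S i * \<theta> \<le> hi"
  shows "ennreal (u x) \<le> (\<integral>\<^sup>+t\<in>{0..<\<theta>}. ennreal (exp (- (arr_rate S + disc S) * t) *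
      (arr_rate S * jump_mean S u (x + prate S i * t) + hold C i (x + prate S i * t))) \<partial>lborel)
    + ennreal (exp (- (arr_rate S + disc S) * \<theta>) * u (x + prate S i * \<theta>))"
proof -
  let ?a = "arr_rate S + disc S" and ?s = "prate S i"
  note u = supersolution_continuous[OF vis]
  define g where "g y = arr_rate S * jump_mean S u y + hold C i y" for y
  obtain B where B: "\<And>y. y \<in> {lo..hi} \<Longrightarrow> 0 \<le> g y \<and> g y \<le> B"
    using running_gain_regular(1)[OF i u(1) nn] unfolding g_def by blast
  obtain N where N: "countable N" "\<And>y. y \<in> {lo..hi} - N \<Longrightarrow> continuous (at y within {lo..hi}) g"
    using running_gain_regular(2)[OF i u(1) nn] unfolding g_def by blast
  have s: "0 < ?s" using params(5) i by (auto simp: good_rates_def)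
  define gk where "gk = sup_convolution lo hi g"
  have gk: "\<And>y k. y \<in> {lo..hi} \<Longrightarrow> g y \<le> gk k y" "\<And>y k. y \<in> {lo..hi} \<Longrightarrow> gk k y \<le> B"
    "\<And>k. continuous_on {lo..hi} (gk k)"
    "\<And>y. y \<in> {lo..hi} \<Longrightarrow> continuous (at y within {lo..hi}) g \<Longrightarrow> (\<lambda>k. gk k y) \<longlonglongrightarrow> g y"
  proof -
    show "g y \<le> gk k y" "gk k y \<le> B" if "y \<in> {lo..hi}" for y k
      unfolding gk_def using B that by (auto intro!: sup_convolution_ge[where B=B] sup_convolution_le[where B=B])
    show "continuous_on {lo..hi} (gk k)" for k
      unfolding gk_def using B by (intro sup_convolution_continuous[where B=B])
    show "(\<lambda>k. gk k y) \<longlonglongrightarrow> g y" if "y \<in> {lo..hi}" "continuous (at y within {lo..hi}) g" for y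
      unfolding gk_def using B that by (intro sup_convolution_tendsto[where B=B])
  qed
  have rng: "x + ?s * t \<in> {lo..hi}" if "t \<in> {0..\<theta>}" for t
  proof -
    have "?s * t \<le> ?s * \<theta>" "0 \<le> ?s * t" using that s by (auto intro: mult_left_mono)
    then show ?thesis using x by simp
  qed
  define f where "f k t = exp (- ?a * t) * gk k (x + ?s * t)" for k t
  have fc: "continuous_on {0..\<theta>} (f k)" for k unfolding f_def
    using rng by (intro continuous_intros continuous_on_compose2[OF gk(3)]) auto
  have f0: "0 \<le> f k t" if "t \<in> {0..\<theta>}" for k t
    using B[OF rng[OF that]] gk(1)[OF rng[OF that], of k] by (simp add: f_def)
  have step: "ennreal (u x) \<le> (\<integral>\<^sup>+t\<in>{0..\<theta>}. ennreal (f k t) \<partial>lborel) + ennreal (exp (- ?a * \<theta>) * u (x + ?s * \<theta>))" for k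
  proof -
    have "u x \<le> integral {0..\<theta>} (\<lambda>t. exp (- ?a * t) * gk k (x + ?s * t)) + exp (- ?a * \<theta>) * u (x + ?s * \<theta>)"
    proof (rule touching_inequality_integrated[OF u(2) gk(3) s _ x])
      fix c d y \<phi> \<phi>'
      assume t: "{c<..<d} \<subseteq> {lo..hi}" "y \<in> {c<..<d}"
        "\<And>z. z \<in> {c<..<d} \<Longrightarrow> (\<phi> has_real_derivative \<phi>' z) (at z)" "continuous_on {c<..<d} \<phi>'"
        "\<And>z. z \<in> {c<..<d} \<Longrightarrow> u z \<le> \<phi> z" "\<phi> y = u y"
      have y: "y \<in> {lo..hi}" using t(1,2) by blast
      have "y \<noteq> hi"
      proof
        assume "y = hi"
        then obtain z where "hi < z" "z < d" using t(2) dense[of hi d] by auto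
        then have "z \<in> {c<..<d}" using t(2) \<open>y = hi\<close> by simp
        then have "z \<in> {lo..hi}" using t(1) by blast
        then show False using \<open>hi < z\<close> by simp
      qed
      then have "hold C i y = hold S i y" using i y by (auto simp: hold_canonical)
      then have "?a * u y - g y \<le> ?s * \<phi>' y"
        using supersolution_touch[OF vis u(2) t] by (simp add: g_def)
      then show "?a * u y - gk k y \<le> ?s * \<phi>' y" using gk(1)[OF y, of k] by simp
    qed
    also have "\<dots> = integral {0..\<theta>} (f k) + exp (- ?a * \<theta>) * u (x + ?s * \<theta>)" by (simp add: f_def[abs_def])
    finally have "ennreal (u x) \<le> ennreal (integral {0..\<theta>} (f k) + exp (- ?a * \<theta>) * u (x + ?s * \<theta>))" by (rule ennreal_leI)
    also have "\<dots> = ennreal (integral {0..\<theta>} (f k)) + ennreal (exp (- ?a * \<theta>) * u (x + ?s * \<theta>))"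
      using f0 fc nn[OF rng[of \<theta>]] x(2)
      by (intro ennreal_plus Henstock_Kurzweil_Integration.integral_nonneg integrable_continuous_real) auto
    finally show ?thesis by (simp only: nn_integral_continuous_Icc[of 0 \<theta> "f k", OF fc f0])
  qed
  define F where "F t = ennreal (exp (- ?a * t) * (arr_rate S * jump_mean S u (clamp (x + ?s * t)) + hold C i (x + ?s * t))) * indicator {0..<\<theta>} t" for t
  have Fm: "F \<in> borel_measurable lborel"
  proof -
    have [measurable]: "(\<lambda>t. jump_mean S u (clamp (x + ?s * t))) \<in> borel_measurable borel"
      by (rule measurable_compose[OF _ jump_mean_clamp_measurable[OF u(1)]]) measurable
    have [measurable]: "(\<lambda>t. hold C i (x + ?s * t)) \<in> borel_measurable borel"
      by (rule measurable_compose[OF _ hold_canonical_measurable]) measurable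
    show ?thesis unfolding F_def[abs_def] by measurable
  qed
  have Feq: "F t = ennreal (exp (- ?a * t) * g (x + ?s * t))" if "0 \<le> t" "t < \<theta>" for t
    using that clamp_id[OF rng[of t]] by (simp add: F_def g_def)
  have AE: "AE t in lborel. (\<lambda>k. ennreal (f k t) * indicator {0..\<theta>} t) \<longlonglongrightarrow> F t"
  proof -
    have "{t. x + ?s * t \<in> N} \<subseteq> (\<lambda>y. (y - x) / ?s) ` N"
    proof
      fix t assume "t \<in> {t. x + ?s * t \<in> N}"
      then show "t \<in> (\<lambda>y. (y - x) / ?s) ` N" using s by (intro image_eqI[of _ _ "x + ?s * t"]) auto
    qed
    then have "countable {t. x + ?s * t \<in> N}" using N(1) by (meson countable_image countable_subset)
    then have "AE t in lborel. t \<notin> {t. x + ?s * t \<in> N}" by (intro AE_not_in countable_imp_null_set_lborel)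
    with AE_lborel_singleton[of \<theta>] show ?thesis
    proof eventually_elim
      case (elim t)
      show ?case
      proof (cases "0 \<le> t \<and> t < \<theta>")
        case True
        then have t: "t \<in> {0..\<theta>}" by simp
        have "x + ?s * t \<in> {lo..hi} - N" using rng[OF t] elim by simp
        then have "(\<lambda>k. gk k (x + ?s * t)) \<longlonglongrightarrow> g (x + ?s * t)" using N(2) gk(4) by simp
        then have "(\<lambda>k. ennreal (f k t)) \<longlonglongrightarrow> ennreal (exp (- ?a * t) * g (x + ?s * t))"
          unfolding f_def by (intro tendsto_ennrealI tendsto_intros)
        then show ?thesis using True Feq[of t] by simp
      next
        case False
        then have "indicator {0..\<theta>} t = (0::ennreal)" "indicator {0..<\<theta>} t = (0::ennreal)" using elim by (auto simp: indicator_def)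
        then show ?thesis by (simp add: F_def)
      qed
    qed
  qed
  have "(\<lambda>k. \<integral>\<^sup>+t\<in>{0..\<theta>}. ennreal (f k t) \<partial>lborel) \<longlonglongrightarrow> (\<integral>\<^sup>+t. F t \<partial>lborel)"
  proof (rule nn_integral_dominated_convergence[where w="\<lambda>t. ennreal B * indicator {0..\<theta>} t"])
    fix k
    have "(\<lambda>t. indicator {0..\<theta>} t *\<^sub>R f k t) \<in> borel_measurable borel"
      using fc by (intro borel_measurable_continuous_on_indicator) auto
    then have "(\<lambda>t. ennreal (indicator {0..\<theta>} t *\<^sub>R f k t)) \<in> borel_measurable lborel" by simp
    also have "(\<lambda>t. ennreal (indicator {0..\<theta>} t *\<^sub>R f k t)) = (\<lambda>t. ennreal (f k t) * indicator {0..\<theta>} t)"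
      by (auto simp: fun_eq_iff indicator_def)
    finally show "(\<lambda>t. ennreal (f k t) * indicator {0..\<theta>} t) \<in> borel_measurable lborel" .
    show "AE t in lborel. ennreal (f k t) * indicator {0..\<theta>} t \<le> ennreal B * indicator {0..\<theta>} t"
    proof (intro AE_I2)
      fix t
      show "ennreal (f k t) * indicator {0..\<theta>} t \<le> ennreal B * indicator {0..\<theta>} t"
      proof (cases "t \<in> {0..\<theta>}")
        case True
        have "- ?a * t \<le> 0" using True arr_rate_pos params(3) by (intro mult_nonpos_nonneg) auto
        then have e1: "exp (- ?a * t) \<le> 1" by (simp only: exp_le_one_iff)
        have "exp (- ?a * t) * gk k (x + ?s * t) \<le> 1 * B"
          using e1 gk(2)[OF rng[OF True]] gk(1)[OF rng[OF True]] B[OF rng[OF True]]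
          by (intro mult_mono) (auto intro: order_trans)
        then show ?thesis using True by (simp add: f_def ennreal_leI)
      qed simp
    qed
    show "(\<integral>\<^sup>+t. ennreal B * indicator {0..\<theta>} t \<partial>lborel) < \<infinity>"
      using x(2) by (simp add: nn_integral_cmult ennreal_mult_less_top)
  qed (use Fm AE in auto)
  then have "(\<lambda>k. (\<integral>\<^sup>+t\<in>{0..\<theta>}. ennreal (f k t) \<partial>lborel) + ennreal (exp (- ?a * \<theta>) * u (x + ?s * \<theta>)))
     \<longlonglongrightarrow> (\<integral>\<^sup>+t. F t \<partial>lborel) + ennreal (exp (- ?a * \<theta>) * u (x + ?s * \<theta>))"
    by (intro tendsto_add) auto
  then have "ennreal (u x) \<le> (\<integral>\<^sup>+t. F t \<partial>lborel) + ennreal (exp (- ?a * \<theta>) * u (x + ?s * \<theta>))"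
    using step by (intro LIMSEQ_le_const) auto
  also have "(\<integral>\<^sup>+t. F t \<partial>lborel) = (\<integral>\<^sup>+t\<in>{0..<\<theta>}. ennreal (exp (- ?a * t) *
      (arr_rate S * jump_mean S u (x + ?s * t) + hold C i (x + ?s * t))) \<partial>lborel)"
    using Feq by (intro nn_integral_cong) (auto simp: indicator_def g_def F_def)
  finally show ?thesis .
qed

text \<open>Test functions touch \<open>u\<close> from above on a dense set only: a steep parabola touches near its vertex.\<close>

lemma obstacle_dense:
  assumes vis: "\<And>x. x \<in> {lo..<hi} \<Longrightarrow> viscosity_supersolution S i j u x"
    and x: "lo \<le> x\<^sub>0" "x\<^sub>0 < x\<^sub>1" "x\<^sub>1 \<le> hi"
  obtains y where "x\<^sub>0 < y" "y < x\<^sub>1" "u y \<le> opt_cost S j y + swcost S i j"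
proof -
  obtain L where L: "L-lipschitz_on {lo..hi} u" using supersolution_continuous[OF vis] by blast
  have L0: "0 \<le> L" using L by (rule lipschitz_on_nonneg)
  define m where "m = (x\<^sub>0 + x\<^sub>1) / 2"
  \<comment> \<open>At the maximum point the parabola has dropped by no more than \<open>u\<close>,
    with Lipschitz constant \<open>L\<close>, can have gained. This puts the point at distance less
    than \<open>(L + 1) / c\<close> from the vertex, and for this \<open>c\<close> that is half the
    length of the interval.\<close>
  define c where "c = (2 * L + 2) / (x\<^sub>1 - x\<^sub>0)"
  have c: "0 < c" using L0 x by (simp add: c_def)
  have m: "m \<in> {lo..hi}" using x by (simp add: m_def)
  have "continuous_on {lo..hi} (\<lambda>y. u y - c * (y - m)\<^sup>2)"
    using lipschitz_on_continuous_on[OF L] by (intro continuous_intros)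
  then obtain y where y: "y \<in> {lo..hi}" and max: "\<And>z. z \<in> {lo..hi} \<Longrightarrow> u z - c * (z - m)\<^sup>2 \<le> u y - c * (y - m)\<^sup>2"
    using continuous_attains_sup[of "{lo..hi}" "\<lambda>y. u y - c * (y - m)\<^sup>2"] params by auto
  have "c * (y - m)\<^sup>2 \<le> u y - u m" using max[OF m] by simp
  also have "\<dots> \<le> L * \<bar>y - m\<bar>" using lipschitz_onD[OF L y m] by (simp add: dist_real_def)
  finally have "c * \<bar>y - m\<bar> * \<bar>y - m\<bar> \<le> L * \<bar>y - m\<bar>" by (simp add: power2_eq_square abs_mult_self_eq mult.assoc)
  then have "y = m \<or> c * \<bar>y - m\<bar> \<le> L" by (auto simp: mult_le_cancel_right)
  then have "c * \<bar>y - m\<bar> < L + 1" using L0 by auto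
  then have "\<bar>y - m\<bar> < (L + 1) / c" using c by (simp add: field_simps)
  also have "(L + 1) / c = (x\<^sub>1 - x\<^sub>0) / 2" using L0 x by (simp add: c_def field_simps)
  finally have near: "x\<^sub>0 < y" "y < x\<^sub>1" by (auto simp: m_def abs_real_def field_simps split: if_splits)
  define \<phi> where "\<phi> z = c * (z - m)\<^sup>2 + (u y - c * (y - m)\<^sup>2)" for z
  have "(\<phi> has_real_derivative 2 * c * (z - m)) (at z within {lo..hi})" for z
    unfolding \<phi>_def by (auto intro!: derivative_eq_intros)
  then have "C1_on_interval lo hi \<phi>"
    unfolding C1_on_interval_def has_real_derivative_iff_has_vector_derivative
    by (intro exI[of _ "\<lambda>z. 2 * c * (z - m)"] conjI ballI continuous_intros) auto
  moreover have "\<phi> y = u y" by (simp add: \<phi>_def)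
  moreover have "\<forall>z\<in>{lo..hi}. u z - \<phi> z \<le> u y - \<phi> y"
  proof
    fix z assume "z \<in> {lo..hi}"
    from max[OF this] show "u z - \<phi> z \<le> u y - \<phi> y" by (simp add: \<phi>_def)
  qed
  ultimately have "0 \<le> opt_cost S j y + swcost S i j - u y"
    using vis[of y] near x unfolding viscosity_supersolution_def by fastforce
  then show ?thesis using near by (intro that[of y]) auto
qed

end

section \<open>Restarting a strategy\<close>

lemma same_upto_delay:
  assumes "0 \<le> s" "same_upto t z z'" shows "same_upto (s + t) (delay s z) (delay s z')"
proof -
  obtain n where n: "\<forall>m<n. fst z m = fst z' m \<and> snd z m = snd z' m" "(\<Sum>m<n. fst z m) \<le> t"
    "t < (\<Sum>m<Suc n. fst z m)" "t < (\<Sum>m<Suc n. fst z' m)"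
    using assms(2) unfolding same_upto_def by blast
  have "(\<Sum>m<n. fst (delay s z) m) \<le> s + t"
    using n(2) assms(1) delay_arrival[where n="n - 1" and s=s and z=z] by (cases n) (auto simp del: sum.lessThan_Suc)
  then show ?thesis unfolding same_upto_def delay_arrival using n
    by (intro exI[of _ n]) (simp add: delay_def del: sum.lessThan_Suc)
qed

lemma same_upto_prepend:
  assumes "same_upto t z z'" shows "same_upto (w + t) (prepend w y z) (prepend w y z')"
proof -
  obtain n where n: "\<forall>m<n. fst z m = fst z' m \<and> snd z m = snd z' m" "(\<Sum>m<n. fst z m) \<le> t"
    "t < (\<Sum>m<Suc n. fst z m)" "t < (\<Sum>m<Suc n. fst z' m)"
    using assms unfolding same_upto_def by blast
  have "\<forall>m<Suc n. fst (prepend w y z) m = fst (prepend w y z') m \<and> snd (prepend w y z) m = snd (prepend w y z') m"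
    using n(1) by (auto simp: prepend_def split: nat.split)
  then show ?thesis unfolding same_upto_def prepend_arrival using n
    by (intro exI[of _ "Suc n"]) (simp add: prepend_arrival del: sum.lessThan_Suc)
qed

context inventory_system begin

lemma AE_C_iff: "(AE z in pspace C. R z) \<longleftrightarrow> (AE z in path_measure S. z \<in> good_paths \<longrightarrow> R z)"
  unfolding canonical_simps using good_paths_sets sets_path_measure[of S] by (intro AE_restrict_space_iff) simp

lemma prepend_integral_measurable:
  assumes f: "f \<in> borel_measurable path_borel"
  shows "(\<lambda>(p, z). f (prepend (fst p) (snd p) z)) \<in> borel_measurable ((WW \<Otimes>\<^sub>M dF S) \<Otimes>\<^sub>M path_measure S)"
    and "(\<lambda>(w, y). \<integral>\<^sup>+z. f (prepend w y z) \<partial>path_measure S) \<in> borel_measurable (WW \<Otimes>\<^sub>M dF S)"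
    and "(\<lambda>w. \<integral>\<^sup>+y. \<integral>\<^sup>+z. f (prepend w y z) \<partial>path_measure S \<partial>dF S) \<in> borel_measurable WW"
proof -
  have s1: "sets ((WW \<Otimes>\<^sub>M dF S) \<Otimes>\<^sub>M path_measure S) = sets ((borel \<Otimes>\<^sub>M borel) \<Otimes>\<^sub>M path_borel)"
    by (intro sets_pair_measure_cong sets_path_measure) auto
  have "(\<lambda>p. (fst (fst p), snd (fst p), snd p)) \<in> (borel \<Otimes>\<^sub>M borel) \<Otimes>\<^sub>M path_borel \<rightarrow>\<^sub>M borel \<Otimes>\<^sub>M (borel \<Otimes>\<^sub>M path_borel)"
    by simp
  from measurable_compose[OF this measurable_compose[OF prepend_measurable f]]
  show g: "(\<lambda>(p, z). f (prepend (fst p) (snd p) z)) \<in> borel_measurable ((WW \<Otimes>\<^sub>M dF S) \<Otimes>\<^sub>M path_measure S)"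
    by (simp add: measurable_cong_sets[OF s1 refl] case_prod_beta')
  from Q.borel_measurable_nn_integral[OF g]
  show 1: "(\<lambda>(w, y). \<integral>\<^sup>+z. f (prepend w y z) \<partial>path_measure S) \<in> borel_measurable (WW \<Otimes>\<^sub>M dF S)"
    by (simp add: case_prod_beta')
  from F.borel_measurable_nn_integral[OF 1]
  show "(\<lambda>w. \<integral>\<^sup>+y. \<integral>\<^sup>+z. f (prepend w y z) \<partial>path_measure S \<partial>dF S) \<in> borel_measurable WW" .
qed

end

locale admissible_strategy = inventory_system S for S :: "'a inventory_data" +
  fixes x i T J
  assumes adm: "admissible (canonical S) x i T J"
    and x_range: "lmin S \<le> x" "x \<le> cap S" and i_range: "i \<in> {0,1,2}" and full: "i = 0 \<longrightarrow> x = cap S"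
begin

sublocale canonical_strategy S i T J using adm by (rule admissible_canonical_strategy)

lemma adapted: "0 \<le> t \<Longrightarrow> phase T J t \<in> demand_filtration C t \<rightarrow>\<^sub>M count_space UNIV"
  using adm by (simp add: admissible_iff)

lemma rules_AE: "AE z in pspace C. operating_rules C x T J z"
  using adm by (simp add: admissible_iff)

lemma rules_sets: "{z\<in>space M. operating_rules C x T J z} \<in> sets M"
  by (rule operating_rules_sets[OF x_range full])

lemma same_phase:
  "0 \<le> t \<Longrightarrow> z \<in> good_paths \<Longrightarrow> z' \<in> good_paths \<Longrightarrow> same_upto t z z' \<Longrightarrow> phase T J t z = phase T J t z'"
  using C_nonanticipative[OF adapted] by blast

lemma pre_arrival_phase:
  assumes "0 \<le> t" "z \<in> good_paths" "z' \<in> good_paths" "t < fst z 0" "t < fst z' 0"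
  shows "phase T J t z = phase T J t z'"
  using assms by (intro same_phase) (auto simp: same_upto_def intro!: exI[of _ 0])

lemma phase_at_first_switch: "z \<in> good_paths \<Longrightarrow> T 1 z = ereal t \<Longrightarrow> phase T J t z = J 1 z \<and> J 1 z \<noteq> i \<and> 0 \<le> t"
  using phase_eq[OF sw, of z 1 t] switching_path_strict[OF sw, of z 1] switching_path_neq[OF sw, of z 0]
    switching_path_nonneg[OF sw, of z 1] switching_path_0(2)[OF sw, of z] by (simp add: zero_ereal_def)

lemma phase_before_first_switch: "z \<in> good_paths \<Longrightarrow> 0 \<le> t \<Longrightarrow> ereal t < T 1 z \<Longrightarrow> phase T J t z = i"
  using phase_eq[OF sw, of z 0 t] switching_path_0[OF sw, of z] by (simp add: zero_ereal_def)

text \<open>Expresses the first switch through the phase process, to which nonanticipation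
  applies.\<close>

lemma first_switch_iff:
  assumes "z \<in> good_paths" "0 \<le> t"
  shows "T 1 z \<le> ereal t \<longleftrightarrow> (\<exists>s. 0 \<le> s \<and> s \<le> t \<and> phase T J s z \<noteq> i)"
proof
  assume le: "T 1 z \<le> ereal t"
  then obtain s where s: "T 1 z = ereal s"
    using switching_path_nonneg[OF sw[OF assms(1)], of 1] by (cases "T 1 z") auto
  then show "\<exists>s. 0 \<le> s \<and> s \<le> t \<and> phase T J s z \<noteq> i"
    using phase_at_first_switch[OF assms(1) s] le by (intro exI[of _ s]) auto
next
  assume "\<exists>s. 0 \<le> s \<and> s \<le> t \<and> phase T J s z \<noteq> i"
  then obtain s where s: "0 \<le> s" "s \<le> t" "phase T J s z \<noteq> i" by blast
  then have "\<not> ereal s < T 1 z" using phase_before_first_switch[OF assms(1)] by blast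
  then show "T 1 z \<le> ereal t" using s(2) by (metis ereal_less_eq(3) not_less order_trans)
qed

lemma first_switch_pre_arrival:
  assumes "z \<in> good_paths" "z' \<in> good_paths" "0 \<le> t" "t < fst z 0" "t < fst z' 0"
  shows "T 1 z \<le> ereal t \<longleftrightarrow> T 1 z' \<le> ereal t"
proof -
  have "phase T J s z = phase T J s z'" if "0 \<le> s" "s \<le> t" for s
    using that assms by (intro pre_arrival_phase) auto
  then have "(\<exists>s. 0 \<le> s \<and> s \<le> t \<and> phase T J s z \<noteq> i) \<longleftrightarrow> (\<exists>s. 0 \<le> s \<and> s \<le> t \<and> phase T J s z' \<noteq> i)"
    by metis
  then show ?thesis unfolding first_switch_iff[OF assms(1,3)] first_switch_iff[OF assms(2,3)] .
qed

text \<open>Extended by 0 from the good paths to the full product space, where the laws of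
  \<open>delay\<close> and \<open>prepend\<close> are stated.\<close>

definition total_cost :: "(nat \<Rightarrow> real) \<times> (nat \<Rightarrow> real) \<Rightarrow> ennreal" where
  "total_cost z = path_cost C x T J z * indicator good_paths z"

lemma total_cost_measurable: "total_cost \<in> borel_measurable path_borel"
proof -
  have "(\<lambda>z. path_cost C x T J z * indicator good_paths z) \<in> borel_measurable (path_measure S)"
    using path_cost_measurable[of x] borel_measurable_restrict_space_iff_ennreal[of good_paths "path_measure S" "path_cost C x T J"]
      good_paths_sets sets_path_measure[of S] by simp
  then show ?thesis by (simp add: total_cost_def[abs_def] measurable_cong_sets[OF sets_path_measure refl])
qed

lemma cost_total: "cost C x T J = (\<integral>\<^sup>+z. total_cost z \<partial>path_measure S)"
  unfolding cost_canonical total_cost_def by (rule nn_integral_canonical)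

definition hold_until :: "real \<Rightarrow> ennreal" where
  "hold_until s = (\<integral>\<^sup>+t\<in>{0..<s}. ennreal (exp (- disc S * t) * hold C i (x + prate S i * t)) \<partial>lborel)"

lemma inventory_first_phase:
  assumes z: "z \<in> good_paths" and ph: "\<And>r. 0 \<le> r \<Longrightarrow> r < t \<Longrightarrow> phase T J r z = i" and t: "0 \<le> t" "t < fst z 0"
  shows "inventory C T J x t z = x + prate S i * t"
  using inventory_at[OF arrival_path_C[OF z], of 0 t T J x] produced_const[of 0 t T J z i C] ph t by simp

end

text \<open>
  After time \<open>s\<close>, the strategy sees the path \<open>z\<close> as the continuation of \<open>\<Psi> z\<close>. Since \<open>T\<close> and \<open>J\<close> are
  functions of the whole demand path, \<open>T' k z = T (k + \<kappa>) (\<Psi> z) - s\<close> defines the continuation as a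
  strategy from time 0 on.
\<close>

locale continuation = admissible_strategy S x i T J for S :: "'a inventory_data" and x i T J +
  fixes \<Psi> and s :: real and m \<kappa> j :: nat and x' :: real
  assumes \<Psi>: "\<Psi> \<in> path_borel \<rightarrow>\<^sub>M path_borel" and \<Psi>_good: "\<And>z. z \<in> good_paths \<Longrightarrow> \<Psi> z \<in> good_paths"
    and \<Psi>_same: "\<And>t z z'. 0 \<le> t \<Longrightarrow> same_upto t z z' \<Longrightarrow> same_upto (s + t) (\<Psi> z) (\<Psi> z')"
    and s: "0 \<le> s" "\<And>z. z \<in> good_paths \<Longrightarrow> arrival (canonical S) m (\<Psi> z) \<le> s"
      "\<And>z. z \<in> good_paths \<Longrightarrow> s < arrival (canonical S) (Suc m) (\<Psi> z)"
    and arr: "\<And>n z. 1 \<le> n \<Longrightarrow> arrival (canonical S) n z = arrival (canonical S) (n + m) (\<Psi> z) - s"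
    and dem: "\<And>n z. 1 \<le> n \<Longrightarrow> demand (canonical S) n z = demand (canonical S) (n + m) (\<Psi> z)"
    and \<kappa>: "\<And>z. z \<in> good_paths \<Longrightarrow> T \<kappa> (\<Psi> z) \<le> ereal s" "\<And>z. z \<in> good_paths \<Longrightarrow> ereal s < T (Suc \<kappa>) (\<Psi> z)"
    and j: "\<And>z. z \<in> good_paths \<Longrightarrow> J \<kappa> (\<Psi> z) = j"
    and x': "\<And>z. z \<in> good_paths \<Longrightarrow> inventory (canonical S) T J x s (\<Psi> z) = x'"
    and rules_\<Psi>: "AE z in pspace (canonical S). operating_rules (canonical S) x T J (\<Psi> z)"
begin

definition "T' k z = (if k = 0 then 0 else T (k + \<kappa>) (\<Psi> z) - ereal s)"
definition "J' k z = J (k + \<kappa>) (\<Psi> z)"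

lemma shift:
  assumes z: "z \<in> good_paths" shows "strategy_shift C (\<Psi> z) z T J T' J' s m \<kappa> x x' i"
proof (rule strategy_shift.intro, goal_cases)
  case 1 show ?case by (rule arrival_path_C[OF \<Psi>_good[OF z]])
next
  case 2 show ?case by (rule arrival_path_C[OF z])
next
  case 3 show ?case unfolding canonical_simps by (rule params(5))
next
  case 4 show ?case by (rule sw[OF \<Psi>_good[OF z]])
next
  case 5 show ?case by (rule s(1))
next
  case 6 show ?case by (rule s(2)[OF z])
next
  case 7 show ?case by (rule s(3)[OF z])
next
  case (8 n) then show ?case by (rule arr)
next
  case (9 n) then show ?case by (rule dem)
next
  case 10 show ?case by (rule \<kappa>(1)[OF z])
next
  case 11 show ?case by (rule \<kappa>(2)[OF z])
next
  case (12 k) show ?case by (rule T'_def)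
next
  case (13 k) show ?case by (rule J'_def)
next
  case 14 show ?case by (rule x'[OF z, symmetric])
qed

lemma T'_pos: "z \<in> good_paths \<Longrightarrow> 0 < T' 1 z"
  by (rule strategy_shift.T'_pos[OF shift])

text \<open>If \<open>z\<close> and \<open>z'\<close> agree up to \<open>t\<close>, then
  \<open>\<Psi> z\<close> and \<open>\<Psi> z'\<close> agree up to \<open>s + t\<close>, so
  Galmarino's test gives adaptedness. The rules pass to the restarted strategy path by path.\<close>

lemma admissible_continuation: "admissible C x' j T' J'"
  unfolding admissible_iff
proof (intro conjI allI impI)
  show "switching_strategy C j T' J'"
    unfolding switching_strategy_iff space_C using strategy_shift.switching_path_shift[OF shift] j by auto
  show "AE z in pspace C. operating_rules C x' T' J' z"
    using rules_\<Psi> AE_space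
  proof eventually_elim
    case (elim z)
    then have "z \<in> good_paths" by (simp only: space_C)
    from strategy_shift.operating_rules_shift[OF shift[OF this] elim(1)] show ?case .
  qed
  fix t :: real assume t: "0 \<le> t"
  have ph: "phase T' J' t z = phase T J (s + t) (\<Psi> z)" if "z \<in> good_paths" for z
    using strategy_shift.phase_shift[OF shift[OF that] t] .
  show "phase T' J' t \<in> demand_filtration C t \<rightarrow>\<^sub>M count_space UNIV"
  proof (rule galmarino[OF _ t])
    have "\<Psi> \<in> M \<rightarrow>\<^sub>M path_borel"
      using \<Psi> by (auto intro!: measurable_restrict_space1 simp: measurable_cong_sets[OF sets_path_measure refl])
    then have "\<Psi> \<in> M \<rightarrow>\<^sub>M M"
      using \<Psi>_good by (auto intro!: measurable_restrict_space2 simp: space_canonical measurable_cong_sets[OF refl sets_path_measure])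
    from measurable_compose[OF this phase_meas[of "s + t"]]
    have "(\<lambda>z. phase T J (s + t) (\<Psi> z)) \<in> M \<rightarrow>\<^sub>M count_space UNIV" using s(1) t by simp
    then show "phase T' J' t \<in> M \<rightarrow>\<^sub>M count_space UNIV"
      by (rule measurable_cong[THEN iffD1, rotated]) (use ph in \<open>simp add: space_canonical\<close>)
  next
    fix z z' assume z: "z \<in> good_paths" "z' \<in> good_paths" "same_upto t z z'"
    have "phase T J (s + t) (\<Psi> z) = phase T J (s + t) (\<Psi> z')"
      using s(1) t z by (intro same_phase \<Psi>_good \<Psi>_same) auto
    then show "phase T' J' t z = phase T' J' t z'" using ph z by simp
  qed
qed

lemma total_cost_continuation:
  assumes z: "z \<in> good_paths" and ph: "\<And>r. 0 \<le> r \<Longrightarrow> r < s \<Longrightarrow> phase T J r (\<Psi> z) = i" and le: "s \<le> fst (\<Psi> z) 0"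
  shows "total_cost (\<Psi> z) = hold_until s + (\<Sum>k<\<kappa>. switch_term C T J (\<Psi> z) k) + (\<Sum>n<m. penalty_term C x T J (\<Psi> z) n)
    + ennreal (exp (- disc S * s)) * path_cost C x' T' J' z"
proof -
  have h: "(\<integral>\<^sup>+t\<in>{0..<s}. ennreal (exp (- disc C * t) * hold C (phase T J t (\<Psi> z)) (inventory C T J x t (\<Psi> z))) \<partial>lborel) = hold_until s"
    unfolding hold_until_def
  proof (intro nn_integral_cong)
    fix t
    have "inventory C T J x t (\<Psi> z) = x + prate S i * t" if "0 \<le> t" "t < s"
      using that ph le by (intro inventory_first_phase \<Psi>_good z) auto
    then show "ennreal (exp (- disc C * t) * hold C (phase T J t (\<Psi> z)) (inventory C T J x t (\<Psi> z))) * indicator {0..<s} t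
      = ennreal (exp (- disc S * t) * hold C i (x + prate S i * t)) * indicator {0..<s} t"
      using ph[of t] by (auto simp: indicator_def)
  qed
  show ?thesis
    unfolding total_cost_def strategy_shift.path_cost_shift[OF shift[OF z] hold_integrand_measurable[OF \<Psi>_good[OF z]]] h
    using \<Psi>_good[OF z] by simp
qed

end

context admissible_strategy begin

lemma rules_null: "(\<integral>\<^sup>+z. indicator (good_paths - {z\<in>good_paths. operating_rules C x T J z}) z \<partial>path_measure S) = 0"
  and rules_null_sets: "good_paths - {z\<in>good_paths. operating_rules C x T J z} \<in> sets path_borel"
proof -
  have *: "{z\<in>good_paths. operating_rules C x T J z} \<in> sets path_borel"
    using rules_sets good_paths_sets sets_path_measure[of S] by (auto simp: space_canonical sets_restrict_space_iff)
  then show s: "good_paths - {z\<in>good_paths. operating_rules C x T J z} \<in> sets path_borel"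
    using good_paths_sets by blast
  have "AE z in path_measure S. z \<in> good_paths \<longrightarrow> operating_rules C x T J z"
    using rules_AE unfolding AE_C_iff .
  then have "AE z in path_measure S. z \<notin> good_paths - {z\<in>good_paths. operating_rules C x T J z}" by eventually_elim simp
  then show "(\<integral>\<^sup>+z. indicator (good_paths - {z\<in>good_paths. operating_rules C x T J z}) z \<partial>path_measure S) = 0"
    using s sets_path_measure[of S] by (subst nn_integral_0_iff_AE) (auto simp: indicator_def elim: eventually_mono)
qed

text \<open>The delayed path has the conditional law given no arrival up to \<open>s\<close>, an
  event of positive probability, so an exceptional null set stays one.\<close>

lemma rules_delay_AE:
  assumes s: "0 \<le> s" shows "AE z in pspace C. operating_rules C x T J (delay s z)"
proof -
  let ?B = "good_paths - {z\<in>good_paths. operating_rules C x T J z}"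
  have m: "(\<lambda>z. indicator ?B z :: ennreal) \<in> borel_measurable path_borel" using rules_null_sets by simp
  have "ennreal (exp (- arr_rate S * s)) * (\<integral>\<^sup>+z. indicator ?B (delay s z) \<partial>path_measure S)
      = (\<integral>\<^sup>+z. indicator ?B z * indicator {z. s < fst z 0} z \<partial>path_measure S)"
    by (rule memoryless[OF m s, symmetric])
  also have "\<dots> \<le> (\<integral>\<^sup>+z. indicator ?B z \<partial>path_measure S)"
    by (intro nn_integral_mono) (auto simp: indicator_def)
  finally have "(\<integral>\<^sup>+z. indicator ?B (delay s z) \<partial>path_measure S) = 0" using rules_null by simp
  moreover have "(\<lambda>z. indicator ?B (delay s z) :: ennreal) \<in> borel_measurable (path_measure S)"
    using measurable_compose[OF delay_measurable m] by (simp add: measurable_cong_sets[OF sets_path_measure refl])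
  ultimately have "AE z in path_measure S. indicator ?B (delay s z) = (0::ennreal)"
    by (simp only: nn_integral_0_iff_AE)
  then show ?thesis unfolding AE_C_iff
  proof eventually_elim
    case (elim z)
    then show ?case using delay_good[OF s, of z] by (auto simp: indicator_def split: if_splits)
  qed
qed

text \<open>By \<open>first_arrival_law\<close> an exceptional null set has null sections for almost
  every first inter-arrival time and demand.\<close>

lemma rules_prepend_AE:
  "AE w in WW. AE y in dF S. AE z in pspace C. 0 < w \<and> 0 < y \<longrightarrow> operating_rules C x T J (prepend w y z)"
proof -
  let ?B = "good_paths - {z\<in>good_paths. operating_rules C x T J z}"
  have m: "(\<lambda>z. indicator ?B z :: ennreal) \<in> borel_measurable path_borel" using rules_null_sets by simp
  note g = prepend_integral_measurable[OF m]
  have "(\<integral>\<^sup>+w. \<integral>\<^sup>+y. \<integral>\<^sup>+z. indicator ?B (prepend w y z) \<partial>path_measure S \<partial>dF S \<partial>WW) = 0"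
    using first_arrival_law[OF m] rules_null by simp
  then have "AE w in WW. (\<integral>\<^sup>+y. \<integral>\<^sup>+z. indicator ?B (prepend w y z) \<partial>path_measure S \<partial>dF S) = 0"
    by (simp only: nn_integral_0_iff_AE[OF g(3)])
  then show ?thesis
  proof eventually_elim
    case (elim w)
    have "(\<lambda>y. \<integral>\<^sup>+z. indicator ?B (prepend w y z) \<partial>path_measure S) \<in> borel_measurable (dF S)"
      using measurable_Pair2[OF g(2), of w] by simp
    from elim have "AE y in dF S. (\<integral>\<^sup>+z. indicator ?B (prepend w y z) \<partial>path_measure S) = 0"
      by (simp only: nn_integral_0_iff_AE[OF \<open>(\<lambda>y. \<integral>\<^sup>+z. indicator ?B (prepend w y z) \<partial>path_measure S) \<in> borel_measurable (dF S)\<close>])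
    then show ?case
    proof eventually_elim
      case (elim y)
      have "(\<lambda>z. indicator ?B (prepend w y z) :: ennreal) \<in> borel_measurable (path_measure S)"
        using measurable_Pair2[OF g(1), of "(w, y)"] by (simp add: space_pair_measure)
      from elim have "AE z in path_measure S. indicator ?B (prepend w y z) = (0::ennreal)"
        by (simp only: nn_integral_0_iff_AE[OF \<open>(\<lambda>z. indicator ?B (prepend w y z) :: ennreal) \<in> borel_measurable (path_measure S)\<close>])
      then show ?case unfolding AE_C_iff
      proof eventually_elim
        case (elim z)
        then show ?case using prepend_good[of w y z] by (auto simp: indicator_def split: if_splits)
      qed
    qed
  qed
qed

end

context inventory_system begin

lemma WW_AE: "AE w in WW. 0 < w" "AE w in WW. w \<noteq> c"
proof -
  have "AE w in lborel. 0 < ennreal (exponential_density (arr_rate S) w) \<longrightarrow> 0 < w"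
    using AE_lborel_singleton[of 0] by eventually_elim (auto simp: exponential_density_def split: if_splits)
  then show "AE w in WW. 0 < w" by (subst AE_density) auto
  have "AE w in lborel. 0 < ennreal (exponential_density (arr_rate S) w) \<longrightarrow> w \<noteq> c"
    using AE_lborel_singleton[of c] by eventually_elim auto
  then show "AE w in WW. w \<noteq> c" by (subst AE_density) auto
qed

lemma exponential_total: "0 < a \<Longrightarrow> (\<integral>\<^sup>+w\<in>{0<..}. ennreal (exp (- a * w)) \<partial>lborel) = ennreal (1 / a)"
proof -
  assume a: "0 < a"
  interpret E: prob_space "density lborel (exponential_density a)" using a by (rule prob_space_exponential_density)
  have "(\<integral>\<^sup>+w. ennreal (exponential_density a w) \<partial>lborel) = 1"
    using E.emeasure_space_1 by (simp add: emeasure_density)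
  then have "ennreal (1 / a) = ennreal (1 / a) * (\<integral>\<^sup>+w. ennreal (exponential_density a w) \<partial>lborel)" by simp
  also have "\<dots> = (\<integral>\<^sup>+w. ennreal (1 / a) * ennreal (exponential_density a w) \<partial>lborel)"
    by (rule nn_integral_cmult[symmetric]) simp
  also have "\<dots> = (\<integral>\<^sup>+w\<in>{0<..}. ennreal (exp (- a * w)) \<partial>lborel)"
  proof (rule nn_integral_cong_AE)
    show "AE w in lborel. ennreal (1 / a) * ennreal (exponential_density a w) = ennreal (exp (- a * w)) * indicator {0<..} w"
      using AE_lborel_singleton[of 0]
      by eventually_elim (use a in \<open>auto simp: exponential_density_def indicator_def ennreal_mult'[symmetric]\<close>)
  qed
  finally show ?thesis by simp
qed

definition "\<rho> = arr_rate S / (arr_rate S + disc S)"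

lemma \<rho>: "0 < \<rho>" "\<rho> < 1"
  using arr_rate_pos params(3) by (auto simp: \<rho>_def)

lemma discount_mean: "(\<integral>\<^sup>+w. ennreal (exp (- disc S * w)) \<partial>WW) = ennreal \<rho>"
proof -
  let ?a = "arr_rate S + disc S"
  have a: "0 < ?a" using arr_rate_pos params(3) by simp
  have "(\<integral>\<^sup>+w. ennreal (exp (- disc S * w)) \<partial>WW) =
      (\<integral>\<^sup>+w\<in>{0<..}. ennreal (arr_rate S * exp (- arr_rate S * w)) * ennreal (exp (- disc S * w)) \<partial>lborel)"
    by (rule nn_integral_WW) simp
  also have "\<dots> = (\<integral>\<^sup>+w. ennreal (arr_rate S) * (ennreal (exp (- ?a * w)) * indicator {0<..} w) \<partial>lborel)"
  proof (intro nn_integral_cong)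
    fix w
    have "exp (- ?a * w) = exp (- arr_rate S * w) * exp (- disc S * w)" by (simp add: exp_add[symmetric] algebra_simps)
    then show "ennreal (arr_rate S * exp (- arr_rate S * w)) * ennreal (exp (- disc S * w)) * indicator {0<..} w =
      ennreal (arr_rate S) * (ennreal (exp (- ?a * w)) * indicator {0<..} w)"
      using arr_rate_pos by (simp add: ennreal_mult' mult_ac)
  qed
  also have "\<dots> = ennreal (arr_rate S) * ennreal (1 / ?a)"
    by (subst nn_integral_cmult) (simp_all only: exponential_total[OF a], measurable)
  also have "\<dots> = ennreal \<rho>" using arr_rate_pos by (simp add: \<rho>_def ennreal_mult'[symmetric])
  finally show ?thesis .
qed

text \<open>Memorylessness again: beyond \<open>\<theta>\<close> the mean discount is that of a
  fresh start, weighted with survival and discount up to \<open>\<theta>\<close>.\<close>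

lemma discount_tail:
  assumes \<theta>: "0 \<le> \<theta>"
  shows "(\<integral>\<^sup>+w. indicator {\<theta><..} w * ennreal (exp (- disc S * w)) \<partial>WW) =
    ennreal (exp (- (arr_rate S + disc S) * \<theta>)) * ennreal \<rho>"
proof -
  have f: "(\<lambda>z. ennreal (exp (- disc S * fst z 0))) \<in> borel_measurable path_borel" by measurable
  have g: "(\<lambda>z. ennreal (exp (- disc S * fst z 0)) * indicator {z. \<theta> < fst z 0} z) \<in> borel_measurable path_borel"
  proof -
    have "{z. \<theta> < fst z 0} = {z\<in>space path_borel. \<theta> < fst z 0}" by simp
    also have "\<dots> \<in> sets path_borel" by measurable
    finally show ?thesis using f by simp
  qed
  have "(\<integral>\<^sup>+w. indicator {\<theta><..} w * ennreal (exp (- disc S * w)) \<partial>WW)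
      = (\<integral>\<^sup>+z. ennreal (exp (- disc S * fst z 0)) * indicator {z. \<theta> < fst z 0} z \<partial>path_measure S)"
    unfolding interarrival_law[OF g] by (simp add: indicator_def Q.emeasure_space_1[simplified] mult.commute)
  also have "\<dots> = ennreal (exp (- arr_rate S * \<theta>)) * (\<integral>\<^sup>+z. ennreal (exp (- disc S * (\<theta> + fst z 0))) \<partial>path_measure S)"
    using memoryless[OF f \<theta>] by (simp add: delay_def)
  also have "(\<integral>\<^sup>+z. ennreal (exp (- disc S * (\<theta> + fst z 0))) \<partial>path_measure S) =
      (\<integral>\<^sup>+z. ennreal (exp (- disc S * \<theta>)) * ennreal (exp (- disc S * fst z 0)) \<partial>path_measure S)"
    by (intro nn_integral_cong) (simp add: ennreal_mult'[symmetric] exp_add[symmetric] algebra_simps)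
  also have "\<dots> = ennreal (exp (- disc S * \<theta>)) * (\<integral>\<^sup>+z. ennreal (exp (- disc S * fst z 0)) \<partial>path_measure S)"
    using f by (intro nn_integral_cmult) (simp add: measurable_cong_sets[OF sets_path_measure refl])
  also have "(\<integral>\<^sup>+z. ennreal (exp (- disc S * fst z 0)) \<partial>path_measure S) = ennreal \<rho>"
    unfolding interarrival_law[OF f] discount_mean[symmetric] by (simp add: Q.emeasure_space_1[simplified])
  finally show ?thesis
    unfolding mult.assoc[symmetric] ennreal_mult'[symmetric, OF exp_ge_zero] exp_add[symmetric]
    by (simp add: distrib_right left_diff_distrib)
qed

text \<open>Supplies a reference path. Quantities that are deterministic before the first arrival,
  such as the first switching time, are read off one path that obeys the rules and has a late first
  arrival.\<close>

lemma AE_C_ex: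
  assumes "AE z in pspace C. R z" and c: "0 \<le> c" shows "\<exists>z\<in>good_paths. R z \<and> c < fst z 0"
proof (rule ccontr)
  assume no: "\<not> ?thesis"
  have "AE z in path_measure S. \<not> c < fst z 0"
    using assms(1) good_paths_AE unfolding AE_C_iff by eventually_elim (use no in blast)
  then have "(\<integral>\<^sup>+z. 1 * indicator {z. c < fst z 0} z \<partial>path_measure S) = (\<integral>\<^sup>+z. 0 \<partial>path_measure S)"
    by (intro nn_integral_cong_AE) (auto elim!: eventually_mono)
  then show False using memoryless[of "\<lambda>_. 1" c] Q.emeasure_space_1 c by simp
qed

lemma opt_cost_le:
  assumes "admissible_strategy S x j T J" shows "ennreal (opt_cost S j x) \<le> cost C x T J"
proof -
  interpret admissible_strategy S x j T J by fact
  obtain T' J' where a: "admissible S x j T' J'" "cost S x T' J' = cost C x T J"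
    using pull_back_admissible[OF adm x_range full] by blast
  let ?I = "Inf {cost S x T J | T J. admissible S x j T J}"
  have "cost C x T J \<in> {cost S x T J | T J. admissible S x j T J}"
    unfolding mem_Collect_eq by (rule exI[of _ T'], rule exI[of _ J']) (use a in simp)
  then have "?I \<le> cost C x T J" by (rule Inf_lower)
  moreover have "ennreal (enn2real a) \<le> a" for a by (cases a) auto
  ultimately show ?thesis unfolding opt_cost_def by (rule order_trans[rotated])
qed

end

context continuation begin

text \<open>Level and phase at the restart are the same for all paths, so the rules on a single path
  place them in the admissible range.\<close>

lemma continuation_strategy: "admissible_strategy S x' j T' J'"
proof -
  obtain z where z: "z \<in> good_paths" and ru: "operating_rules C x T J (\<Psi> z)"
    using AE_C_ex[OF rules_\<Psi> order_refl] by blast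
  have ph: "phase T J s (\<Psi> z) = j" using phase_eq[OF sw[OF \<Psi>_good[OF z]] \<kappa>(1)[OF z] \<kappa>(2)[OF z]] j[OF z] by simp
  have lc: "lmin C < cap C" "good_rates (prate C)" "lmin C \<le> x" "x \<le> cap C" using params x_range by simp_all
  note r = inventory_range[OF lc(2) sw[OF \<Psi>_good[OF z]] arrival_path_C[OF \<Psi>_good[OF z]] lc(3,4,1) ru s(1)]
  have "j \<in> {0,1,2}" using switching_path_phases[OF sw[OF \<Psi>_good[OF z]], of \<kappa>] j[OF z] by simp
  moreover have "lo \<le> x'" "x' \<le> hi" "j = 0 \<longrightarrow> x' = hi" using r(1,2) x'[OF z] ph by auto
  ultimately show ?thesis
    using admissible_continuation by (intro admissible_strategy.intro inventory_system_axioms admissible_strategy_axioms.intro)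
qed

end

context admissible_strategy begin

text \<open>Restart at \<open>s\<close> given no arrival by then. The case
  \<open>\<kappa> = 0\<close> stands for no switch up to \<open>s\<close>, the case
  \<open>\<kappa> = 1\<close> for a first switch exactly at \<open>s\<close>, whose cost is charged
  before the restart.\<close>

lemma continuation_delay:
  assumes s: "0 \<le> s" and \<kappa>01: "\<kappa> = 0 \<or> \<kappa> = 1"
    and at: "\<And>z. z \<in> good_paths \<Longrightarrow> s < fst z 0 \<Longrightarrow> T \<kappa> z \<le> ereal s \<and> ereal s < T (Suc \<kappa>) z \<and> J \<kappa> z = j"
    and ph: "\<And>z r. z \<in> good_paths \<Longrightarrow> s < fst z 0 \<Longrightarrow> 0 \<le> r \<Longrightarrow> r < s \<Longrightarrow> phase T J r z = i"
  shows "\<exists>T' J'. admissible_strategy S (x + prate S i * s) j T' J' \<and> (\<forall>z\<in>good_paths. 0 < T' 1 z) \<and>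
    (\<integral>\<^sup>+z. total_cost z * indicator {z. s < fst z 0} z \<partial>path_measure S) = ennreal (exp (- arr_rate S * s)) *
      (hold_until s + (if \<kappa> = 1 then ennreal (exp (- disc S * s) * swcost S i j) else 0)
        + ennreal (exp (- disc S * s)) * cost C (x + prate S i * s) T' J')"
proof -
  let ?x = "x + prate S i * s"
  have gd: "delay s z \<in> good_paths" "s < fst (delay s z) 0" if "z \<in> good_paths" for z
    using delay_good[OF s that] that by (auto simp: delay_def good_paths_def)
  interpret continuation S x i T J "delay s" s 0 \<kappa> j ?x
  proof (rule continuation.intro[OF admissible_strategy_axioms], rule continuation_axioms.intro, goal_cases)
    case 1 show ?case by (rule delay_measurable)
  next
    case (2 z) then show ?case by (rule gd)
  next
    case (3 t z z') then show ?case using s by (intro same_upto_delay)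
  next
    case 4 show ?case by (rule s)
  next
    case (5 z) show ?case using s by simp
  next
    case (6 z) then show ?case using gd(2) by simp
  next
    case (7 n z) then show ?case using delay_arrival[of s z "n - 1"] by (cases n) (simp_all del: sum.lessThan_Suc)
  next
    case (8 n z) show ?case by (simp add: delay_def)
  next
    case (9 z) show ?case using at[OF gd[OF 9]] by blast
  next
    case (10 z) show ?case using at[OF gd[OF 10]] by blast
  next
    case (11 z) show ?case using at[OF gd[OF 11]] by blast
  next
    case (12 z) show ?case by (rule inventory_first_phase[OF gd(1)[OF 12] ph[OF gd[OF 12]] s gd(2)[OF 12]])
  next
    case 13 show ?case by (rule rules_delay_AE[OF s])
  qed
  interpret N: admissible_strategy S ?x j T' J' by (rule continuation_strategy)
  \<comment> \<open>By \<open>ph\<close> the first switch cannot come before \<open>s\<close>, so it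
    takes place at \<open>s\<close>.\<close>
  have first: "switch_term C T J (delay s z) 0 = ennreal (exp (- disc S * s) * swcost S i j)"
    if z: "z \<in> good_paths" and k: "\<kappa> = 1" for z
  proof -
    note g = gd[OF z]
    have 1: "T 1 (delay s z) \<le> ereal s" "J 1 (delay s z) = j" using at[OF g] k by auto
    obtain t where t: "T 1 (delay s z) = ereal t"
      using 1 switching_path_nonneg[OF sw[OF g(1)], of 1] by (cases "T 1 (delay s z)") auto
    have "\<not> t < s" using phase_at_first_switch[OF g(1) t] ph[OF g, of t] by auto
    then have "T 1 (delay s z) = ereal s" using 1 t by simp
    then show ?thesis using 1 switching_path_0(2)[OF sw[OF g(1)]] by (simp add: switch_term_def)
  qed
  have "(\<integral>\<^sup>+z. total_cost (delay s z) \<partial>path_measure S) =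
    (\<integral>\<^sup>+z. (hold_until s + (if \<kappa> = 1 then ennreal (exp (- disc S * s) * swcost S i j) else 0))
      + ennreal (exp (- disc S * s)) * N.total_cost z \<partial>path_measure S)"
  proof (rule nn_integral_cong_AE)
    show "AE z in path_measure S. total_cost (delay s z) =
      (hold_until s + (if \<kappa> = 1 then ennreal (exp (- disc S * s) * swcost S i j) else 0)) + ennreal (exp (- disc S * s)) * N.total_cost z"
      using good_paths_AE
    proof eventually_elim
      case (elim z)
      have "total_cost (delay s z) = hold_until s + (\<Sum>k<\<kappa>. switch_term C T J (delay s z) k)
          + ennreal (exp (- disc S * s)) * path_cost C ?x T' J' z"
        using total_cost_continuation[OF elim ph[OF gd[OF elim]]] gd(2)[OF elim] by simp
      then show ?case using \<kappa>01 first[OF elim] elim by (auto simp: N.total_cost_def)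
    qed
  qed
  also have "\<dots> = (hold_until s + (if \<kappa> = 1 then ennreal (exp (- disc S * s) * swcost S i j) else 0))
      + ennreal (exp (- disc S * s)) * cost C ?x T' J'"
    using N.total_cost_measurable Q.emeasure_space_1
    by (simp add: N.cost_total nn_integral_add nn_integral_cmult measurable_cong_sets[OF sets_path_measure refl])
  finally have eq: "(\<integral>\<^sup>+z. total_cost (delay s z) \<partial>path_measure S) =
     hold_until s + (if \<kappa> = 1 then ennreal (exp (- disc S * s) * swcost S i j) else 0)
        + ennreal (exp (- disc S * s)) * cost C ?x T' J'" .
  show ?thesis
    unfolding memoryless[OF total_cost_measurable s(1)] eq
    using continuation_strategy T'_pos by (intro exI[of _ T'] exI[of _ J']) simp
qed

text \<open>Restart at the first arrival, with its demand already subtracted. A strategy may react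
  to the arrival by switching at the same instant; this cost belongs to the part before the restart,
  and \<open>j\<close> is the phase after the reaction.\<close>

lemma continuation_prepend:
  assumes w: "0 < w" and y: "0 < y"
    and late: "\<And>z. z \<in> good_paths \<Longrightarrow> fst z 0 = w \<Longrightarrow> ereal w \<le> T 1 z"
    and rules: "AE z in pspace C. operating_rules C x T J (prepend w y z)"
  defines "v \<equiv> x + prate S i * w"
  shows "v \<in> {lo..hi} \<and> max lo (v - y) < hi \<and> (\<exists>T' J' j. admissible_strategy S (max lo (v - y)) j T' J' \<and> j \<in> {1,2} \<and>
    (\<forall>z\<in>good_paths. 0 < T' 1 z) \<and>
    (\<integral>\<^sup>+z. total_cost (prepend w y z) \<partial>path_measure S) = hold_until w +
      ennreal (exp (- disc S * w)) * (ennreal (if j = i then 0 else swcost S i j) + ennreal (excess_penalty S (y - (v - lo)))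
        + cost C (max lo (v - y)) T' J'))"
proof -
  let ?p = "prepend w y" and ?x = "max lo (v - y)"
  have gd: "?p z \<in> good_paths" "fst (?p z) 0 = w" "snd (?p z) 0 = y" if "z \<in> good_paths" for z
    using prepend_good[OF w y that] by (auto simp: prepend_def)
  have ph: "phase T J r (?p z) = i" if "z \<in> good_paths" "0 \<le> r" "r < w" for z r
    using phase_before_first_switch[OF gd(1)[OF that(1)] that(2)] late[OF gd(1,2)[OF that(1)]] that(3)
    by (meson ereal_less_eq(3) less_le_trans not_le)
  have before: "level_before C T J x (Suc 0) (?p z) = v" if z: "z \<in> good_paths" for z
    using produced_const[of 0 w T J "?p z" i C] ph[OF z] gd(2)[OF z] w by (simp add: level_before_def v_def)
  have after: "level_after C T J x (Suc 0) (?p z) = ?x" if z: "z \<in> good_paths" for z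
    using produced_const[of 0 w T J "?p z" i C] ph[OF z] gd[OF z] w by (simp add: Let_def v_def max_def min_def)
  have arr1: "arrival C (Suc 0) (?p z) = w" "w < arrival C (Suc (Suc 0)) (?p z)" if "z \<in> good_paths" for z
    using that prepend_arrival[of w y z 0] prepend_arrival[of w y z 1] by (auto simp: good_paths_def)
  obtain z0 where z0: "z0 \<in> good_paths" and ru: "operating_rules C x T J (?p z0)"
    using AE_C_ex[OF rules order_refl] by blast
  have lc: "lmin C < cap C" "good_rates (prate C)" "lmin C \<le> x" "x \<le> cap C" using params x_range by simp_all
  note rng = level_before_range[OF lc(2) sw[OF gd(1)[OF z0]] arrival_path_C[OF gd(1)[OF z0]] lc(3,4,1) ru]
    level_after_range[OF lc(2) sw[OF gd(1)[OF z0]] arrival_path_C[OF gd(1)[OF z0]] lc(3,4,1) ru]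
    inventory_range[OF lc(2) sw[OF gd(1)[OF z0]] arrival_path_C[OF gd(1)[OF z0]] lc(3,4,1) ru]
  have v: "v \<in> {lo..hi}" using rng(1)[of 0] before[OF z0] by simp
  have x'': "?x < hi" using rng(3)[of 0] after[OF z0] by simp
  have inv: "inventory C T J x w (?p z) = ?x" if z: "z \<in> good_paths" for z
    using inventory_at[OF arrival_path_C[OF gd(1)[OF z]], of "Suc 0" w T J x] arr1[OF z] after[OF z]
      produced_const[of w w T J "?p z" i C] by simp
  \<comment> \<open>Paths with the same first inter-arrival time and demand agree up to and
    including \<open>w\<close>, so the reaction at \<open>w\<close> does not depend on
    \<open>z\<close>.\<close>
  have same: "phase T J r (?p z) = phase T J r (?p z0)" if z: "z \<in> good_paths" and r: "0 \<le> r" "r \<le> w" for z r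
  proof (cases "r = w")
    case True
    have "same_upto 0 z z0" using z z0 unfolding same_upto_def by (intro exI[of _ 0]) (auto simp: good_paths_def)
    then show ?thesis using True r gd(1) z z0 same_upto_prepend[of 0 z z0 w y] by (intro same_phase) auto
  qed (use ph[OF z] ph[OF z0] r in simp)
  define j where "j = phase T J w (?p z0)"
  define \<kappa> :: nat where "\<kappa> = (if T 1 (?p z0) \<le> ereal w then 1 else 0)"
  have j12: "j \<in> {1,2}"
    using rng(4,5,6)[of w] w inv[OF z0] x'' unfolding j_def by auto
  have iff: "T 1 (?p z) \<le> ereal w \<longleftrightarrow> \<kappa> = 1" if z: "z \<in> good_paths" for z
  proof -
    have "(\<exists>r. 0 \<le> r \<and> r \<le> w \<and> phase T J r (?p z) \<noteq> i) \<longleftrightarrow> (\<exists>r. 0 \<le> r \<and> r \<le> w \<and> phase T J r (?p z0) \<noteq> i)"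
      using same[OF z] by metis
    then have "T 1 (?p z) \<le> ereal w \<longleftrightarrow> T 1 (?p z0) \<le> ereal w"
      unfolding first_switch_iff[OF gd(1)[OF z] less_imp_le[OF w]] first_switch_iff[OF gd(1)[OF z0] less_imp_le[OF w]] .
    then show ?thesis by (simp add: \<kappa>_def)
  qed
  have T1: "T 1 (?p z) = ereal w" if z: "z \<in> good_paths" and k: "\<kappa> = 1" for z
    using iff[OF z] k late[OF gd(1,2)[OF z]] by (intro antisym) auto
  have \<kappa>01: "\<kappa> = 0 \<or> \<kappa> = 1" by (simp add: \<kappa>_def)
  have J: "T \<kappa> (?p z) \<le> ereal w \<and> ereal w < T (Suc \<kappa>) (?p z) \<and> J \<kappa> (?p z) = j" if z: "z \<in> good_paths" for z
    using \<kappa>01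
  proof
    assume k: "\<kappa> = 0"
    then have "ereal w < T 1 (?p z)" using iff[OF z] by (simp add: not_le)
    moreover have "phase T J w (?p z) = i" by (rule phase_before_first_switch[OF gd(1)[OF z] less_imp_le[OF w] calculation])
    ultimately show ?thesis using k switching_path_0[OF sw[OF gd(1)[OF z]]] same[OF z, of w] w by (simp add: j_def)
  next
    assume k: "\<kappa> = 1"
    note t = T1[OF z k]
    have "T 1 (?p z) < T (Suc 1) (?p z)" using switching_path_strict[OF sw[OF gd(1)[OF z]], of 1] t by simp
    then show ?thesis using k t phase_at_first_switch[OF gd(1)[OF z] t] same[OF z, of w] w by (simp add: j_def)
  qed
  have ji: "j = i \<longleftrightarrow> \<kappa> = 0"
  proof -
    have "phase T J w (?p z0) \<noteq> i" if "\<kappa> = 1" using phase_at_first_switch[OF gd(1)[OF z0] T1[OF z0 that]] by simp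
    moreover have "j = i" if "\<kappa> = 0" using J[OF z0] that switching_path_0(2)[OF sw[OF gd(1)[OF z0]]] by simp
    ultimately show ?thesis using \<kappa>01 by (auto simp: j_def)
  qed
  interpret continuation S x i T J ?p w 1 \<kappa> j ?x
  proof (rule continuation.intro[OF admissible_strategy_axioms], rule continuation_axioms.intro, goal_cases)
    case 1
    have "(\<lambda>z. (w, y, z)) \<in> path_borel \<rightarrow>\<^sub>M borel \<Otimes>\<^sub>M (borel \<Otimes>\<^sub>M path_borel)" by measurable
    from measurable_compose[OF this prepend_measurable] show ?case by simp
  next
    case (2 z) then show ?case by (rule gd)
  next
    case (3 t z z') then show ?case by (intro same_upto_prepend)
  next
    case 4 show ?case using w by simp
  next
    case (5 z) then show ?case using arr1(1) by simp
  next
    case (6 z) then show ?case using arr1(2) by simp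
  next
    case (7 n z) then show ?case using prepend_arrival[of w y z n] by (simp del: sum.lessThan_Suc)
  next
    case (8 n z) then show ?case by (cases n) (simp_all add: prepend_def)
  next
    case (9 z) show ?case using J[OF 9] by blast
  next
    case (10 z) show ?case using J[OF 10] by blast
  next
    case (11 z) show ?case using J[OF 11] by blast
  next
    case (12 z) then show ?case by (rule inv)
  next
    case 13 show ?case by (rule rules)
  qed
  interpret N: admissible_strategy S ?x j T' J' by (rule continuation_strategy)
  have first: "(\<Sum>k<\<kappa>. switch_term C T J (?p z) k) = ennreal (exp (- disc S * w)) * ennreal (if j = i then 0 else swcost S i j)"
    if z: "z \<in> good_paths" for z
    using \<kappa>01
  proof
    assume "\<kappa> = 1"
    then show ?thesis using T1[OF z] J[OF z] ji switching_path_0(2)[OF sw[OF gd(1)[OF z]]]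
      by (simp add: switch_term_def ennreal_mult')
  qed (use ji in simp)
  have pen: "penalty_term C x T J (?p z) 0 = ennreal (exp (- disc S * w)) * ennreal (excess_penalty S (y - (v - lo)))"
    if z: "z \<in> good_paths" for z
    using before[OF z] arr1(1)[OF z] gd(3)[OF z]
    by (simp add: penalty_term_def excess_penalty_def Let_def ennreal_mult')
  have "(\<integral>\<^sup>+z. total_cost (?p z) \<partial>path_measure S) =
    (\<integral>\<^sup>+z. (hold_until w + ennreal (exp (- disc S * w)) * (ennreal (if j = i then 0 else swcost S i j) + ennreal (excess_penalty S (y - (v - lo)))))
      + ennreal (exp (- disc S * w)) * N.total_cost z \<partial>path_measure S)"
  proof (rule nn_integral_cong_AE)
    show "AE z in path_measure S. total_cost (?p z) =
      (hold_until w + ennreal (exp (- disc S * w)) * (ennreal (if j = i then 0 else swcost S i j) + ennreal (excess_penalty S (y - (v - lo)))))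
      + ennreal (exp (- disc S * w)) * N.total_cost z"
      using good_paths_AE
    proof eventually_elim
      case (elim z)
      have "total_cost (?p z) = hold_until w + (\<Sum>k<\<kappa>. switch_term C T J (?p z) k) + penalty_term C x T J (?p z) 0
          + ennreal (exp (- disc S * w)) * path_cost C ?x T' J' z"
        using total_cost_continuation[OF elim ph[OF elim]] gd(2)[OF elim] by simp
      then show ?case using elim unfolding first[OF elim] pen[OF elim] by (simp add: N.total_cost_def distrib_left add.assoc)
    qed
  qed
  also have "\<dots> = hold_until w + ennreal (exp (- disc S * w)) * (ennreal (if j = i then 0 else swcost S i j) + ennreal (excess_penalty S (y - (v - lo))))
      + ennreal (exp (- disc S * w)) * cost C ?x T' J'"
    using N.total_cost_measurable Q.emeasure_space_1
    by (simp add: N.cost_total nn_integral_add nn_integral_cmult measurable_cong_sets[OF sets_path_measure refl])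
  finally have eq: "(\<integral>\<^sup>+z. total_cost (?p z) \<partial>path_measure S) = hold_until w + ennreal (exp (- disc S * w)) *
     (ennreal (if j = i then 0 else swcost S i j) + ennreal (excess_penalty S (y - (v - lo))) + cost C ?x T' J')"
    by (simp add: distrib_left add.assoc)
  show ?thesis
    using v x'' j12 continuation_strategy T'_pos eq by blast
qed

end

section \<open>Comparison at the first switch and at the first arrival\<close>

context inventory_system begin

lemma swcost_nonneg: "i \<in> {0,1,2} \<Longrightarrow> j \<in> {0,1,2} \<Longrightarrow> i \<noteq> j \<Longrightarrow> 0 \<le> swcost S i j"
  using model unfolding inventory_model_def by blast

lemma prate_pos: "i \<in> {1,2} \<Longrightarrow> 0 < prate S i"
  using params(5) by (auto simp: good_rates_def)

lemma running_integral_measurable: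
  fixes f :: "real \<Rightarrow> ennreal"
  assumes f[measurable]: "f \<in> borel_measurable borel"
  shows "(\<lambda>w. \<integral>\<^sup>+t\<in>{0..<w}. f t \<partial>lborel) \<in> borel_measurable borel"
proof -
  have m: "(\<lambda>p. f (snd p) * indicator {q. 0 \<le> snd q \<and> snd q < fst q} p) \<in> borel_measurable (borel \<Otimes>\<^sub>M borel)"
    by measurable
  have e: "(\<lambda>p. f (snd p) * indicator {q. 0 \<le> snd q \<and> snd q < fst q} p) = (\<lambda>(w, t). f t * indicator {0..<w} t)"
    by (auto simp: fun_eq_iff indicator_def)
  have s: "sets (borel \<Otimes>\<^sub>M lborel) = sets (borel \<Otimes>\<^sub>M (borel :: real measure))"
    by (intro sets_pair_measure_cong) auto
  have "(\<lambda>(w, t). f t * indicator {0..<w} t) \<in> borel_measurable (borel \<Otimes>\<^sub>M lborel)"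
    unfolding e[symmetric] measurable_cong_sets[OF s refl] by (rule m)
  from lborel.borel_measurable_nn_integral[OF this] show ?thesis .
qed

text \<open>Fubini: a cost incurred at time \<open>t\<close> counts if the first arrival comes
  later, which has probability \<open>exp (- arr_rate S * t)\<close>.\<close>

lemma exponential_running_integral:
  assumes f[measurable]: "f \<in> borel_measurable borel"
  shows "(\<integral>\<^sup>+w. (\<integral>\<^sup>+t\<in>{0..<w}. f t \<partial>lborel) \<partial>WW) = (\<integral>\<^sup>+t\<in>{0..}. ennreal (exp (- arr_rate S * t)) * f t \<partial>lborel)"
proof -
  interpret pair_sigma_finite lborel WW
    by (intro pair_sigma_finite.intro sigma_finite_lborel W.sigma_finite_measure_axioms)
  have m: "(\<lambda>(t, w). f t * indicator {0..} t * indicator {t<..} w) \<in> borel_measurable (lborel \<Otimes>\<^sub>M WW)"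
  proof -
    have m: "(\<lambda>p. f (fst p) * indicator {0..} (fst p) * indicator {q. fst q < snd q} p) \<in> borel_measurable (borel \<Otimes>\<^sub>M borel)"
      by measurable
    have s: "sets (lborel \<Otimes>\<^sub>M WW) = sets (borel \<Otimes>\<^sub>M (borel :: real measure))"
      by (intro sets_pair_measure_cong) auto
    have e: "(\<lambda>(t, w). f t * indicator {0..} t * indicator {t<..} w) = (\<lambda>p. f (fst p) * indicator {0..} (fst p) * indicator {q. fst q < snd q} p)"
      by (auto simp: fun_eq_iff indicator_def)
    show ?thesis unfolding e measurable_cong_sets[OF s refl] by (rule m)
  qed
  have "(\<integral>\<^sup>+w. (\<integral>\<^sup>+t\<in>{0..<w}. f t \<partial>lborel) \<partial>WW) = (\<integral>\<^sup>+w. \<integral>\<^sup>+t. f t * indicator {0..} t * indicator {t<..} w \<partial>lborel \<partial>WW)"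
    by (intro nn_integral_cong) (auto simp: indicator_def)
  also have "\<dots> = (\<integral>\<^sup>+t. \<integral>\<^sup>+w. f t * indicator {0..} t * indicator {t<..} w \<partial>WW \<partial>lborel)"
    using Fubini'[OF m] by simp
  also have "\<dots> = (\<integral>\<^sup>+t\<in>{0..}. ennreal (exp (- arr_rate S * t)) * f t \<partial>lborel)"
  proof (intro nn_integral_cong)
    fix t :: real
    have "(\<integral>\<^sup>+w. f t * indicator {0..} t * indicator {t<..} w \<partial>WW) = f t * indicator {0..} t * (\<integral>\<^sup>+w. indicator {t<..} w \<partial>WW)"
      by (rule nn_integral_cmult) simp
    then show "(\<integral>\<^sup>+w. f t * indicator {0..} t * indicator {t<..} w \<partial>WW) = ennreal (exp (- arr_rate S * t)) * f t * indicator {0..} t"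
      using exponential_tail[of t] by (cases "0 \<le> t") (simp_all add: mult_ac)
  qed
  finally show ?thesis .
qed

text \<open>The same for a cost that runs until \<open>\<theta>\<close> or the first arrival,
  whichever is earlier: the integrand is cut off at \<open>\<theta>\<close>.\<close>

lemma exponential_stopped_integral:
  assumes f[measurable]: "f \<in> borel_measurable borel" and \<theta>: "0 \<le> \<theta>"
  shows "(\<integral>\<^sup>+w. indicator {0<..<\<theta>} w * (\<integral>\<^sup>+t\<in>{0..<w}. f t \<partial>lborel) \<partial>WW)
      + ennreal (exp (- arr_rate S * \<theta>)) * (\<integral>\<^sup>+t\<in>{0..<\<theta>}. f t \<partial>lborel)
    = (\<integral>\<^sup>+t\<in>{0..<\<theta>}. ennreal (exp (- arr_rate S * t)) * f t \<partial>lborel)"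
proof -
  let ?f = "\<lambda>t. f t * indicator {..<\<theta>} t" and ?I = "\<integral>\<^sup>+t\<in>{0..<\<theta>}. f t \<partial>lborel"
  have [measurable]: "(\<lambda>w. indicator {0<..<\<theta>} w * (\<integral>\<^sup>+t\<in>{0..<w}. f t \<partial>lborel)) \<in> borel_measurable WW"
    using running_integral_measurable[OF f] by simp
  have "(\<integral>\<^sup>+w. indicator {0<..<\<theta>} w * (\<integral>\<^sup>+t\<in>{0..<w}. f t \<partial>lborel) \<partial>WW) + ennreal (exp (- arr_rate S * \<theta>)) * ?I =
     (\<integral>\<^sup>+w. indicator {0<..<\<theta>} w * (\<integral>\<^sup>+t\<in>{0..<w}. f t \<partial>lborel) \<partial>WW) + (\<integral>\<^sup>+w. indicator {\<theta><..} w * ?I \<partial>WW)"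
    by (subst nn_integral_multc) (simp_all add: exponential_tail[OF \<theta>])
  also have "\<dots> = (\<integral>\<^sup>+w. indicator {0<..<\<theta>} w * (\<integral>\<^sup>+t\<in>{0..<w}. f t \<partial>lborel) + indicator {\<theta><..} w * ?I \<partial>WW)"
    by (rule nn_integral_add[symmetric]) measurable
  also have "\<dots> = (\<integral>\<^sup>+w. (\<integral>\<^sup>+t\<in>{0..<w}. ?f t \<partial>lborel) \<partial>WW)"
  proof (rule nn_integral_cong_AE)
    show "AE w in WW. indicator {0<..<\<theta>} w * (\<integral>\<^sup>+t\<in>{0..<w}. f t \<partial>lborel) + indicator {\<theta><..} w * ?I = (\<integral>\<^sup>+t\<in>{0..<w}. ?f t \<partial>lborel)"
      using WW_AE(1) WW_AE(2)[of \<theta>]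
    proof eventually_elim
      case (elim w)
      show ?case
      proof (cases "w < \<theta>")
        case True
        then have "(\<integral>\<^sup>+t\<in>{0..<w}. ?f t \<partial>lborel) = (\<integral>\<^sup>+t\<in>{0..<w}. f t \<partial>lborel)"
          by (intro nn_integral_cong) (auto simp: indicator_def)
        then show ?thesis using True elim by simp
      next
        case False
        then have "(\<integral>\<^sup>+t\<in>{0..<w}. ?f t \<partial>lborel) = ?I"
          by (intro nn_integral_cong) (auto simp: indicator_def)
        then show ?thesis using False elim by simp
      qed
    qed
  qed
  also have "\<dots> = (\<integral>\<^sup>+t\<in>{0..}. ennreal (exp (- arr_rate S * t)) * ?f t \<partial>lborel)"
    by (rule exponential_running_integral) measurable
  also have "\<dots> = (\<integral>\<^sup>+t\<in>{0..<\<theta>}. ennreal (exp (- arr_rate S * t)) * f t \<partial>lborel)"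
    by (intro nn_integral_cong) (auto simp: indicator_def)
  finally show ?thesis .
qed

text \<open>The obstacle inequality is known on a dense set of levels only. The strategy itself
  bridges the gap: it stays in phase \<open>j\<close> for a short time \<open>\<delta>\<close> and,
  if no demand arrives, has then reached a level at which the inequality holds; from there on it
  costs at least \<open>opt_cost\<close>. As \<open>\<delta>\<close> tends to 0, continuity of
  \<open>u\<close> gives the bound at \<open>x\<close>.\<close>

lemma switch_obstacle:
  assumes vis: "\<And>x. x \<in> {lo..<hi} \<Longrightarrow> viscosity_supersolution S i j u x"
    and str: "admissible_strategy S x j T J" and ij: "i \<in> {1,2}" "j \<in> {1,2}" "i \<noteq> j" and x: "x < hi"
    and pos: "\<And>z. z \<in> good_paths \<Longrightarrow> 0 < T 1 z"
  shows "ennreal (u x) \<le> ennreal (swcost S i j) + cost C x T J"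
proof (cases "cost C x T J")
  case (real c)
  interpret admissible_strategy S x j T J by fact
  let ?a = "arr_rate S + disc S"
  have sj: "0 < prate S j" using ij by (intro prate_pos)
  have K: "0 \<le> swcost S i j" using ij by (intro swcost_nonneg) auto
  obtain z0 where z0: "z0 \<in> good_paths" "1 < fst z0 0" using AE_C_ex[OF rules_AE, of 1] by auto
  \<comment> \<open>The strategy does not switch at time 0, so on the reference path
    \<open>z0\<close> neither a switch nor an arrival happens up to \<open>d\<close>.\<close>
  obtain d :: real where d: "0 < d" "ereal d < T 1 z0" "d < 1"
  proof -
    have "0 < min (T 1 z0) (1::ereal)" using pos[OF z0(1)] by simp
    then obtain q where "0 < ereal q" "ereal q < min (T 1 z0) 1" using ereal_dense2 by blast
    then show ?thesis using that by (auto simp: one_ereal_def)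
  qed
  have key: "u (x + prate S j * \<delta>) \<le> swcost S i j + exp (?a * \<delta>) * c"
    if \<delta>: "0 < \<delta>" "\<delta> < d" and y: "u (x + prate S j * \<delta>) \<le> opt_cost S j (x + prate S j * \<delta>) + swcost S i j" for \<delta>
  proof -
    have no: "ereal \<delta> < T 1 z" if z: "z \<in> good_paths" "\<delta> < fst z 0" for z
    proof -
      have "\<not> T 1 z0 \<le> ereal \<delta>" using d(2) \<delta>(2) by (meson ereal_less_eq(3) less_imp_le less_le_trans not_less order_trans)
      then show ?thesis using first_switch_pre_arrival[OF z(1) z0(1), of \<delta>] \<delta> d z z0 by simp
    qed
    have at: "T 0 z \<le> ereal \<delta> \<and> ereal \<delta> < T (Suc 0) z \<and> J 0 z = j" if "z \<in> good_paths" "\<delta> < fst z 0" for z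
      using switching_path_0[OF sw[OF that(1)]] no[OF that] \<delta> by simp
    have ph: "phase T J r z = j" if "z \<in> good_paths" "\<delta> < fst z 0" "0 \<le> r" "r < \<delta>" for z r
      using no[OF that(1,2)] that by (intro phase_before_first_switch) (auto intro: less_trans[of _ "ereal \<delta>"])
    obtain T' J' where n: "admissible_strategy S (x + prate S j * \<delta>) j T' J'"
      "(\<integral>\<^sup>+z. total_cost z * indicator {z. \<delta> < fst z 0} z \<partial>path_measure S) = ennreal (exp (- arr_rate S * \<delta>)) *
      (hold_until \<delta> + (if (0::nat) = 1 then ennreal (exp (- disc S * \<delta>) * swcost S j j) else 0)
        + ennreal (exp (- disc S * \<delta>)) * cost C (x + prate S j * \<delta>) T' J')"
      using continuation_delay[of \<delta> 0 j, OF _ _ at ph] \<delta> by auto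
    let ?o = "opt_cost S j (x + prate S j * \<delta>)"
    have "ennreal (exp (- ?a * \<delta>)) * ennreal ?o = ennreal (exp (- arr_rate S * \<delta>)) * (ennreal (exp (- disc S * \<delta>)) * ennreal ?o)"
      by (simp add: mult.assoc[symmetric] ennreal_mult'[symmetric, OF exp_ge_zero] exp_add[symmetric] distrib_right left_diff_distrib)
    also have "\<dots> \<le> (\<integral>\<^sup>+z. total_cost z * indicator {z. \<delta> < fst z 0} z \<partial>path_measure S)"
      unfolding n(2) using opt_cost_le[OF n(1)] by (intro mult_left_mono order_trans[OF _ add_increasing[OF _ order_refl]]) auto
    also have "\<dots> \<le> cost C x T J" unfolding cost_total by (intro nn_integral_mono) (auto simp: indicator_def)
    finally have "ennreal (exp (- ?a * \<delta>) * ?o) \<le> ennreal c" using real by (simp add: ennreal_mult')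
    then have "exp (- ?a * \<delta>) * ?o \<le> c" using real by simp
    then have "exp (?a * \<delta>) * (exp (- ?a * \<delta>) * ?o) \<le> exp (?a * \<delta>) * c" by (rule mult_left_mono) simp
    also have "exp (?a * \<delta>) * (exp (- ?a * \<delta>) * ?o) = ?o"
      by (simp add: mult.assoc[symmetric] exp_add[symmetric] distrib_right left_diff_distrib)
    finally show ?thesis using y by simp
  qed
  \<comment> \<open>Short enough to stay before \<open>d\<close> and to keep the level at or below
    the capacity; the divisor makes it tend to 0.\<close>
  define e where "e n = min (d / 2) ((hi - x) / prate S j) / real (Suc n)" for n
  have e: "0 < e n" "x + prate S j * e n \<le> hi" "e n < d" for n
  proof -
    have m: "0 < min (d / 2) ((hi - x) / prate S j)" using d x sj by simp
    then show "0 < e n" by (simp add: e_def)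
    have le: "e n \<le> min (d / 2) ((hi - x) / prate S j)" unfolding e_def
      by (rule divide_le_eq[THEN iffD2]) (use mult_left_mono[OF _ less_imp_le[OF m], of 1 "real (Suc n)"] in simp)
    then show "e n < d" using d(1) by linarith
    have "e n \<le> (hi - x) / prate S j" using le by simp
    then show "x + prate S j * e n \<le> hi" using sj by (simp add: pos_le_divide_eq mult.commute)
  qed
  have "\<exists>\<delta>. 0 < \<delta> \<and> \<delta> < e n \<and> u (x + prate S j * \<delta>) \<le> opt_cost S j (x + prate S j * \<delta>) + swcost S i j" for n
  proof -
    obtain y where y: "x < y" "y < x + prate S j * e n" "u y \<le> opt_cost S j y + swcost S i j"
      using obstacle_dense[OF vis, of x "x + prate S j * e n"] x_range(1) e(1,2)[of n] sj by auto
    then show ?thesis using sj by (intro exI[of _ "(y - x) / prate S j"]) (auto simp: field_simps)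
  qed
  then obtain \<delta> where \<delta>: "\<And>n. 0 < \<delta> n" "\<And>n. \<delta> n < e n"
    "\<And>n. u (x + prate S j * \<delta> n) \<le> opt_cost S j (x + prate S j * \<delta> n) + swcost S i j" by metis
  have "e \<longlonglongrightarrow> 0" unfolding e_def[abs_def] by (rule LIMSEQ_Suc[OF lim_const_over_n])
  then have \<delta>0: "\<delta> \<longlonglongrightarrow> 0"
    by (rule tendsto_sandwich[OF _ _ tendsto_const, rotated 2]) (use \<delta> in \<open>auto intro: less_imp_le always_eventually\<close>)
  have rng: "x + prate S j * \<delta> n \<in> {lo..hi}" for n
  proof -
    have "prate S j * \<delta> n \<le> prate S j * e n" by (rule mult_left_mono) (use \<delta>(2)[of n] sj in simp_all)
    then have "x + prate S j * \<delta> n \<le> hi" using e(2)[of n] by linarith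
    then show ?thesis using x_range(1) \<delta>(1)[of n] sj by (simp add: add_increasing2)
  qed
  have "(\<lambda>n. x + prate S j * \<delta> n) \<longlonglongrightarrow> x + prate S j * 0" by (intro tendsto_intros \<delta>0)
  then have "(\<lambda>n. u (x + prate S j * \<delta> n)) \<longlonglongrightarrow> u x"
    using supersolution_continuous(2)[OF vis] rng x_range by (simp add: continuous_on_sequentially comp_def)
  moreover have "(\<lambda>n. swcost S i j + exp (?a * \<delta> n) * c) \<longlonglongrightarrow> swcost S i j + exp (?a * 0) * c"
    by (intro tendsto_intros \<delta>0)
  ultimately have "u x \<le> swcost S i j + c"
    using key[OF \<delta>(1) less_trans[OF \<delta>(2) e(3)] \<delta>(3)] by (auto intro: LIMSEQ_le)
  then show ?thesis using real K by (simp flip: ennreal_plus add: ennreal_leI)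
qed simp

end

context admissible_strategy begin

text \<open>The rules hold almost surely only. But a switch before the first arrival on one good
  path occurs on all paths with a later first arrival, and one of these obeys the rules.\<close>

lemma first_switch_full:
  assumes i: "i = 0" and z: "z \<in> good_paths" shows "ereal (fst z 0) \<le> T 1 z"
proof (rule ccontr)
  assume "\<not> ?thesis"
  then have lt: "T 1 z < ereal (fst z 0)" by simp
  then obtain t where t: "T 1 z = ereal t" using switching_path_nonneg[OF sw[OF z], of 1] by (cases "T 1 z") auto
  have t0: "0 \<le> t" using phase_at_first_switch[OF z t] by simp
  obtain z0 where z0: "z0 \<in> good_paths" and ru: "operating_rules C x T J z0" and big: "t < fst z0 0"
    using AE_C_ex[OF rules_AE t0] by blast
  have 1: "T 1 z0 \<le> ereal t" using first_switch_pre_arrival[OF z z0 t0 _ big] lt t by simp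
  have "demand_count C 0 z0 = 0"
    using demand_count_eq[OF arrival_path_C[OF z0], of 0 0] z0 by (simp add: good_paths_def)
  moreover have "T 0 z0 < \<infinity> \<and> J 0 z0 = 0" using switching_path_0[OF sw[OF z0]] i by simp
  ultimately have "T (Suc 0) z0 = ereal (arrival C (Suc 0) z0)"
    using ru switching_path_0[OF sw[OF z0]] unfolding operating_rules_def by (metis real_of_ereal_0)
  then show False using 1 big by simp
qed

text \<open>The reference path obeys the rules and has its first arrival after the capacity would be
  reached, so a switch is forced on it by then. Nonanticipation transfers the time and the new phase
  to all paths that have no arrival by \<open>\<theta>\<close>.\<close>

lemma first_switch:
  assumes i: "i \<in> {1,2}" and x: "x < hi"
  obtains \<theta> j where "0 \<le> \<theta>" "x + prate S i * \<theta> \<le> hi" "j \<in> {0,1,2}" "j \<noteq> i" "j = 0 \<longleftrightarrow> x + prate S i * \<theta> = hi"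
    "\<And>z. z \<in> good_paths \<Longrightarrow> \<theta> < fst z 0 \<Longrightarrow> T 1 z = ereal \<theta> \<and> J 1 z = j"
    "\<And>z. z \<in> good_paths \<Longrightarrow> fst z 0 \<le> \<theta> \<Longrightarrow> ereal (fst z 0) \<le> T 1 z"
proof -
  have si: "0 < prate S i" using i by (rule prate_pos)
  \<comment> \<open>The time needed to reach the capacity in phase \<open>i\<close>.\<close>
  define c where "c = (hi - x) / prate S i"
  have c: "0 < c" "x + prate S i * c = hi" using x si by (simp_all add: c_def)
  obtain z0 where z0: "z0 \<in> good_paths" and ru: "operating_rules C x T J z0" and big: "c < fst z0 0"
    using AE_C_ex[OF rules_AE less_imp_le[OF c(1)]] by blast
  have lc: "lmin C < cap C" "good_rates (prate C)" "lmin C \<le> x" "x \<le> cap C" using params x_range by simp_all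
  note rng = inventory_range[OF lc(2) sw[OF z0] arrival_path_C[OF z0] lc(3,4,1) ru]
  have le: "T 1 z0 \<le> ereal c"
  proof (rule ccontr)
    assume "\<not> T 1 z0 \<le> ereal c"
    then have lt: "ereal c < T 1 z0" by simp
    have ph: "phase T J r z0 = i" if "0 \<le> r" "r \<le> c" for r
      using that lt by (intro phase_before_first_switch z0) (auto intro: le_less_trans[of _ "ereal c"])
    have "inventory C T J x c z0 = hi"
      using inventory_first_phase[OF z0 ph less_imp_le[OF c(1)] big] c(2) by simp
    then have "phase T J c z0 = 0" using rng(2)[of c] c(1) by simp
    then show False using ph[of c] c(1) i by simp
  qed
  then obtain \<theta> where \<theta>: "T 1 z0 = ereal \<theta>" using switching_path_nonneg[OF sw[OF z0], of 1] by (cases "T 1 z0") auto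
  define j where "j = J 1 z0"
  note at = phase_at_first_switch[OF z0 \<theta>]
  have \<theta>c: "0 \<le> \<theta>" "\<theta> \<le> c" using at le \<theta> by auto
  have inv: "inventory C T J x \<theta> z0 = x + prate S i * \<theta>"
    using phase_before_first_switch[OF z0] \<theta> \<theta>c big by (intro inventory_first_phase z0) auto
  show ?thesis
  proof (rule that[of \<theta> j])
    show "0 \<le> \<theta>" by fact
    show "x + prate S i * \<theta> \<le> hi" using rng(1)[OF \<theta>c(1)] inv by simp
    show "j \<in> {0,1,2}" unfolding j_def by (rule switching_path_phases[OF sw[OF z0]])
    show "j \<noteq> i" using at by (simp add: j_def)
    show "j = 0 \<longleftrightarrow> x + prate S i * \<theta> = hi" using rng(2)[OF \<theta>c(1)] at inv by (simp add: j_def)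
  next
    fix z assume z: "z \<in> good_paths" and lt: "\<theta> < fst z 0"
    have "T 1 z \<le> ereal \<theta>" using first_switch_pre_arrival[OF z z0 \<theta>c(1) lt] \<theta>c(2) big \<theta> by simp
    then obtain t where t: "T 1 z = ereal t" "t \<le> \<theta>" using switching_path_nonneg[OF sw[OF z], of 1] by (cases "T 1 z") auto
    have "0 \<le> t" using phase_at_first_switch[OF z t(1)] by simp
    \<comment> \<open>A switch of \<open>z\<close> before \<open>\<theta>\<close> would be seen on
      the reference path as well.\<close>
    then have "T 1 z0 \<le> ereal t" using first_switch_pre_arrival[OF z z0, of t] t lt \<theta>c(2) big by simp
    then have "T 1 z = ereal \<theta>" using t \<theta> by simp
    moreover have "phase T J \<theta> z = phase T J \<theta> z0" using z z0 lt \<theta>c big by (intro pre_arrival_phase) auto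
    ultimately show "T 1 z = ereal \<theta> \<and> J 1 z = j" using phase_at_first_switch[OF z, of \<theta>] at by (simp add: j_def)
  next
    fix z assume z: "z \<in> good_paths" and le: "fst z 0 \<le> \<theta>"
    show "ereal (fst z 0) \<le> T 1 z"
    proof (rule ccontr)
      assume "\<not> ?thesis"
      then obtain t where t: "T 1 z = ereal t" "t < fst z 0"
        using switching_path_nonneg[OF sw[OF z], of 1] by (cases "T 1 z") auto
      have "0 \<le> t" using phase_at_first_switch[OF z t(1)] by simp
      then have "T 1 z0 \<le> ereal t" using first_switch_pre_arrival[OF z z0, of t] t le \<theta>c(2) big by simp
      then show False using t \<theta> le by simp
    qed
  qed
qed

text \<open>First inter-arrival time and demand are integrated out last. With no switch before the
  arrival, the cost consists of holding up to the arrival, the penalty, a possible switch at the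
  arrival and the discounted restart, which \<open>H\<close> compares with \<open>v\<close>. The
  error \<open>\<epsilon>\<close> is discounted along with the restart.\<close>

lemma first_arrival_bound:
  assumes \<Theta>: "\<Theta> \<in> sets borel" "\<Theta> \<subseteq> {0<..}"
    and late: "\<And>z. z \<in> good_paths \<Longrightarrow> fst z 0 \<in> \<Theta> \<Longrightarrow> ereal (fst z 0) \<le> T 1 z"
    and v: "continuous_on {lo..hi} v" "\<And>y. y \<in> {lo..hi} \<Longrightarrow> 0 \<le> v y" and \<epsilon>: "0 \<le> \<epsilon>"
    and H: "\<And>x' j' T' J'. admissible_strategy S x' j' T' J' \<Longrightarrow> j' \<in> {1,2} \<Longrightarrow> x' < hi \<Longrightarrow>
      (\<And>z. z \<in> good_paths \<Longrightarrow> 0 < T' 1 z) \<Longrightarrow>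
      ennreal (v x') \<le> ennreal (if j' = i then 0 else swcost S i j') + cost C x' T' J' + ennreal \<epsilon>"
  shows "(\<integral>\<^sup>+w. indicator \<Theta> w * (hold_until w + ennreal (exp (- disc S * w)) * ennreal (jump_mean S v (x + prate S i * w))) \<partial>WW)
    \<le> (\<integral>\<^sup>+z. total_cost z * indicator {z. fst z 0 \<in> \<Theta>} z \<partial>path_measure S)
      + ennreal \<epsilon> * (\<integral>\<^sup>+w. indicator \<Theta> w * ennreal (exp (- disc S * w)) \<partial>WW)"
proof -
  let ?G = "\<lambda>w y. \<integral>\<^sup>+z. total_cost (prepend w y z) \<partial>path_measure S"
  note gm = prepend_integral_measurable(2,3)[OF total_cost_measurable]
  have [measurable]: "\<Theta> \<in> sets borel" "(\<lambda>w. \<integral>\<^sup>+y. ?G w y \<partial>dF S) \<in> borel_measurable borel" using \<Theta> gm(2) by auto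
  have "AE w in WW. indicator \<Theta> w * (hold_until w + ennreal (exp (- disc S * w)) * ennreal (jump_mean S v (x + prate S i * w)))
     \<le> indicator \<Theta> w * (\<integral>\<^sup>+y. ?G w y \<partial>dF S) + ennreal \<epsilon> * (indicator \<Theta> w * ennreal (exp (- disc S * w)))"
    using rules_prepend_AE
  proof eventually_elim
    case (elim w)
    show ?case
    proof (cases "w \<in> \<Theta>")
      case True
      then have w: "0 < w" using \<Theta>(2) by auto
      define V where "V = x + prate S i * w"
      let ?e = "ennreal (exp (- disc S * w))"
      have late': "ereal w \<le> T 1 z" if "z \<in> good_paths" "fst z 0 = w" for z using late[OF that(1)] that(2) True by simp
      have y: "AE y in dF S. V \<in> {lo..hi} \<and>
          hold_until w + ?e * ennreal (after_demand S v V y + excess_penalty S (y - (V - lo))) \<le> ?G w y + ennreal \<epsilon> * ?e"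
        using elim dF_pos
      proof eventually_elim
        case (elim y)
        then have ru: "AE z in pspace C. operating_rules C x T J (prepend w y z)" using w by simp
        note c = continuation_prepend[OF w elim(2) late' ru, folded V_def]
        obtain T' J' j where n: "admissible_strategy S (max lo (V - y)) j T' J'" "j \<in> {1,2}" "\<And>z. z \<in> good_paths \<Longrightarrow> 0 < T' 1 z"
          "?G w y = hold_until w + ?e * (ennreal (if j = i then 0 else swcost S i j) + ennreal (excess_penalty S (y - (V - lo)))
            + cost C (max lo (V - y)) T' J')" using c by blast
        have V: "V \<in> {lo..hi}" "max lo (V - y) < hi" using c by blast+
        have ad: "after_demand S v V y = v (max lo (V - y))" using V elim(2) by (simp add: after_demand_def min_def)
        have "0 \<le> v (max lo (V - y))" using V by (intro v(2)) auto
        then have "ennreal (after_demand S v V y + excess_penalty S (y - (V - lo))) = ennreal (v (max lo (V - y))) + ennreal (excess_penalty S (y - (V - lo)))"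
          unfolding ad by (intro ennreal_plus excess_penalty_nonneg)
        also have "\<dots> \<le> (ennreal (if j = i then 0 else swcost S i j) + cost C (max lo (V - y)) T' J' + ennreal \<epsilon>)
           + ennreal (excess_penalty S (y - (V - lo)))"
          by (intro add_right_mono H n V)
        finally have "hold_until w + ?e * ennreal (after_demand S v V y + excess_penalty S (y - (V - lo))) \<le> hold_until w + ?e *
          ((ennreal (if j = i then 0 else swcost S i j) + cost C (max lo (V - y)) T' J' + ennreal \<epsilon>) + ennreal (excess_penalty S (y - (V - lo))))"
          by (intro add_left_mono mult_left_mono) auto
        also have "\<dots> = ?G w y + ennreal \<epsilon> * ?e" unfolding n(4) by (simp add: distrib_left mult.commute add_ac)
        finally show ?case using V by simp
      qed
      \<comment> \<open>The level before the arrival does not depend on the demand, so what holds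
        for almost every demand holds outright.\<close>
      have V: "V \<in> {lo..hi}"
      proof (rule ccontr)
        assume "V \<notin> {lo..hi}"
        then have "AE y in dF S. False" using y by simp
        then show False by simp
      qed
      have [measurable]: "?G w \<in> borel_measurable (dF S)" using measurable_Pair2[OF gm(1), of w] by simp
      have [measurable]: "after_demand S v V \<in> borel_measurable (dF S)"
        using borel_measurable_integrable[OF after_demand_integrable[OF v(1)]] .
      have [measurable]: "(\<lambda>y. excess_penalty S (y - (V - lo))) \<in> borel_measurable (dF S)" by measurable
      have jm: "ennreal (jump_mean S v V) = (\<integral>\<^sup>+y. ennreal (after_demand S v V y + excess_penalty S (y - (V - lo))) \<partial>dF S)"
        by (rule jump_mean_nn_integral(1)[OF v(1) _ V]) (rule v(2))
      have "hold_until w + ?e * ennreal (jump_mean S v V) =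
          (\<integral>\<^sup>+y. hold_until w + ?e * ennreal (after_demand S v V y + excess_penalty S (y - (V - lo))) \<partial>dF S)"
        unfolding jm using F.emeasure_space_1
        by (subst nn_integral_add, simp, simp, subst nn_integral_cmult) simp_all
      also have "\<dots> \<le> (\<integral>\<^sup>+y. ?G w y + ennreal \<epsilon> * ?e \<partial>dF S)"
        using y by (intro nn_integral_mono_AE) (auto elim: eventually_mono)
      also have "\<dots> = (\<integral>\<^sup>+y. ?G w y \<partial>dF S) + ennreal \<epsilon> * ?e"
        using F.emeasure_space_1 by (simp add: nn_integral_add)
      finally show ?thesis using True by (simp add: V_def)
    qed simp
  qed
  then have "(\<integral>\<^sup>+w. indicator \<Theta> w * (hold_until w + ennreal (exp (- disc S * w)) * ennreal (jump_mean S v (x + prate S i * w))) \<partial>WW)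
    \<le> (\<integral>\<^sup>+w. indicator \<Theta> w * (\<integral>\<^sup>+y. ?G w y \<partial>dF S) + ennreal \<epsilon> * (indicator \<Theta> w * ennreal (exp (- disc S * w))) \<partial>WW)"
    by (rule nn_integral_mono_AE)
  also have "\<dots> = (\<integral>\<^sup>+w. indicator \<Theta> w * (\<integral>\<^sup>+y. ?G w y \<partial>dF S) \<partial>WW) + ennreal \<epsilon> * (\<integral>\<^sup>+w. indicator \<Theta> w * ennreal (exp (- disc S * w)) \<partial>WW)"
    by (simp add: nn_integral_add nn_integral_cmult)
  also have "(\<integral>\<^sup>+w. indicator \<Theta> w * (\<integral>\<^sup>+y. ?G w y \<partial>dF S) \<partial>WW) = (\<integral>\<^sup>+z. total_cost z * indicator {z. fst z 0 \<in> \<Theta>} z \<partial>path_measure S)"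
  proof -
    have "{z. fst z 0 \<in> \<Theta>} = (\<lambda>z. fst z 0) -` \<Theta> \<inter> space path_borel" by auto
    also have "\<dots> \<in> sets path_borel" by (rule measurable_sets[OF path_component_measurable(1) \<Theta>(1)])
    finally have f: "(\<lambda>z. total_cost z * indicator {z. fst z 0 \<in> \<Theta>} z) \<in> borel_measurable path_borel"
      using total_cost_measurable by simp
    show ?thesis unfolding first_arrival_law[OF f]
    proof (intro nn_integral_cong)
      fix w
      show "indicator \<Theta> w * (\<integral>\<^sup>+y. ?G w y \<partial>dF S) =
         (\<integral>\<^sup>+y. \<integral>\<^sup>+z. total_cost (prepend w y z) * indicator {z. fst z 0 \<in> \<Theta>} (prepend w y z) \<partial>path_measure S \<partial>dF S)"
        by (cases "w \<in> \<Theta>") (simp_all add: prepend_def)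
    qed
  qed
  finally show ?thesis .
qed

end

section \<open>The contraction\<close>

locale supersolution = inventory_system S for S :: "'a inventory_data" +
  fixes u :: "nat \<Rightarrow> real \<Rightarrow> real"
  assumes u_nonneg: "\<And>i x. i \<in> {1,2} \<Longrightarrow> x \<in> {lmin S..cap S} \<Longrightarrow> 0 \<le> u i x"
    and vis: "\<And>i j x. i \<in> {1,2} \<Longrightarrow> j \<in> {1,2} \<Longrightarrow> i \<noteq> j \<Longrightarrow> x \<in> {lmin S..<cap S} \<Longrightarrow>
      viscosity_supersolution S i j (u i) x"
    and u_cap: "\<And>i. i \<in> {1,2} \<Longrightarrow> u i (cap S) \<le> u_bar0 S u + swcost S i 0"
begin

lemma vis_other: assumes "i \<in> {1,2}" obtains j where "\<And>x. x \<in> {lo..<hi} \<Longrightarrow> viscosity_supersolution S i j (u i) x"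
\<comment> \<open>\<open>3 - i\<close> exchanges the phases 1 and 2.\<close>
proof (rule that[of "3 - i"])
  fix x assume "x \<in> {lo..<hi}"
  then show "viscosity_supersolution S i (3 - i) (u i) x" using assms by (intro vis) auto
qed

lemma u_lipschitz: assumes "i \<in> {1,2}" shows "\<exists>L. L-lipschitz_on {lo..hi} (u i)" "continuous_on {lo..hi} (u i)"
proof -
  obtain j where j: "\<And>x. x \<in> {lo..<hi} \<Longrightarrow> viscosity_supersolution S i j (u i) x" using vis_other[OF assms] by blast
  show "\<exists>L. L-lipschitz_on {lo..hi} (u i)" "continuous_on {lo..hi} (u i)" by (rule supersolution_continuous[OF j], assumption)+
qed

lemma u_bar_continuous: "continuous_on {lo..hi} (u_bar S u)"
  unfolding u_bar_def[abs_def] by (intro continuous_intros u_lipschitz) auto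

lemma u_bar_nonneg: "x \<in> {lo..hi} \<Longrightarrow> 0 \<le> u_bar S u x"
  unfolding u_bar_def using u_nonneg[of 1 x] u_nonneg[of 2 x] swcost_nonneg[of 0 1] swcost_nonneg[of 0 2] by simp

lemma u_bar0_nonneg: "0 \<le> u_bar0 S u"
proof -
  have "0 \<le> hold S 0 hi" using model by (simp add: inventory_model_def)
  moreover have "0 \<le> jump_mean S (u_bar S u) hi"
    by (rule jump_mean_nn_integral(2)[OF u_bar_continuous u_bar_nonneg]) (use params in auto)
  ultimately show ?thesis unfolding u_bar0_eq[OF u_bar_continuous] using arr_rate_pos params(3) by simp
qed

definition approx :: "real \<Rightarrow> bool" where
  "approx \<epsilon> \<longleftrightarrow> (\<forall>x j T J. admissible_strategy S x j T J \<longrightarrow> j \<in> {1,2} \<longrightarrow> x < hi \<longrightarrow>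
     ennreal (u j x) \<le> cost C x T J + ennreal \<epsilon>)"

text \<open>Phase 0 lasts until the first arrival, so the error enters with the mean discount
  \<open>\<rho>\<close>; holding up to the arrival and the mean of \<open>u_bar\<close> after it
  reproduce \<open>u_bar0\<close> exactly.\<close>

lemma approx_full:
  assumes ap: "approx \<epsilon>" and \<epsilon>: "0 \<le> \<epsilon>" and str: "admissible_strategy S hi 0 T J"
  shows "ennreal (u_bar0 S u) \<le> cost C hi T J + ennreal (\<rho> * \<epsilon>)"
proof -
  interpret admissible_strategy S hi 0 T J by fact
  let ?a = "arr_rate S + disc S" and ?m = "jump_mean S (u_bar S u) hi"
  have a: "0 < ?a" using arr_rate_pos params(3) by simp
  have h0: "0 \<le> hold S 0 hi" using model by (simp add: inventory_model_def)
  have p0: "prate S 0 = 0" using params(5) by (simp add: good_rates_def)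
  have m0: "0 \<le> ?m" by (rule jump_mean_nn_integral(2)[OF u_bar_continuous u_bar_nonneg]) (use params in auto)
  have hu: "hold_until w = (\<integral>\<^sup>+t\<in>{0..<w}. ennreal (exp (- disc S * t)) * ennreal (hold S 0 hi) \<partial>lborel)" for w
    unfolding hold_until_def using h0 by (intro nn_integral_cong) (simp add: hold_canonical ennreal_mult')
  have [measurable]: "hold_until \<in> borel_measurable borel"
    unfolding hu[abs_def] by (rule running_integral_measurable) measurable
  \<comment> \<open>\<open>u_bar\<close> is a minimum over the two phases, so it is covered
    whichever phase is chosen when phase 0 ends.\<close>
  have bound: "ennreal (u_bar S u x') \<le> ennreal (if j' = 0 then 0 else swcost S 0 j') + cost C x' T' J' + ennreal \<epsilon>"
    if n: "admissible_strategy S x' j' T' J'" "j' \<in> {1,2}" "x' < hi" for x' j' T' J'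
  proof -
    have r: "x' \<in> {lo..hi}" using admissible_strategy.x_range[OF n(1)] by simp
    have "u_bar S u x' \<le> swcost S 0 j' + u j' x'" using n(2) by (auto simp: u_bar_def)
    then have "ennreal (u_bar S u x') \<le> ennreal (swcost S 0 j') + ennreal (u j' x')"
      using u_nonneg[OF n(2) r] swcost_nonneg[of 0 j'] n(2) by (subst ennreal_plus[symmetric]) (auto intro: ennreal_leI)
    also have "\<dots> \<le> ennreal (swcost S 0 j') + (cost C x' T' J' + ennreal \<epsilon>)"
      using ap n unfolding approx_def by (intro add_left_mono) blast
    finally show ?thesis using n(2) by (auto simp: add.assoc)
  qed
  have "(\<integral>\<^sup>+w. hold_until w \<partial>WW) + (\<integral>\<^sup>+w. ennreal (exp (- disc S * w)) * ennreal ?m \<partial>WW)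
      = (\<integral>\<^sup>+w. hold_until w + ennreal (exp (- disc S * w)) * ennreal ?m \<partial>WW)"
    by (rule nn_integral_add[symmetric]) measurable
  also have "\<dots> = (\<integral>\<^sup>+w. indicator {0<..} w * (hold_until w + ennreal (exp (- disc S * w)) * ennreal (jump_mean S (u_bar S u) (hi + prate S 0 * w))) \<partial>WW)"
    by (rule nn_integral_cong_AE) (use WW_AE(1) in eventually_elim, simp add: p0)
  also have "\<dots> \<le> (\<integral>\<^sup>+z. total_cost z * indicator {z. fst z 0 \<in> {0<..}} z \<partial>path_measure S)
      + ennreal \<epsilon> * (\<integral>\<^sup>+w. indicator {0<..} w * ennreal (exp (- disc S * w)) \<partial>WW)"
    by (rule first_arrival_bound[OF _ _ first_switch_full[OF refl] u_bar_continuous u_bar_nonneg \<epsilon> bound]) auto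
  also have "\<dots> \<le> cost C hi T J + ennreal \<epsilon> * (\<integral>\<^sup>+w. ennreal (exp (- disc S * w)) \<partial>WW)"
    unfolding cost_total by (intro add_mono mult_left_mono nn_integral_mono) (auto simp: indicator_def)
  also have "\<dots> = cost C hi T J + ennreal (\<rho> * \<epsilon>)"
    unfolding discount_mean using \<rho> \<epsilon> by (simp add: ennreal_mult'[symmetric] mult.commute)
  finally have le: "(\<integral>\<^sup>+w. hold_until w \<partial>WW) + (\<integral>\<^sup>+w. ennreal (exp (- disc S * w)) * ennreal ?m \<partial>WW) \<le> cost C hi T J + ennreal (\<rho> * \<epsilon>)" .
  have "(\<integral>\<^sup>+w. hold_until w \<partial>WW) = (\<integral>\<^sup>+t\<in>{0..}. ennreal (exp (- arr_rate S * t)) * (ennreal (exp (- disc S * t)) * ennreal (hold S 0 hi)) \<partial>lborel)"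
    unfolding hu by (rule exponential_running_integral) measurable
  also have "\<dots> = (\<integral>\<^sup>+t. ennreal (hold S 0 hi) * (ennreal (exp (- ?a * t)) * indicator {0<..} t) \<partial>lborel)"
  proof (rule nn_integral_cong_AE)
    show "AE t in lborel. ennreal (exp (- arr_rate S * t)) * (ennreal (exp (- disc S * t)) * ennreal (hold S 0 hi)) * indicator {0..} t =
      ennreal (hold S 0 hi) * (ennreal (exp (- ?a * t)) * indicator {0<..} t)"
      using AE_lborel_singleton[of 0]
    proof eventually_elim
      case (elim t)
      have "exp (- ?a * t) = exp (- arr_rate S * t) * exp (- disc S * t)" by (simp add: exp_add[symmetric] algebra_simps)
      then show ?case using elim by (auto simp: indicator_def ennreal_mult' mult_ac)
    qed
  qed
  also have "\<dots> = ennreal (hold S 0 hi) * ennreal (1 / ?a)"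
    by (subst nn_integral_cmult) (simp_all only: exponential_total[OF a], measurable)
  also have "\<dots> = ennreal (hold S 0 hi / ?a)" using h0 by (simp add: ennreal_mult'[symmetric])
  finally have 1: "(\<integral>\<^sup>+w. hold_until w \<partial>WW) = ennreal (hold S 0 hi / ?a)" .
  have 2: "(\<integral>\<^sup>+w. ennreal (exp (- disc S * w)) * ennreal ?m \<partial>WW) = ennreal (\<rho> * ?m)"
    using \<rho> by (subst nn_integral_multc) (simp_all only: discount_mean ennreal_mult'[symmetric] less_imp_le, measurable)
  have "ennreal (u_bar0 S u) = ennreal (hold S 0 hi / ?a + \<rho> * ?m)"
    unfolding u_bar0_eq[OF u_bar_continuous] \<rho>_def by (simp add: add.commute)
  also have "\<dots> = ennreal (hold S 0 hi / ?a) + ennreal (\<rho> * ?m)"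
    using h0 a \<rho> m0 by (intro ennreal_plus) auto
  finally show ?thesis using le unfolding 1 2 by simp
qed

text \<open>The exponent \<open>arr_rate S + disc S\<close> combines survival and discount. Survival
  times \<open>arr_rate S\<close> is the density of the first arrival, which turns the nonlocal term
  into an expectation at the arrival; survival alone weights a holding cost that runs until
  \<open>\<theta>\<close> or the first arrival.\<close>

lemma discounted_gain_split:
  assumes i: "i \<in> {1,2}" and x: "lo \<le> x" "0 \<le> \<theta>" "x + prate S i * \<theta> \<le> hi"
  shows "(\<integral>\<^sup>+t\<in>{0..<\<theta>}. ennreal (exp (- (arr_rate S + disc S) * t) *
      (arr_rate S * jump_mean S (u i) (x + prate S i * t) + hold C i (x + prate S i * t))) \<partial>lborel)
    = (\<integral>\<^sup>+w. indicator {0<..<\<theta>} w * ((\<integral>\<^sup>+t\<in>{0..<w}. ennreal (exp (- disc S * t) * hold C i (x + prate S i * t)) \<partial>lborel)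
        + ennreal (exp (- disc S * w)) * ennreal (jump_mean S (u i) (x + prate S i * w))) \<partial>WW)
     + ennreal (exp (- arr_rate S * \<theta>)) * (\<integral>\<^sup>+t\<in>{0..<\<theta>}. ennreal (exp (- disc S * t) * hold C i (x + prate S i * t)) \<partial>lborel)"
proof -
  let ?a = "arr_rate S + disc S" and ?s = "prate S i"
  let ?h = "\<lambda>t. ennreal (exp (- disc S * t) * hold C i (x + ?s * t))"
  let ?j = "\<lambda>t. jump_mean S (u i) (clamp (x + ?s * t))"
  have si: "0 < ?s" using i by (rule prate_pos)
  have rng: "x + ?s * t \<in> {lo..hi}" if "0 \<le> t" "t < \<theta>" for t
  proof -
    have "?s * t \<le> ?s * \<theta>" "0 \<le> ?s * t" using that si by auto
    then show ?thesis using x by simp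
  qed
  have j0: "0 \<le> ?j t" for t
    by (rule jump_mean_nn_integral(2)[OF u_lipschitz(2)[OF i] u_nonneg[OF i]]) (use clamp_range in \<open>auto simp: clamp_def\<close>)
  have h0: "0 \<le> hold C i y" for y by (rule hold_canonical_bounds(1)[OF i])
  have [measurable]: "?j \<in> borel_measurable borel"
    by (rule measurable_compose[OF _ jump_mean_clamp_measurable[OF u_lipschitz(1)[OF i]]]) measurable
  have [measurable]: "(\<lambda>t. hold C i (x + ?s * t)) \<in> borel_measurable borel"
    by (rule measurable_compose[OF _ hold_canonical_measurable]) measurable
  have hm[measurable]: "?h \<in> borel_measurable borel" by measurable
  have [measurable]: "(\<lambda>w. \<integral>\<^sup>+t\<in>{0..<w}. ?h t \<partial>lborel) \<in> borel_measurable borel"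
    by (rule running_integral_measurable) (rule hm)
  have ex: "exp (- ?a * t) = exp (- arr_rate S * t) * exp (- disc S * t)" for t by (simp add: exp_add[symmetric] algebra_simps)
  have "(\<integral>\<^sup>+t\<in>{0..<\<theta>}. ennreal (exp (- ?a * t) * (arr_rate S * jump_mean S (u i) (x + ?s * t) + hold C i (x + ?s * t))) \<partial>lborel)
     = (\<integral>\<^sup>+t. ennreal (exp (- ?a * t) * (arr_rate S * ?j t)) * indicator {0..<\<theta>} t + ennreal (exp (- arr_rate S * t)) * ?h t * indicator {0..<\<theta>} t \<partial>lborel)"
  proof (intro nn_integral_cong)
    fix t
    show "ennreal (exp (- ?a * t) * (arr_rate S * jump_mean S (u i) (x + ?s * t) + hold C i (x + ?s * t))) * indicator {0..<\<theta>} t =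
      ennreal (exp (- ?a * t) * (arr_rate S * ?j t)) * indicator {0..<\<theta>} t + ennreal (exp (- arr_rate S * t)) * ?h t * indicator {0..<\<theta>} t"
    proof (cases "t \<in> {0..<\<theta>}")
      case True
      then have c: "clamp (x + ?s * t) = x + ?s * t" using rng by (intro clamp_id) auto
      have "ennreal (exp (- ?a * t) * (arr_rate S * ?j t + hold C i (x + ?s * t))) =
         ennreal (exp (- ?a * t) * (arr_rate S * ?j t)) + ennreal (exp (- ?a * t) * hold C i (x + ?s * t))"
        unfolding distrib_left using j0[of t] h0 arr_rate_pos by (intro ennreal_plus) auto
      also have "ennreal (exp (- ?a * t) * hold C i (x + ?s * t)) = ennreal (exp (- arr_rate S * t)) * ?h t"
        unfolding ex by (simp add: ennreal_mult' mult.assoc)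
      finally show ?thesis using True c by simp
    qed simp
  qed
  also have "\<dots> = (\<integral>\<^sup>+t. ennreal (exp (- ?a * t) * (arr_rate S * ?j t)) * indicator {0..<\<theta>} t \<partial>lborel) + (\<integral>\<^sup>+t\<in>{0..<\<theta>}. ennreal (exp (- arr_rate S * t)) * ?h t \<partial>lborel)"
    by (rule nn_integral_add) measurable
  also have "(\<integral>\<^sup>+t. ennreal (exp (- ?a * t) * (arr_rate S * ?j t)) * indicator {0..<\<theta>} t \<partial>lborel) =
     (\<integral>\<^sup>+w. indicator {0<..<\<theta>} w * (ennreal (exp (- disc S * w)) * ennreal (jump_mean S (u i) (x + ?s * w))) \<partial>WW)"
  proof -
    have "(\<integral>\<^sup>+w. indicator {0<..<\<theta>} w * (ennreal (exp (- disc S * w)) * ennreal (jump_mean S (u i) (x + ?s * w))) \<partial>WW) =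
       (\<integral>\<^sup>+w. indicator {0<..<\<theta>} w * (ennreal (exp (- disc S * w)) * ennreal (?j w)) \<partial>WW)"
      using rng clamp_id by (intro nn_integral_cong) (auto simp: indicator_def)
    also have "\<dots> = (\<integral>\<^sup>+w\<in>{0<..}. ennreal (arr_rate S * exp (- arr_rate S * w)) * (indicator {0<..<\<theta>} w * (ennreal (exp (- disc S * w)) * ennreal (?j w))) \<partial>lborel)"
      by (rule nn_integral_WW) measurable
    also have "\<dots> = (\<integral>\<^sup>+t. ennreal (exp (- ?a * t) * (arr_rate S * ?j t)) * indicator {0..<\<theta>} t \<partial>lborel)"
    proof (rule nn_integral_cong_AE)
      show "AE w in lborel. ennreal (arr_rate S * exp (- arr_rate S * w)) * (indicator {0<..<\<theta>} w * (ennreal (exp (- disc S * w)) * ennreal (?j w))) * indicator {0<..} w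
        = ennreal (exp (- ?a * w) * (arr_rate S * ?j w)) * indicator {0..<\<theta>} w"
        using AE_lborel_singleton[of 0]
      proof eventually_elim
        case (elim w)
        have "ennreal (exp (- ?a * w) * (arr_rate S * ?j w)) = ennreal (arr_rate S * exp (- arr_rate S * w)) * (ennreal (exp (- disc S * w)) * ennreal (?j w))"
          unfolding ex using j0[of w] arr_rate_pos by (simp add: ennreal_mult'[symmetric] mult_ac)
        then show ?case using elim by (auto simp: indicator_def)
      qed
    qed
    finally show ?thesis by simp
  qed
  also have "(\<integral>\<^sup>+t\<in>{0..<\<theta>}. ennreal (exp (- arr_rate S * t)) * ?h t \<partial>lborel) =
     (\<integral>\<^sup>+w. indicator {0<..<\<theta>} w * (\<integral>\<^sup>+t\<in>{0..<w}. ?h t \<partial>lborel) \<partial>WW)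
      + ennreal (exp (- arr_rate S * \<theta>)) * (\<integral>\<^sup>+t\<in>{0..<\<theta>}. ?h t \<partial>lborel)"
    by (rule exponential_stopped_integral[OF hm x(2), symmetric])
  finally have *: "(\<integral>\<^sup>+t\<in>{0..<\<theta>}. ennreal (exp (- ?a * t) * (arr_rate S * jump_mean S (u i) (x + ?s * t) + hold C i (x + ?s * t))) \<partial>lborel) =
    ((\<integral>\<^sup>+w. indicator {0<..<\<theta>} w * (\<integral>\<^sup>+t\<in>{0..<w}. ?h t \<partial>lborel) \<partial>WW)
      + (\<integral>\<^sup>+w. indicator {0<..<\<theta>} w * (ennreal (exp (- disc S * w)) * ennreal (jump_mean S (u i) (x + ?s * w))) \<partial>WW))
      + ennreal (exp (- arr_rate S * \<theta>)) * (\<integral>\<^sup>+t\<in>{0..<\<theta>}. ?h t \<partial>lborel)"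
    by (simp only: add_ac)
  have "(\<integral>\<^sup>+w. indicator {0<..<\<theta>} w * (\<integral>\<^sup>+t\<in>{0..<w}. ?h t \<partial>lborel) \<partial>WW)
      + (\<integral>\<^sup>+w. indicator {0<..<\<theta>} w * (ennreal (exp (- disc S * w)) * ennreal (jump_mean S (u i) (x + ?s * w))) \<partial>WW)
    = (\<integral>\<^sup>+w. indicator {0<..<\<theta>} w * (\<integral>\<^sup>+t\<in>{0..<w}. ?h t \<partial>lborel) \<partial>WW)
      + (\<integral>\<^sup>+w. indicator {0<..<\<theta>} w * (ennreal (exp (- disc S * w)) * ennreal (?j w)) \<partial>WW)"
    using rng clamp_id by (intro arg_cong2[where f="(+)"] refl nn_integral_cong) (auto simp: indicator_def)
  also have "\<dots> = (\<integral>\<^sup>+w. indicator {0<..<\<theta>} w * (\<integral>\<^sup>+t\<in>{0..<w}. ?h t \<partial>lborel) + indicator {0<..<\<theta>} w * (ennreal (exp (- disc S * w)) * ennreal (?j w)) \<partial>WW)"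
    by (rule nn_integral_add[symmetric]) measurable
  also have "\<dots> = (\<integral>\<^sup>+w. indicator {0<..<\<theta>} w * ((\<integral>\<^sup>+t\<in>{0..<w}. ?h t \<partial>lborel)
        + ennreal (exp (- disc S * w)) * ennreal (jump_mean S (u i) (x + ?s * w))) \<partial>WW)"
    using rng clamp_id by (intro nn_integral_cong) (auto simp: indicator_def)
  finally show ?thesis unfolding * by simp
qed

lemma approx_step:
  assumes ap: "approx \<epsilon>" and \<epsilon>: "0 \<le> \<epsilon>" shows "approx (\<rho> * \<epsilon>)"
  unfolding approx_def
proof (intro allI impI)
  fix x i T J assume str: "admissible_strategy S x i T J" and i: "i \<in> {1,2}" and x: "x < hi"
  interpret admissible_strategy S x i T J by fact
  let ?a = "arr_rate S + disc S"
  obtain \<theta> j where \<theta>: "0 \<le> \<theta>" "x + prate S i * \<theta> \<le> hi" and j: "j \<in> {0,1,2}" "j \<noteq> i" "j = 0 \<longleftrightarrow> x + prate S i * \<theta> = hi"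
    and first: "\<And>z. z \<in> good_paths \<Longrightarrow> \<theta> < fst z 0 \<Longrightarrow> T 1 z = ereal \<theta> \<and> J 1 z = j"
    and late: "\<And>z. z \<in> good_paths \<Longrightarrow> fst z 0 \<le> \<theta> \<Longrightarrow> ereal (fst z 0) \<le> T 1 z"
    using first_switch[OF i x] by metis
  let ?x = "x + prate S i * \<theta>" and ?E = "ennreal (exp (- ?a * \<theta>))"
  have xr: "?x \<in> {lo..hi}" using \<theta> x_range(1) prate_pos[OF i] by (simp add: add_increasing2)
  have K: "0 \<le> swcost S i j" using swcost_nonneg[of i j] i j by auto
  obtain k where k: "\<And>y. y \<in> {lo..<hi} \<Longrightarrow> viscosity_supersolution S i k (u i) y" using vis_other[OF i] by blast
  have at: "T 1 z \<le> ereal \<theta> \<and> ereal \<theta> < T (Suc 1) z \<and> J 1 z = j" if "z \<in> good_paths" "\<theta> < fst z 0" for z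
    using first[OF that] switching_path_strict[OF sw[OF that(1)], of 1] by simp
  have ph: "phase T J r z = i" if "z \<in> good_paths" "\<theta> < fst z 0" "0 \<le> r" "r < \<theta>" for z r
    using first[OF that(1,2)] that by (intro phase_before_first_switch) auto
  obtain T' J' where n: "admissible_strategy S ?x j T' J'" "\<And>z. z \<in> good_paths \<Longrightarrow> 0 < T' 1 z"
    and B: "(\<integral>\<^sup>+z. total_cost z * indicator {z. \<theta> < fst z 0} z \<partial>path_measure S) = ennreal (exp (- arr_rate S * \<theta>)) *
      (hold_until \<theta> + ennreal (exp (- disc S * \<theta>) * swcost S i j) + ennreal (exp (- disc S * \<theta>)) * cost C ?x T' J')"
    using continuation_delay[of \<theta> 1 j, OF \<theta>(1) _ at ph] by auto
  \<comment> \<open>A switch between the phases 1 and 2 is settled by the obstacle without error.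
    Only the mandatory switch to phase 0 relies on the induction, and there the error is already
    reduced to \<open>\<rho> * \<epsilon>\<close>, because an arrival is still to come.\<close>
  have after: "ennreal (u i ?x) \<le> ennreal (swcost S i j) + cost C ?x T' J' + ennreal (\<rho> * \<epsilon>)"
  proof (cases "j = 0")
    case True
    then have hi: "?x = hi" using j by simp
    have "ennreal (u i ?x) \<le> ennreal (swcost S i j) + ennreal (u_bar0 S u)"
      unfolding ennreal_plus[OF K u_bar0_nonneg, symmetric] using u_cap[OF i] hi True by (intro ennreal_leI) simp
    also have "\<dots> \<le> ennreal (swcost S i j) + (cost C hi T' J' + ennreal (\<rho> * \<epsilon>))"
      using n(1) unfolding hi True by (intro add_left_mono approx_full[OF ap \<epsilon>])
    finally show ?thesis unfolding hi by (simp add: add.assoc)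
  next
    case False
    then have "j \<in> {1,2}" "?x < hi" using j xr by auto
    then have "ennreal (u i ?x) \<le> ennreal (swcost S i j) + cost C ?x T' J'"
      using i j n by (intro switch_obstacle[OF vis]) auto
    then show ?thesis by (rule order_trans) simp
  qed
  have A: "(\<integral>\<^sup>+w. indicator {0<..<\<theta>} w * (hold_until w + ennreal (exp (- disc S * w)) * ennreal (jump_mean S (u i) (x + prate S i * w))) \<partial>WW)
    \<le> (\<integral>\<^sup>+z. total_cost z * indicator {z. fst z 0 \<in> {0<..<\<theta>}} z \<partial>path_measure S)
      + ennreal \<epsilon> * (\<integral>\<^sup>+w. indicator {0<..<\<theta>} w * ennreal (exp (- disc S * w)) \<partial>WW)"
  proof (rule first_arrival_bound[OF _ _ late u_lipschitz(2)[OF i] u_nonneg[OF i] \<epsilon>])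
    fix x' j' T' J' assume m: "admissible_strategy S x' j' T' J'" "j' \<in> {1,2}" "x' < hi" "\<And>z. z \<in> good_paths \<Longrightarrow> 0 < T' 1 z"
    show "ennreal (u i x') \<le> ennreal (if j' = i then 0 else swcost S i j') + cost C x' T' J' + ennreal \<epsilon>"
    proof (cases "j' = i")
      case True
      then show ?thesis using ap m(1-3) unfolding approx_def by simp blast
    next
      case False
      then have "ennreal (u i x') \<le> ennreal (swcost S i j') + cost C x' T' J'"
        using i m by (intro switch_obstacle[OF vis]) auto
      then show ?thesis using False by (simp add: add_increasing2)
    qed
  qed auto
  have E: "ennreal (exp (- arr_rate S * \<theta>)) * ennreal (exp (- disc S * \<theta>)) = ?E"
    by (simp add: ennreal_mult'[symmetric] exp_add[symmetric] distrib_right left_diff_distrib)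
  have B': "ennreal (exp (- arr_rate S * \<theta>)) * hold_until \<theta> + ?E * ennreal (u i ?x)
     \<le> (\<integral>\<^sup>+z. total_cost z * indicator {z. \<theta> < fst z 0} z \<partial>path_measure S) + ?E * ennreal (\<rho> * \<epsilon>)"
  proof -
    have "ennreal (exp (- arr_rate S * \<theta>)) * hold_until \<theta> + ?E * ennreal (u i ?x) \<le>
      ennreal (exp (- arr_rate S * \<theta>)) * hold_until \<theta> + ?E * (ennreal (swcost S i j) + cost C ?x T' J' + ennreal (\<rho> * \<epsilon>))"
      using after by (intro add_left_mono mult_left_mono) auto
    also have "\<dots> = (\<integral>\<^sup>+z. total_cost z * indicator {z. \<theta> < fst z 0} z \<partial>path_measure S) + ?E * ennreal (\<rho> * \<epsilon>)"
      unfolding B ennreal_mult'[OF exp_ge_zero] distrib_left mult.assoc[symmetric] E by (simp only: add.assoc)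
    finally show ?thesis .
  qed
  have "ennreal (u i x) \<le> (\<integral>\<^sup>+w. indicator {0<..<\<theta>} w * (hold_until w + ennreal (exp (- disc S * w)) * ennreal (jump_mean S (u i) (x + prate S i * w))) \<partial>WW)
     + ennreal (exp (- arr_rate S * \<theta>)) * hold_until \<theta> + ennreal (exp (- ?a * \<theta>) * u i ?x)"
    using supersolution_integrated[OF i k u_nonneg[OF i] x_range(1) \<theta>]
    unfolding discounted_gain_split[OF i x_range(1) \<theta>] hold_until_def[symmetric] by blast
  also have "\<dots> = (\<integral>\<^sup>+w. indicator {0<..<\<theta>} w * (hold_until w + ennreal (exp (- disc S * w)) * ennreal (jump_mean S (u i) (x + prate S i * w))) \<partial>WW)
     + (ennreal (exp (- arr_rate S * \<theta>)) * hold_until \<theta> + ?E * ennreal (u i ?x))"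
    by (simp only: add.assoc ennreal_mult'[OF exp_ge_zero])
  also have "\<dots> \<le> ((\<integral>\<^sup>+z. total_cost z * indicator {z. fst z 0 \<in> {0<..<\<theta>}} z \<partial>path_measure S)
      + ennreal \<epsilon> * (\<integral>\<^sup>+w. indicator {0<..<\<theta>} w * ennreal (exp (- disc S * w)) \<partial>WW))
    + ((\<integral>\<^sup>+z. total_cost z * indicator {z. \<theta> < fst z 0} z \<partial>path_measure S) + ?E * ennreal (\<rho> * \<epsilon>))"
    by (intro add_mono A B')
  \<comment> \<open>By \<open>discount_tail\<close> the error at \<open>\<theta>\<close> equals
    \<open>\<epsilon>\<close> times the mean discount at a first arrival after
    \<open>\<theta>\<close>. Added to the error from arrivals before \<open>\<theta>\<close>, it
    gives at most \<open>\<epsilon>\<close> times \<open>\<rho>\<close>.\<close>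
  also have "\<dots> = ((\<integral>\<^sup>+z. total_cost z * indicator {z. fst z 0 \<in> {0<..<\<theta>}} z \<partial>path_measure S)
      + (\<integral>\<^sup>+z. total_cost z * indicator {z. \<theta> < fst z 0} z \<partial>path_measure S))
    + ennreal \<epsilon> * ((\<integral>\<^sup>+w. indicator {0<..<\<theta>} w * ennreal (exp (- disc S * w)) \<partial>WW)
      + (\<integral>\<^sup>+w. indicator {\<theta><..} w * ennreal (exp (- disc S * w)) \<partial>WW))"
    unfolding discount_tail[OF \<theta>(1)] using \<rho> \<epsilon> by (simp add: distrib_left ennreal_mult' mult_ac add_ac)
  also have "\<dots> \<le> cost C x T J + ennreal \<epsilon> * ennreal \<rho>"
  proof (intro add_mono mult_left_mono)
    have [measurable]: "total_cost \<in> borel_measurable (path_measure S)"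
      using total_cost_measurable by (simp add: measurable_cong_sets[OF sets_path_measure refl])
    have s: "{z. fst z 0 \<in> {0<..<\<theta>}} = {z\<in>space path_borel. 0 < fst z 0 \<and> fst z 0 < \<theta>}" "{z. \<theta> < fst z 0} = {z\<in>space path_borel. \<theta> < fst z 0}" by auto
    have [measurable]: "{z. fst z 0 \<in> {0<..<\<theta>}} \<in> sets path_borel" "{z. \<theta> < fst z 0} \<in> sets path_borel" unfolding s by measurable
    have "(\<integral>\<^sup>+z. total_cost z * indicator {z. fst z 0 \<in> {0<..<\<theta>}} z \<partial>path_measure S) + (\<integral>\<^sup>+z. total_cost z * indicator {z. \<theta> < fst z 0} z \<partial>path_measure S)
      = (\<integral>\<^sup>+z. total_cost z * indicator {z. fst z 0 \<in> {0<..<\<theta>}} z + total_cost z * indicator {z. \<theta> < fst z 0} z \<partial>path_measure S)"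
      by (rule nn_integral_add[symmetric]) measurable
    also have "\<dots> \<le> cost C x T J" unfolding cost_total by (intro nn_integral_mono) (auto simp: indicator_def)
    finally show "(\<integral>\<^sup>+z. total_cost z * indicator {z. fst z 0 \<in> {0<..<\<theta>}} z \<partial>path_measure S) + (\<integral>\<^sup>+z. total_cost z * indicator {z. \<theta> < fst z 0} z \<partial>path_measure S) \<le> cost C x T J" .
    have "(\<integral>\<^sup>+w. indicator {0<..<\<theta>} w * ennreal (exp (- disc S * w)) \<partial>WW) + (\<integral>\<^sup>+w. indicator {\<theta><..} w * ennreal (exp (- disc S * w)) \<partial>WW)
      = (\<integral>\<^sup>+w. indicator {0<..<\<theta>} w * ennreal (exp (- disc S * w)) + indicator {\<theta><..} w * ennreal (exp (- disc S * w)) \<partial>WW)"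
      by (rule nn_integral_add[symmetric]) measurable
    also have "\<dots> \<le> ennreal \<rho>" unfolding discount_mean[symmetric] by (intro nn_integral_mono) (auto simp: indicator_def)
    finally show "(\<integral>\<^sup>+w. indicator {0<..<\<theta>} w * ennreal (exp (- disc S * w)) \<partial>WW) + (\<integral>\<^sup>+w. indicator {\<theta><..} w * ennreal (exp (- disc S * w)) \<partial>WW) \<le> ennreal \<rho>" .
  qed auto
  also have "\<dots> = cost C x T J + ennreal (\<rho> * \<epsilon>)" using \<rho> \<epsilon> by (simp add: ennreal_mult'[symmetric] mult.commute)
  finally show "ennreal (u i x) \<le> cost C x T J + ennreal (\<rho> * \<epsilon>)" .
qed

lemma approx_0: "approx 0"
proof -
  have "bounded (u i ` {lo..hi})" if "i \<in> {1,2}" for i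
    using u_lipschitz(2)[OF that] by (intro compact_imp_bounded compact_continuous_image) auto
  then have "bounded (u 1 ` {lo..hi} \<union> u 2 ` {lo..hi})" by simp
  then obtain B where B: "\<And>y. y \<in> u 1 ` {lo..hi} \<union> u 2 ` {lo..hi} \<Longrightarrow> \<bar>y\<bar> \<le> B" by (auto simp: bounded_iff)
  have "approx \<bar>B\<bar>" unfolding approx_def
  proof (intro allI impI)
    fix x j T J assume a: "admissible_strategy S x j T J" "j \<in> {1,2}"
    have "u j x \<in> u 1 ` {lo..hi} \<union> u 2 ` {lo..hi}" using admissible_strategy.x_range[OF a(1)] a(2) by auto
    from B[OF this] have "ennreal (u j x) \<le> ennreal \<bar>B\<bar>" by (intro ennreal_leI) simp
    then show "ennreal (u j x) \<le> cost C x T J + ennreal \<bar>B\<bar>" by (simp add: add_increasing)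
  qed
  then have n: "approx (\<rho> ^ n * \<bar>B\<bar>)" for n
    by (induction n) (use \<rho> approx_step in \<open>simp_all add: mult.assoc\<close>)
  show ?thesis unfolding approx_def
  proof (intro allI impI)
    fix x j T J assume a: "admissible_strategy S x j T J" "j \<in> {1,2}" "x < hi"
    have "(\<lambda>n. \<rho> ^ n * \<bar>B\<bar>) \<longlonglongrightarrow> 0 * \<bar>B\<bar>" using \<rho> by (intro tendsto_intros LIMSEQ_realpow_zero) auto
    then have "(\<lambda>n. cost C x T J + ennreal (\<rho> ^ n * \<bar>B\<bar>)) \<longlonglongrightarrow> cost C x T J + ennreal (0 * \<bar>B\<bar>)"
      by (intro tendsto_add tendsto_const tendsto_ennrealI)
    moreover have "ennreal (u j x) \<le> cost C x T J + ennreal (\<rho> ^ n * \<bar>B\<bar>)" for n using n[of n] a unfolding approx_def by blast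
    ultimately show "ennreal (u j x) \<le> cost C x T J + ennreal 0" by (intro LIMSEQ_le_const) auto
  qed
qed

lemma cost_lower_bound:
  assumes x: "lo \<le> x" "x \<le> hi" and i: "i \<in> {0,1,2}" "i = 0 \<longleftrightarrow> x = hi" and adm: "admissible S x i T J"
  shows "ennreal (if i = 0 then u_bar0 S u else u i x) \<le> cost S x T J"
proof -
  obtain T' J' where a: "admissible C x i T' J'" "cost C x T' J' = cost S x T J"
    using canonical_version[OF adm] x i by auto
  have s: "admissible_strategy S x i T' J'"
    using a(1) x i by (intro admissible_strategy.intro inventory_system_axioms admissible_strategy_axioms.intro) auto
  show ?thesis
  proof (cases "i = 0")
    case True
    then show ?thesis using approx_full[OF approx_0, of T' J'] s i a(2) by simp
  next
    case False
    then have "i \<in> {1,2}" "x < hi" using i x by auto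
    then show ?thesis using approx_0 s a(2) False unfolding approx_def by fastforce
  qed
qed

end

theorem proposition4p3:
  fixes S :: "'a inventory_data" and u :: "nat \<Rightarrow> real \<Rightarrow> real"
  assumes "inventory_model S"
    and "\<forall>i\<in>{1,2}. \<forall>x\<in>{lmin S..cap S}. 0 \<le> u i x"
    and "\<forall>x\<in>{lmin S..<cap S}. viscosity_supersolution S 1 2 (u 1) x"
    and "\<forall>x\<in>{lmin S..<cap S}. viscosity_supersolution S 2 1 (u 2) x"
    and "u 1 (cap S) \<le> u_bar0 S u + swcost S 1 0"
    and "u 2 (cap S) \<le> u_bar0 S u + swcost S 2 0"
  shows "(\<forall>j\<in>{1,2}. \<forall>x\<in>{lmin S..<cap S}. \<forall>T J.
            admissible S x j T J \<longrightarrow> ennreal (u j x) \<le> cost S x T J) \<and>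
         (\<forall>T J. admissible S (cap S) 0 T J \<longrightarrow> ennreal (u_bar0 S u) \<le> cost S (cap S) T J)"
proof -
  interpret supersolution S u
    using assms by unfold_locales auto
  show ?thesis
  proof (intro conjI ballI allI impI)
    fix j x T J assume "j \<in> {1,2::nat}" "x \<in> {lmin S..<cap S}" "admissible S x j T J"
    then show "ennreal (u j x) \<le> cost S x T J" using cost_lower_bound[of x j T J] by auto
  next
    fix T J assume "admissible S (cap S) 0 T J"
    then show "ennreal (u_bar0 S u) \<le> cost S (cap S) T J" using cost_lower_bound[of "cap S" 0 T J] params(4) by simp
  qed
qed

end
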